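(* Let $H\in(0,1)$, $n\ge1$, $f\in\mathcal{H}_H^{\otimes n}$, and let $I_n^H(f)$ be the multiple Wiener integral of $f$ with respect to $W^H$, where $W^H$ is the isonormal Gaussian process on $\mathcal{H}_H$ constructed from the complex-valued Gaussian measure $\tilde W$ as described in the context. Let $\hat f$ be the function defined by $$\hat f(t_1,x_1,t_2,x_2,\dots,t_n,x_n)=(c_H)^{\frac n2}\,\mathcal{F}[f(t_1,\cdot,t_2,\cdot,\dots,t_n,\cdot)](x_1,\dots,x_n)\,|x_1|^{\frac12-H}\cdots|x_n|^{\frac12-H}.$$ Then $$I_n^H(f)=\tilde I_n(\hat f),\quad\mathbb{P}\text{-a.s.},$$ where $\tilde I_n$ is the $n$-th order Wiener integral with respect to the complex Gaussian measure $\tilde W$.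
   Context: $\mathcal{F}$ is the Fourier transform in the space variables, $\mathcal{F}f(\xi)=\int e^{-i\xi\cdot x}f(x)\,dx$ for integrable $f$; the same symbol denotes the Fourier transform of tempered distributions on $\mathbb{R}^n$. For $H\in(0,1)$, $c_H=\frac{\Gamma(2H+1)\sin(\pi H)}{2\pi}$ and $\mu_H(d\xi)=c_H|\xi|^{1-2H}d\xi$. $\mathcal{H}_H$ is the Hilbert space completion of $\mathcal{C}_0^\infty(\mathbb{R}_+\times\mathbb{R})$ with respect to $\langle\varphi,\psi\rangle_H=\int_0^\infty\int_{\mathbb{R}}\mathcal{F}\varphi(t,\cdot)(\xi)\overline{\mathcal{F}\psi(t,\cdot)(\xi)}\,\mu_H(d\xi)\,dt$ (for $H>\frac12$ it contains distributions). The norm of $f\in\mathcal{H}_H^{\otimes n}$ is given by $\|f\|^2_{\mathcal{H}_H^{\otimes n}}=\int_{\mathbb{R}_+^n}\int_{\mathbb{R}^n}|\mathcal{F}f(t_1,\cdot,\dots,t_n,\cdot)(\xi_1,\dots,\xi_n)|^2\mu_H(d\xi_1)\cdots\mu_H(d\xi_n)\,dt_1\cdots dt_n$. Complex Gaussian measure: $\tilde W=\tilde W_1+i\tilde W_2$ is a complex-valued Gaussian measure on the bounded Borel sets of $\mathbb{R}_+\times\mathbb{R}$, where $\tilde W_1$ and $\tilde W_2$ are independent real-valued centered Gaussian measures with $\mathbb{E}[\tilde W_j(A)\tilde W_j(B)]=\frac{|A\cap B|}{2}$, $j=1,2$ ($|\cdot|$ is Lebesgue measure); in particular $\mathbb{E}[|\tilde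 W(A)|^2]=|A|$. For $g\in L^2(\mathbb{R}_+\times\mathbb{R};\mathbb{C})$ the integral is $\int\int g\,d\tilde W=\int\int g\,d\tilde W_1+i\int\int g\,d\tilde W_2$, with $\int\int g\,d\tilde W_j=\int\int\mathrm{Re}[g]\,d\tilde W_j+i\int\int\mathrm{Im}[g]\,d\tilde W_j$, and it satisfies $\mathbb{E}\big[|\int\int g\,d\tilde W|^2\big]=\int_{\mathbb{R}_+}\int_{\mathbb{R}}|g(t,x)|^2dx\,dt$. For $n=1$, $\tilde I_1(g)=\int\int g\,d\tilde W$; for general $n$, $\tilde I_n$ is the multiple Wiener integral of order $n$ with respect to $\tilde W$ on $L^2((\mathbb{R}_+\times\mathbb{R})^n;\mathbb{C})$, in the usual sense: $\tilde I_n(1_{A_1\times\cdots\times A_n})=\tilde W(A_1)\cdots\tilde W(A_n)$ for pairwise disjoint bounded Borel sets $A_1,\dots,A_n$, extended by linearity and $L^2$-continuity. Construction of $W^H$ from $\tilde W$: for $(t,x)\in\mathbb{R}_+\times\mathbb{R}$ set $W^H(1_{[0,t]\times[0,x]})=\sqrt{c_H}\int_0^t\int_{\mathbb{R}}\mathcal{F}[1_{[0,x]}](\xi)|\xi|^{\frac12-H}\,\tilde W(ds,d\xi)$ (with the convention $1_{[0,x]}:=-1_{[x,0]}$ for $x<0$); this is extended by linearity to simple functions (finite linear combinations of indicators of rectangles), which are dense in $\mathcal{H}_H$, and then by approximation to an isonormal Gaussian process $W^H=\{W^H(\varphi),\varphi\in\mathcal{H}_H\}$ with covariance $\langle\cdot,\cdot\rangle_H$.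 Multiple integral $I_n^H$: let $\{e_k\}$ be an orthonormal basis of $\mathcal{H}_H$. If $j_1,\dots,j_m$ are all different and $k_1+\dots+k_m=n$, then $I_n^H(e_{j_1}^{\otimes k_1}\hat\otimes\cdots\hat\otimes e_{j_m}^{\otimes k_m})=P_{k_1}(W^H(e_{j_1}))\cdots P_{k_m}(W^H(e_{j_m}))$, where $\hat\otimes$ is the symmetrized tensor product and $P_k$ is the normalized $k$-th Hermite polynomial; $I_n^H$ is extended by linearity and density. For every $f\in\mathcal{H}_H^{\otimes n}$, $\mathbb{E}[|I_n^H(f)|^2]=\mathbb{E}[|I_n^H(\tilde f)|^2]=n!\,\|\tilde f\|^2_{\mathcal{H}_H^{\otimes n}}$, with $\tilde f$ the symmetrization of $f$.
   Formalization: The W^H built from W̃ is complex with E[W^H(e)²]=0, so ordinary Hermite P_k break the isometry and the claim (n=2, f=e⊗e gives Z²−1 versus Z²); P_k(W^H(e)) is taken as the Hermite polynomial with variance parameter E[W^H(e)²]. *)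

theory Defs
  imports "HOL-Probability.Probability"
begin

text \<open>
  The space $\mathbb{R}^n$ is a type of class \<^class>\<open>euclidean_space\<close> with
  \<open>n = DIM('a)\<close>; the coordinates of \<open>x\<close> are the numbers \<open>x \<bullet> b\<close> for \<open>b \<in> Basis\<close>. The type
  \<^typ>\<open>real\<close> itself (with \<open>Basis = {1}\<close>) is the case \<open>n = 1\<close>. A point
  $(t_1,x_1,\dots,t_n,x_n)$ of $(\mathbb{R}_+\times\mathbb{R})^n$ is written as the pair
  $(t,x)$ with $t=(t_1,\dots,t_n)$ and $x=(x_1,\dots,x_n)$, an element of \<open>'a \<times> 'a\<close>.
\<close>

section \<open>Tempered distributions and the Fourier transform\<close>

primrec iter_partial ::
  "'a list \<Rightarrow> ('a::euclidean_space \<Rightarrow> complex) \<Rightarrow> 'a \<Rightarrow> complex" where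
  "iter_partial [] f = f"
| "iter_partial (b # bs) f = (\<lambda>x. frechet_derivative (iter_partial bs f) (at x) b)"

definition smooth :: "('a::euclidean_space \<Rightarrow> complex) \<Rightarrow> bool" where
  "smooth f \<longleftrightarrow> (\<forall>bs\<in>lists Basis. \<forall>x. iter_partial bs f differentiable (at x))"

definition schwartz :: "('a::euclidean_space \<Rightarrow> complex) set" where
  "schwartz = {f. smooth f \<and>
     (\<forall>bs\<in>lists Basis. \<forall>N. \<exists>B. \<forall>x. (1 + norm x) ^ N * norm (iter_partial bs f x) \<le> B)}"

text \<open>
  A tempered distribution is given by its values on the Schwartz space; continuity means that
  it is bounded by finitely many of the Schwartz seminorms (values outside the Schwartz space
  are irrelevant).
\<close>

definition tempered :: "(('a::euclidean_space \<Rightarrow> complex) \<Rightarrow> complex) \<Rightarrow> bool" where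
  "tempered u \<longleftrightarrow>
     (\<forall>\<phi>\<in>schwartz. \<forall>\<psi>\<in>schwartz. \<forall>a b. u (\<lambda>x. a * \<phi> x + b * \<psi> x) = a * u \<phi> + b * u \<psi>) \<and>
     (\<exists>C N. \<forall>\<phi>\<in>schwartz. \<forall>B.
        (\<forall>bs\<in>lists Basis. length bs \<le> N \<longrightarrow>
           (\<forall>x. (1 + norm x) ^ N * norm (iter_partial bs \<phi> x) \<le> B)) \<longrightarrow>
        norm (u \<phi>) \<le> C * B)"

definition fourier :: "('a::euclidean_space \<Rightarrow> complex) \<Rightarrow> 'a \<Rightarrow> complex" where
  "fourier f \<xi> = (LINT x|lborel. exp (- \<i> * complex_of_real (\<xi> \<bullet> x)) * f x)"

definition fourier_dist ::
  "(('a::euclidean_space \<Rightarrow> complex) \<Rightarrow> complex) \<Rightarrow> ('a \<Rightarrow> complex) \<Rightarrow> complex" where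
  "fourier_dist u = (\<lambda>\<phi>. u (fourier \<phi>))"

definition dist_is_function ::
  "(('a::euclidean_space \<Rightarrow> complex) \<Rightarrow> complex) \<Rightarrow> ('a \<Rightarrow> complex) \<Rightarrow> bool" where
  "dist_is_function u g \<longleftrightarrow>
     (\<forall>\<phi>\<in>schwartz. integrable lborel (\<lambda>\<xi>. g \<xi> * \<phi> \<xi>) \<and> u \<phi> = (LINT \<xi>|lborel. g \<xi> * \<phi> \<xi>))"

section \<open>The Hilbert spaces $\mathcal{H}_H^{\otimes n}$\<close>

definition orthant :: "'a::euclidean_space set" where
  "orthant = {t. \<forall>b\<in>Basis. 0 \<le> t \<bullet> b}"

definition c_H :: "real \<Rightarrow> real" where
  "c_H H = Gamma (2 * H + 1) * sin (pi * H) / (2 * pi)"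

definition mu_H :: "real \<Rightarrow> 'a::euclidean_space measure" where
  "mu_H H = density lborel (\<lambda>\<xi>. ennreal (\<Prod>b\<in>Basis. c_H H * \<bar>\<xi> \<bullet> b\<bar> powr (1 - 2 * H)))"

text \<open>The measure $dt_1\cdots dt_n\,\mu_H(d\xi_1)\cdots\mu_H(d\xi_n)$.\<close>

definition spectral_measure :: "real \<Rightarrow> ('a::euclidean_space \<times> 'a) measure" where
  "spectral_measure H = restrict_space lborel orthant \<Otimes>\<^sub>M mu_H H"

definition L2_tendsto :: "'b measure \<Rightarrow> (nat \<Rightarrow> 'b \<Rightarrow> 'c::real_normed_vector) \<Rightarrow> ('b \<Rightarrow> 'c) \<Rightarrow> bool"
  where "L2_tendsto N F g \<longleftrightarrow> (\<lambda>k. \<integral>\<^sup>+z. ennreal ((norm (F k z - g z))\<^sup>2) \<partial>N) \<longlonglongrightarrow> 0"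

text \<open>
  An element $f$ of $\mathcal{H}_H^{\otimes n}$ is a family $t\mapsto f(t,\cdot)$ of tempered
  distributions on $\mathbb{R}^n$ whose Fourier transforms are functions. Its Fourier transform
  in space is a jointly measurable function of $(t,\xi)$ and is determined up to null sets;
  \<open>space_ft f\<close> is a version of it.
\<close>

definition is_space_ft ::
  "('a::euclidean_space \<Rightarrow> ('a \<Rightarrow> complex) \<Rightarrow> complex) \<Rightarrow> ('a \<times> 'a \<Rightarrow> complex) \<Rightarrow> bool" where
  "is_space_ft f G \<longleftrightarrow> G \<in> borel_measurable borel \<and>
     (AE t in restrict_space lborel orthant.
        tempered (f t) \<and> dist_is_function (fourier_dist (f t)) (\<lambda>\<xi>. G (t, \<xi>)))"

definition space_ft ::
  "('a::euclidean_space \<Rightarrow> ('a \<Rightarrow> complex) \<Rightarrow> complex) \<Rightarrow> 'a \<times> 'a \<Rightarrow> complex" where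
  "space_ft f = (SOME G. is_space_ft f G)"

text \<open>
  $\mathcal{C}_0^\infty(\mathbb{R}_+\times\mathbb{R})$, with values in the scalar field \<open>K\<close>, which
  is either \<open>\<real>\<close> or all of the complex numbers.
\<close>

definition test_functions :: "complex set \<Rightarrow> (real \<times> real \<Rightarrow> complex) set" where
  "test_functions K = {\<phi>. smooth \<phi> \<and> range \<phi> \<subseteq> K \<and>
     (\<exists>C. compact C \<and> C \<subseteq> {0<..} \<times> UNIV \<and> (\<forall>z. z \<notin> C \<longrightarrow> \<phi> z = 0))}"

text \<open>
  $\mathcal{H}_H^{\otimes n}$ over \<open>K\<close> with \<open>n = DIM('a)\<close> (so \<open>'a = real\<close> gives $\mathcal{H}_H$):
  the completion of the span of the elementary tensors
  $\varphi_1\otimes\cdots\otimes\varphi_n$ of test functions, realized inside the families of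
  tempered distributions.
\<close>

definition hilbert_H ::
  "complex set \<Rightarrow> real \<Rightarrow> ('a::euclidean_space \<Rightarrow> ('a \<Rightarrow> complex) \<Rightarrow> complex) set" where
  "hilbert_H K H = {f. (\<exists>G. is_space_ft f G) \<and>
     (\<exists>S :: nat \<Rightarrow> (complex \<times> ('a \<Rightarrow> real \<times> real \<Rightarrow> complex)) list.
        (\<forall>k. \<forall>(c, \<phi>)\<in>set (S k). c \<in> K \<and> (\<forall>b\<in>Basis. \<phi> b \<in> test_functions K)) \<and>
        L2_tendsto (spectral_measure H)
          (\<lambda>k (t, \<xi>). fourier (\<lambda>x. \<Sum>(c, \<phi>)\<leftarrow>S k. c * (\<Prod>b\<in>Basis. \<phi> b (t \<bullet> b, x \<bullet> b))) \<xi>)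
          (space_ft f))}"

definition inner_H ::
  "real \<Rightarrow> ('a::euclidean_space \<Rightarrow> ('a \<Rightarrow> complex) \<Rightarrow> complex) \<Rightarrow>
     ('a \<Rightarrow> ('a \<Rightarrow> complex) \<Rightarrow> complex) \<Rightarrow> complex" where
  "inner_H H f g = (LINT z|spectral_measure H. space_ft f z * cnj (space_ft g z))"

definition orthonormal_basis_H ::
  "complex set \<Rightarrow> real \<Rightarrow> (nat \<Rightarrow> real \<Rightarrow> (real \<Rightarrow> complex) \<Rightarrow> complex) \<Rightarrow> bool" where
  "orthonormal_basis_H K H e \<longleftrightarrow>
     (\<forall>j. e j \<in> hilbert_H K H) \<and>
     (\<forall>j k. inner_H H (e j) (e k) = (if j = k then 1 else 0)) \<and>
     (\<forall>f\<in>hilbert_H K H. \<exists>a :: nat \<Rightarrow> nat \<Rightarrow> complex. (\<forall>k j. a k j \<in> K) \<and>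
        L2_tendsto (spectral_measure H) (\<lambda>k z. \<Sum>j<k. a k j * space_ft (e j) z) (space_ft f))"

section \<open>The complex Gaussian measure and its integrals\<close>

definition bounded_borel :: "(real \<times> real) set set" where
  "bounded_borel = {A \<in> sets borel. bounded A \<and> A \<subseteq> {0..} \<times> UNIV}"

definition centered_gaussian :: "'w measure \<Rightarrow> ('w \<Rightarrow> real) \<Rightarrow> bool" where
  "centered_gaussian M X \<longleftrightarrow> X \<in> borel_measurable M \<and>
     ((\<exists>\<sigma>>0. distributed M lborel X (\<lambda>x. ennreal (normal_density 0 \<sigma> x))) \<or>
      (AE \<omega> in M. X \<omega> = 0))"

text \<open>Additivity of the random measure (in $L^2$) follows from the covariance.\<close>

definition gaussian_measure_half ::
  "'w measure \<Rightarrow> ((real \<times> real) set \<Rightarrow> 'w \<Rightarrow> real) \<Rightarrow> bool" where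
  "gaussian_measure_half M W \<longleftrightarrow>
     (\<forall>F a. finite F \<longrightarrow> F \<subseteq> bounded_borel \<longrightarrow>
        centered_gaussian M (\<lambda>\<omega>. \<Sum>A\<in>F. a A * W A \<omega>)) \<and>
     (\<forall>A\<in>bounded_borel. \<forall>B\<in>bounded_borel.
        (LINT \<omega>|M. W A \<omega> * W B \<omega>) = measure lborel (A \<inter> B) / 2)"

definition complex_gaussian_measure ::
  "'w measure \<Rightarrow> ((real \<times> real) set \<Rightarrow> 'w \<Rightarrow> real) \<Rightarrow> ((real \<times> real) set \<Rightarrow> 'w \<Rightarrow> real) \<Rightarrow> bool" where
  "complex_gaussian_measure M W1 W2 \<longleftrightarrow>
     gaussian_measure_half M W1 \<and> gaussian_measure_half M W2 \<and>
     prob_space.indep_var M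
       (PiM bounded_borel (\<lambda>_. borel)) (\<lambda>\<omega>. \<lambda>A\<in>bounded_borel. W1 A \<omega>)
       (PiM bounded_borel (\<lambda>_. borel)) (\<lambda>\<omega>. \<lambda>A\<in>bounded_borel. W2 A \<omega>)"

text \<open>Lebesgue measure on $(\mathbb{R}_+\times\mathbb{R})^n$.\<close>

definition leb_plus :: "('a::euclidean_space \<times> 'a) measure" where
  "leb_plus = restrict_space lborel (orthant \<times> UNIV)"

text \<open>
  All integrals below are $L^2$-limits, hence only determined almost surely; \<open>is_\<dots>\<close> says
  that \<open>X\<close> is a version of the integral, and the integral itself is a chosen version.
\<close>

definition is_gauss_int ::
  "'w measure \<Rightarrow> ((real \<times> real) set \<Rightarrow> 'w \<Rightarrow> real) \<Rightarrow> (real \<times> real \<Rightarrow> real) \<Rightarrow> ('w \<Rightarrow> real) \<Rightarrow> bool"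
  where
  "is_gauss_int M W g X \<longleftrightarrow> X \<in> borel_measurable M \<and>
     (\<exists>S :: nat \<Rightarrow> (real \<times> (real \<times> real) set) list.
        (\<forall>k. \<forall>(c, A)\<in>set (S k). A \<in> bounded_borel) \<and>
        L2_tendsto leb_plus (\<lambda>k z. \<Sum>(c, A)\<leftarrow>S k. c * indicator A z) g \<and>
        L2_tendsto M (\<lambda>k \<omega>. \<Sum>(c, A)\<leftarrow>S k. c * W A \<omega>) X)"

definition gauss_int ::
  "'w measure \<Rightarrow> ((real \<times> real) set \<Rightarrow> 'w \<Rightarrow> real) \<Rightarrow> (real \<times> real \<Rightarrow> real) \<Rightarrow> 'w \<Rightarrow> real" where
  "gauss_int M W g = (SOME X. is_gauss_int M W g X)"

definition gauss_int_c ::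
  "'w measure \<Rightarrow> ((real \<times> real) set \<Rightarrow> 'w \<Rightarrow> real) \<Rightarrow> (real \<times> real \<Rightarrow> complex) \<Rightarrow> 'w \<Rightarrow> complex" where
  "gauss_int_c M W g \<omega> =
     complex_of_real (gauss_int M W (\<lambda>z. Re (g z)) \<omega>) +
     \<i> * complex_of_real (gauss_int M W (\<lambda>z. Im (g z)) \<omega>)"

definition complex_gauss_int ::
  "'w measure \<Rightarrow> ((real \<times> real) set \<Rightarrow> 'w \<Rightarrow> real) \<Rightarrow> ((real \<times> real) set \<Rightarrow> 'w \<Rightarrow> real) \<Rightarrow>
     (real \<times> real \<Rightarrow> complex) \<Rightarrow> 'w \<Rightarrow> complex" where
  "complex_gauss_int M W1 W2 g \<omega> = gauss_int_c M W1 g \<omega> + \<i> * gauss_int_c M W2 g \<omega>"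

text \<open>The multiple Wiener integral $\tilde I_n$ with respect to $\tilde W=\tilde W_1+i\tilde W_2$.\<close>

definition is_mult_int ::
  "'w measure \<Rightarrow> ((real \<times> real) set \<Rightarrow> 'w \<Rightarrow> real) \<Rightarrow> ((real \<times> real) set \<Rightarrow> 'w \<Rightarrow> real) \<Rightarrow>
     ('a::euclidean_space \<times> 'a \<Rightarrow> complex) \<Rightarrow> ('w \<Rightarrow> complex) \<Rightarrow> bool" where
  "is_mult_int M W1 W2 g X \<longleftrightarrow> X \<in> borel_measurable M \<and>
     (\<exists>S :: nat \<Rightarrow> (complex \<times> ('a \<Rightarrow> (real \<times> real) set)) list.
        (\<forall>k. \<forall>(c, A)\<in>set (S k). (\<forall>b\<in>Basis. A b \<in> bounded_borel) \<and> disjoint_family_on A Basis) \<and>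
        L2_tendsto leb_plus
          (\<lambda>k (t, x). \<Sum>(c, A)\<leftarrow>S k. c * (\<Prod>b\<in>Basis. indicator (A b) (t \<bullet> b, x \<bullet> b))) g \<and>
        L2_tendsto M
          (\<lambda>k \<omega>. \<Sum>(c, A)\<leftarrow>S k. c * (\<Prod>b\<in>Basis. Complex (W1 (A b) \<omega>) (W2 (A b) \<omega>))) X)"

definition mult_int ::
  "'w measure \<Rightarrow> ((real \<times> real) set \<Rightarrow> 'w \<Rightarrow> real) \<Rightarrow> ((real \<times> real) set \<Rightarrow> 'w \<Rightarrow> real) \<Rightarrow>
     ('a::euclidean_space \<times> 'a \<Rightarrow> complex) \<Rightarrow> 'w \<Rightarrow> complex" where
  "mult_int M W1 W2 g = (SOME X. is_mult_int M W1 W2 g X)"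

section \<open>The process $W^H$ and its multiple integrals\<close>

definition signed_ind :: "real \<Rightarrow> real \<Rightarrow> complex" where
  "signed_ind x y = (if 0 \<le> x then indicator {0..x} y else - indicator {x..0} y)"

definition WH_rect ::
  "'w measure \<Rightarrow> ((real \<times> real) set \<Rightarrow> 'w \<Rightarrow> real) \<Rightarrow> ((real \<times> real) set \<Rightarrow> 'w \<Rightarrow> real) \<Rightarrow>
     real \<Rightarrow> real \<Rightarrow> real \<Rightarrow> 'w \<Rightarrow> complex" where
  "WH_rect M W1 W2 H t x \<omega> = complex_of_real (sqrt (c_H H)) *
     complex_gauss_int M W1 W2
       (\<lambda>(s, \<xi>). indicator {0..t} s * fourier (signed_ind x) \<xi> *
                 complex_of_real (\<bar>\<xi>\<bar> powr (1 / 2 - H))) \<omega>"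

definition is_WH ::
  "'w measure \<Rightarrow> ((real \<times> real) set \<Rightarrow> 'w \<Rightarrow> real) \<Rightarrow> ((real \<times> real) set \<Rightarrow> 'w \<Rightarrow> real) \<Rightarrow>
     complex set \<Rightarrow> real \<Rightarrow> (real \<Rightarrow> (real \<Rightarrow> complex) \<Rightarrow> complex) \<Rightarrow> ('w \<Rightarrow> complex) \<Rightarrow> bool" where
  "is_WH M W1 W2 K H \<phi> X \<longleftrightarrow> X \<in> borel_measurable M \<and>
     (\<exists>S :: nat \<Rightarrow> (complex \<times> real \<times> real) list.
        (\<forall>k. \<forall>(c, t, x)\<in>set (S k). c \<in> K \<and> 0 \<le> t) \<and>
        L2_tendsto (spectral_measure H)
          (\<lambda>k (s, \<xi>). fourier (\<lambda>y. \<Sum>(c, t, x)\<leftarrow>S k. c * indicator {0..t} s * signed_ind x y) \<xi>)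
          (space_ft \<phi>) \<and>
        L2_tendsto M (\<lambda>k \<omega>. \<Sum>(c, t, x)\<leftarrow>S k. c * WH_rect M W1 W2 H t x \<omega>) X)"

definition WH ::
  "'w measure \<Rightarrow> ((real \<times> real) set \<Rightarrow> 'w \<Rightarrow> real) \<Rightarrow> ((real \<times> real) set \<Rightarrow> 'w \<Rightarrow> real) \<Rightarrow>
     complex set \<Rightarrow> real \<Rightarrow> (real \<Rightarrow> (real \<Rightarrow> complex) \<Rightarrow> complex) \<Rightarrow> 'w \<Rightarrow> complex" where
  "WH M W1 W2 K H \<phi> = (SOME X. is_WH M W1 W2 K H \<phi> X)"

text \<open>
  The monic Hermite polynomial of degree \<open>k\<close> with variance parameter \<open>v\<close>, i.e.
  $v^{k/2}\mathrm{He}_k(z/\sqrt v)$; for \<open>v = 1\<close> it is $\mathrm{He}_k$. Evaluated at a centered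
  Gaussian variable $Z$ it has to be taken with $v=\mathbf{E}[Z^2]$ (not $\mathbf{E}[|Z|^2]$) to be
  the Wick power of $Z$; for a real variable of unit variance this is $\mathrm{He}_k(Z)$. The process
  $W^H$ built from $\tilde W$ is complex-valued, and with $v=1$ the variables
  $P_k(W^H(e))$ would not satisfy $\mathbf{E}|P_k(W^H(e))|^2=k!$.
\<close>

definition hermite :: "nat \<Rightarrow> complex \<Rightarrow> complex \<Rightarrow> complex" where
  "hermite k v z = (\<Sum>j\<le>k div 2.
     fact k / (fact j * fact (k - 2 * j)) * (- v / 2) ^ j * z ^ (k - 2 * j))"

definition hermite_rv :: "'w measure \<Rightarrow> nat \<Rightarrow> ('w \<Rightarrow> complex) \<Rightarrow> 'w \<Rightarrow> complex" where
  "hermite_rv M k Z \<omega> = hermite k (LINT \<omega>'|M. (Z \<omega>')\<^sup>2) (Z \<omega>)"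

definition permute_coords :: "('a \<Rightarrow> 'a) \<Rightarrow> 'a::euclidean_space \<Rightarrow> 'a" where
  "permute_coords p x = (\<Sum>b\<in>Basis. (x \<bullet> p b) *\<^sub>R b)"

definition symmetrize :: "('a::euclidean_space \<times> 'a \<Rightarrow> complex) \<Rightarrow> 'a \<times> 'a \<Rightarrow> complex" where
  "symmetrize G = (\<lambda>(t, x).
     (\<Sum>p | p permutes Basis. G (permute_coords p t, permute_coords p x)) / fact DIM('a))"

text \<open>
  For \<open>\<sigma> :: 'a \<Rightarrow> nat\<close> this is the symmetrization of $\bigotimes_b e_{\sigma(b)}$, which is
  $e_{j_1}^{\otimes k_1}\hat\otimes\cdots\hat\otimes e_{j_m}^{\otimes k_m}$ where
  $j_1,\dots,j_m$ are the distinct values of \<open>\<sigma>\<close> on the coordinates and $k_i$ is the number of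
  times that $j_i$ occurs. It is given by its Fourier transform in space, which commutes
  with tensor products and with symmetrization.
\<close>

definition sym_tensor_ft ::
  "(nat \<Rightarrow> real \<Rightarrow> (real \<Rightarrow> complex) \<Rightarrow> complex) \<Rightarrow> ('a::euclidean_space \<Rightarrow> nat) \<Rightarrow> 'a \<times> 'a \<Rightarrow> complex"
  where
  "sym_tensor_ft e \<sigma> =
     symmetrize (\<lambda>(t, \<xi>). \<Prod>b\<in>Basis. space_ft (e (\<sigma> b)) (t \<bullet> b, \<xi> \<bullet> b))"

text \<open>
  $I_n^H(f)$, constructed from the orthonormal basis \<open>e\<close>. The elements
  $e_{j_1}^{\otimes k_1}\hat\otimes\cdots\hat\otimes e_{j_m}^{\otimes k_m}$ span the symmetric
  tensors, and $I_n^H(f)=I_n^H(\tilde f)$ for the symmetrization $\tilde f$ of $f$.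
\<close>

definition is_mult_int_WH ::
  "'w measure \<Rightarrow> ((real \<times> real) set \<Rightarrow> 'w \<Rightarrow> real) \<Rightarrow> ((real \<times> real) set \<Rightarrow> 'w \<Rightarrow> real) \<Rightarrow>
     complex set \<Rightarrow> real \<Rightarrow> (nat \<Rightarrow> real \<Rightarrow> (real \<Rightarrow> complex) \<Rightarrow> complex) \<Rightarrow>
     ('a::euclidean_space \<Rightarrow> ('a \<Rightarrow> complex) \<Rightarrow> complex) \<Rightarrow> ('w \<Rightarrow> complex) \<Rightarrow> bool" where
  "is_mult_int_WH M W1 W2 K H e f X \<longleftrightarrow> X \<in> borel_measurable M \<and>
     (\<exists>S :: nat \<Rightarrow> (complex \<times> ('a \<Rightarrow> nat)) list.
        (\<forall>k. \<forall>(c, \<sigma>)\<in>set (S k). c \<in> K) \<and>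
        L2_tendsto (spectral_measure H)
          (\<lambda>k z. \<Sum>(c, \<sigma>)\<leftarrow>S k. c * sym_tensor_ft e \<sigma> z) (symmetrize (space_ft f)) \<and>
        L2_tendsto M
          (\<lambda>k \<omega>. \<Sum>(c, \<sigma>)\<leftarrow>S k. c *
             (\<Prod>j\<in>\<sigma> ` Basis. hermite_rv M (card {b \<in> Basis. \<sigma> b = j}) (WH M W1 W2 K H (e j)) \<omega>)) X)"

definition mult_int_WH ::
  "'w measure \<Rightarrow> ((real \<times> real) set \<Rightarrow> 'w \<Rightarrow> real) \<Rightarrow> ((real \<times> real) set \<Rightarrow> 'w \<Rightarrow> real) \<Rightarrow>
     complex set \<Rightarrow> real \<Rightarrow> (nat \<Rightarrow> real \<Rightarrow> (real \<Rightarrow> complex) \<Rightarrow> complex) \<Rightarrow>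
     ('a::euclidean_space \<Rightarrow> ('a \<Rightarrow> complex) \<Rightarrow> complex) \<Rightarrow> 'w \<Rightarrow> complex" where
  "mult_int_WH M W1 W2 K H e f = (SOME X. is_mult_int_WH M W1 W2 K H e f X)"

definition f_hat ::
  "real \<Rightarrow> ('a::euclidean_space \<Rightarrow> ('a \<Rightarrow> complex) \<Rightarrow> complex) \<Rightarrow> 'a \<times> 'a \<Rightarrow> complex" where
  "f_hat H f = (\<lambda>(t, x). complex_of_real (c_H H powr (real DIM('a) / 2)) * space_ft f (t, x) *
     complex_of_real (\<Prod>b\<in>Basis. \<bar>x \<bullet> b\<bar> powr (1 / 2 - H)))"

end

theory Submission
  imports Defs "HOL-Combinatorics.Permutations"
begin

text \<open>
  The complex Gaussian measure is circular: $\mathbf{E}[\tilde W(A)\tilde W(B)]=0$ for all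
  $A$ and $B$. Hence the Hermite polynomials in the construction of $I_n^H$, taken with variance
  parameter $\mathbf{E}[Z^2]=0$, are plain powers, and $\tilde I_n(h_1\otimes\cdots\otimes h_n)
  =\prod_b\tilde I_1(h_b)$ without any diagonal correction. The latter follows from
  $\mathbf{E}\bigl[\prod_b\tilde W(A_b)\overline{\prod_b\tilde W(B_b)}\bigr]
  =\sum_p\prod_b|A_b\cap B_{p(b)}|$: it gives $\mathbf{E}|\tilde I_n(g)|^2\le n!\,\|g\|^2$
  for step functions that need not vanish on the diagonals, so both sides are limits of the
  same elementary integrals. The moment formula is obtained from the moments of one real Gaussian
  variable by averaging over rotations by roots of unity, followed by polarization.
\<close>

section \<open>Mean-square distance\<close>

text \<open>Every integral in the statement is a \<open>SOME\<close>-chosen version of an L2 limit,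
  so nothing is known about it before some version is shown to exist. Integrals are therefore
  handled as pairs (integrand, random variable) in the closure of the graph of an elementary
  integral: one Lipschitz bound on the graph yields existence, uniqueness and stability under
  limits. On the side of W^H existence needs density: rectangles for W^H(e_j), tensors of the e_j
  for I_n^H, both reached from test functions. The basis hypothesis speaks only of elements of
  \<open>hilbert_H\<close>, so a test function must first become such an element, and its chosen
  transform \<open>space_ft\<close> must be compared with the classical one. In the approximation by
  rectangles the weight |xi|^(1-2H) has infinite mass at infinity and is unbounded at 0 for H > 1/2;
  uniform convergence in xi is not enough, and a bound of order 1/|xi| independent of the mesh is
  required. Multiplication by the square root of the spectral density (\<open>hat\<close>) moves
  everything to Lebesgue measure.\<close>

definition L2d :: "'b measure \<Rightarrow> ('b \<Rightarrow> 'c::real_normed_vector) \<Rightarrow> ('b \<Rightarrow> 'c) \<Rightarrow> ennreal" where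
  "L2d N f g = (\<integral>\<^sup>+z. ennreal ((norm (f z - g z))\<^sup>2) \<partial>N)"

lemma L2_tendsto_L2d: "L2_tendsto N F g \<longleftrightarrow> (\<lambda>k. L2d N (F k) g) \<longlonglongrightarrow> 0"
  unfolding L2_tendsto_def L2d_def ..

lemma L2d_commute: "L2d N f g = L2d N g f"
  by (simp add: L2d_def norm_minus_commute)

lemma L2d_refl [simp]: "L2d N f f = 0"
  by (simp add: L2d_def)

lemma norm_add_square_le: "(norm (a + b))\<^sup>2 \<le> 2 * (norm a)\<^sup>2 + 2 * (norm b)\<^sup>2"
  for a b :: "'c::real_normed_vector"
proof -
  have "(norm (a + b))\<^sup>2 \<le> (norm a + norm b)\<^sup>2"
    by (intro power_mono norm_triangle_ineq) auto
  also have "\<dots> \<le> 2 * (norm a)\<^sup>2 + 2 * (norm b)\<^sup>2"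
    using sum_squares_bound[of "norm a" "norm b"] by (simp add: power2_sum)
  finally show ?thesis .
qed

lemma L2d_add_le:
  fixes f g f' g' :: "'b \<Rightarrow> 'c::{real_normed_vector, second_countable_topology}"
  assumes [measurable]: "f \<in> borel_measurable N" "g \<in> borel_measurable N"
    "f' \<in> borel_measurable N" "g' \<in> borel_measurable N"
  shows "L2d N (\<lambda>z. f z + f' z) (\<lambda>z. g z + g' z) \<le> 2 * L2d N f g + 2 * L2d N f' g'"
proof -
  have "L2d N (\<lambda>z. f z + f' z) (\<lambda>z. g z + g' z)
      \<le> (\<integral>\<^sup>+z. 2 * ennreal ((norm (f z - g z))\<^sup>2) + 2 * ennreal ((norm (f' z - g' z))\<^sup>2) \<partial>N)"
    unfolding L2d_def
  proof (rule nn_integral_mono)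
    fix z
    have "(norm ((f z + f' z) - (g z + g' z)))\<^sup>2 \<le> 2 * (norm (f z - g z))\<^sup>2 + 2 * (norm (f' z - g' z))\<^sup>2"
      using norm_add_square_le[of "f z - g z" "f' z - g' z"] by (simp add: algebra_simps)
    then have "ennreal ((norm ((f z + f' z) - (g z + g' z)))\<^sup>2)
        \<le> ennreal (2 * (norm (f z - g z))\<^sup>2 + 2 * (norm (f' z - g' z))\<^sup>2)"
      by (rule ennreal_leI)
    then show "ennreal ((norm ((f z + f' z) - (g z + g' z)))\<^sup>2)
        \<le> 2 * ennreal ((norm (f z - g z))\<^sup>2) + 2 * ennreal ((norm (f' z - g' z))\<^sup>2)"
      by (simp add: ennreal_plus ennreal_mult)
  qed
  also have "\<dots> = 2 * L2d N f g + 2 * L2d N f' g'"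
    unfolding L2d_def by (subst nn_integral_add) (auto simp: nn_integral_cmult)
  finally show ?thesis .
qed

text \<open>Distances stay squared and \<open>ennreal\<close>-valued so that no integrability has to
  be tracked; the price is a factor 2 at each use of the triangle inequality, and these factors are
  behind the constants 4, 16 and 64 further down.\<close>

lemma L2d_triangle:
  fixes f g h :: "'b \<Rightarrow> 'c::{real_normed_vector, second_countable_topology}"
  assumes [measurable]: "f \<in> borel_measurable N" "g \<in> borel_measurable N" "h \<in> borel_measurable N"
  shows "L2d N f h \<le> 2 * L2d N f g + 2 * L2d N g h"
proof -
  have "L2d N f h = L2d N (\<lambda>z. (f z - g z) + (g z - h z)) (\<lambda>z. 0 + 0)"
    by (simp add: L2d_def)
  also have "\<dots> \<le> 2 * L2d N (\<lambda>z. f z - g z) (\<lambda>z. 0) + 2 * L2d N (\<lambda>z. g z - h z) (\<lambda>z. 0)"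
    by (rule L2d_add_le) auto
  finally show ?thesis by (simp add: L2d_def)
qed

lemma L2d_scale:
  fixes f g :: "'b \<Rightarrow> 'c::{real_normed_field, second_countable_topology}"
  assumes [measurable]: "f \<in> borel_measurable N" "g \<in> borel_measurable N"
  shows "L2d N (\<lambda>z. a * f z) (\<lambda>z. a * g z) = ennreal ((norm a)\<^sup>2) * L2d N f g"
proof -
  have "L2d N (\<lambda>z. a * f z) (\<lambda>z. a * g z)
      = (\<integral>\<^sup>+z. ennreal ((norm a)\<^sup>2) * ennreal ((norm (f z - g z))\<^sup>2) \<partial>N)"
    unfolding L2d_def
  proof (rule nn_integral_cong)
    fix z
    have "a * f z - a * g z = a * (f z - g z)" by (simp add: right_diff_distrib)
    then have "(norm (a * f z - a * g z))\<^sup>2 = (norm a)\<^sup>2 * (norm (f z - g z))\<^sup>2"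
      by (simp only: norm_mult power_mult_distrib)
    then show "ennreal ((norm (a * f z - a * g z))\<^sup>2) = ennreal ((norm a)\<^sup>2) * ennreal ((norm (f z - g z))\<^sup>2)"
      by (simp add: ennreal_mult)
  qed
  then show ?thesis unfolding L2d_def by (simp add: nn_integral_cmult)
qed

lemma L2d_cong_AE:
  assumes "AE z in N. f z = f' z" "AE z in N. g z = g' z"
  shows "L2d N f g = L2d N f' g'"
  unfolding L2d_def by (rule nn_integral_cong_AE) (use assms in eventually_elim, simp)

lemma L2d_eq_0D:
  fixes f g :: "'b \<Rightarrow> 'c::{real_normed_vector, second_countable_topology}"
  assumes [measurable]: "f \<in> borel_measurable N" "g \<in> borel_measurable N" and "L2d N f g = 0"
  shows "AE z in N. f z = g z"
proof -
  have "AE z in N. ennreal ((norm (f z - g z))\<^sup>2) = 0"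
    using assms(3) unfolding L2d_def by (subst (asm) nn_integral_0_iff_AE) auto
  then show ?thesis by eventually_elim simp
qed

lemma ennreal_numeral_less_top: "(numeral n :: ennreal) < \<top>"
  by (metis ennreal_less_top ennreal_numeral)

lemma L2_tendsto_add:
  fixes F G :: "nat \<Rightarrow> 'b \<Rightarrow> 'c::{real_normed_vector, second_countable_topology}"
  assumes [measurable]: "\<And>k. F k \<in> borel_measurable N" "\<And>k. G k \<in> borel_measurable N"
    "f \<in> borel_measurable N" "g \<in> borel_measurable N"
    and "L2_tendsto N F f" "L2_tendsto N G g"
  shows "L2_tendsto N (\<lambda>k z. F k z + G k z) (\<lambda>z. f z + g z)"
proof -
  have "(\<lambda>k. 2 * L2d N (F k) f + 2 * L2d N (G k) g) \<longlonglongrightarrow> 2 * 0 + 2 * 0"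
    using assms(5,6) unfolding L2_tendsto_L2d
    by (intro tendsto_add ennreal_tendsto_cmult) (auto simp: ennreal_numeral_less_top)
  moreover have "\<forall>k. L2d N (\<lambda>z. F k z + G k z) (\<lambda>z. f z + g z) \<le> 2 * L2d N (F k) f + 2 * L2d N (G k) g"
    by (auto intro!: L2d_add_le)
  ultimately show ?thesis unfolding L2_tendsto_L2d
    by (auto intro: tendsto_sandwich[OF always_eventually always_eventually tendsto_const])
qed

lemma L2_tendsto_scale:
  fixes F :: "nat \<Rightarrow> 'b \<Rightarrow> 'c::{real_normed_field, second_countable_topology}"
  assumes [measurable]: "\<And>k. F k \<in> borel_measurable N" "f \<in> borel_measurable N"
    and "L2_tendsto N F f"
  shows "L2_tendsto N (\<lambda>k z. a * F k z) (\<lambda>z. a * f z)"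
proof -
  have "(\<lambda>k. ennreal ((norm a)\<^sup>2) * L2d N (F k) f) \<longlonglongrightarrow> ennreal ((norm a)\<^sup>2) * 0"
    using assms(3) unfolding L2_tendsto_L2d by (intro ennreal_tendsto_cmult) auto
  then show ?thesis unfolding L2_tendsto_L2d by (simp add: L2d_scale)
qed

lemma L2_tendsto_dominated:
  fixes F :: "nat \<Rightarrow> 'b \<Rightarrow> 'c::{real_normed_vector, second_countable_topology}"
  assumes [measurable]: "\<And>k. F k \<in> borel_measurable N" "g \<in> borel_measurable N" "w \<in> borel_measurable N"
    and lim: "AE z in N. (\<lambda>k. F k z) \<longlonglongrightarrow> g z"
    and dom: "\<And>k. AE z in N. norm (F k z) \<le> w z"
    and fin: "(\<integral>\<^sup>+z. ennreal ((w z)\<^sup>2) \<partial>N) < \<infinity>"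
  shows "L2_tendsto N F g"
proof -
  have gw: "AE z in N. norm (g z) \<le> w z"
  proof -
    have "AE z in N. \<forall>k. norm (F k z) \<le> w z" using dom by (simp add: AE_all_countable)
    with lim show ?thesis
      by eventually_elim (auto intro: LIMSEQ_le_const2[OF tendsto_norm])
  qed
  \<comment> \<open>The limit inherits the bound \<open>w\<close>, so differences are at most 2w in
    norm and 4 w^2 is the majorant.\<close>
  have "(\<lambda>k. \<integral>\<^sup>+z. ennreal ((norm (F k z - g z))\<^sup>2) \<partial>N) \<longlonglongrightarrow> (\<integral>\<^sup>+z. 0 \<partial>N)"
  proof (rule nn_integral_dominated_convergence[where w="\<lambda>z. 4 * ennreal ((w z)\<^sup>2)"])
    show "AE z in N. ennreal ((norm (F k z - g z))\<^sup>2) \<le> 4 * ennreal ((w z)\<^sup>2)" for k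
      using gw dom[of k]
    proof eventually_elim
      case (elim z)
      have "norm (F k z - g z) \<le> 2 * w z" using elim norm_triangle_ineq4[of "F k z" "g z"] by simp
      then have "(norm (F k z - g z))\<^sup>2 \<le> (2 * w z)\<^sup>2" by (intro power_mono) auto
      then have "ennreal ((norm (F k z - g z))\<^sup>2) \<le> ennreal (4 * (w z)\<^sup>2)"
        by (intro ennreal_leI) (simp add: power_mult_distrib)
      then show ?case by (simp add: ennreal_mult)
    qed
    show "(\<integral>\<^sup>+z. 4 * ennreal ((w z)\<^sup>2) \<partial>N) < \<infinity>"
      using fin by (simp add: nn_integral_cmult ennreal_mult_less_top)
    show "AE z in N. (\<lambda>k. ennreal ((norm (F k z - g z))\<^sup>2)) \<longlonglongrightarrow> 0"
      using lim
    proof eventually_elim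
      case (elim z)
      then have "(\<lambda>k. (norm (F k z - g z))\<^sup>2) \<longlonglongrightarrow> (norm (g z - g z))\<^sup>2"
        by (intro tendsto_intros)
      then have "(\<lambda>k. ennreal ((norm (F k z - g z))\<^sup>2)) \<longlonglongrightarrow> ennreal ((norm (g z - g z))\<^sup>2)"
        by (rule tendsto_ennrealI)
      then show ?case by simp
    qed
  qed auto
  then show ?thesis by (simp add: L2_tendsto_def)
qed

lemma ennreal_lim_0_iff:
  fixes a :: "nat \<Rightarrow> ennreal"
  shows "a \<longlonglongrightarrow> 0 \<longleftrightarrow> (\<forall>\<epsilon>>0. \<exists>k0. \<forall>k\<ge>k0. a k < ennreal \<epsilon>)"
proof
  assume "a \<longlonglongrightarrow> 0"
  then show "\<forall>\<epsilon>>0. \<exists>k0. \<forall>k\<ge>k0. a k < ennreal \<epsilon>"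
    using order_tendstoD(2)[of a 0 sequentially] by (simp add: eventually_sequentially)
next
  assume *: "\<forall>\<epsilon>>0. \<exists>k0. \<forall>k\<ge>k0. a k < ennreal \<epsilon>"
  show "a \<longlonglongrightarrow> 0"
  proof (rule order_tendstoI)
    fix y :: ennreal assume "0 < y"
    then obtain r where "0 < r" "ennreal r \<le> y"
    proof (cases y)
      case (real r) then show ?thesis using that \<open>0 < y\<close> by (auto simp: ennreal_zero_less_top)
    next
      case top then show ?thesis using that[of 1] by auto
    qed
    with * show "\<forall>\<^sub>F k in sequentially. a k < y"
      unfolding eventually_sequentially by (meson less_le_trans)
  qed auto
qed

text \<open>Two uses of the relaxed triangle inequality leave a factor 4 in front of the middle
  term, once over \<open>M\<close> and once over \<open>N\<close>; together they give 16.\<close>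

lemma L2d_limit_bound:
  fixes F F' :: "nat \<Rightarrow> 'b \<Rightarrow> 'c::{real_normed_vector, second_countable_topology}"
    and Y Y' :: "nat \<Rightarrow> 'w \<Rightarrow> 'd::{real_normed_vector, second_countable_topology}"
  assumes [measurable]: "\<And>k. F k \<in> borel_measurable N" "\<And>k. F' k \<in> borel_measurable N"
      "g \<in> borel_measurable N" "g' \<in> borel_measurable N"
      "\<And>k. Y k \<in> borel_measurable M" "\<And>k. Y' k \<in> borel_measurable M"
      "X \<in> borel_measurable M" "X' \<in> borel_measurable M"
    and lim: "L2_tendsto N F g" "L2_tendsto N F' g'" "L2_tendsto M Y X" "L2_tendsto M Y' X'"
    and bound: "\<And>k. L2d M (Y k) (Y' k) \<le> ennreal C * L2d N (F k) (F' k)"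
  shows "L2d M X X' \<le> ennreal (16 * C) * L2d N g g'"
proof -
  have ineq: "L2d M X X' \<le> 2 * L2d M (Y k) X + (4 * (ennreal C * (2 * L2d N (F k) g + (4 * L2d N g g' + 4 * L2d N (F' k) g')))
      + 4 * L2d M (Y' k) X')" for k
  proof -
    have "L2d N (F k) (F' k) \<le> 2 * L2d N (F k) g + 2 * (2 * L2d N g g' + 2 * L2d N g' (F' k))"
      by (rule order_trans[OF L2d_triangle[of _ _ g] add_left_mono[OF mult_left_mono[OF L2d_triangle[of _ _ g']]]]) auto
    then have 1: "L2d N (F k) (F' k) \<le> 2 * L2d N (F k) g + (4 * L2d N g g' + 4 * L2d N (F' k) g')"
      by (simp add: distrib_left mult.assoc[symmetric] L2d_commute[of N g'])
    have "L2d M X X' \<le> 2 * L2d M X (Y k) + 2 * (2 * L2d M (Y k) (Y' k) + 2 * L2d M (Y' k) X')"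
      by (rule order_trans[OF L2d_triangle[of _ _ "Y k"] add_left_mono[OF mult_left_mono[OF L2d_triangle[of _ _ "Y' k"]]]]) auto
    also have "\<dots> = 2 * L2d M (Y k) X + (4 * L2d M (Y k) (Y' k) + 4 * L2d M (Y' k) X')"
      by (simp add: distrib_left mult.assoc[symmetric] L2d_commute[of M X])
    also have "\<dots> \<le> 2 * L2d M (Y k) X + (4 * (ennreal C * (2 * L2d N (F k) g + (4 * L2d N g g' + 4 * L2d N (F' k) g')))
      + 4 * L2d M (Y' k) X')"
      by (intro add_mono mult_left_mono order_refl order_trans[OF bound] 1) auto
    finally show ?thesis .
  qed
  have "(\<lambda>k. 2 * L2d M (Y k) X + (4 * (ennreal C * (2 * L2d N (F k) g + (4 * L2d N g g' + 4 * L2d N (F' k) g')))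
      + 4 * L2d M (Y' k) X')) \<longlonglongrightarrow> 2 * 0 + (4 * (ennreal C * (2 * 0 + (4 * L2d N g g' + 4 * 0))) + 4 * 0)"
    using lim unfolding L2_tendsto_L2d
    by (intro tendsto_add ennreal_tendsto_cmult tendsto_const ennreal_numeral_less_top) auto
  from LIMSEQ_le_const[OF this] ineq
  have "L2d M X X' \<le> 4 * (ennreal C * (4 * L2d N g g'))" by simp
  also have "\<dots> = ennreal (16 * C) * L2d N g g'"
  proof -
    have "ennreal (16 * C) = 16 * ennreal C" by (simp add: ennreal_mult')
    then show ?thesis by (simp add: mult.left_commute[of "ennreal C"] mult.assoc)
  qed
  finally show ?thesis .
qed

text \<open>The Riesz-Fischer argument. The almost surely convergent subsequence is kept in the
  conclusion because limits of products are later identified pointwise.\<close>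

lemma (in prob_space) L2_complete:
  fixes X :: "nat \<Rightarrow> 'a \<Rightarrow> 'd::{banach, second_countable_topology}"
  assumes X[measurable]: "\<And>k. X k \<in> borel_measurable M"
    and cauchy: "\<And>\<epsilon>::real. \<epsilon> > 0 \<Longrightarrow> \<exists>k0. \<forall>k\<ge>k0. \<forall>l\<ge>k0. L2d M (X k) (X l) < ennreal \<epsilon>"
  obtains Y where "Y \<in> borel_measurable M" "L2_tendsto M X Y"
    "\<exists>r. strict_mono r \<and> (AE \<omega> in M. (\<lambda>k. X (r k) \<omega>) \<longlonglongrightarrow> Y \<omega>)"
proof -
  \<comment> \<open>Squared distance below 4^-n, that is distance below 2^-n: a summable
    rate.\<close>
  obtain K where K: "\<And>n k l. k \<ge> K n \<Longrightarrow> l \<ge> K n \<Longrightarrow> L2d M (X k) (X l) < ennreal ((1/4)^n)"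
  proof -
    have "\<exists>k0. \<forall>k\<ge>k0. \<forall>l\<ge>k0. L2d M (X k) (X l) < ennreal ((1/4)^n)" for n :: nat
      by (rule cauchy) simp
    then show ?thesis using that by metis
  qed
  \<comment> \<open>The sum dominates \<open>K n\<close>, and the added \<open>n\<close> makes the
    index sequence strictly increasing.\<close>
  define r where "r n = (\<Sum>i\<le>n. K i) + n" for n
  have r: "strict_mono r" unfolding strict_mono_Suc_iff r_def by simp
  have rK: "r n \<ge> K n" for n
  proof -
    have "K n \<le> (\<Sum>i\<le>n. K i)" by (rule member_le_sum) auto
    then show ?thesis unfolding r_def by simp
  qed
  have "mono r" using r by (rule strict_mono_mono)
  then have rm: "r m \<ge> K n" if "m \<ge> n" for m n
    using rK[of n] that by (meson monoD order_trans)
  define d where "d n \<omega> = norm (X (r (Suc n)) \<omega> - X (r n) \<omega>)" for n \<omega>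
  have [measurable]: "d n \<in> borel_measurable M" for n unfolding d_def by measurable
  have d1: "(\<integral>\<^sup>+\<omega>. ennreal (d n \<omega>) \<partial>M) \<le> ennreal (2 * (1/2)^n)" for n
  proof -
    have "ennreal (d n \<omega>) \<le> ennreal (2^n) * ennreal ((d n \<omega>)\<^sup>2) + ennreal ((1/2)^n)" for \<omega>
    proof -
      \<comment> \<open>Young's inequality 2 d 2^-n <= d^2 + 4^-n, multiplied by 2^n: it turns the
        bounds on second moments into bounds on first moments.\<close>
      have "d n \<omega> \<le> 2^n * (d n \<omega>)\<^sup>2 + (1/2)^n"
      proof -
        have "0 \<le> (d n \<omega> - (1/2)^n)\<^sup>2" by simp
        then have "2 * (d n \<omega> * (1/2)^n) \<le> (d n \<omega>)\<^sup>2 + (1/2)^n*(1/2)^n"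
          unfolding power2_diff by (simp add: power2_eq_square mult_ac)
        then have "2^n * (2 * (d n \<omega> * (1/2)^n)) \<le> 2^n * ((d n \<omega>)\<^sup>2 + (1/2)^n*(1/2)^n)"
          by (rule mult_left_mono) simp
        moreover have "2^n * (2 * (d n \<omega> * (1/2)^n)) = 2 * d n \<omega>"
          by (simp add: power_one_over)
        moreover have "2^n * ((d n \<omega>)\<^sup>2 + (1/2)^n*(1/2)^n) = 2^n * (d n \<omega>)\<^sup>2 + (1/2)^n"
          by (simp add: power_one_over distrib_left)
        ultimately show ?thesis using norm_ge_zero[of "X (r (Suc n)) \<omega> - X (r n) \<omega>"] unfolding d_def[symmetric] by linarith
      qed
      then have "ennreal (d n \<omega>) \<le> ennreal (2^n * (d n \<omega>)\<^sup>2 + (1/2)^n)" by (rule ennreal_leI)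
      also have "\<dots> = ennreal (2^n) * ennreal ((d n \<omega>)\<^sup>2) + ennreal ((1/2)^n)"
        by (subst ennreal_plus) (auto simp: ennreal_mult)
      finally show ?thesis .
    qed
    then have "(\<integral>\<^sup>+\<omega>. ennreal (d n \<omega>) \<partial>M) \<le> (\<integral>\<^sup>+\<omega>. ennreal (2^n) * ennreal ((d n \<omega>)\<^sup>2) + ennreal ((1/2)^n) \<partial>M)"
      by (intro nn_integral_mono) auto
    also have "\<dots> = ennreal (2^n) * (\<integral>\<^sup>+\<omega>. ennreal ((d n \<omega>)\<^sup>2) \<partial>M) + ennreal ((1/2)^n)"
      by (subst nn_integral_add) (auto simp: nn_integral_cmult emeasure_space_1)
    also have "(\<integral>\<^sup>+\<omega>. ennreal ((d n \<omega>)\<^sup>2) \<partial>M) = L2d M (X (r (Suc n))) (X (r n))"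
      unfolding L2d_def d_def ..
    also have "ennreal (2^n) * L2d M (X (r (Suc n))) (X (r n)) + ennreal ((1/2)^n) \<le> ennreal (2^n) * ennreal ((1/4)^n) + ennreal ((1/2)^n)"
      by (intro add_right_mono mult_left_mono K[THEN less_imp_le] rm) auto
    also have "\<dots> = ennreal (2^n * (1/4)^n + (1/2)^n)"
      by (simp add: ennreal_mult)
    also have "2^n * (1/4)^n = ((1/2)^n::real)" by (simp add: power_mult_distrib[symmetric])
    finally show ?thesis by simp
  qed
  have "(\<integral>\<^sup>+\<omega>. (\<Sum>n. ennreal (d n \<omega>)) \<partial>M) = (\<Sum>n. \<integral>\<^sup>+\<omega>. ennreal (d n \<omega>) \<partial>M)"
    by (rule nn_integral_suminf) auto
  also have "\<dots> \<le> (\<Sum>n. ennreal (2 * (1/2)^n))" by (intro suminf_le d1) auto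
  also have "\<dots> = ennreal (\<Sum>n. 2 * (1/2)^n)" by (intro suminf_ennreal2) auto
  also have "\<dots> < \<infinity>" by simp
  finally have fin: "(\<integral>\<^sup>+\<omega>. (\<Sum>n. ennreal (d n \<omega>)) \<partial>M) \<noteq> \<infinity>" by simp
  then have "AE \<omega> in M. (\<Sum>n. ennreal (d n \<omega>)) \<noteq> \<infinity>"
    by (rule nn_integral_PInf_AE[rotated]) auto
  then have conv: "AE \<omega> in M. convergent (\<lambda>k. X (r k) \<omega>)"
  proof eventually_elim
    case (elim \<omega>)
    have "summable (\<lambda>n. d n \<omega>)"
      using elim by (intro summable_suminf_not_top) (auto simp: d_def)
    then have "summable (\<lambda>n. X (r (Suc n)) \<omega> - X (r n) \<omega>)"
      unfolding d_def by (rule summable_norm_cancel)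
    then have "convergent (\<lambda>n. \<Sum>i<n. X (r (Suc i)) \<omega> - X (r i) \<omega>)"
      by (simp add: summable_iff_convergent)
    moreover have "(\<Sum>i<n. X (r (Suc i)) \<omega> - X (r i) \<omega>) = X (r n) \<omega> - X (r 0) \<omega>" for n
      by (rule sum_lessThan_telescope)
    ultimately have "convergent (\<lambda>n. X (r n) \<omega> - X (r 0) \<omega>)" by simp
    then have "convergent (\<lambda>n. (X (r n) \<omega> - X (r 0) \<omega>) + X (r 0) \<omega>)"
      by (intro convergent_add convergent_const)
    then show ?case by simp
  qed
  define Y where "Y \<omega> = lim (\<lambda>k. X (r k) \<omega>)" for \<omega>
  have Y[measurable]: "Y \<in> borel_measurable M" unfolding Y_def by measurable
  have AEc: "AE \<omega> in M. (\<lambda>k. X (r k) \<omega>) \<longlonglongrightarrow> Y \<omega>"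
    using conv unfolding Y_def by eventually_elim (simp add: convergent_LIMSEQ_iff)
  have "\<exists>k0. \<forall>k\<ge>k0. L2d M (X k) Y < ennreal \<epsilon>" if "\<epsilon> > 0" for \<epsilon>
  proof -
    obtain k0 where k0: "\<And>k l. k \<ge> k0 \<Longrightarrow> l \<ge> k0 \<Longrightarrow> L2d M (X k) (X l) < ennreal (\<epsilon>/2)"
    proof -
      have "\<exists>k0. \<forall>k\<ge>k0. \<forall>l\<ge>k0. L2d M (X k) (X l) < ennreal (\<epsilon>/2)"
        by (rule cauchy) (use \<open>\<epsilon> > 0\<close> in simp)
      then show ?thesis using that by blast
    qed
    have "L2d M (X k) Y < ennreal \<epsilon>" if "k \<ge> k0" for k
    proof -
      \<comment> \<open>Fatou's lemma along the subsequence carries the Cauchy estimate over to the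
        limit.\<close>
      have "L2d M (X k) Y = (\<integral>\<^sup>+\<omega>. liminf (\<lambda>n. ennreal ((norm (X k \<omega> - X (r n) \<omega>))\<^sup>2)) \<partial>M)"
        unfolding L2d_def
      proof (rule nn_integral_cong_AE, use AEc in eventually_elim)
        fix \<omega> assume "(\<lambda>n. X (r n) \<omega>) \<longlonglongrightarrow> Y \<omega>"
        then have "(\<lambda>n. ennreal ((norm (X k \<omega> - X (r n) \<omega>))\<^sup>2)) \<longlonglongrightarrow> ennreal ((norm (X k \<omega> - Y \<omega>))\<^sup>2)"
          by (intro tendsto_ennrealI tendsto_intros)
        then show "ennreal ((norm (X k \<omega> - Y \<omega>))\<^sup>2) = liminf (\<lambda>n. ennreal ((norm (X k \<omega> - X (r n) \<omega>))\<^sup>2))"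
          by (metis lim_imp_Liminf sequentially_bot)
      qed
      also have "\<dots> \<le> liminf (\<lambda>n. \<integral>\<^sup>+\<omega>. ennreal ((norm (X k \<omega> - X (r n) \<omega>))\<^sup>2) \<partial>M)"
        by (rule nn_integral_liminf) auto
      also have "\<dots> \<le> ennreal (\<epsilon>/2)"
      proof (rule Liminf_le)
        have "L2d M (X k) (X (r n)) \<le> ennreal (\<epsilon>/2)" if "n \<ge> k0" for n
          using k0[of k "r n"] \<open>k \<ge> k0\<close> that strict_mono_imp_increasing[OF r, of n] by (meson less_imp_le order_trans)
        then show "\<forall>\<^sub>F n in sequentially. (\<integral>\<^sup>+\<omega>. ennreal ((norm (X k \<omega> - X (r n) \<omega>))\<^sup>2) \<partial>M) \<le> ennreal (\<epsilon>/2)"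
          unfolding L2d_def eventually_sequentially by blast
      qed simp
      also have "\<dots> < ennreal \<epsilon>" using \<open>\<epsilon> > 0\<close> by (simp add: ennreal_less_iff)
      finally show ?thesis .
    qed
    then show ?thesis by blast
  qed
  then have "L2_tendsto M X Y" unfolding L2_tendsto_L2d ennreal_lim_0_iff by blast
  with Y AEc r that show ?thesis by blast
qed

section \<open>Closures of graphs of operators\<close>

text \<open>Only the random variable has to be measurable, and nothing is asked of the integrand:
  this mirrors \<open>is_mult_int\<close> and \<open>is_gauss_int\<close>.\<close>

definition graph_closure ::
  "'b measure \<Rightarrow> 'w measure \<Rightarrow> (('b \<Rightarrow> 'c::real_normed_vector) \<times> ('w \<Rightarrow> 'd::real_normed_vector)) set
    \<Rightarrow> (('b \<Rightarrow> 'c) \<times> ('w \<Rightarrow> 'd)) set" where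
  "graph_closure N M E = {(g, X). X \<in> borel_measurable M \<and>
     (\<exists>F Y. (\<forall>k::nat. (F k, Y k) \<in> E) \<and> L2_tendsto N F g \<and> L2_tendsto M Y X)}"

text \<open>With tolerances instead of sequences, taking limits inside a closure needs no diagonal
  sequence.\<close>

lemma graph_closure_iff:
  "(g, X) \<in> graph_closure N M E \<longleftrightarrow> X \<in> borel_measurable M \<and>
     (\<forall>\<epsilon>>0. \<exists>F Y. (F, Y) \<in> E \<and> L2d N F g < ennreal \<epsilon> \<and> L2d M Y X < ennreal \<epsilon>)"
proof safe
  assume "(g, X) \<in> graph_closure N M E"
  then obtain F Y where FY: "\<And>k::nat. (F k, Y k) \<in> E" "L2_tendsto N F g" "L2_tendsto M Y X"
    and X: "X \<in> borel_measurable M"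
    unfolding graph_closure_def by blast
  show "X \<in> borel_measurable M" by fact
  fix \<epsilon> :: real assume "\<epsilon> > 0"
  then obtain k1 k2 where "\<forall>k\<ge>k1. L2d N (F k) g < ennreal \<epsilon>" "\<forall>k\<ge>k2. L2d M (Y k) X < ennreal \<epsilon>"
    using FY(2,3) unfolding L2_tendsto_L2d ennreal_lim_0_iff by blast
  then show "\<exists>F Y. (F, Y) \<in> E \<and> L2d N F g < ennreal \<epsilon> \<and> L2d M Y X < ennreal \<epsilon>"
    using FY(1)[of "max k1 k2"] by (meson max.cobounded1 max.cobounded2)
next
  assume X: "X \<in> borel_measurable M"
    and *: "\<forall>\<epsilon>>0. \<exists>F Y. (F, Y) \<in> E \<and> L2d N F g < ennreal \<epsilon> \<and> L2d M Y X < ennreal \<epsilon>"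
  have "\<forall>k::nat. \<exists>F Y. (F, Y) \<in> E \<and> L2d N F g < ennreal (1 / (real k + 1)) \<and> L2d M Y X < ennreal (1 / (real k + 1))"
    using * by simp
  then obtain F Y where FY: "\<And>k. (F k, Y k) \<in> E" "\<And>k. L2d N (F k) g < ennreal (1 / (real k + 1))"
      "\<And>k. L2d M (Y k) X < ennreal (1 / (real k + 1))"
    by metis
  have "(\<lambda>k. 1 / (real k + 1)) \<longlonglongrightarrow> 0"
    using LIMSEQ_inverse_real_of_nat by (simp add: inverse_eq_divide add.commute)
  then have z: "(\<lambda>k. ennreal (1 / (real k + 1))) \<longlonglongrightarrow> 0"
    using tendsto_ennrealI by fastforce
  have "L2_tendsto N F g" "L2_tendsto M Y X"
    unfolding L2_tendsto_L2d
    by (rule tendsto_sandwich[OF _ _ tendsto_const z]; auto intro!: less_imp_le FY always_eventually)+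
  then show "(g, X) \<in> graph_closure N M E" unfolding graph_closure_def using FY(1) X by blast
qed

lemma graph_closure_incl:
  "(g, X) \<in> E \<Longrightarrow> X \<in> borel_measurable M \<Longrightarrow> (g, X) \<in> graph_closure N M E"
  unfolding graph_closure_iff by (intro conjI allI impI exI[of _ g] exI[of _ X]) simp_all

lemma graph_closure_closed:
  fixes E :: "(('b \<Rightarrow> 'c::{real_normed_vector, second_countable_topology}) \<times> ('w \<Rightarrow> 'd::{real_normed_vector, second_countable_topology})) set"
  assumes E: "\<And>F Y. (F, Y) \<in> E \<Longrightarrow> F \<in> borel_measurable N \<and> Y \<in> borel_measurable M"
    and cl: "\<And>k::nat. (g k, X k) \<in> graph_closure N M E"
    and meas: "\<And>k. g k \<in> borel_measurable N" "h \<in> borel_measurable N" "Z \<in> borel_measurable M"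
    and lim: "L2_tendsto N g h" "L2_tendsto M X Z"
  shows "(h, Z) \<in> graph_closure N M E"
  unfolding graph_closure_iff
proof (intro conjI allI impI meas)
  fix \<epsilon> :: real assume e: "\<epsilon> > 0"
  \<comment> \<open>A quarter for each leg, because \<open>L2d_triangle\<close> doubles both of
    them.\<close>
  then have "\<epsilon> / 4 > 0" by simp
  then obtain k1 k2 where "\<forall>k\<ge>k1. L2d N (g k) h < ennreal (\<epsilon>/4)" "\<forall>k\<ge>k2. L2d M (X k) Z < ennreal (\<epsilon>/4)"
    using lim unfolding L2_tendsto_L2d ennreal_lim_0_iff by blast
  then obtain k where k: "L2d N (g k) h < ennreal (\<epsilon>/4)" "L2d M (X k) Z < ennreal (\<epsilon>/4)"
    by (meson max.cobounded1 max.cobounded2)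
  obtain F Y where FY: "(F, Y) \<in> E" "L2d N F (g k) < ennreal (\<epsilon>/4)" "L2d M Y (X k) < ennreal (\<epsilon>/4)"
    and Xk: "X k \<in> borel_measurable M"
    using cl[of k] \<open>\<epsilon>/4 > 0\<close> unfolding graph_closure_iff by blast
  have sum: "2 * a + 2 * b < ennreal \<epsilon>" if "a < ennreal (\<epsilon>/4)" "b < ennreal (\<epsilon>/4)" for a b
  proof -
    have "a + b < ennreal (\<epsilon>/4) + ennreal (\<epsilon>/4)" using that by (intro add_strict_mono)
    also have "\<dots> = ennreal (\<epsilon>/2)" using e by (simp add: ennreal_plus[symmetric] del: ennreal_plus)
    finally have "2 * (a + b) < 2 * ennreal (\<epsilon>/2)"
      by (intro ennreal_mult_strict_left_mono) (auto simp: ennreal_numeral_less_top)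
    also have "\<dots> = ennreal (2 * (\<epsilon>/2))" using e by (simp only: ennreal_mult' ennreal_numeral zero_le_numeral)
    finally show ?thesis by (simp add: distrib_left)
  qed
  have "L2d N F h < ennreal \<epsilon>"
    using E[OF FY(1)] meas FY k by (intro le_less_trans[OF L2d_triangle[of F _ "g k"] sum]) auto
  moreover have "L2d M Y Z < ennreal \<epsilon>"
    using E[OF FY(1)] meas Xk FY k by (intro le_less_trans[OF L2d_triangle[of Y _ "X k"] sum]) auto
  ultimately show "\<exists>F Y. (F, Y) \<in> E \<and> L2d N F h < ennreal \<epsilon> \<and> L2d M Y Z < ennreal \<epsilon>"
    using FY(1) by blast
qed

lemma graph_closure_bound:
  fixes E :: "(('b \<Rightarrow> 'c::{real_normed_vector, second_countable_topology}) \<times> ('w \<Rightarrow> 'd::{real_normed_vector, second_countable_topology})) set"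
  assumes E: "\<And>F Y. (F, Y) \<in> E \<Longrightarrow> F \<in> borel_measurable N \<and> Y \<in> borel_measurable M"
    and bound: "\<And>F Y F' Y'. (F, Y) \<in> E \<Longrightarrow> (F', Y') \<in> E \<Longrightarrow> L2d M Y Y' \<le> ennreal C * L2d N F F'"
    and "(g, X) \<in> graph_closure N M E" "(g', X') \<in> graph_closure N M E"
    and "g \<in> borel_measurable N" "g' \<in> borel_measurable N"
  shows "L2d M X X' \<le> ennreal (16 * C) * L2d N g g'"
proof -
  obtain F Y F' Y' where "\<And>k. (F k, Y k) \<in> E" "L2_tendsto N F g" "L2_tendsto M Y X"
      "\<And>k. (F' k, Y' k) \<in> E" "L2_tendsto N F' g'" "L2_tendsto M Y' X'"
      "X \<in> borel_measurable M" "X' \<in> borel_measurable M"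
    using assms(3,4) unfolding graph_closure_def by blast
  note FY = this
  show ?thesis
    using E[OF FY(1)] E[OF FY(4)] bound[OF FY(1) FY(4)] assms(5,6) FY
    by (intro L2d_limit_bound[where F=F and F'=F' and Y=Y and Y'=Y']) auto
qed

text \<open>The bound on the graph turns a convergent sequence of integrands into a Cauchy sequence
  of random variables. This is the source of every existence statement for integrals.\<close>

lemma (in prob_space) graph_closure_complete:
  fixes E :: "(('b \<Rightarrow> 'c::{real_normed_vector, second_countable_topology}) \<times> ('a \<Rightarrow> 'd::{banach, second_countable_topology})) set"
  assumes E: "\<And>F Y. (F, Y) \<in> E \<Longrightarrow> F \<in> borel_measurable N \<and> Y \<in> borel_measurable M"
    and bound: "\<And>F Y F' Y'. (F, Y) \<in> E \<Longrightarrow> (F', Y') \<in> E \<Longrightarrow> L2d M Y Y' \<le> ennreal C * L2d N F F'"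
    and C: "C > 0"
    and cl: "\<And>k::nat. (g k, X k) \<in> graph_closure N M E"
    and meas: "\<And>k. g k \<in> borel_measurable N" "h \<in> borel_measurable N"
    and lim: "L2_tendsto N g h"
  obtains Z where "(h, Z) \<in> graph_closure N M E" "L2_tendsto M X Z"
    "\<exists>r. strict_mono r \<and> (AE \<omega> in M. (\<lambda>k. X (r k) \<omega>) \<longlonglongrightarrow> Z \<omega>)"
proof -
  have X[measurable]: "X k \<in> borel_measurable M" for k
    using cl[of k] unfolding graph_closure_iff by blast
  have "\<exists>k0. \<forall>k\<ge>k0. \<forall>l\<ge>k0. L2d M (X k) (X l) < ennreal \<epsilon>" if e: "\<epsilon> > 0" for \<epsilon>
  proof -
    \<comment> \<open>Two integrands within \<delta> of \<open>h\<close> are within 4\<delta> of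
      each other, and the bound on the closure has constant 16 C; hence 64 C.\<close>
    define \<delta> where "\<delta> = \<epsilon> / (64 * C)"
    have "\<delta> > 0" using e C by (simp add: \<delta>_def)
    then obtain k0 where k0: "\<And>k. k \<ge> k0 \<Longrightarrow> L2d N (g k) h < ennreal \<delta>"
      using lim unfolding L2_tendsto_L2d ennreal_lim_0_iff by blast
    have "L2d M (X k) (X l) < ennreal \<epsilon>" if "k \<ge> k0" "l \<ge> k0" for k l
    proof -
      have "L2d N (g k) (g l) \<le> 2 * (L2d N (g k) h + L2d N (g l) h)"
        using L2d_triangle[of "g k" N h "g l"] meas by (simp add: L2d_commute[of N h] distrib_left)
      also have "L2d N (g k) h + L2d N (g l) h < ennreal \<delta> + ennreal \<delta>"
        using k0 that by (intro add_strict_mono) auto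
      then have "2 * (L2d N (g k) h + L2d N (g l) h) < 2 * (ennreal \<delta> + ennreal \<delta>)"
        by (intro ennreal_mult_strict_left_mono) (auto simp: ennreal_numeral_less_top)
      also have "\<dots> = 4 * ennreal \<delta>"
        by (simp only: mult_2[symmetric] mult.assoc[symmetric]) simp
      also have "\<dots> = ennreal (4 * \<delta>)" using \<open>\<delta> > 0\<close> by (simp add: ennreal_mult')
      finally have 1: "L2d N (g k) (g l) < ennreal (4 * \<delta>)" .
      have "L2d M (X k) (X l) \<le> ennreal (16 * C) * L2d N (g k) (g l)"
        by (rule graph_closure_bound[OF E bound cl cl meas(1) meas(1)])
      also have "\<dots> < ennreal (16 * C) * ennreal (4 * \<delta>)"
        using C by (intro ennreal_mult_strict_left_mono 1) auto
      also have "\<dots> = ennreal (16 * C * (4 * \<delta>))" using C \<open>\<delta> > 0\<close> by (subst ennreal_mult) auto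
      also have "16 * C * (4 * \<delta>) = \<epsilon>" using C by (simp add: \<delta>_def)
      finally show ?thesis .
    qed
    then show ?thesis by blast
  qed
  then obtain Z where Z: "Z \<in> borel_measurable M" "L2_tendsto M X Z"
      "\<exists>r. strict_mono r \<and> (AE \<omega> in M. (\<lambda>k. X (r k) \<omega>) \<longlonglongrightarrow> Z \<omega>)"
    using L2_complete[of X thesis, OF X] by blast
  have "(h, Z) \<in> graph_closure N M E"
    by (rule graph_closure_closed[OF E cl meas Z(1) lim Z(2)])
  with Z that show ?thesis by blast
qed

lemma (in prob_space) graph_closure_unique:
  fixes E :: "(('b \<Rightarrow> 'c::{real_normed_vector, second_countable_topology}) \<times> ('a \<Rightarrow> 'd::{real_normed_vector, second_countable_topology})) set"
  assumes E: "\<And>F Y. (F, Y) \<in> E \<Longrightarrow> F \<in> borel_measurable N \<and> Y \<in> borel_measurable M"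
    and bound: "\<And>F Y F' Y'. (F, Y) \<in> E \<Longrightarrow> (F', Y') \<in> E \<Longrightarrow> L2d M Y Y' \<le> ennreal C * L2d N F F'"
    and "(g, X) \<in> graph_closure N M E" "(g, X') \<in> graph_closure N M E"
    and "g \<in> borel_measurable N"
  shows "AE \<omega> in M. X \<omega> = X' \<omega>"
proof (rule L2d_eq_0D)
  show "L2d M X X' = 0"
    using graph_closure_bound[OF E bound assms(3,4) assms(5,5)] by simp
qed (use assms(3,4) in \<open>auto simp: graph_closure_iff\<close>)

lemma L2_tendsto_AE_subseq:
  fixes X :: "nat \<Rightarrow> 'w \<Rightarrow> 'd::{banach, second_countable_topology}"
  assumes "prob_space M" "\<And>k. X k \<in> borel_measurable M" "Z \<in> borel_measurable M" "L2_tendsto M X Z"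
  obtains r where "strict_mono r" "AE \<omega> in M. (\<lambda>k. X (r k) \<omega>) \<longlonglongrightarrow> Z \<omega>"
proof -
  interpret prob_space M by fact
  \<comment> \<open>The graph of the identity: completeness produces the almost surely convergent
    subsequence, and uniqueness identifies its limit with \<open>Z\<close>.\<close>
  let ?E = "{(F, Y). F = Y \<and> F \<in> borel_measurable M}"
  obtain Z' where Z': "(Z, Z') \<in> graph_closure M M ?E"
      and r: "\<exists>r. strict_mono r \<and> (AE \<omega> in M. (\<lambda>k. X (r k) \<omega>) \<longlonglongrightarrow> Z' \<omega>)"
    by (rule graph_closure_complete[of ?E M 1 X X Z])
      (use assms in \<open>auto intro!: graph_closure_incl\<close>)
  have "(Z, Z) \<in> graph_closure M M ?E" using assms by (auto intro!: graph_closure_incl)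
  then have "AE \<omega> in M. Z' \<omega> = Z \<omega>"
    using graph_closure_unique[of ?E M 1 Z Z' Z] Z' assms by auto
  moreover obtain r where r: "strict_mono r" and "AE \<omega> in M. (\<lambda>k. X (r k) \<omega>) \<longlonglongrightarrow> Z' \<omega>"
    using r by blast
  ultimately have "AE \<omega> in M. (\<lambda>k. X (r k) \<omega>) \<longlonglongrightarrow> Z \<omega>"
    by (auto elim: eventually_elim2)
  with r show ?thesis using that by blast
qed

section \<open>Polarization and Ryser's formula\<close>

definition unit_root :: "nat \<Rightarrow> nat \<Rightarrow> complex" where
  "unit_root m l = exp (2 * of_real pi * \<i> * of_nat l / of_nat m)"

lemma unit_root_cnj [simp]: "unit_root m l * cnj (unit_root m l) = 1"
proof -
  have "unit_root m l = cis (2 * pi * real l / real m)"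
    unfolding unit_root_def cis_conv_exp by (simp add: mult_ac)
  then show ?thesis by (simp add: cis_cnj cis_mult)
qed

lemma unit_root_cnj_left [simp]: "unit_root m l * (cnj (unit_root m l) * y) = y"
  using unit_root_cnj[of m l] by (simp only: mult.assoc[symmetric] mult_1_left)

lemma sum_unit_root_power:
  assumes "0 < m" "k < m"
  shows "(\<Sum>l<m. unit_root m l ^ k) = (if k = 0 then of_nat m else 0)"
proof (cases "k = 0")
  case False
  define w where "w = exp (2 * of_real pi * \<i> * of_nat k / of_nat m :: complex)"
  have wl: "unit_root m l ^ k = w ^ l" for l
    unfolding unit_root_def w_def exp_of_nat_mult[symmetric] by (simp add: mult_ac)
  have "w \<noteq> 1"
    using complex_root_unity_eq_1[of m k] assms False unfolding w_def by (auto dest: dvd_imp_le)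
  moreover have "w ^ m = 1"
    unfolding w_def exp_of_nat_mult[symmetric] using assms
    by (simp add: exp_eq_1 mult_ac)
  ultimately show ?thesis using False unfolding wl by (simp add: sum_gp_strict)
qed simp

text \<open>On the unit circle conjugation is inversion, so the summand is a power with exponent k -
  n (or the conjugate of one), and this exponent is smaller than m in absolute value.\<close>

lemma sum_unit_root_cnj:
  assumes "k < m" "n < m"
  shows "(\<Sum>l<m. unit_root m l ^ k * cnj (unit_root m l) ^ n) = (if k = n then of_nat m else 0)"
proof -
  have red: "unit_root m l ^ (j + i) * cnj (unit_root m l) ^ i = unit_root m l ^ j" for l i j
  proof -
    have "unit_root m l ^ (j + i) * cnj (unit_root m l) ^ i
        = unit_root m l ^ j * (unit_root m l * cnj (unit_root m l)) ^ i"
      unfolding power_add power_mult_distrib by (simp only: mult.assoc)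
    then show ?thesis by simp
  qed
  show ?thesis
  proof (cases "n \<le> k")
    case True
    then have "(\<Sum>l<m. unit_root m l ^ k * cnj (unit_root m l) ^ n) = (\<Sum>l<m. unit_root m l ^ (k - n))"
      using red[of _ "k - n" n] by simp
    then show ?thesis using sum_unit_root_power[of m "k - n"] assms True by auto
  next
    case False
    have "(\<Sum>l<m. unit_root m l ^ k * cnj (unit_root m l) ^ n)
        = cnj (\<Sum>l<m. unit_root m l ^ (n - k + k) * cnj (unit_root m l) ^ k)"
      using False by (simp add: mult.commute)
    also have "\<dots> = cnj (\<Sum>l<m. unit_root m l ^ (n - k))" by (simp only: red)
    finally show ?thesis using sum_unit_root_power[of m "n - k"] assms False by auto
  qed
qed

text \<open>Among the exponents below m only 0 is divisible by m. This is the discrete form of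
  averaging a polynomial over the circle.\<close>

lemma sum_poly_unit_root:
  assumes "degree p < m"
  shows "(\<Sum>l<m. poly p (unit_root m l)) = of_nat m * poly p 0"
proof -
  have "(\<Sum>l<m. poly p (unit_root m l)) = (\<Sum>i\<le>degree p. coeff p i * (\<Sum>l<m. unit_root m l ^ i))"
    unfolding poly_altdef by (subst sum.swap) (simp add: sum_distrib_left)
  also have "\<dots> = (\<Sum>i\<le>degree p. if i = 0 then coeff p i * of_nat m else 0)"
    using assms by (intro sum.cong refl) (auto simp: sum_unit_root_power)
  finally show ?thesis by (simp add: poly_0_coeff_0)
qed

text \<open>Expand a product of |C| factors (-1) + 1.\<close>

lemma sum_alternating_Pow:
  assumes "finite C"
  shows "(\<Sum>T\<in>Pow C. (-1) ^ card T) = (if C = {} then 1 else 0 :: 'c::comm_ring_1)"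
proof -
  have "(\<Prod>x\<in>C. (-1) + (1::'c)) = (\<Sum>T\<in>Pow C. (\<Prod>x\<in>T. -1) * (\<Prod>x\<in>C-T. 1))"
    by (rule prod_add[OF assms])
  then have "(\<Sum>T\<in>Pow C. (-1) ^ card T) = (0::'c) ^ card C" by simp
  then show ?thesis using assms by (simp add: power_0_left)
qed

text \<open>Inclusion-exclusion: multiplying out gives a sum over all maps f from B to B, and the
  signs of the sets S containing f(B) cancel unless f is onto, in which case f is a permutation. The
  right-hand side is a permanent.\<close>

lemma Ryser_formula:
  fixes a :: "'b \<Rightarrow> 'b \<Rightarrow> 'c::comm_ring_1"
  assumes B: "finite B"
  shows "(\<Sum>S\<in>Pow B. (-1) ^ card (B - S) * (\<Prod>b\<in>B. \<Sum>c\<in>S. a b c)) = (\<Sum>p | p permutes B. \<Prod>b\<in>B. a b (p b))"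
proof -
  let ?F = "PiE B (\<lambda>_. B)"
  have fin: "finite ?F" using B by (intro finite_PiE) auto
  have "(\<Prod>b\<in>B. \<Sum>c\<in>S. a b c) = (\<Sum>f\<in>?F. if f ` B \<subseteq> S then \<Prod>b\<in>B. a b (f b) else 0)" if "S \<in> Pow B" for S
  proof -
    have "finite S" using that B by (auto intro: finite_subset)
    then have "(\<Prod>b\<in>B. \<Sum>c\<in>S. a b c) = (\<Sum>f\<in>PiE B (\<lambda>_. S). \<Prod>b\<in>B. a b (f b))"
      using B by (subst prod_sum_PiE) auto
    also have "PiE B (\<lambda>_. S) = {f \<in> ?F. f ` B \<subseteq> S}"
      using that unfolding PiE_def by auto
    finally show ?thesis using fin by (simp add: sum.inter_filter)
  qed
  then have "(\<Sum>S\<in>Pow B. (-1) ^ card (B - S) * (\<Prod>b\<in>B. \<Sum>c\<in>S. a b c))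
     = (\<Sum>S\<in>Pow B. \<Sum>f\<in>?F. (\<Prod>b\<in>B. a b (f b)) * (if f ` B \<subseteq> S then (-1) ^ card (B - S) else 0))"
    by (intro sum.cong refl) (auto simp: sum_distrib_left intro!: sum.cong)
  also have "\<dots> = (\<Sum>f\<in>?F. (\<Prod>b\<in>B. a b (f b)) * (\<Sum>S\<in>Pow B. if f ` B \<subseteq> S then (-1) ^ card (B - S) else 0))"
    by (subst sum.swap) (simp add: sum_distrib_left)
  also have "\<dots> = (\<Sum>f\<in>?F. (\<Prod>b\<in>B. a b (f b)) * (if f ` B = B then 1 else 0))"
  proof (intro sum.cong refl arg_cong2[where f="(*)"])
    fix f assume f: "f \<in> ?F"
    have "(\<Sum>S\<in>Pow B. if f ` B \<subseteq> S then (-1) ^ card (B - S) else 0)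
        = (\<Sum>S | S \<in> Pow B \<and> f ` B \<subseteq> S. (-1) ^ card (B - S) :: 'c)"
      using B by (intro sum.inter_filter[symmetric]) auto
    also have "\<dots> = (\<Sum>T\<in>Pow (B - f ` B). (-1) ^ card T)"
      by (rule sum.reindex_bij_witness[of _ "\<lambda>T. B - T" "\<lambda>S. B - S"])
        (use f in \<open>auto simp: PiE_iff double_diff\<close>)
    also have "\<dots> = (if B - f ` B = {} then 1 else 0)" using B by (intro sum_alternating_Pow) auto
    also have "B - f ` B = {} \<longleftrightarrow> f ` B = B" using f by (auto simp: PiE_iff)
    finally show "(\<Sum>S\<in>Pow B. if f ` B \<subseteq> S then (-1) ^ card (B - S) else 0) = (if f ` B = B then 1 else (0::'c))" .
  qed
  also have "\<dots> = (\<Sum>f | f \<in> ?F \<and> f ` B = B. \<Prod>b\<in>B. a b (f b))"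
    using fin by (subst sum.inter_filter) (auto intro!: sum.cong)
  also have "\<dots> = (\<Sum>p | p permutes B. \<Prod>b\<in>B. a b (p b))"
  \<comment> \<open>Elements of \<open>?F\<close> are \<open>undefined\<close> outside B,
    permutations are the identity there; the two witnesses translate between these
    conventions.\<close>
  proof (rule sum.reindex_bij_witness[of _ "\<lambda>p. restrict p B" "\<lambda>f x. if x \<in> B then f x else x"])
    fix f assume f: "f \<in> {f \<in> ?F. f ` B = B}"
    then have "bij_betw f B B"
      using B by (auto simp: bij_betw_def intro: eq_card_imp_inj_on)
    then have "bij_betw (\<lambda>x. if x \<in> B then f x else x) B B"
      by (rule bij_betw_cong[THEN iffD1, rotated]) auto
    then show "(\<lambda>x. if x \<in> B then f x else x) \<in> {p. p permutes B}"
      by (auto intro: bij_imp_permutes)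
    show "restrict (\<lambda>x. if x \<in> B then f x else x) B = f"
      using f by (auto simp: fun_eq_iff PiE_iff extensional_def)
    show "(\<Prod>b\<in>B. a b (if b \<in> B then f b else b)) = (\<Prod>b\<in>B. a b (f b))"
      by (intro prod.cong) auto
  next
    fix p assume "p \<in> {p. p permutes B}"
    then have p: "p permutes B" by simp
    show "(\<lambda>x. if x \<in> B then restrict p B x else x) = p"
      using p by (auto simp: fun_eq_iff permutes_def)
    show "restrict p B \<in> {f \<in> ?F. f ` B = B}"
      using p permutes_image[OF p] by (auto simp: permutes_in_image image_restrict_eq)
  qed
  finally show ?thesis .
qed

text \<open>Ryser's formula for a matrix with equal rows: all card B! terms of the permanent
  coincide. It writes a product as a signed sum of powers, so that mixed moments reduce to moments
  of single linear combinations.\<close>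

lemma prod_polarization:
  fixes z :: "'b \<Rightarrow> 'c::comm_ring_1"
  assumes B: "finite B"
  shows "(\<Sum>S\<in>Pow B. (-1) ^ card (B - S) * (\<Sum>c\<in>S. z c) ^ card B) = of_nat (fact (card B)) * (\<Prod>b\<in>B. z b)"
proof -
  have "(\<Sum>S\<in>Pow B. (-1) ^ card (B - S) * (\<Prod>b\<in>B. \<Sum>c\<in>S. z c)) = (\<Sum>p | p permutes B. \<Prod>b\<in>B. z (p b))"
    by (rule Ryser_formula[OF B])
  also have "\<dots> = (\<Sum>p | p permutes B. \<Prod>b\<in>B. z b)"
  proof (intro sum.cong refl)
    fix p assume "p \<in> {p. p permutes B}"
    then show "(\<Prod>b\<in>B. z (p b)) = (\<Prod>b\<in>B. z b)"
      using prod.permute[of p B z] by (simp add: o_def)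
  qed
  finally show ?thesis using B by (simp add: card_permutations)
qed

section \<open>Moments of the complex Gaussian measure\<close>

text \<open>An algebra of random variables closed under products and conjugation, so that
  integrability of any polynomial in the Gaussian variables follows from its syntax.\<close>

definition (in prob_space) fin_mom :: "('a \<Rightarrow> complex) \<Rightarrow> bool" where
  "fin_mom X \<longleftrightarrow> X \<in> borel_measurable M \<and> (\<forall>k. integrable M (\<lambda>\<omega>. norm (X \<omega>) ^ k))"

context prob_space begin

lemma fin_mom_measurable: "fin_mom X \<Longrightarrow> X \<in> borel_measurable M"
  by (simp add: fin_mom_def)

lemma fin_mom_integrable: "fin_mom X \<Longrightarrow> integrable M X"
  unfolding fin_mom_def using integrable_norm_iff[of X M] by (metis (no_types, lifting) Bochner_Integration.integrable_cong power_one_right)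

lemma fin_mom_const: "fin_mom (\<lambda>_. c)"
  by (simp add: fin_mom_def)

lemma fin_mom_mult:
  assumes "fin_mom X" "fin_mom Y" shows "fin_mom (\<lambda>\<omega>. X \<omega> * Y \<omega>)"
  unfolding fin_mom_def
proof (intro conjI allI)
  have [measurable]: "X \<in> borel_measurable M" "Y \<in> borel_measurable M"
    using assms by (auto simp: fin_mom_def)
  show "(\<lambda>\<omega>. X \<omega> * Y \<omega>) \<in> borel_measurable M" by measurable
  fix k
  show "integrable M (\<lambda>\<omega>. norm (X \<omega> * Y \<omega>) ^ k)"
  proof (rule Bochner_Integration.integrable_bound)
    show "integrable M (\<lambda>\<omega>. norm (X \<omega>) ^ (2*k) + norm (Y \<omega>) ^ (2*k))"
      using assms unfolding fin_mom_def by (intro Bochner_Integration.integrable_add) auto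
    \<comment> \<open>An elementary substitute for Hoelder's inequality: the squares of a^k and b^k
      bound their product.\<close>
    have "(a * b) ^ k \<le> a ^ (2*k) + b ^ (2*k)" if "a \<ge> 0" "b \<ge> 0" for a b :: real
    proof -
      have "0 \<le> (a^k)*(b^k)" using that by simp
      then show ?thesis
        using sum_squares_bound[of "a^k" "b^k"]
        by (simp add: power_mult_distrib power_even_eq del: zero_le_mult_iff)
    qed
    then show "AE \<omega> in M. norm (norm (X \<omega> * Y \<omega>) ^ k) \<le> norm (norm (X \<omega>) ^ (2*k) + norm (Y \<omega>) ^ (2*k))"
      by (auto simp: norm_mult norm_power)
  qed measurable
qed

lemma fin_mom_add:
  assumes "fin_mom X" "fin_mom Y" shows "fin_mom (\<lambda>\<omega>. X \<omega> + Y \<omega>)"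
  unfolding fin_mom_def
proof (intro conjI allI)
  have [measurable]: "X \<in> borel_measurable M" "Y \<in> borel_measurable M"
    using assms by (auto simp: fin_mom_def)
  show "(\<lambda>\<omega>. X \<omega> + Y \<omega>) \<in> borel_measurable M" by measurable
  fix k
  show "integrable M (\<lambda>\<omega>. norm (X \<omega> + Y \<omega>) ^ k)"
  proof (rule Bochner_Integration.integrable_bound)
    show "integrable M (\<lambda>\<omega>. 2 ^ k * (norm (X \<omega>) ^ k + norm (Y \<omega>) ^ k))"
      using assms unfolding fin_mom_def
      by (intro integrable_mult_right Bochner_Integration.integrable_add) auto
    have "norm (x + y) ^ k \<le> 2 ^ k * (norm x ^ k + norm y ^ k)" for x y :: complex
    proof -
      have "norm (x + y) ^ k \<le> (2 * max (norm x) (norm y)) ^ k"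
        by (intro power_mono) (use norm_triangle_ineq[of x y] in auto)
      also have "\<dots> = 2 ^ k * max (norm x) (norm y) ^ k" by (simp add: power_mult_distrib)
      also have "\<dots> \<le> 2 ^ k * (norm x ^ k + norm y ^ k)"
        by (intro mult_left_mono) (auto simp: max_def)
      finally show ?thesis .
    qed
    then show "AE \<omega> in M. norm (norm (X \<omega> + Y \<omega>) ^ k) \<le> norm (2 ^ k * (norm (X \<omega>) ^ k + norm (Y \<omega>) ^ k))"
      by (auto simp: norm_power)
  qed measurable
qed

lemma fin_mom_cnj: "fin_mom X \<Longrightarrow> fin_mom (\<lambda>\<omega>. cnj (X \<omega>))"
  unfolding fin_mom_def by (auto intro: borel_measurable_continuous_on[OF continuous_on_cnj[OF continuous_on_id]])

lemma fin_mom_sum: "(\<And>i. i \<in> I \<Longrightarrow> fin_mom (X i)) \<Longrightarrow> fin_mom (\<lambda>\<omega>. \<Sum>i\<in>I. X i \<omega>)"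
  by (induction I rule: infinite_finite_induct) (auto intro: fin_mom_const fin_mom_add)

lemma fin_mom_prod: "(\<And>i. i \<in> I \<Longrightarrow> fin_mom (X i)) \<Longrightarrow> fin_mom (\<lambda>\<omega>. \<Prod>i\<in>I. X i \<omega>)"
  by (induction I rule: infinite_finite_induct) (auto intro: fin_mom_const fin_mom_mult)

lemma fin_mom_power: "fin_mom X \<Longrightarrow> fin_mom (\<lambda>\<omega>. X \<omega> ^ k)"
  by (induction k) (auto intro: fin_mom_const fin_mom_mult)

lemma fin_mom_sum_list: "(\<And>x. x \<in> set L \<Longrightarrow> fin_mom (X x)) \<Longrightarrow> fin_mom (\<lambda>\<omega>. \<Sum>x\<leftarrow>L. X x \<omega>)"
  by (induction L) (auto intro: fin_mom_const fin_mom_add)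

lemmas fin_mom_intros = fin_mom_const fin_mom_add fin_mom_mult fin_mom_sum fin_mom_prod
  fin_mom_power fin_mom_cnj fin_mom_sum_list

section \<open>Centered Gaussian variables, including the degenerate one\<close>

lemma centered_gaussian_moments:
  assumes "centered_gaussian M X"
  shows "integrable M (\<lambda>\<omega>. X \<omega> ^ k)"
    and "expectation X = 0"
    and "expectation (\<lambda>\<omega>. X \<omega> ^ (2 * n)) = fact (2 * n) / (2 ^ n * fact n) * expectation (\<lambda>\<omega>. (X \<omega>)\<^sup>2) ^ n"
proof -
  have [measurable]: "X \<in> borel_measurable M" using assms by (simp add: centered_gaussian_def)
  \<comment> \<open>The degenerate variable has no density. Moments written through E[X^2] instead
    of \<sigma> cover it by the same formula.\<close>
  have "integrable M (\<lambda>\<omega>. X \<omega> ^ k) \<and> expectation X = 0 \<and>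
    expectation (\<lambda>\<omega>. X \<omega> ^ (2 * n)) = fact (2 * n) / (2 ^ n * fact n) * expectation (\<lambda>\<omega>. (X \<omega>)\<^sup>2) ^ n"
  proof (cases "AE \<omega> in M. X \<omega> = 0")
    case True
    have "integrable M (\<lambda>\<omega>. X \<omega> ^ k)"
      by (subst integrable_cong_AE[where g="\<lambda>_. 0 ^ k"]) (use True in auto)
    moreover have e: "expectation (\<lambda>\<omega>. X \<omega> ^ j) = 0 ^ j" for j
      by (subst integral_cong_AE[where g="\<lambda>_. 0 ^ j"]) (use True in \<open>auto simp: prob_space\<close>)
    ultimately show ?thesis using e[of 1] by (auto simp: e power_0_left)
  next
    case False
    then obtain \<sigma> where s: "\<sigma> > 0" and d: "distributed M lborel X (\<lambda>x. ennreal (normal_density 0 \<sigma> x))"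
      using assms unfolding centered_gaussian_def by auto
    have int: "integrable M (\<lambda>\<omega>. X \<omega> ^ j)" for j
      using distributed_integrable[OF d, of "\<lambda>x. x ^ j"] integrable_normal_moment[OF s, of 0 j] by simp
    have ev: "expectation (\<lambda>\<omega>. X \<omega> ^ (2 * j)) = fact (2 * j) / ((2 / \<sigma>\<^sup>2) ^ j * fact j)" for j
      using distributed_integral[OF d, of "\<lambda>x. x ^ (2 * j)"] integral_normal_moment_even[OF s, of 0 j] by simp
    have "expectation X = 0"
      using distributed_integral[OF d, of "\<lambda>x. x"] integral_normal_moment_odd[OF s, of 0 0] by simp
    moreover have "expectation (\<lambda>\<omega>. (X \<omega>)\<^sup>2) = \<sigma>\<^sup>2"
      using ev[of 1] by (simp add: fact_numeral)
    ultimately show ?thesis using int s by (auto simp: ev power_divide)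
  qed
  then show "integrable M (\<lambda>\<omega>. X \<omega> ^ k)" "expectation X = 0"
    "expectation (\<lambda>\<omega>. X \<omega> ^ (2 * n)) = fact (2 * n) / (2 ^ n * fact n) * expectation (\<lambda>\<omega>. (X \<omega>)\<^sup>2) ^ n"
    by auto
qed

lemma centered_gaussian_cong_AE:
  assumes "centered_gaussian M X" "AE \<omega> in M. X \<omega> = Y \<omega>" "Y \<in> borel_measurable M"
  shows "centered_gaussian M Y"
proof -
  have [measurable]: "X \<in> borel_measurable M" "Y \<in> borel_measurable M"
    using assms by (auto simp: centered_gaussian_def)
  show ?thesis
  proof (cases "AE \<omega> in M. X \<omega> = 0")
    case True
    with assms(2) have "AE \<omega> in M. Y \<omega> = 0" by eventually_elim simp
    then show ?thesis by (simp add: centered_gaussian_def)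
  next
    case False
    then obtain \<sigma> where s: "\<sigma> > 0" and d: "distributed M lborel X (\<lambda>x. ennreal (normal_density 0 \<sigma> x))"
      using assms unfolding centered_gaussian_def by auto
    have "distr M lborel X = distr M lborel Y"
      by (rule distr_cong_AE) (use assms(2) in auto)
    then have "distributed M lborel Y (\<lambda>x. ennreal (normal_density 0 \<sigma> x))"
      using d unfolding distributed_def by simp
    then show ?thesis using s unfolding centered_gaussian_def by auto
  qed
qed

text \<open>A vanishing summand has no density, so the two degenerate cases are reduced to the other
  summand before normal densities are convolved.\<close>

lemma centered_gaussian_add_indep:
  assumes X: "centered_gaussian M X" and Y: "centered_gaussian M Y" and ind: "indep_var borel X borel Y"
  shows "centered_gaussian M (\<lambda>\<omega>. X \<omega> + Y \<omega>)"
proof -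
  have [measurable]: "X \<in> borel_measurable M" "Y \<in> borel_measurable M"
    using assms by (auto simp: centered_gaussian_def)
  consider "AE \<omega> in M. X \<omega> = 0" | "AE \<omega> in M. Y \<omega> = 0" |
    "\<exists>\<sigma>>0. distributed M lborel X (\<lambda>x. ennreal (normal_density 0 \<sigma> x))"
    "\<exists>\<sigma>>0. distributed M lborel Y (\<lambda>x. ennreal (normal_density 0 \<sigma> x))"
    using X Y unfolding centered_gaussian_def by blast
  then show ?thesis
  proof cases
    case 1
    then show ?thesis by (intro centered_gaussian_cong_AE[OF Y]) auto
  next
    case 2
    then show ?thesis by (intro centered_gaussian_cong_AE[OF X]) auto
  next
    case 3
    then obtain \<sigma> \<tau> where st: "\<sigma> > 0" "\<tau> > 0" "distributed M lborel X (\<lambda>x. ennreal (normal_density 0 \<sigma> x))"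
      "distributed M lborel Y (\<lambda>x. ennreal (normal_density 0 \<tau> x))" by blast
    have "distributed M lborel (\<lambda>\<omega>. X \<omega> + Y \<omega>) (\<lambda>x. ennreal (normal_density (0 + 0) (sqrt (\<sigma>\<^sup>2 + \<tau>\<^sup>2)) x))"
      by (rule add_indep_normal[OF ind st])
    moreover have "sqrt (\<sigma>\<^sup>2 + \<tau>\<^sup>2) > 0" using st by (simp add: sum_power2_gt_zero_iff)
    ultimately show ?thesis unfolding centered_gaussian_def by auto
  qed
qed

end

section \<open>Joint moments of the complex Gaussian measure\<close>

locale gaussian_measure = prob_space M for M :: "'w measure" +
  fixes W1 W2 :: "(real \<times> real) set \<Rightarrow> 'w \<Rightarrow> real"
  assumes cgm: "complex_gaussian_measure M W1 W2"
begin

definition W :: "(real \<times> real) set \<Rightarrow> 'w \<Rightarrow> complex" where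
  "W A \<omega> = Complex (W1 A \<omega>) (W2 A \<omega>)"

lemma halves: "gaussian_measure_half M W1" "gaussian_measure_half M W2"
  using cgm unfolding complex_gaussian_measure_def by auto

lemma half_gaussian:
  assumes "V = W1 \<or> V = W2" "finite F" "F \<subseteq> bounded_borel"
  shows "centered_gaussian M (\<lambda>\<omega>. \<Sum>A\<in>F. a A * V A \<omega>)"
proof -
  have "gaussian_measure_half M V" using halves assms(1) by auto
  from this[unfolded gaussian_measure_half_def, THEN conjunct1, rule_format, OF assms(2,3)] show ?thesis .
qed

lemma half_single:
  assumes "V = W1 \<or> V = W2" "A \<in> bounded_borel"
  shows "centered_gaussian M (V A)"
  using half_gaussian[OF assms(1), of "{A}" "\<lambda>_. 1"] assms by simp

lemma half_cov:
  assumes "V = W1 \<or> V = W2" "A \<in> bounded_borel" "B \<in> bounded_borel"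
  shows "expectation (\<lambda>\<omega>. V A \<omega> * V B \<omega>) = measure lborel (A \<inter> B) / 2"
proof -
  have "gaussian_measure_half M V" using halves assms(1) by auto
  from this[unfolded gaussian_measure_half_def, THEN conjunct2, rule_format, OF assms(2,3)] show ?thesis .
qed

lemma fin_mom_half:
  assumes "V = W1 \<or> V = W2" "A \<in> bounded_borel"
  shows "fin_mom (\<lambda>\<omega>. complex_of_real (V A \<omega>))"
  unfolding fin_mom_def
proof (intro conjI allI)
  have cg: "centered_gaussian M (V A)" by (rule half_single[OF assms])
  then have [measurable]: "V A \<in> borel_measurable M" by (simp add: centered_gaussian_def)
  show "(\<lambda>\<omega>. complex_of_real (V A \<omega>)) \<in> borel_measurable M" by measurable
  show "integrable M (\<lambda>\<omega>. norm (complex_of_real (V A \<omega>)) ^ k)" for k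
    using integrable_norm[OF centered_gaussian_moments(1)[OF cg, of k]] by (simp add: power_abs)
qed

lemma fin_mom_W:
  assumes "A \<in> bounded_borel" shows "fin_mom (W A)"
proof -
  have "fin_mom (\<lambda>\<omega>. complex_of_real (W1 A \<omega>) + \<i> * complex_of_real (W2 A \<omega>))"
    using assms by (intro fin_mom_intros fin_mom_half) auto
  also have "(\<lambda>\<omega>. complex_of_real (W1 A \<omega>) + \<i> * complex_of_real (W2 A \<omega>)) = W A"
    by (auto simp: W_def complex_eq_iff)
  finally show ?thesis .
qed

definition lin :: "(real \<times> real) set set \<Rightarrow> ((real \<times> real) set \<Rightarrow> complex) \<Rightarrow> 'w \<Rightarrow> complex" where
  "lin F \<alpha> \<omega> = (\<Sum>A\<in>F. \<alpha> A * W A \<omega>)"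

text \<open>A Hermitian form; \<open>lin_cross_moment\<close> with n = 1 identifies it as the
  expectation of \<open>lin F \<alpha>\<close> times the conjugate of
  \<open>lin F \<beta>\<close>.\<close>

definition cov :: "(real \<times> real) set set \<Rightarrow> ((real \<times> real) set \<Rightarrow> complex) \<Rightarrow> ((real \<times> real) set \<Rightarrow> complex) \<Rightarrow> complex" where
  "cov F \<alpha> \<beta> = (\<Sum>A\<in>F. \<Sum>B\<in>F. \<alpha> A * cnj (\<beta> B) * of_real (measure lborel (A \<inter> B)))"

lemma half_sum_square:
  assumes V: "V = W1 \<or> V = W2" and F: "finite F" "F \<subseteq> bounded_borel"
  shows "expectation (\<lambda>\<omega>. (\<Sum>A\<in>F. a A * V A \<omega>)\<^sup>2) = (\<Sum>A\<in>F. \<Sum>B\<in>F. a A * a B * measure lborel (A \<inter> B)) / 2"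
proof -
  have int: "integrable M (\<lambda>\<omega>. V A \<omega> * V B \<omega>)" if "A \<in> F" "B \<in> F" for A B
  proof -
    have "fin_mom (\<lambda>\<omega>. complex_of_real (V A \<omega>) * complex_of_real (V B \<omega>))"
      using that F by (intro fin_mom_intros fin_mom_half V) auto
    from integrable_Re[OF fin_mom_integrable[OF this]] show ?thesis by simp
  qed
  have "expectation (\<lambda>\<omega>. (\<Sum>A\<in>F. a A * V A \<omega>)\<^sup>2)
      = expectation (\<lambda>\<omega>. \<Sum>A\<in>F. \<Sum>B\<in>F. a A * a B * (V A \<omega> * V B \<omega>))"
    by (simp add: power2_eq_square sum_product mult_ac)
  also have "\<dots> = (\<Sum>A\<in>F. \<Sum>B\<in>F. a A * a B * expectation (\<lambda>\<omega>. V A \<omega> * V B \<omega>))"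
    using int by (simp add: integrable_mult_right)
  also have "\<dots> = (\<Sum>A\<in>F. \<Sum>B\<in>F. a A * a B * (measure lborel (A \<inter> B) / 2))"
    using F by (intro sum.cong refl) (subst half_cov[OF V], auto)
  finally show ?thesis by (simp add: sum_divide_distrib)
qed

text \<open>Independence is given for the two processes as a whole, and a finite linear combination
  is a measurable function of finitely many coordinates.\<close>

lemma indep_halves:
  assumes F: "finite F" "F \<subseteq> bounded_borel"
  shows "indep_var borel (\<lambda>\<omega>. \<Sum>A\<in>F. a A * W1 A \<omega>) borel (\<lambda>\<omega>. \<Sum>A\<in>F. b A * W2 A \<omega>)"
proof -
  let ?f = "\<lambda>(c::(real \<times> real) set \<Rightarrow> real) (x::(real \<times> real) set \<Rightarrow> real). \<Sum>A\<in>F. c A * x A"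
  have [measurable]: "?f c \<in> borel_measurable (PiM bounded_borel (\<lambda>_. borel))" for c
  proof (intro borel_measurable_sum borel_measurable_times borel_measurable_const)
    fix A assume "A \<in> F"
    then show "(\<lambda>x. x A) \<in> borel_measurable (PiM bounded_borel (\<lambda>_. borel))"
      using F by (intro measurable_component_singleton) auto
  qed
  have "indep_var borel (?f a \<circ> (\<lambda>\<omega>. \<lambda>A\<in>bounded_borel. W1 A \<omega>)) borel (?f b \<circ> (\<lambda>\<omega>. \<lambda>A\<in>bounded_borel. W2 A \<omega>))"
    using cgm unfolding complex_gaussian_measure_def by (intro indep_var_compose) auto
  moreover have "?f a \<circ> (\<lambda>\<omega>. \<lambda>A\<in>bounded_borel. W1 A \<omega>) = (\<lambda>\<omega>. \<Sum>A\<in>F. a A * W1 A \<omega>)"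
    "?f b \<circ> (\<lambda>\<omega>. \<lambda>A\<in>bounded_borel. W2 A \<omega>) = (\<lambda>\<omega>. \<Sum>A\<in>F. b A * W2 A \<omega>)"
    using F by (auto simp: fun_eq_iff subset_iff intro!: sum.cong)
  ultimately show ?thesis by simp
qed

lemma cov_cnj: "cnj (cov F \<alpha> \<beta>) = cov F \<beta> \<alpha>"
  unfolding cov_def by (subst sum.swap) (simp add: Int_commute mult_ac)

text \<open>The real part is a sum of independent Gaussians, Re \<alpha> against \<open>W1\<close>
  and -Im \<alpha> against \<open>W2\<close>. Each half has covariance |A Int B|/2, so the variance
  is half of the covariance form, and 2^n in the Gaussian moment becomes 4^n.\<close>

lemma Re_lin_moment:
  assumes F: "finite F" "F \<subseteq> bounded_borel"
  shows "expectation (\<lambda>\<omega>. Re (lin F \<alpha> \<omega>) ^ (2 * n))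
      = fact (2 * n) / (4 ^ n * fact n) * Re (cov F \<alpha> \<alpha>) ^ n"
proof -
  define U where "U \<omega> = (\<Sum>A\<in>F. Re (\<alpha> A) * W1 A \<omega>)" for \<omega>
  define V where "V \<omega> = (\<Sum>A\<in>F. (- Im (\<alpha> A)) * W2 A \<omega>)" for \<omega>
  have UV: "Re (lin F \<alpha> \<omega>) = U \<omega> + V \<omega>" for \<omega>
    unfolding lin_def U_def V_def W_def by (simp add: sum.distrib[symmetric])
  have U: "centered_gaussian M U" and V: "centered_gaussian M V"
    unfolding U_def V_def by (intro half_gaussian F; simp)+
  have ind: "indep_var borel U borel V"
    unfolding U_def V_def by (rule indep_halves[OF F])
  have cg: "centered_gaussian M (\<lambda>\<omega>. U \<omega> + V \<omega>)"
    by (rule centered_gaussian_add_indep[OF U V ind])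
  have intU: "integrable M U" and intV: "integrable M V"
    using centered_gaussian_moments(1)[OF U, of 1] centered_gaussian_moments(1)[OF V, of 1] by auto
  have "expectation (\<lambda>\<omega>. (U \<omega> + V \<omega>)\<^sup>2) = expectation (\<lambda>\<omega>. (U \<omega>)\<^sup>2 + (V \<omega>)\<^sup>2 + 2 * (U \<omega> * V \<omega>))"
    by (simp add: power2_sum mult_ac)
  also have "\<dots> = expectation (\<lambda>\<omega>. (U \<omega>)\<^sup>2) + expectation (\<lambda>\<omega>. (V \<omega>)\<^sup>2) + 2 * expectation (\<lambda>\<omega>. U \<omega> * V \<omega>)"
    using centered_gaussian_moments(1)[OF U, of 2] centered_gaussian_moments(1)[OF V, of 2]
      indep_var_integrable[OF ind intU intV]
    by simp
  also have "expectation (\<lambda>\<omega>. U \<omega> * V \<omega>) = 0"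
    using indep_var_lebesgue_integral[OF ind intU intV] centered_gaussian_moments(2)[OF U] by simp
  also have "expectation (\<lambda>\<omega>. (U \<omega>)\<^sup>2) + expectation (\<lambda>\<omega>. (V \<omega>)\<^sup>2) + 2 * 0 = Re (cov F \<alpha> \<alpha>) / 2"
    unfolding U_def V_def using half_sum_square[OF _ F, of W1 "\<lambda>A. Re (\<alpha> A)"] half_sum_square[OF _ F, of W2 "\<lambda>A. - Im (\<alpha> A)"]
    by (simp add: cov_def sum.distrib[symmetric] add_divide_distrib[symmetric] distrib_right)
  finally have var: "expectation (\<lambda>\<omega>. (U \<omega> + V \<omega>)\<^sup>2) = Re (cov F \<alpha> \<alpha>) / 2" .
  have "(4::real) ^ n = 2 ^ n * 2 ^ n" by (simp add: power_mult_distrib[symmetric])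
  then show ?thesis
    unfolding UV centered_gaussian_moments(3)[OF cg] var by (simp add: power_divide)
qed

lemma fin_mom_lin:
  assumes "F \<subseteq> bounded_borel" shows "fin_mom (lin F \<alpha>)"
proof -
  have "fin_mom (\<lambda>\<omega>. \<Sum>A\<in>F. \<alpha> A * W A \<omega>)"
    using assms by (intro fin_mom_intros fin_mom_W) auto
  then show ?thesis by (simp add: lin_def[abs_def])
qed

lemma lin_scale: "lin F (\<lambda>A. c * \<alpha> A) \<omega> = c * lin F \<alpha> \<omega>"
  by (simp add: lin_def sum_distrib_left mult.assoc)

lemma lin_add: "lin F (\<lambda>A. \<alpha> A + \<beta> A) \<omega> = lin F \<alpha> \<omega> + lin F \<beta> \<omega>"
  by (simp add: lin_def distrib_right sum.distrib)

lemma lin_sum: "lin F (\<lambda>A. \<Sum>s\<in>S. \<alpha> s A) \<omega> = (\<Sum>s\<in>S. lin F (\<alpha> s) \<omega>)"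
  unfolding lin_def sum_distrib_right by (rule sum.swap)

lemma cov_add_left: "cov F (\<lambda>A. \<alpha> A + \<beta> A) \<gamma> = cov F \<alpha> \<gamma> + cov F \<beta> \<gamma>"
  by (simp add: cov_def distrib_right sum.distrib)

lemma cov_scale_left: "cov F (\<lambda>A. c * \<alpha> A) \<gamma> = c * cov F \<alpha> \<gamma>"
  by (simp add: cov_def sum_distrib_left mult.assoc)

lemma cov_add_right: "cov F \<gamma> (\<lambda>A. \<alpha> A + \<beta> A) = cov F \<gamma> \<alpha> + cov F \<gamma> \<beta>"
  by (simp add: cov_def distrib_right distrib_left sum.distrib)

lemma cov_scale_right: "cov F \<gamma> (\<lambda>A. c * \<alpha> A) = cnj c * cov F \<gamma> \<alpha>"
  by (simp add: cov_def sum_distrib_left mult_ac)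

lemma cov_zero: "cov F (\<lambda>A. 0) \<gamma> = 0" "cov F \<gamma> (\<lambda>A. 0) = 0"
  by (simp_all add: cov_def)

lemma cov_sum_left: "cov F (\<lambda>A. \<Sum>s\<in>S. \<alpha> s A) \<gamma> = (\<Sum>s\<in>S. cov F (\<alpha> s) \<gamma>)"
  by (induction S rule: infinite_finite_induct) (simp_all add: cov_zero cov_add_left)

lemma cov_sum_right: "cov F \<gamma> (\<lambda>A. \<Sum>s\<in>S. \<alpha> s A) = (\<Sum>s\<in>S. cov F \<gamma> (\<alpha> s))"
  by (induction S rule: infinite_finite_induct) (simp_all add: cov_zero cov_add_right)

text \<open>A rotation of the coefficients leaves \<open>cov F \<alpha> \<alpha>\<close> unchanged,
  so all rotated real parts have the same even moments. Averaging (uZ + conj(uZ))^(2n) over the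
  roots of unity u leaves only the balanced binomial term, a multiple of |Z|^(2n).\<close>

lemma lin_abs_moment:
  assumes F: "finite F" "F \<subseteq> bounded_borel"
  shows "expectation (\<lambda>\<omega>. lin F \<alpha> \<omega> ^ n * cnj (lin F \<alpha> \<omega>) ^ n) = fact n * cov F \<alpha> \<alpha> ^ n"
proof -
  \<comment> \<open>Larger than every exponent k and 2n - k of the binomial expansion, as
    \<open>sum_unit_root_cnj\<close> requires.\<close>
  define m where "m = 2 * n + 1"
  have m: "m > 0" by (simp add: m_def)
  let ?Z = "lin F \<alpha>" and ?u = "unit_root m"
  have pt: "(\<Sum>l<m. complex_of_real (2 * Re (lin F (\<lambda>A. ?u l * \<alpha> A) \<omega>)) ^ (2 * n))
      = of_nat m * of_nat ((2 * n) choose n) * (?Z \<omega> ^ n * cnj (?Z \<omega>) ^ n)" for \<omega>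
  proof -
    let ?z = "?Z \<omega>"
    have "(\<Sum>l<m. complex_of_real (2 * Re (lin F (\<lambda>A. ?u l * \<alpha> A) \<omega>)) ^ (2 * n))
        = (\<Sum>l<m. (?u l * ?z + cnj (?u l) * cnj ?z) ^ (2 * n))"
      unfolding lin_scale by (simp only: complex_add_cnj[symmetric] complex_cnj_mult)
    also have "\<dots> = (\<Sum>l<m. \<Sum>k\<le>2*n. of_nat ((2 * n) choose k) * (?u l * ?z) ^ k * (cnj (?u l) * cnj ?z) ^ (2 * n - k))"
      by (simp only: binomial_ring)
    also have "\<dots> = (\<Sum>k\<le>2*n. of_nat ((2 * n) choose k) * ?z ^ k * cnj ?z ^ (2 * n - k) * (\<Sum>l<m. ?u l ^ k * cnj (?u l) ^ (2 * n - k)))"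
      unfolding power_mult_distrib sum_distrib_left by (subst sum.swap) (simp add: mult_ac)
    also have "\<dots> = (\<Sum>k\<le>2*n. if k = n then of_nat ((2 * n) choose k) * ?z ^ k * cnj ?z ^ (2 * n - k) * of_nat m else 0)"
    proof (intro sum.cong refl)
      fix k assume "k \<in> {..2 * n}"
      then have "(\<Sum>l<m. ?u l ^ k * cnj (?u l) ^ (2 * n - k)) = (if k = 2 * n - k then of_nat m else 0)"
        by (intro sum_unit_root_cnj) (auto simp: m_def)
      moreover have "k = 2 * n - k \<longleftrightarrow> k = n" using \<open>k \<in> _\<close> by auto
      ultimately show "of_nat ((2 * n) choose k) * ?z ^ k * cnj ?z ^ (2 * n - k) * (\<Sum>l<m. ?u l ^ k * cnj (?u l) ^ (2 * n - k))
         = (if k = n then of_nat ((2 * n) choose k) * ?z ^ k * cnj ?z ^ (2 * n - k) * of_nat m else 0)"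
        by simp
    qed
    also have "\<dots> = of_nat ((2 * n) choose n) * ?z ^ n * cnj ?z ^ (2 * n - n) * of_nat m"
      by (subst sum.delta) auto
    finally show ?thesis by (simp add: mult_ac)
  qed
  have covu: "cov F (\<lambda>A. ?u l * \<alpha> A) (\<lambda>A. ?u l * \<alpha> A) = cov F \<alpha> \<alpha>" for l
    unfolding cov_scale_left cov_scale_right by (simp add: mult.assoc[symmetric])
  have re: "complex_of_real (Re (cov F \<alpha> \<alpha>)) = cov F \<alpha> \<alpha>"
    using cov_cnj[of F \<alpha> \<alpha>] by (simp add: complex_eq_iff)
  have intl: "integrable M (\<lambda>\<omega>. complex_of_real (2 * Re (lin F (\<lambda>A. ?u l * \<alpha> A) \<omega>)) ^ (2 * n))" for l
  proof -
    have "fin_mom (\<lambda>\<omega>. (lin F (\<lambda>A. ?u l * \<alpha> A) \<omega> + cnj (lin F (\<lambda>A. ?u l * \<alpha> A) \<omega>)) ^ (2 * n))"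
      by (intro fin_mom_intros fin_mom_lin F)
    from fin_mom_integrable[OF this] show ?thesis by (simp only: complex_add_cnj)
  qed
  have "of_nat m * of_nat ((2 * n) choose n) * expectation (\<lambda>\<omega>. ?Z \<omega> ^ n * cnj (?Z \<omega>) ^ n)
      = expectation (\<lambda>\<omega>. \<Sum>l<m. complex_of_real (2 * Re (lin F (\<lambda>A. ?u l * \<alpha> A) \<omega>)) ^ (2 * n))"
    unfolding pt by simp
  also have "\<dots> = (\<Sum>l<m. expectation (\<lambda>\<omega>. complex_of_real (2 * Re (lin F (\<lambda>A. ?u l * \<alpha> A) \<omega>)) ^ (2 * n)))"
    using intl by (intro Bochner_Integration.integral_sum)
  also have "\<dots> = (\<Sum>l<m. complex_of_real (2 ^ (2 * n) * expectation (\<lambda>\<omega>. Re (lin F (\<lambda>A. ?u l * \<alpha> A) \<omega>) ^ (2 * n))))"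
    by (intro sum.cong refl) (simp only: of_real_power[symmetric] integral_complex_of_real power_mult_distrib integral_mult_right_zero)
  also have "\<dots> = of_nat m * of_real (2 ^ (2 * n) * (fact (2 * n) / (4 ^ n * fact n) * Re (cov F \<alpha> \<alpha>) ^ n))"
    unfolding Re_lin_moment[OF F] covu by simp
  also have "\<dots> = of_nat m * (fact (2 * n) / fact n * cov F \<alpha> \<alpha> ^ n)"
    by (simp add: re power_mult)
  finally have "of_nat ((2 * n) choose n) * expectation (\<lambda>\<omega>. ?Z \<omega> ^ n * cnj (?Z \<omega>) ^ n) = fact (2 * n) / fact n * cov F \<alpha> \<alpha> ^ n"
    using m by (simp only: mult.assoc mult_left_cancel of_nat_eq_0_iff neq0_conv)
  \<comment> \<open>The central binomial coefficient has two factors n! in its denominator and the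
    real moment only one; the other becomes the n! of the result.\<close>
  moreover have "of_nat ((2 * n) choose n) = (fact (2 * n) / (fact n * fact n) :: complex)"
    using binomial_fact[of n "2 * n", where ?'a = complex] by (simp add: mult_2)
  ultimately have "(fact (2 * n) / fact n) * (expectation (\<lambda>\<omega>. ?Z \<omega> ^ n * cnj (?Z \<omega>) ^ n) / fact n)
      = (fact (2 * n) / fact n) * cov F \<alpha> \<alpha> ^ n"
    by simp
  then have "expectation (\<lambda>\<omega>. ?Z \<omega> ^ n * cnj (?Z \<omega>) ^ n) / fact n = cov F \<alpha> \<alpha> ^ n"
    by (subst (asm) mult_left_cancel) auto
  then show ?thesis by (simp add: field_simps)
qed

text \<open>Apply the previous moment to \<alpha> + u \<beta> for roots of unity u and multiply by
  u^n. Since conj u = 1/u, both sides become polynomials in u of degree at most 2n, and comparing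
  constant coefficients isolates the mixed term.\<close>

lemma lin_cross_moment:
  assumes F: "finite F" "F \<subseteq> bounded_borel"
  shows "expectation (\<lambda>\<omega>. lin F \<alpha> \<omega> ^ n * cnj (lin F \<beta> \<omega>) ^ n) = fact n * cov F \<alpha> \<beta> ^ n"
proof -
  define m where "m = 2 * n + 1"
  have m: "m > 0" by (simp add: m_def)
  let ?u = "unit_root m"
  let ?Y = "\<lambda>l. lin F (\<lambda>A. \<alpha> A + ?u l * \<beta> A)"
  have deg: "degree ([:a, b:] ^ n * [:c, d:] ^ n) < m" for a b c d :: complex
  proof -
    have "degree ([:a, b:] ^ n) \<le> n" "degree ([:c, d:] ^ n) \<le> n" for a b c d :: complex
      by (rule order_trans[OF degree_power_le], simp)+
    then show ?thesis
      using degree_mult_le[of "[:a, b:] ^ n" "[:c, d:] ^ n"] unfolding m_def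
      by (smt (verit, best) add_le_mono le_less_trans less_add_one mult_2 order_trans)
  qed
  have pt: "(\<Sum>l<m. ?u l ^ n * (?Y l \<omega> ^ n * cnj (?Y l \<omega>) ^ n)) = of_nat m * (lin F \<alpha> \<omega> ^ n * cnj (lin F \<beta> \<omega>) ^ n)" for \<omega>
  proof -
    \<comment> \<open>The factor u^n is distributed over the conjugate: u conj(Y) = conj(lin
      \<beta>) + u conj(lin \<alpha>), which is polynomial in u.\<close>
    define p where "p = [:lin F \<alpha> \<omega>, lin F \<beta> \<omega>:] ^ n * [:cnj (lin F \<beta> \<omega>), cnj (lin F \<alpha> \<omega>):] ^ n"
    have "?u l ^ n * (?Y l \<omega> ^ n * cnj (?Y l \<omega>) ^ n) = poly p (?u l)" for l
    proof -
      have "?u l * cnj (?Y l \<omega>) = ?u l * cnj (lin F \<alpha> \<omega>) + (?u l * cnj (?u l)) * cnj (lin F \<beta> \<omega>)"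
        unfolding lin_add lin_scale by (simp add: distrib_left mult.assoc)
      then have "?u l * cnj (?Y l \<omega>) = cnj (lin F \<beta> \<omega>) + ?u l * cnj (lin F \<alpha> \<omega>)" by simp
      then have "?Y l \<omega> ^ n * (?u l * cnj (?Y l \<omega>)) ^ n = poly p (?u l)"
        unfolding p_def lin_add lin_scale by (simp add: poly_power)
      then show ?thesis by (simp add: power_mult_distrib mult_ac)
    qed
    then have "(\<Sum>l<m. ?u l ^ n * (?Y l \<omega> ^ n * cnj (?Y l \<omega>) ^ n)) = of_nat m * poly p 0"
      using sum_poly_unit_root[of p m] deg unfolding p_def by simp
    then show ?thesis unfolding p_def by (simp add: poly_power)
  qed
  \<comment> \<open>u times the covariance form of \<alpha> + u \<beta>, raised to the power n; the
    constant coefficient is the n-th power of \<open>cov F \<alpha> \<beta>\<close>.\<close>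
  define q where "q = [:cov F \<alpha> \<beta>, cov F \<alpha> \<alpha> + cov F \<beta> \<beta>, cov F \<beta> \<alpha>:] ^ n"
  have degq: "degree q < m"
  proof -
    have "degree q \<le> 2 * n"
      unfolding q_def by (rule order_trans[OF degree_power_le]) (simp add: mult_le_mono1)
    then show ?thesis by (simp add: m_def)
  qed
  have qpt: "?u l ^ n * cov F (\<lambda>A. \<alpha> A + ?u l * \<beta> A) (\<lambda>A. \<alpha> A + ?u l * \<beta> A) ^ n = poly q (?u l)" for l
  proof -
    have "?u l * cov F (\<lambda>A. \<alpha> A + ?u l * \<beta> A) (\<lambda>A. \<alpha> A + ?u l * \<beta> A)
       = ?u l * cov F \<alpha> \<alpha> + (?u l * cnj (?u l)) * cov F \<alpha> \<beta> + ?u l * ?u l * cov F \<beta> \<alpha> + ?u l * (?u l * cnj (?u l)) * cov F \<beta> \<beta>"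
      unfolding cov_add_left cov_add_right cov_scale_left cov_scale_right by (simp add: algebra_simps)
    also have "\<dots> = cov F \<alpha> \<beta> + ?u l * (cov F \<alpha> \<alpha> + cov F \<beta> \<beta> + ?u l * cov F \<beta> \<alpha>)"
      by (simp add: algebra_simps)
    finally show ?thesis unfolding q_def poly_power power_mult_distrib[symmetric] by simp
  qed
  have "of_nat m * expectation (\<lambda>\<omega>. lin F \<alpha> \<omega> ^ n * cnj (lin F \<beta> \<omega>) ^ n)
     = expectation (\<lambda>\<omega>. \<Sum>l<m. ?u l ^ n * (?Y l \<omega> ^ n * cnj (?Y l \<omega>) ^ n))"
    unfolding pt by simp
  also have "\<dots> = (\<Sum>l<m. expectation (\<lambda>\<omega>. ?u l ^ n * (?Y l \<omega> ^ n * cnj (?Y l \<omega>) ^ n)))"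
    by (intro Bochner_Integration.integral_sum fin_mom_integrable fin_mom_intros fin_mom_lin F)
  also have "\<dots> = (\<Sum>l<m. ?u l ^ n * (fact n * cov F (\<lambda>A. \<alpha> A + ?u l * \<beta> A) (\<lambda>A. \<alpha> A + ?u l * \<beta> A) ^ n))"
    by (simp only: integral_mult_right_zero lin_abs_moment[OF F])
  also have "\<dots> = fact n * (\<Sum>l<m. poly q (?u l))"
    unfolding qpt[symmetric] sum_distrib_left by (simp add: mult_ac)
  also have "\<dots> = fact n * (of_nat m * cov F \<alpha> \<beta> ^ n)"
    unfolding sum_poly_unit_root[OF degq] by (simp add: q_def poly_power)
  finally show ?thesis using m by simp
qed

text \<open>Polarization in the unconjugated factors, then in the conjugated ones. The alternating
  sum that remains is Ryser's formula for the matrix of covariances.\<close>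

lemma lin_prod_moment:
  assumes F: "finite F" "F \<subseteq> bounded_borel" and B: "finite B"
  shows "expectation (\<lambda>\<omega>. (\<Prod>b\<in>B. lin F (\<alpha> b) \<omega>) * cnj (\<Prod>b\<in>B. lin F (\<beta> b) \<omega>))
     = (\<Sum>p | p permutes B. \<Prod>b\<in>B. cov F (\<alpha> b) (\<beta> (p b)))"
proof -
  define n where "n = card B"
  have pol: "fact n * (\<Prod>b\<in>B. lin F (\<gamma> b) \<omega>) = (\<Sum>S\<in>Pow B. (-1) ^ card (B - S) * lin F (\<lambda>A. \<Sum>c\<in>S. \<gamma> c A) \<omega> ^ n)" for \<gamma> \<omega>
    using prod_polarization[OF B, of "\<lambda>b. lin F (\<gamma> b) \<omega>"] unfolding n_def lin_sum by simp
  have pol': "fact n * cnj (\<Prod>b\<in>B. lin F (\<gamma> b) \<omega>) = (\<Sum>S\<in>Pow B. (-1) ^ card (B - S) * cnj (lin F (\<lambda>A. \<Sum>c\<in>S. \<gamma> c A) \<omega>) ^ n)" for \<gamma> \<omega>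
    using arg_cong[OF pol[of \<gamma> \<omega>], of cnj] by simp
  \<comment> \<open>Polarization is used twice here: forwards for the random variables, backwards
    for the numbers \<open>cov F (\<alpha> b) \<gamma>\<close>.\<close>
  have half: "expectation (\<lambda>\<omega>. (\<Prod>b\<in>B. lin F (\<alpha> b) \<omega>) * cnj (lin F \<gamma> \<omega>) ^ n) = fact n * (\<Prod>b\<in>B. cov F (\<alpha> b) \<gamma>)" for \<gamma>
  proof -
    have "fact n * expectation (\<lambda>\<omega>. (\<Prod>b\<in>B. lin F (\<alpha> b) \<omega>) * cnj (lin F \<gamma> \<omega>) ^ n)
       = expectation (\<lambda>\<omega>. fact n * (\<Prod>b\<in>B. lin F (\<alpha> b) \<omega>) * cnj (lin F \<gamma> \<omega>) ^ n)"
      by (simp add: mult.assoc)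
    also have "\<dots> = expectation (\<lambda>\<omega>. \<Sum>S\<in>Pow B. (-1) ^ card (B - S) * (lin F (\<lambda>A. \<Sum>c\<in>S. \<alpha> c A) \<omega> ^ n * cnj (lin F \<gamma> \<omega>) ^ n))"
      unfolding pol sum_distrib_right by (simp only: mult.assoc)
    also have "\<dots> = (\<Sum>S\<in>Pow B. (-1) ^ card (B - S) * expectation (\<lambda>\<omega>. lin F (\<lambda>A. \<Sum>c\<in>S. \<alpha> c A) \<omega> ^ n * cnj (lin F \<gamma> \<omega>) ^ n))"
      by (subst Bochner_Integration.integral_sum) (auto intro!: fin_mom_integrable fin_mom_intros fin_mom_lin F)
    also have "\<dots> = fact n * (\<Sum>S\<in>Pow B. (-1) ^ card (B - S) * (\<Sum>c\<in>S. cov F (\<alpha> c) \<gamma>) ^ n)"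
      unfolding lin_cross_moment[OF F] cov_sum_left by (simp add: sum_distrib_left mult_ac)
    also have "\<dots> = fact n * (fact n * (\<Prod>b\<in>B. cov F (\<alpha> b) \<gamma>))"
      using prod_polarization[OF B, of "\<lambda>b. cov F (\<alpha> b) \<gamma>"] unfolding n_def by simp
    finally show ?thesis by simp
  qed
  have "fact n * expectation (\<lambda>\<omega>. (\<Prod>b\<in>B. lin F (\<alpha> b) \<omega>) * cnj (\<Prod>b\<in>B. lin F (\<beta> b) \<omega>))
     = expectation (\<lambda>\<omega>. fact n * ((\<Prod>b\<in>B. lin F (\<alpha> b) \<omega>) * cnj (\<Prod>b\<in>B. lin F (\<beta> b) \<omega>)))"
    by (simp only: integral_mult_right_zero)
  also have "\<dots> = expectation (\<lambda>\<omega>. (\<Prod>b\<in>B. lin F (\<alpha> b) \<omega>) * (fact n * cnj (\<Prod>b\<in>B. lin F (\<beta> b) \<omega>)))"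
    by (simp only: mult.left_commute[of "fact n"])
  also have "\<dots> = expectation (\<lambda>\<omega>. \<Sum>S\<in>Pow B. (-1) ^ card (B - S) * ((\<Prod>b\<in>B. lin F (\<alpha> b) \<omega>) * cnj (lin F (\<lambda>A. \<Sum>c\<in>S. \<beta> c A) \<omega>) ^ n))"
    unfolding pol' sum_distrib_left
    by (intro Bochner_Integration.integral_cong sum.cong refl) (simp only: mult.left_commute)
  also have "\<dots> = (\<Sum>S\<in>Pow B. (-1) ^ card (B - S) * expectation (\<lambda>\<omega>. (\<Prod>b\<in>B. lin F (\<alpha> b) \<omega>) * cnj (lin F (\<lambda>A. \<Sum>c\<in>S. \<beta> c A) \<omega>) ^ n))"
    by (subst Bochner_Integration.integral_sum) (auto intro!: fin_mom_integrable fin_mom_intros fin_mom_lin F)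
  also have "\<dots> = fact n * (\<Sum>S\<in>Pow B. (-1) ^ card (B - S) * (\<Prod>b\<in>B. \<Sum>c\<in>S. cov F (\<alpha> b) (\<beta> c)))"
    unfolding half cov_sum_right by (simp add: sum_distrib_left mult_ac)
  also have "\<dots> = fact n * (\<Sum>p | p permutes B. \<Prod>b\<in>B. cov F (\<alpha> b) (\<beta> (p b)))"
    unfolding Ryser_formula[OF B] ..
  finally show ?thesis by simp
qed

text \<open>Coefficient functions concentrated at one set. They are indexed by the sets themselves,
  so coincidences among the \<open>A b\<close> and \<open>A' b\<close> need no separate
  treatment.\<close>

lemma W_prod_moment:
  assumes B: "finite B" and A: "\<And>b. b \<in> B \<Longrightarrow> A b \<in> bounded_borel" "\<And>b. b \<in> B \<Longrightarrow> A' b \<in> bounded_borel"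
  shows "expectation (\<lambda>\<omega>. (\<Prod>b\<in>B. W (A b) \<omega>) * cnj (\<Prod>b\<in>B. W (A' b) \<omega>))
     = (\<Sum>p | p permutes B. \<Prod>b\<in>B. of_real (measure lborel (A b \<inter> A' (p b))))"
proof -
  define F where "F = A ` B \<union> A' ` B"
  have F: "finite F" "F \<subseteq> bounded_borel" using A B by (auto simp: F_def)
  have memb: "A b \<in> F" "A' b \<in> F" if "b \<in> B" for b using that by (auto simp: F_def)
  define \<delta> where "\<delta> X Y = (if Y = X then 1 else 0 :: complex)" for X Y :: "(real \<times> real) set"
  have l: "lin F (\<delta> X) \<omega> = W X \<omega>" if "X \<in> F" for X \<omega>
  proof -
    have "lin F (\<delta> X) \<omega> = (\<Sum>Y\<in>F. if Y = X then W Y \<omega> else 0)"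
      unfolding lin_def \<delta>_def by (intro sum.cong) auto
    then show ?thesis using F that by simp
  qed
  have c: "cov F (\<delta> X) (\<delta> Y) = of_real (measure lborel (X \<inter> Y))" if "X \<in> F" "Y \<in> F" for X Y
  proof -
    have "cov F (\<delta> X) (\<delta> Y) = (\<Sum>A\<in>F. if A = X then (\<Sum>B\<in>F. if B = Y then of_real (measure lborel (A \<inter> B)) else 0) else 0)"
      unfolding cov_def \<delta>_def by (intro sum.cong) (auto intro!: sum.cong)
    then show ?thesis using F that by simp
  qed
  have "expectation (\<lambda>\<omega>. (\<Prod>b\<in>B. W (A b) \<omega>) * cnj (\<Prod>b\<in>B. W (A' b) \<omega>))
     = expectation (\<lambda>\<omega>. (\<Prod>b\<in>B. lin F (\<delta> (A b)) \<omega>) * cnj (\<Prod>b\<in>B. lin F (\<delta> (A' b)) \<omega>))"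
    by (intro Bochner_Integration.integral_cong refl arg_cong2[where f="(*)"] arg_cong[where f=cnj] prod.cong)
      (auto simp: l memb)
  also have "\<dots> = (\<Sum>p | p permutes B. \<Prod>b\<in>B. cov F (\<delta> (A b)) (\<delta> (A' (p b))))"
    by (rule lin_prod_moment[OF F B])
  also have "\<dots> = (\<Sum>p | p permutes B. \<Prod>b\<in>B. of_real (measure lborel (A b \<inter> A' (p b))))"
    by (intro sum.cong prod.cong refl c) (auto simp: memb permutes_in_image)
  finally show ?thesis .
qed

end

section \<open>Lebesgue measure on the product of half planes\<close>

lemma measurable_borel_fst [measurable]:
  "(fst :: 'a::euclidean_space \<times> 'b::euclidean_space \<Rightarrow> 'a) \<in> borel_measurable borel"
  by (intro borel_measurable_continuous_onI continuous_intros)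

lemma measurable_borel_snd [measurable]:
  "(snd :: 'a::euclidean_space \<times> 'b::euclidean_space \<Rightarrow> 'b) \<in> borel_measurable borel"
  by (intro borel_measurable_continuous_onI continuous_intros)

definition coord :: "'a::euclidean_space \<Rightarrow> 'a \<times> 'a \<Rightarrow> real \<times> real" where
  "coord b z = (fst z \<bullet> b, snd z \<bullet> b)"

lemma measurable_coord [measurable]: "coord b \<in> borel_measurable borel"
  unfolding coord_def by (intro borel_measurable_continuous_onI continuous_intros)

text \<open>The polymorphic codomain lets the same product serve complex integrands, real indicators
  and \<open>ennreal\<close> integrands.\<close>

definition tensor :: "('a::euclidean_space \<Rightarrow> real \<times> real \<Rightarrow> 'c::comm_monoid_mult) \<Rightarrow> 'a \<times> 'a \<Rightarrow> 'c" where
  "tensor h z = (\<Prod>b\<in>Basis. h b (coord b z))"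

lemma measurable_tensor [measurable]:
  assumes [measurable]: "\<And>b. b \<in> Basis \<Longrightarrow> h b \<in> borel_measurable borel"
  shows "(tensor h :: 'a::euclidean_space \<times> 'a \<Rightarrow> complex) \<in> borel_measurable borel"
  unfolding tensor_def by measurable

lemma closed_orthant: "closed (orthant :: 'a::euclidean_space set)"
proof -
  have "orthant = (\<Inter>b\<in>Basis. {t::'a. 0 \<le> t \<bullet> b})" by (auto simp: orthant_def)
  also have "closed \<dots>" by (intro closed_INT ballI closed_Collect_le continuous_intros)
  finally show ?thesis .
qed

lemma sets_orthant [measurable]: "orthant \<in> sets borel"
  by (intro borel_closed closed_orthant)

lemma sets_orthant_UNIV [measurable]: "orthant \<times> UNIV \<in> sets (borel :: ('a::euclidean_space \<times> 'a) measure)"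
  by (intro borel_closed closed_Times closed_orthant closed_UNIV)

lemma orthant_real: "(orthant :: real set) = {0..}"
  by (auto simp: orthant_def)

lemma orthant_prod: "indicator orthant t = (\<Prod>b\<in>Basis. indicator {0..} (t \<bullet> b) :: ennreal)"
proof (cases "t \<in> orthant")
  case True
  then show ?thesis by (simp add: orthant_def)
next
  case False
  then obtain b where "b \<in> Basis" "t \<bullet> b \<notin> {0..}" by (auto simp: orthant_def)
  then have "(\<Prod>b\<in>Basis. indicator {0..} (t \<bullet> b) :: ennreal) = 0"
    by (intro prod_zero bexI[of _ b]) auto
  with False show ?thesis by simp
qed

lemma measurable_leb_plus [measurable (raw)]:
  "f \<in> borel_measurable borel \<Longrightarrow> f \<in> borel_measurable (leb_plus :: ('a::euclidean_space \<times> 'a) measure)"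
  unfolding leb_plus_def by (intro measurable_restrict_space1) simp

lemma space_leb_plus: "space leb_plus = orthant \<times> UNIV"
  unfolding leb_plus_def by (simp add: space_restrict_space)

lemma nn_integral_leb_plus:
  assumes [measurable]: "u \<in> borel_measurable (borel :: ('a::euclidean_space \<times> 'a) measure)"
  shows "(\<integral>\<^sup>+z. u z \<partial>leb_plus) = (\<integral>\<^sup>+t. \<integral>\<^sup>+x. u (t, x) * indicator orthant t \<partial>lborel \<partial>lborel)"
proof -
  have m[measurable]: "(\<lambda>z. u z * indicator (orthant \<times> UNIV) z) \<in> borel_measurable (lborel \<Otimes>\<^sub>M lborel)"
    unfolding lborel_prod by measurable
  have "(\<integral>\<^sup>+z. u z \<partial>leb_plus) = (\<integral>\<^sup>+z. u z * indicator (orthant \<times> UNIV) z \<partial>lborel)"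
    unfolding leb_plus_def by (intro nn_integral_restrict_space) simp
  also have "\<dots> = (\<integral>\<^sup>+z. u z * indicator (orthant \<times> UNIV) z \<partial>(lborel \<Otimes>\<^sub>M lborel))"
    by (simp add: lborel_prod)
  also have "\<dots> = (\<integral>\<^sup>+t. \<integral>\<^sup>+x. u (t, x) * indicator (orthant \<times> UNIV) (t, x) \<partial>lborel \<partial>lborel)"
    by (subst lborel.nn_integral_fst[OF m, symmetric]) simp
  finally show ?thesis by (simp add: indicator_times)
qed

text \<open>Points are grouped as (t, x) and not coordinate by coordinate, so the product is split
  in two rounds: over x with t fixed, then over t.\<close>

lemma nn_integral_tensor:
  fixes u :: "'a::euclidean_space \<Rightarrow> real \<times> real \<Rightarrow> ennreal"
  assumes u[measurable]: "\<And>b. b \<in> Basis \<Longrightarrow> u b \<in> borel_measurable borel"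
  shows "(\<integral>\<^sup>+z. tensor u z \<partial>leb_plus) = (\<Prod>b\<in>Basis. \<integral>\<^sup>+z. u b z \<partial>leb_plus)"
proof -
  have pm: "(\<lambda>x. u b (s, x)) \<in> borel_measurable borel" if "b \<in> Basis" for b s
    using u[OF that] by measurable
  have pm2: "(\<lambda>s. \<integral>\<^sup>+x. u b (s, x) * indicator {0..} s \<partial>lborel) \<in> borel_measurable borel" if "b \<in> Basis" for b
  proof -
    have "(\<lambda>(s, x). u b (s, x) * indicator {0..} s) \<in> borel_measurable (borel \<Otimes>\<^sub>M lborel)"
      using u[OF that]
      by (subst measurable_cong_sets[OF sets_pair_measure_cong[OF refl sets_lborel] refl]) (simp add: borel_prod)
    then show ?thesis by (rule lborel.borel_measurable_nn_integral)
  qed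
  have [measurable]: "tensor u \<in> borel_measurable borel" unfolding tensor_def by measurable
  have "(\<integral>\<^sup>+z. tensor u z \<partial>leb_plus)
     = (\<integral>\<^sup>+t. \<integral>\<^sup>+x. (\<Prod>b\<in>Basis. u b (t \<bullet> b, x \<bullet> b) * indicator {0..} (t \<bullet> b)) \<partial>lborel \<partial>lborel)"
    by (subst nn_integral_leb_plus) (auto simp: tensor_def coord_def orthant_prod prod.distrib)
  also have "\<dots> = (\<integral>\<^sup>+t. (\<Prod>b\<in>Basis. \<integral>\<^sup>+x. u b (t \<bullet> b, x) * indicator {0..} (t \<bullet> b) \<partial>lborel) \<partial>lborel)"
    using pm by (intro nn_integral_cong nn_integral_lborel_prod) auto
  also have "\<dots> = (\<Prod>b\<in>Basis. \<integral>\<^sup>+s. \<integral>\<^sup>+x. u b (s, x) * indicator {0..} s \<partial>lborel \<partial>lborel)"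
    using pm2 by (intro nn_integral_lborel_prod) auto
  also have "\<dots> = (\<Prod>b\<in>Basis. \<integral>\<^sup>+z. u b z \<partial>leb_plus)"
    by (intro prod.cong refl) (subst nn_integral_leb_plus, auto simp: orthant_real)
  finally show ?thesis .
qed

section \<open>Permutations of the coordinates\<close>

lemma permute_coords_inner: "b \<in> Basis \<Longrightarrow> permute_coords p x \<bullet> b = x \<bullet> p b"
  unfolding permute_coords_def by (simp add: inner_sum_left_Basis)

lemma measurable_permute_coords [measurable]: "permute_coords p \<in> borel_measurable borel"
  unfolding permute_coords_def by measurable

lemma distr_permute_coords:
  fixes p :: "'a::euclidean_space \<Rightarrow> 'a"
  assumes p: "p permutes Basis"
  shows "distr lborel borel (permute_coords p) = lborel"
proof (rule lborel_eqI[symmetric])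
  fix l u :: 'a assume lu: "\<And>b. b \<in> Basis \<Longrightarrow> l \<bullet> b \<le> u \<bullet> b"
  let ?q = "inv p"
  have q: "?q permutes Basis" by (rule permutes_inv[OF p])
  have pq: "p (?q b) = b" "?q (p b) = b" for b using permutes_inverses[OF p] by auto
  have mem: "p b \<in> Basis \<longleftrightarrow> b \<in> Basis" "?q b \<in> Basis \<longleftrightarrow> b \<in> Basis" for b
    using permutes_in_image[OF p] permutes_in_image[OF q] by auto
  \<comment> \<open>Lebesgue measure is determined by boxes, and the preimage of a box is the box
    with inversely permuted corners, which has the same side lengths in another order.\<close>
  have "permute_coords p -` box l u = box (permute_coords ?q l) (permute_coords ?q u)"
  proof (intro set_eqI iffI)
    fix x assume "x \<in> permute_coords p -` box l u"
    then have x: "\<And>b. b \<in> Basis \<Longrightarrow> l \<bullet> b < x \<bullet> p b \<and> x \<bullet> p b < u \<bullet> b"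
      by (auto simp: mem_box permute_coords_inner)
    show "x \<in> box (permute_coords ?q l) (permute_coords ?q u)"
      unfolding mem_box using x[of "?q b" for b] by (auto simp: permute_coords_inner mem pq)
  next
    fix x assume "x \<in> box (permute_coords ?q l) (permute_coords ?q u)"
    then have x: "\<And>b. b \<in> Basis \<Longrightarrow> l \<bullet> ?q b < x \<bullet> b \<and> x \<bullet> b < u \<bullet> ?q b"
      by (auto simp: mem_box permute_coords_inner)
    show "x \<in> permute_coords p -` box l u"
      unfolding vimage_eq mem_box using x[of "p b" for b] by (auto simp: permute_coords_inner mem pq)
  qed
  then have "emeasure (distr lborel borel (permute_coords p)) (box l u)
      = emeasure lborel (box (permute_coords ?q l) (permute_coords ?q u))"
    by (simp add: emeasure_distr)
  also have "\<dots> = ennreal (\<Prod>b\<in>Basis. (permute_coords ?q u - permute_coords ?q l) \<bullet> b)"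
    using lu by (intro emeasure_lborel_box) (auto simp: permute_coords_inner mem)
  also have "(\<Prod>b\<in>Basis. (permute_coords ?q u - permute_coords ?q l) \<bullet> b) = (\<Prod>b\<in>Basis. (u - l) \<bullet> ?q b)"
    by (intro prod.cong refl) (simp add: inner_diff_left permute_coords_inner)
  also have "\<dots> = (\<Prod>b\<in>Basis. (u - l) \<bullet> b)"
    using prod.permute[OF q, of "\<lambda>b. (u - l) \<bullet> b"] by (simp add: o_def)
  finally show "emeasure (distr lborel borel (permute_coords p)) (box l u) = ennreal (\<Prod>b\<in>Basis. (u - l) \<bullet> b)" .
qed simp

definition permute_pair :: "('a \<Rightarrow> 'a) \<Rightarrow> 'a::euclidean_space \<times> 'a \<Rightarrow> 'a \<times> 'a" where
  "permute_pair p z = (permute_coords p (fst z), permute_coords p (snd z))"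

lemma measurable_permute_pair [measurable]: "permute_pair p \<in> borel_measurable borel"
  unfolding permute_pair_def by (intro borel_measurable_Pair) measurable

lemma orthant_permute:
  assumes p: "p permutes Basis" shows "permute_coords p t \<in> orthant \<longleftrightarrow> t \<in> orthant"
proof -
  have "(\<forall>b\<in>Basis. 0 \<le> t \<bullet> p b) \<longleftrightarrow> (\<forall>b\<in>p ` Basis. 0 \<le> t \<bullet> b)" by simp
  then show ?thesis
    by (auto simp: orthant_def permute_coords_inner permutes_image[OF p])
qed

lemma nn_integral_permute_pair:
  fixes u :: "'a::euclidean_space \<times> 'a \<Rightarrow> ennreal"
  assumes p: "p permutes Basis" and u[measurable]: "u \<in> borel_measurable borel"
  shows "(\<integral>\<^sup>+z. u (permute_pair p z) \<partial>leb_plus) = (\<integral>\<^sup>+z. u z \<partial>leb_plus)"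
proof -
  define v where "v t = (\<integral>\<^sup>+x. u (t, x) * indicator orthant t \<partial>lborel)" for t
  have v[measurable]: "v \<in> borel_measurable borel"
  proof -
    have "(\<lambda>(t, x). u (t, x) * indicator orthant t) \<in> borel_measurable (borel \<Otimes>\<^sub>M lborel)"
      by (subst measurable_cong_sets[OF sets_pair_measure_cong[OF refl sets_lborel] refl]) (simp add: borel_prod)
    then show ?thesis unfolding v_def by (rule lborel.borel_measurable_nn_integral)
  qed
  have "(\<integral>\<^sup>+z. u (permute_pair p z) \<partial>leb_plus)
      = (\<integral>\<^sup>+t. \<integral>\<^sup>+x. u (permute_coords p t, permute_coords p x) * indicator orthant t \<partial>lborel \<partial>lborel)"
    by (subst nn_integral_leb_plus) (auto simp: permute_pair_def)
  also have "\<dots> = (\<integral>\<^sup>+t. v (permute_coords p t) \<partial>lborel)"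
  proof (rule nn_integral_cong)
    fix t
    let ?w = "\<lambda>x. u (permute_coords p t, x) * indicator orthant t"
    have "(\<integral>\<^sup>+x. ?w (permute_coords p x) \<partial>lborel) = (\<integral>\<^sup>+x. ?w x \<partial>distr lborel borel (permute_coords p))"
      by (subst nn_integral_distr) auto
    then show "(\<integral>\<^sup>+x. ?w (permute_coords p x) \<partial>lborel) = v (permute_coords p t)"
      unfolding distr_permute_coords[OF p] v_def by (simp add: indicator_def orthant_permute[OF p])
  qed
  also have "\<dots> = (\<integral>\<^sup>+t. v t \<partial>distr lborel borel (permute_coords p))"
    by (subst nn_integral_distr) auto
  also have "\<dots> = (\<integral>\<^sup>+z. u z \<partial>leb_plus)"
    unfolding distr_permute_coords[OF p] v_def by (subst nn_integral_leb_plus) auto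
  finally show ?thesis .
qed

text \<open>Permuting the variables by the inverse permutes the factors by p; this is where
  \<open>inv p\<close> in the second moment formula comes from.\<close>

lemma tensor_permute:
  assumes p: "p permutes Basis"
  shows "tensor h (permute_pair (inv p) z) = tensor (\<lambda>b. h (p b)) z"
proof -
  have q: "inv p permutes Basis" by (rule permutes_inv[OF p])
  have "tensor h (permute_pair (inv p) z) = (\<Prod>b\<in>Basis. h b (coord (inv p b) z))"
    unfolding tensor_def by (intro prod.cong refl) (simp add: coord_def permute_pair_def permute_coords_inner)
  also have "\<dots> = (\<Prod>b\<in>Basis. h (p b) (coord (inv p (p b)) z))"
    using prod.permute[OF p, of "\<lambda>b. h b (coord (inv p b) z)"] by (simp add: o_def)
  finally show ?thesis unfolding tensor_def using permutes_inverses[OF p] by simp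
qed

section \<open>Bounded Borel sets and their tensor indicators\<close>

lemma bounded_borelD:
  assumes "A \<in> bounded_borel"
  shows "A \<in> sets borel" "bounded A" "A \<subseteq> {0..} \<times> UNIV" "emeasure lborel A < \<infinity>"
    "emeasure lborel A = ennreal (measure lborel A)"
proof -
  show "A \<in> sets borel" "bounded A" "A \<subseteq> {0..} \<times> UNIV"
    using assms by (auto simp: bounded_borel_def)
  then show "emeasure lborel A < \<infinity>" using emeasure_bounded_finite[of A] by simp
  then show "emeasure lborel A = ennreal (measure lborel A)"
    by (intro emeasure_eq_ennreal_measure) auto
qed

lemma bounded_borel_Int: "A \<in> bounded_borel \<Longrightarrow> B \<in> sets borel \<Longrightarrow> A \<inter> B \<in> bounded_borel"
  unfolding bounded_borel_def by (auto intro: bounded_subset)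

lemma emeasure_leb_plus_bounded_borel:
  assumes "A \<in> bounded_borel"
  shows "(\<integral>\<^sup>+z. indicator A z \<partial>leb_plus) = ennreal (measure lborel A)"
proof -
  have [measurable]: "A \<in> sets borel" using bounded_borelD[OF assms] by auto
  have "(\<integral>\<^sup>+z. indicator A z \<partial>leb_plus) = (\<integral>\<^sup>+z. indicator A z * indicator (orthant \<times> UNIV) z \<partial>lborel)"
    unfolding leb_plus_def by (intro nn_integral_restrict_space) simp
  also have "\<dots> = (\<integral>\<^sup>+z. indicator A z \<partial>lborel)"
    using bounded_borelD(3)[OF assms] by (intro nn_integral_cong) (auto simp: indicator_def orthant_real)
  finally show ?thesis using bounded_borelD(5)[OF assms] by simp
qed

lemma tensor_indicator_integral:
  fixes A :: "'a::euclidean_space \<Rightarrow> (real \<times> real) set"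
  assumes A: "\<And>b. b \<in> Basis \<Longrightarrow> A b \<in> bounded_borel"
  defines "g \<equiv> tensor (\<lambda>b. indicator (A b)) :: 'a \<times> 'a \<Rightarrow> complex"
  shows "integrable leb_plus g" "(LINT z|leb_plus. g z) = (\<Prod>b\<in>Basis. of_real (measure lborel (A b)))"
proof -
  let ?r = "tensor (\<lambda>b. indicator (A b)) :: 'a \<times> 'a \<Rightarrow> real"
  have [measurable]: "\<And>b. b \<in> Basis \<Longrightarrow> A b \<in> sets borel" using bounded_borelD[OF A] by auto
  have [measurable]: "?r \<in> borel_measurable borel" unfolding tensor_def by measurable
  have gr: "g z = complex_of_real (?r z)" for z
    unfolding g_def tensor_def of_real_prod by (intro prod.cong refl) (simp add: indicator_def)
  have nn: "0 \<le> ?r z" for z unfolding tensor_def by (intro prod_nonneg) auto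
  have "(\<integral>\<^sup>+z. ennreal (?r z) \<partial>leb_plus) = (\<integral>\<^sup>+z. tensor (\<lambda>b. indicator (A b) :: _ \<Rightarrow> ennreal) z \<partial>leb_plus)"
    unfolding tensor_def by (intro nn_integral_cong) (subst prod_ennreal[symmetric], auto simp: ennreal_indicator)
  also have "\<dots> = (\<Prod>b\<in>Basis. ennreal (measure lborel (A b)))"
    by (subst nn_integral_tensor) (auto intro!: prod.cong simp: emeasure_leb_plus_bounded_borel[OF A] simp del: nn_integral_indicator)
  also have "\<dots> = ennreal (\<Prod>b\<in>Basis. measure lborel (A b))" by (intro prod_ennreal) auto
  finally have nnI: "(\<integral>\<^sup>+z. ennreal (?r z) \<partial>leb_plus) = ennreal (\<Prod>b\<in>Basis. measure lborel (A b))" .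
  have r: "has_bochner_integral leb_plus ?r (\<Prod>b\<in>Basis. measure lborel (A b))"
    by (rule has_bochner_integral_nn_integral) (use nn nnI in \<open>auto intro: prod_nonneg\<close>)
  then show "integrable leb_plus g"
    unfolding gr[abs_def] by (intro integrable_of_real) (rule integrable.intros)
  show "(LINT z|leb_plus. g z) = (\<Prod>b\<in>Basis. of_real (measure lborel (A b)))"
    unfolding gr using has_bochner_integral_integral_eq[OF r] by simp
qed

section \<open>The multiple integral of elementary functions\<close>

definition elem_fun :: "(complex \<times> ('a \<Rightarrow> (real \<times> real) set)) list \<Rightarrow> 'a::euclidean_space \<times> 'a \<Rightarrow> complex" where
  "elem_fun L z = (\<Sum>(c, A)\<leftarrow>L. c * tensor (\<lambda>b. indicator (A b)) z)"

text \<open>\<open>disjoint_list\<close> without the disjointness. The moment bound holds at this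
  generality, which is what gives access to products with sets meeting on the diagonals.\<close>

definition borel_list :: "(complex \<times> ('a::euclidean_space \<Rightarrow> (real \<times> real) set)) list \<Rightarrow> bool" where
  "borel_list L \<longleftrightarrow> (\<forall>(c, A)\<in>set L. \<forall>b\<in>Basis. A b \<in> bounded_borel)"

definition disjoint_list :: "(complex \<times> ('a::euclidean_space \<Rightarrow> (real \<times> real) set)) list \<Rightarrow> bool" where
  "disjoint_list L \<longleftrightarrow> (\<forall>(c, A)\<in>set L. (\<forall>b\<in>Basis. A b \<in> bounded_borel) \<and> disjoint_family_on A Basis)"

definition scale_list :: "complex \<Rightarrow> (complex \<times> 'b) list \<Rightarrow> (complex \<times> 'b) list" where
  "scale_list a L = map (\<lambda>(c, A). (a * c, A)) L"

lemma elem_fun_append: "elem_fun (L @ L') z = elem_fun L z + elem_fun L' z"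
  by (simp add: elem_fun_def)

lemma elem_fun_scale: "elem_fun (scale_list a L) z = a * elem_fun L z"
  unfolding elem_fun_def scale_list_def by (induction L) (auto simp: distrib_left mult.assoc)

lemma borel_list_append: "borel_list (L @ L') \<longleftrightarrow> borel_list L \<and> borel_list L'"
  by (auto simp: borel_list_def)

lemma borel_list_scale: "borel_list L \<Longrightarrow> borel_list (scale_list a L)"
  by (auto simp: borel_list_def scale_list_def)

lemma disjoint_list_append: "disjoint_list (L @ L') \<longleftrightarrow> disjoint_list L \<and> disjoint_list L'"
  by (auto simp: disjoint_list_def)

lemma disjoint_list_scale: "disjoint_list L \<Longrightarrow> disjoint_list (scale_list a L)"
  by (auto simp: disjoint_list_def scale_list_def)

lemma disjoint_list_borel: "disjoint_list L \<Longrightarrow> borel_list L"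
  by (auto simp: disjoint_list_def borel_list_def)

lemma measurable_sum_list:
  fixes f :: "'x \<Rightarrow> 'b \<Rightarrow> 'c::{second_countable_topology, topological_comm_monoid_add}"
  assumes "\<And>x. x \<in> set L \<Longrightarrow> f x \<in> borel_measurable N"
  shows "(\<lambda>z. \<Sum>x\<leftarrow>L. f x z) \<in> borel_measurable N"
  using assms by (induction L) (auto intro!: borel_measurable_add)

lemma measurable_elem_fun [measurable]:
  assumes "borel_list L" shows "elem_fun L \<in> borel_measurable borel"
proof -
  have "(tensor (\<lambda>b. indicator (A b)) :: _ \<Rightarrow> complex) \<in> borel_measurable borel"
    if "(c, A) \<in> set L" for c :: complex and A :: "'a \<Rightarrow> (real \<times> real) set"
  proof (rule measurable_tensor)
    fix b :: 'a assume "b \<in> Basis"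
    then have "A b \<in> sets borel" using assms that bounded_borelD(1) unfolding borel_list_def by blast
    then show "(indicator (A b) :: _ \<Rightarrow> complex) \<in> borel_measurable borel" by simp
  qed
  then show ?thesis
    unfolding elem_fun_def[abs_def] case_prod_beta'
    by (intro measurable_sum_list borel_measurable_times borel_measurable_const) (metis prod.collapse)
qed

lemma sum_list_product:
  "(\<Sum>x\<leftarrow>L. f x) * (\<Sum>y\<leftarrow>L'. g y) = (\<Sum>x\<leftarrow>L. \<Sum>y\<leftarrow>L'. f x * g y)"
  for f :: "_ \<Rightarrow> 'c::semiring_0"
  by (simp add: sum_list_const_mult sum_list_mult_const)

lemma cnj_sum_list: "cnj (\<Sum>x\<leftarrow>L. f x) = (\<Sum>x\<leftarrow>L. cnj (f x))"
  by (induction L) auto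

lemma integral_sum_list:
  fixes f :: "'x \<Rightarrow> 'b \<Rightarrow> complex"
  assumes "\<And>x. x \<in> set L \<Longrightarrow> integrable N (f x)"
  shows "integrable N (\<lambda>z. \<Sum>x\<leftarrow>L. f x z)" "(LINT z|N. (\<Sum>x\<leftarrow>L. f x z)) = (\<Sum>x\<leftarrow>L. LINT z|N. f x z)"
  using assms by (induction L) auto

context gaussian_measure
begin

definition elem_int :: "(complex \<times> ('a::euclidean_space \<Rightarrow> (real \<times> real) set)) list \<Rightarrow> 'w \<Rightarrow> complex" where
  "elem_int L \<omega> = (\<Sum>(c, A)\<leftarrow>L. c * (\<Prod>b\<in>Basis. W (A b) \<omega>))"

lemma elem_int_append: "elem_int (L @ L') \<omega> = elem_int L \<omega> + elem_int L' \<omega>"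
  by (simp add: elem_int_def)

lemma elem_int_scale: "elem_int (scale_list a L) \<omega> = a * elem_int L \<omega>"
  unfolding elem_int_def scale_list_def by (induction L) (auto simp: distrib_left mult.assoc)

lemma fin_mom_elem_int: "borel_list L \<Longrightarrow> fin_mom (elem_int L)"
  unfolding elem_int_def[abs_def] borel_list_def case_prod_beta'
  by (intro fin_mom_intros fin_mom_W) auto

text \<open>Each permutation in \<open>W_prod_moment\<close> contributes products of |A b Int A' (p
  b)|, the Lebesgue inner product of one tensor indicator with a permuted one. Integrability is
  stated as well; for p = id it says that the integrand is square integrable.\<close>

lemma elem_int_square:
  fixes L :: "(complex \<times> ('a::euclidean_space \<Rightarrow> (real \<times> real) set)) list"
  assumes L: "borel_list L"
  shows "expectation (\<lambda>\<omega>. elem_int L \<omega> * cnj (elem_int L \<omega>))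
     = (\<Sum>p | p permutes Basis. LINT z|leb_plus. elem_fun L z * cnj (elem_fun L (permute_pair (inv p) z)))"
    and "p permutes Basis \<Longrightarrow> integrable leb_plus (\<lambda>z. elem_fun L z * cnj (elem_fun L (permute_pair (inv p) z)))"
proof -
  have LA: "A b \<in> bounded_borel" if "(c, A) \<in> set L" "b \<in> Basis" for c A b
    using L that unfolding borel_list_def by blast
  let ?T = "\<lambda>A. tensor (\<lambda>b. indicator (A b)) :: 'a \<times> 'a \<Rightarrow> complex"
  let ?m = "\<lambda>A A' p. \<Prod>b\<in>(Basis :: 'a set). complex_of_real (measure lborel (A b \<inter> A' (p b)))"
  have TT: "integrable leb_plus (\<lambda>z. ?T A z * cnj (?T A' (permute_pair (inv p) z)))"
     "(LINT z|leb_plus. ?T A z * cnj (?T A' (permute_pair (inv p) z))) = ?m A A' p"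
    if "(c, A) \<in> set L" "(c', A') \<in> set L" and p: "p permutes Basis" for c A c' A' p
  proof -
    have eq: "?T A z * cnj (?T A' (permute_pair (inv p) z)) = tensor (\<lambda>b. indicator (A b \<inter> A' (p b))) z" for z
      unfolding tensor_permute[OF p]
      by (auto simp: tensor_def prod.distrib[symmetric] indicator_def intro!: prod.cong)
    have bb: "A b \<inter> A' (p b) \<in> bounded_borel" if "b \<in> Basis" for b
      using that LA[OF \<open>(c, A) \<in> set L\<close>] LA[OF \<open>(c', A') \<in> set L\<close>, of "p b"] permutes_in_image[OF p, of b]
      by (intro bounded_borel_Int) (auto intro: bounded_borelD)
    show "integrable leb_plus (\<lambda>z. ?T A z * cnj (?T A' (permute_pair (inv p) z)))"
      "(LINT z|leb_plus. ?T A z * cnj (?T A' (permute_pair (inv p) z))) = ?m A A' p"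
      unfolding eq using tensor_indicator_integral[of "\<lambda>b. A b \<inter> A' (p b)", OF bb] by auto
  qed
  have expand: "elem_fun L z * cnj (elem_fun L (permute_pair (inv p) z))
     = (\<Sum>x\<leftarrow>L. \<Sum>y\<leftarrow>L. fst x * cnj (fst y) * (?T (snd x) z * cnj (?T (snd y) (permute_pair (inv p) z))))" for z p
    unfolding elem_fun_def case_prod_beta' cnj_sum_list sum_list_product by (simp add: mult_ac)
  have int: "(LINT z|leb_plus. elem_fun L z * cnj (elem_fun L (permute_pair (inv p) z)))
     = (\<Sum>x\<leftarrow>L. \<Sum>y\<leftarrow>L. fst x * cnj (fst y) * ?m (snd x) (snd y) p)"
   and intb: "integrable leb_plus (\<lambda>z. elem_fun L z * cnj (elem_fun L (permute_pair (inv p) z)))"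
   if p: "p permutes Basis" for p
  proof -
    have i: "integrable leb_plus (\<lambda>z. fst x * cnj (fst y) * (?T (snd x) z * cnj (?T (snd y) (permute_pair (inv p) z))))"
      if "x \<in> set L" "y \<in> set L" for x y
      using TT(1)[of "fst x" "snd x" "fst y" "snd y" p] that p by (intro integrable_mult_right) simp
    show "integrable leb_plus (\<lambda>z. elem_fun L z * cnj (elem_fun L (permute_pair (inv p) z)))"
      unfolding expand by (intro integral_sum_list i)
    show "(LINT z|leb_plus. elem_fun L z * cnj (elem_fun L (permute_pair (inv p) z)))
     = (\<Sum>x\<leftarrow>L. \<Sum>y\<leftarrow>L. fst x * cnj (fst y) * ?m (snd x) (snd y) p)"
    proof -
      have t: "(LINT z|leb_plus. ?T (snd x) z * cnj (?T (snd y) (permute_pair (inv p) z))) = ?m (snd x) (snd y) p"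
        if "x \<in> set L" "y \<in> set L" for x y
        using TT(2)[of "fst x" "snd x" "fst y" "snd y" p] that p by simp
      show ?thesis unfolding expand
        using i by (simp add: integral_sum_list t cong: map_cong)
    qed
  qed
  show "integrable leb_plus (\<lambda>z. elem_fun L z * cnj (elem_fun L (permute_pair (inv p) z)))" if "p permutes Basis"
    by (rule intb[OF that])
  let ?P = "\<lambda>A \<omega>. \<Prod>b\<in>(Basis :: 'a set). W (A b) \<omega>"
  have i: "integrable M (\<lambda>\<omega>. fst x * cnj (fst y) * (?P (snd x) \<omega> * cnj (?P (snd y) \<omega>)))"
    if "x \<in> set L" "y \<in> set L" for x y
    using LA[of "fst x" "snd x"] LA[of "fst y" "snd y"] that
    by (intro fin_mom_integrable fin_mom_intros fin_mom_W) auto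
  have "expectation (\<lambda>\<omega>. elem_int L \<omega> * cnj (elem_int L \<omega>))
     = expectation (\<lambda>\<omega>. \<Sum>x\<leftarrow>L. \<Sum>y\<leftarrow>L. fst x * cnj (fst y) * (?P (snd x) \<omega> * cnj (?P (snd y) \<omega>)))"
    unfolding elem_int_def case_prod_beta' cnj_sum_list sum_list_product by (simp add: mult_ac)
  also have "\<dots> = (\<Sum>x\<leftarrow>L. \<Sum>y\<leftarrow>L. fst x * cnj (fst y) * expectation (\<lambda>\<omega>. ?P (snd x) \<omega> * cnj (?P (snd y) \<omega>)))"
    using i by (simp add: integral_sum_list integral_mult_right_zero cong: map_cong)
  also have "\<dots> = (\<Sum>x\<leftarrow>L. \<Sum>y\<leftarrow>L. fst x * cnj (fst y) * (\<Sum>p | p permutes Basis. ?m (snd x) (snd y) p))"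
    using LA by (intro arg_cong[where f=sum_list] map_cong refl arg_cong2[where f="(*)"] W_prod_moment) auto
  also have "\<dots> = (\<Sum>p | p permutes Basis. \<Sum>x\<leftarrow>L. \<Sum>y\<leftarrow>L. fst x * cnj (fst y) * ?m (snd x) (snd y) p)"
  proof -
    have sw: "(\<Sum>x\<leftarrow>L. \<Sum>p\<in>P. f x p) = (\<Sum>p\<in>P. \<Sum>x\<leftarrow>L. f x p)" for f :: "_ \<Rightarrow> _ \<Rightarrow> complex" and P and L :: "'x list"
      by (induction L) (auto simp: sum.distrib)
    show ?thesis unfolding sum_distrib_left sw ..
  qed
  also have "\<dots> = (\<Sum>p | p permutes Basis. LINT z|leb_plus. elem_fun L z * cnj (elem_fun L (permute_pair (inv p) z)))"
    by (intro sum.cong refl int[symmetric]) auto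
  finally show "expectation (\<lambda>\<omega>. elem_int L \<omega> * cnj (elem_int L \<omega>))
     = (\<Sum>p | p permutes Basis. LINT z|leb_plus. elem_fun L z * cnj (elem_fun L (permute_pair (inv p) z)))" .
qed

text \<open>Each of the n! inner products of \<open>elem_fun L\<close> with a permuted copy is at
  most its squared norm, because permutations preserve Lebesgue measure.\<close>

lemma elem_int_norm_bound:
  fixes L :: "(complex \<times> ('a::euclidean_space \<Rightarrow> (real \<times> real) set)) list"
  assumes L: "borel_list L"
  shows "L2d M (elem_int L) (\<lambda>_. 0) \<le> ennreal (fact DIM('a)) * L2d leb_plus (elem_fun L) (\<lambda>_. 0)"
proof -
  let ?g = "elem_fun L" and ?X = "elem_int L"
  note [measurable] = measurable_elem_fun[OF L]
  have idp: "(id :: 'a \<Rightarrow> 'a) permutes Basis" by (rule permutes_id)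
  have pid: "permute_pair id z = z" for z :: "'a \<times> 'a"
    by (simp add: permute_pair_def permute_coords_def euclidean_representation)
  have int2: "integrable leb_plus (\<lambda>z. (norm (?g z))\<^sup>2)"
  proof -
    have "integrable leb_plus (\<lambda>z. Re (?g z * cnj (?g z)))"
      using elem_int_square(2)[OF L idp] by (intro integrable_Re) (simp add: pid)
    then show ?thesis by (simp add: complex_mult_cnj cmod_power2)
  qed
  have nn2: "(\<integral>\<^sup>+z. ennreal ((norm (?g z))\<^sup>2) \<partial>leb_plus) = ennreal (LINT z|leb_plus. (norm (?g z))\<^sup>2)"
    using int2 by (intro nn_integral_eq_integral) auto
  have pi: "integrable leb_plus (\<lambda>z. (norm (?g (permute_pair q z)))\<^sup>2)"
    "(LINT z|leb_plus. (norm (?g (permute_pair q z)))\<^sup>2) = (LINT z|leb_plus. (norm (?g z))\<^sup>2)"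
    if q: "q permutes Basis" for q
  proof -
    have nn: "(\<integral>\<^sup>+z. ennreal ((norm (?g (permute_pair q z)))\<^sup>2) \<partial>leb_plus) = ennreal (LINT z|leb_plus. (norm (?g z))\<^sup>2)"
      using nn_integral_permute_pair[OF q, of "\<lambda>z. ennreal ((norm (?g z))\<^sup>2)"] nn2 by simp
    have "has_bochner_integral leb_plus (\<lambda>z. (norm (?g (permute_pair q z)))\<^sup>2) (LINT z|leb_plus. (norm (?g z))\<^sup>2)"
      by (rule has_bochner_integral_nn_integral) (use nn in auto)
    then show "integrable leb_plus (\<lambda>z. (norm (?g (permute_pair q z)))\<^sup>2)"
       "(LINT z|leb_plus. (norm (?g (permute_pair q z)))\<^sup>2) = (LINT z|leb_plus. (norm (?g z))\<^sup>2)"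
      by (auto intro: integrable.intros has_bochner_integral_integral_eq)
  qed
  have fm: "fin_mom ?X" by (rule fin_mom_elem_int[OF L])
  then have iX: "integrable M (\<lambda>\<omega>. (norm (?X \<omega>))\<^sup>2)" by (simp add: fin_mom_def)
  have "expectation (\<lambda>\<omega>. (norm (?X \<omega>))\<^sup>2) = Re (expectation (\<lambda>\<omega>. ?X \<omega> * cnj (?X \<omega>)))"
  proof -
    have "(\<lambda>\<omega>. ?X \<omega> * cnj (?X \<omega>)) = (\<lambda>\<omega>. complex_of_real ((norm (?X \<omega>))\<^sup>2))"
      by (simp add: complex_norm_square del: of_real_power)
    then show ?thesis by (simp del: of_real_power)
  qed
  also have "\<dots> = (\<Sum>p | p permutes (Basis::'a set). Re (LINT z|leb_plus. ?g z * cnj (?g (permute_pair (inv p) z))))"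
    unfolding elem_int_square(1)[OF L] by simp
  also have "\<dots> \<le> (\<Sum>p | p permutes (Basis::'a set). LINT z|leb_plus. (norm (?g z))\<^sup>2)"
  proof (rule sum_mono)
    fix p assume "p \<in> {p. p permutes (Basis::'a set)}"
    then have p: "p permutes Basis" by simp
    let ?h = "\<lambda>z. ?g (permute_pair (inv p) z)"
    note pi' = pi[OF permutes_inv[OF p]]
    have "Re (LINT z|leb_plus. ?g z * cnj (?h z)) = (LINT z|leb_plus. Re (?g z * cnj (?h z)))"
      using elem_int_square(2)[OF L p] by (intro integral_Re[symmetric])
    \<comment> \<open>The arithmetic mean of the two squared norms replaces the Cauchy-Schwarz
      inequality; both have the same integral.\<close>
    also have "\<dots> \<le> (LINT z|leb_plus. ((norm (?g z))\<^sup>2 + (norm (?h z))\<^sup>2) / 2)"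
    proof (rule integral_mono)
      show "integrable leb_plus (\<lambda>z. Re (?g z * cnj (?h z)))"
        using elem_int_square(2)[OF L p] by (intro integrable_Re)
      show "integrable leb_plus (\<lambda>z. ((norm (?g z))\<^sup>2 + (norm (?h z))\<^sup>2) / 2)"
        using int2 pi'(1) by (intro integrable_divide Bochner_Integration.integrable_add) auto
      fix z
      have "Re (?g z * cnj (?h z)) \<le> norm (?g z * cnj (?h z))" by (rule complex_Re_le_cmod)
      also have "\<dots> = norm (?g z) * norm (?h z)" by (simp add: norm_mult)
      also have "\<dots> \<le> ((norm (?g z))\<^sup>2 + (norm (?h z))\<^sup>2) / 2"
        using sum_squares_bound[of "norm (?g z)" "norm (?h z)"] by simp
      finally show "Re (?g z * cnj (?h z)) \<le> ((norm (?g z))\<^sup>2 + (norm (?h z))\<^sup>2) / 2" .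
    qed
    also have "\<dots> = (LINT z|leb_plus. (norm (?g z))\<^sup>2)"
      using int2 pi' by simp
    finally show "Re (LINT z|leb_plus. ?g z * cnj (?h z)) \<le> (LINT z|leb_plus. (norm (?g z))\<^sup>2)" .
  qed
  also have "\<dots> = fact DIM('a) * (LINT z|leb_plus. (norm (?g z))\<^sup>2)"
    by (simp add: card_permutations[OF refl])
  finally have le: "expectation (\<lambda>\<omega>. (norm (?X \<omega>))\<^sup>2) \<le> fact DIM('a) * (LINT z|leb_plus. (norm (?g z))\<^sup>2)" .
  have "L2d M ?X (\<lambda>_. 0) = ennreal (expectation (\<lambda>\<omega>. (norm (?X \<omega>))\<^sup>2))"
    unfolding L2d_def using iX by (simp add: nn_integral_eq_integral)
  also have "\<dots> \<le> ennreal (fact DIM('a) * (LINT z|leb_plus. (norm (?g z))\<^sup>2))"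
    by (rule ennreal_leI[OF le])
  also have "\<dots> = ennreal (fact DIM('a)) * L2d leb_plus ?g (\<lambda>_. 0)"
    unfolding L2d_def using nn2 by (simp add: ennreal_mult')
  finally show ?thesis .
qed

lemma elem_int_bound:
  fixes L L' :: "(complex \<times> ('a::euclidean_space \<Rightarrow> (real \<times> real) set)) list"
  assumes "borel_list L" "borel_list L'"
  shows "L2d M (elem_int L) (elem_int L') \<le> ennreal (fact DIM('a)) * L2d leb_plus (elem_fun L) (elem_fun L')"
proof -
  have "borel_list (L @ scale_list (-1) L')"
    using assms by (simp add: borel_list_append borel_list_scale)
  from elem_int_norm_bound[OF this] show ?thesis
    by (simp add: L2d_def elem_fun_append elem_fun_scale elem_int_append elem_int_scale)
qed

end

section \<open>Closure properties of the multiple integral\<close>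

lemma L2d_of_real: "L2d N (\<lambda>z. complex_of_real (f z)) (\<lambda>z. complex_of_real (g z)) = L2d N f g"
  unfolding L2d_def of_real_diff[symmetric] norm_of_real by simp

lemma tensor_fun_upd:
  assumes "d \<in> Basis"
  shows "tensor (h(d := u)) z = u (coord d z) * (\<Prod>b\<in>Basis - {d}. h b (coord b z))"
  unfolding tensor_def by (subst prod.remove[OF _ assms]) auto

text \<open>Two tensors that differ in one slot have a tensor as difference, so the squared distance
  factorizes exactly.\<close>

lemma L2d_tensor_fun_upd:
  fixes h :: "'a::euclidean_space \<Rightarrow> real \<times> real \<Rightarrow> complex"
  assumes d: "d \<in> Basis" and [measurable]: "\<And>b. b \<in> Basis \<Longrightarrow> h b \<in> borel_measurable borel"
    "u \<in> borel_measurable borel" "v \<in> borel_measurable borel"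
  shows "L2d leb_plus (tensor (h(d := u))) (tensor (h(d := v)))
     = L2d leb_plus u v * (\<Prod>b\<in>Basis - {d}. L2d leb_plus (h b) (\<lambda>_. 0))"
proof -
  \<comment> \<open>The factors of the squared difference: the changed slot carries |u - v|^2, the
    others |h b|^2.\<close>
  define n where "n b z = (if b = d then ennreal ((norm (u z - v z))\<^sup>2) else ennreal ((norm (h b z))\<^sup>2))" for b z
  have [measurable]: "n b \<in> borel_measurable borel" if "b \<in> Basis" for b
    using that unfolding n_def by (cases "b = d") auto
  have "ennreal ((norm (tensor (h(d := u)) z - tensor (h(d := v)) z))\<^sup>2) = tensor n z" for z
  proof -
    have "tensor n z = n d (coord d z) * (\<Prod>b\<in>Basis - {d}. n b (coord b z))"
      unfolding tensor_def by (subst prod.remove[OF _ d]) auto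
    also have "(\<Prod>b\<in>Basis - {d}. n b (coord b z)) = (\<Prod>b\<in>Basis - {d}. ennreal ((norm (h b (coord b z)))\<^sup>2))"
      by (intro prod.cong) (auto simp: n_def)
    also have "\<dots> = ennreal (\<Prod>b\<in>Basis - {d}. (norm (h b (coord b z)))\<^sup>2)"
      by (intro prod_ennreal) auto
    also have "n d (coord d z) * \<dots> = ennreal ((norm (u (coord d z) - v (coord d z)))\<^sup>2 * (\<Prod>b\<in>Basis - {d}. (norm (h b (coord b z)))\<^sup>2))"
      by (simp add: n_def ennreal_mult prod_nonneg)
    also have "(norm (u (coord d z) - v (coord d z)))\<^sup>2 * (\<Prod>b\<in>Basis - {d}. (norm (h b (coord b z)))\<^sup>2)
       = (norm ((u (coord d z) - v (coord d z)) * (\<Prod>b\<in>Basis - {d}. h b (coord b z))))\<^sup>2"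
      by (simp only: norm_mult prod_norm[symmetric] power_mult_distrib prod_power_distrib)
    finally show ?thesis
      unfolding tensor_fun_upd[OF d] by (simp add: left_diff_distrib)
  qed
  then have "L2d leb_plus (tensor (h(d := u))) (tensor (h(d := v))) = (\<integral>\<^sup>+z. tensor n z \<partial>leb_plus)"
    unfolding L2d_def by simp
  also have "\<dots> = (\<Prod>b\<in>Basis. \<integral>\<^sup>+z. n b z \<partial>leb_plus)" by (rule nn_integral_tensor) auto
  also have "\<dots> = (\<integral>\<^sup>+z. n d z \<partial>leb_plus) * (\<Prod>b\<in>Basis - {d}. \<integral>\<^sup>+z. n b z \<partial>leb_plus)"
    by (subst prod.remove[OF _ d]) auto
  also have "\<dots> = L2d leb_plus u v * (\<Prod>b\<in>Basis - {d}. L2d leb_plus (h b) (\<lambda>_. 0))"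
    by (intro arg_cong2[where f="(*)"] prod.cong) (auto simp: n_def L2d_def)
  finally show ?thesis .
qed

lemma L2_tendsto_tensor_fun_upd:
  fixes h :: "'a::euclidean_space \<Rightarrow> real \<times> real \<Rightarrow> complex"
  assumes d: "d \<in> Basis" and meas: "\<And>b. b \<in> Basis \<Longrightarrow> h b \<in> borel_measurable borel"
    "\<And>k. F k \<in> borel_measurable borel"
    and fin: "\<And>b. b \<in> Basis \<Longrightarrow> L2d leb_plus (h b) (\<lambda>_. 0) < \<infinity>"
    and lim: "L2_tendsto leb_plus F (h d)"
  shows "L2_tendsto leb_plus (\<lambda>k. tensor (h(d := F k))) (tensor h)"
proof -
  have "(\<Prod>b\<in>Basis - {d}. L2d leb_plus (h b) (\<lambda>_. 0)) < top"
    using fin by (auto simp: less_top[symmetric] ennreal_prod_eq_top)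
  then have "(\<lambda>k. (\<Prod>b\<in>Basis - {d}. L2d leb_plus (h b) (\<lambda>_. 0)) * L2d leb_plus (F k) (h d)) \<longlonglongrightarrow> (\<Prod>b\<in>Basis - {d}. L2d leb_plus (h b) (\<lambda>_. 0)) * 0"
    using lim unfolding L2_tendsto_L2d by (intro ennreal_tendsto_cmult)
  moreover have "L2d leb_plus (tensor (h(d := F k))) (tensor h) = L2d leb_plus (F k) (h d) * (\<Prod>b\<in>Basis - {d}. L2d leb_plus (h b) (\<lambda>_. 0))" for k
    using L2d_tensor_fun_upd[of d h "F k" "h d", OF d meas(1) meas(2)[of k] meas(1)[OF d]] by simp
  ultimately show ?thesis unfolding L2_tendsto_L2d by (simp add: mult.commute)
qed

lemma coord_real [simp]: "coord (1::real) z = z"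
  by (simp add: coord_def)

lemma tensor_real: "tensor h z = h (1::real) z"
  by (simp add: tensor_def)

text \<open>Finitely many hyperplanes t_b = t_c are null sets. Separating the times is enough to
  leave the diagonals.\<close>

lemma AE_distinct_coords:
  "AE z in (leb_plus :: ('a::euclidean_space \<times> 'a) measure). inj_on (\<lambda>b. fst z \<bullet> b) Basis"
proof -
  have one: "AE z in (lborel :: ('a \<times> 'a) measure). fst z \<bullet> b \<noteq> fst z \<bullet> c" if "b \<noteq> c" for b c :: 'a
  proof -
    \<comment> \<open>The hyperplane t_b = t_c in the space of pairs (t, x), with normal vector (b -
      c, 0).\<close>
    let ?S = "{z :: 'a \<times> 'a. (b - c, 0) \<bullet> z = 0}"
    have "negligible ?S" using that by (intro negligible_hyperplane) (auto simp: zero_prod_def)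
    moreover have "?S \<in> sets lborel" by (simp add: borel_closed closed_hyperplane)
    ultimately have "?S \<in> null_sets lborel"
      by (simp add: negligible_iff_null_sets null_sets_completion_iff)
    then have "AE z in lborel. z \<notin> ?S" by (rule AE_not_in)
    then show ?thesis by eventually_elim (auto simp: inner_diff_left inner_diff_right inner_commute split_beta inner_prod_def)
  qed
  have "AE z in (lborel :: ('a \<times> 'a) measure). \<forall>b\<in>Basis. \<forall>c\<in>Basis. b \<noteq> c \<longrightarrow> fst z \<bullet> b \<noteq> fst z \<bullet> c"
  proof -
    have "AE z in (lborel :: ('a \<times> 'a) measure). b \<noteq> c \<longrightarrow> fst z \<bullet> b \<noteq> fst z \<bullet> c" for b c :: 'a
      using one[of b c] by (cases "b = c") auto
    then show ?thesis by (intro AE_finite_allI) auto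
  qed
  then have "AE z in (lborel :: ('a \<times> 'a) measure). inj_on (\<lambda>b. fst z \<bullet> b) Basis"
    by eventually_elim (auto simp: inj_on_def)
  then show ?thesis unfolding leb_plus_def by (subst AE_restrict_space_iff) auto
qed

lemma symmetrize_permute_pair:
  "symmetrize g z = (\<Sum>p | p permutes Basis. 1 / fact DIM('a) * g (permute_pair p (z :: 'a::euclidean_space \<times> 'a)))"
  by (simp add: symmetrize_def permute_pair_def split_beta sum_divide_distrib)

text \<open>Simple functions converging pointwise with |F i| <= 2|g|, cut off to growing bounded
  sets; dominated convergence does the rest.\<close>

lemma L2_dense_step_functions:
  fixes g :: "real \<times> real \<Rightarrow> real"
  assumes g[measurable]: "g \<in> borel_measurable borel" and fin: "L2d leb_plus g (\<lambda>_. 0) < \<infinity>"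
  shows "\<exists>S :: nat \<Rightarrow> (real \<times> (real \<times> real) set) list. (\<forall>k. \<forall>(c, A)\<in>set (S k). A \<in> bounded_borel) \<and>
     L2_tendsto leb_plus (\<lambda>k z. \<Sum>(c, A)\<leftarrow>S k. c * indicator A z) g"
proof -
  obtain F where F: "\<And>i. simple_function borel (F i)" "\<And>x. (\<lambda>i. F i x) \<longlonglongrightarrow> g x"
      "\<And>i x. dist (F i x) 0 \<le> 2 * dist (g x) 0"
    using borel_measurable_implies_sequence_metric[OF g, of 0] by auto
  have [measurable]: "F k \<in> borel_measurable borel" for k
    using F(1) by (rule borel_measurable_simple_function)
  \<comment> \<open>The cut-off makes the level sets elements of \<open>bounded_borel\<close>,
    including the level set of the value 0.\<close>
  define Q where "Q k = ({0..} \<times> UNIV) \<inter> cball (0 :: real \<times> real) (real k)" for k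
  have Qb: "Q k \<in> sets borel" "bounded (Q k)" "Q k \<subseteq> {0..} \<times> UNIV" for k
    unfolding Q_def by (auto intro!: borel_closed closed_Int closed_Times bounded_Int)
  define cs where "cs k = (SOME l. distinct l \<and> set l = F k ` UNIV)" for k
  have cs: "distinct (cs k) \<and> set (cs k) = F k ` UNIV" for k
    unfolding cs_def
  proof (rule someI_ex)
    have "finite (F k ` UNIV)" using F(1)[of k] by (auto simp: simple_function_def)
    then show "\<exists>l. distinct l \<and> set l = F k ` UNIV" using finite_distinct_list by metis
  qed
  define S where "S k = map (\<lambda>c. (c, F k -` {c} \<inter> Q k)) (cs k)" for k
  have S1: "\<forall>(c, A)\<in>set (S k). A \<in> bounded_borel" for k
  proof -
    have m: "F k -` {c} \<in> sets borel" for c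
      using measurable_sets[of "F k" borel borel "{c}"] by simp
    have "F k -` {c} \<inter> Q k \<in> bounded_borel" for c
      unfolding bounded_borel_def
      using sets.Int[OF m[of c] Qb(1)[of k]] Qb(3)[of k] bounded_subset[OF Qb(2)[of k], of "F k -` {c} \<inter> Q k"]
      by blast
    then show ?thesis unfolding S_def by auto
  qed
  have Sum: "(\<Sum>(c, A)\<leftarrow>S k. c * indicator A z) = F k z * indicator (Q k) z" for k z
  proof -
    have "(\<Sum>(c, A)\<leftarrow>S k. c * indicator A z) = (\<Sum>c\<leftarrow>cs k. c * indicator (F k -` {c} \<inter> Q k) z)"
      unfolding S_def by (simp add: o_def)
    also have "\<dots> = (\<Sum>c\<in>F k ` UNIV. c * indicator (F k -` {c} \<inter> Q k) z)"
      using cs[of k] by (simp add: sum_list_distinct_conv_sum_set)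
    also have "\<dots> = (\<Sum>c\<in>F k ` UNIV. if c = F k z then F k z * indicator (Q k) z else 0)"
      by (intro sum.cong) (auto simp: indicator_def)
    also have "\<dots> = F k z * indicator (Q k) z"
      using F(1)[of k] by (subst sum.delta) (auto simp: simple_function_def)
    finally show ?thesis .
  qed
  have "L2_tendsto leb_plus (\<lambda>k z. F k z * indicator (Q k) z) g"
  proof (rule L2_tendsto_dominated[where w="\<lambda>z. 2 * norm (g z)"])
    show "(\<lambda>z. F k z * indicator (Q k) z) \<in> borel_measurable leb_plus" for k
      using Qb(1)[of k] by measurable
    show "AE z in leb_plus. norm (F k z * indicator (Q k) z) \<le> 2 * norm (g z)" for k
      using F(3)[of k] by (auto simp: indicator_def dist_norm)
    have "(\<integral>\<^sup>+z. ennreal ((2 * norm (g z))\<^sup>2) \<partial>leb_plus) = (\<integral>\<^sup>+z. 4 * ennreal ((norm (g z))\<^sup>2) \<partial>leb_plus)"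
      by (simp add: power_mult_distrib ennreal_mult)
    also have "\<dots> = 4 * L2d leb_plus g (\<lambda>_. 0)"
      unfolding L2d_def by (subst nn_integral_cmult) auto
    also have "\<dots> < \<infinity>" using fin by (simp add: ennreal_mult_less_top ennreal_numeral_less_top)
    finally show "(\<integral>\<^sup>+z. ennreal ((2 * norm (g z))\<^sup>2) \<partial>leb_plus) < \<infinity>" .
    show "AE z in leb_plus. (\<lambda>k. F k z * indicator (Q k) z) \<longlonglongrightarrow> g z"
    proof (rule AE_I2)
      fix z :: "real \<times> real" assume "z \<in> space leb_plus"
      then have z: "z \<in> {0..} \<times> UNIV" by (simp add: space_leb_plus orthant_real)
      obtain k0 where "norm z \<le> real k0" using real_arch_simple by blast
      then have "\<forall>\<^sub>F k in sequentially. indicator (Q k) z = (1::real)"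
        using z unfolding eventually_sequentially Q_def
        by (intro exI[of _ k0]) (auto simp: indicator_def dist_norm)
      then have "\<forall>\<^sub>F k in sequentially. F k z = F k z * indicator (Q k) z"
        by eventually_elim simp
      then show "(\<lambda>k. F k z * indicator (Q k) z) \<longlonglongrightarrow> g z"
        by (rule Lim_transform_eventually[OF F(2)])
    qed
  qed simp_all
  then have "L2_tendsto leb_plus (\<lambda>k z. \<Sum>(c, A)\<leftarrow>S k. c * indicator A z) g" by (simp add: Sum)
  with S1 show ?thesis by blast
qed

section \<open>The graph of the elementary integral and its closure\<close>

context gaussian_measure
begin

definition elem_graph :: "(('a::euclidean_space \<times> 'a \<Rightarrow> complex) \<times> ('w \<Rightarrow> complex)) set" where
  "elem_graph = {(elem_fun L, elem_int L) |L. disjoint_list L}"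

abbreviation mint :: "('a::euclidean_space \<times> 'a \<Rightarrow> complex) \<Rightarrow> ('w \<Rightarrow> complex) \<Rightarrow> bool" where
  "mint \<equiv> is_mult_int M W1 W2"

lemma elem_graph_measurable:
  "(F, Y) \<in> elem_graph \<Longrightarrow> F \<in> borel_measurable leb_plus \<and> Y \<in> borel_measurable M"
  unfolding elem_graph_def
  using measurable_elem_fun[OF disjoint_list_borel] fin_mom_measurable[OF fin_mom_elem_int[OF disjoint_list_borel]]
  by (auto intro: measurable_leb_plus)

lemma elem_graph_bound:
  "(F, Y) \<in> elem_graph \<Longrightarrow> (F', Y') \<in> elem_graph \<Longrightarrow>
     L2d M Y Y' \<le> ennreal (fact DIM('a)) * L2d leb_plus F (F' :: 'a::euclidean_space \<times> 'a \<Rightarrow> complex)"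
  unfolding elem_graph_def by (auto intro!: elem_int_bound disjoint_list_borel)

text \<open>Turns a sequence of lists, as in the definition of the integral, into a sequence of
  points of the graph. The closure lemmas become available for \<open>is_mult_int\<close>.\<close>

lemma mint_iff: "mint g X \<longleftrightarrow> (g, X) \<in> graph_closure leb_plus M elem_graph"
proof -
  have f: "(\<lambda>(t, x). \<Sum>(c, A)\<leftarrow>L. c * (\<Prod>b\<in>Basis. indicator (A b) (t \<bullet> b, x \<bullet> b))) = elem_fun L" for L
    by (auto simp: fun_eq_iff elem_fun_def tensor_def coord_def)
  have i: "(\<lambda>\<omega>. \<Sum>(c, A)\<leftarrow>L. c * (\<Prod>b\<in>Basis. Complex (W1 (A b) \<omega>) (W2 (A b) \<omega>))) = elem_int L"
    for L :: "(complex \<times> ('a \<Rightarrow> (real \<times> real) set)) list"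
    by (auto simp: fun_eq_iff elem_int_def W_def)
  have "mint g X \<longleftrightarrow> X \<in> borel_measurable M \<and> (\<exists>S. (\<forall>k. disjoint_list (S k)) \<and>
      L2_tendsto leb_plus (\<lambda>k. elem_fun (S k)) g \<and> L2_tendsto M (\<lambda>k. elem_int (S k)) X)"
    unfolding is_mult_int_def disjoint_list_def[symmetric] f i ..
  also have "\<dots> \<longleftrightarrow> X \<in> borel_measurable M \<and> (\<exists>F Y. (\<forall>k::nat. (F k, Y k) \<in> elem_graph) \<and>
      L2_tendsto leb_plus F g \<and> L2_tendsto M Y X)"
  proof (intro conj_cong refl iffI; elim exE conjE)
    fix S assume S: "\<forall>k. disjoint_list (S k)" "L2_tendsto leb_plus (\<lambda>k. elem_fun (S k)) g" "L2_tendsto M (\<lambda>k. elem_int (S k)) X"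
    then show "\<exists>F Y. (\<forall>k::nat. (F k, Y k) \<in> elem_graph) \<and> L2_tendsto leb_plus F g \<and> L2_tendsto M Y X"
      by (intro exI[of _ "\<lambda>k. elem_fun (S k)"] exI[of _ "\<lambda>k. elem_int (S k)"]) (auto simp: elem_graph_def)
  next
    fix F Y assume FY: "\<forall>k::nat. (F k, Y k) \<in> elem_graph" "L2_tendsto leb_plus F g" "L2_tendsto M Y X"
    then have "\<forall>k. \<exists>L. disjoint_list L \<and> F k = elem_fun L \<and> Y k = elem_int L"
      unfolding elem_graph_def by blast
    from choice[OF this] obtain S where S': "\<forall>k. disjoint_list (S k) \<and> F k = elem_fun (S k) \<and> Y k = elem_int (S k)"
      by blast
    then have S: "\<And>k. disjoint_list (S k)" "F = (\<lambda>k. elem_fun (S k))" "Y = (\<lambda>k. elem_int (S k))"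
      by auto
    show "\<exists>S. (\<forall>k. disjoint_list (S k)) \<and> L2_tendsto leb_plus (\<lambda>k. elem_fun (S k)) g \<and> L2_tendsto M (\<lambda>k. elem_int (S k)) X"
      using S(1) FY(2,3) unfolding S(2,3) by blast
  qed
  finally show ?thesis unfolding graph_closure_def by simp
qed

lemma mint_measurable: "mint g X \<Longrightarrow> X \<in> borel_measurable M"
  unfolding is_mult_int_def by blast

lemma mint_lists:
  assumes "mint g X"
  obtains S where "\<And>k. disjoint_list (S k)" "L2_tendsto leb_plus (\<lambda>k. elem_fun (S k)) g"
    "L2_tendsto M (\<lambda>k. elem_int (S k)) X"
proof -
  obtain F Y where FY: "\<forall>k::nat. (F k, Y k) \<in> elem_graph" "L2_tendsto leb_plus F g" "L2_tendsto M Y X"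
    using assms unfolding mint_iff graph_closure_def by blast
  then have "\<forall>k. \<exists>L. disjoint_list L \<and> F k = elem_fun L \<and> Y k = elem_int L"
    unfolding elem_graph_def by blast
  from choice[OF this] obtain S where S': "\<forall>k. disjoint_list (S k) \<and> F k = elem_fun (S k) \<and> Y k = elem_int (S k)"
    by blast
  then have S: "\<And>k. disjoint_list (S k)" "F = (\<lambda>k. elem_fun (S k))" "Y = (\<lambda>k. elem_int (S k))"
    by auto
  then show ?thesis using FY that by blast
qed

lemma mint_listsI:
  assumes "X \<in> borel_measurable M" "\<And>k. disjoint_list (S k)" "L2_tendsto leb_plus (\<lambda>k. elem_fun (S k)) g"
    "L2_tendsto M (\<lambda>k. elem_int (S k)) X"
  shows "mint g X"
  unfolding mint_iff graph_closure_def
  using assms by (auto intro!: exI[of _ "\<lambda>k. elem_fun (S k)"] exI[of _ "\<lambda>k. elem_int (S k)"] simp: elem_graph_def)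

lemma mint_elem: "disjoint_list L \<Longrightarrow> mint (elem_fun L) (elem_int L)"
  by (rule mint_listsI[of _ "\<lambda>_. L"])
    (auto simp: L2_tendsto_L2d intro: fin_mom_measurable fin_mom_elem_int disjoint_list_borel)

lemma mint_bound:
  fixes g g' :: "'a::euclidean_space \<times> 'a \<Rightarrow> complex"
  assumes "mint g X" "mint g' X'" "g \<in> borel_measurable leb_plus" "g' \<in> borel_measurable leb_plus"
  shows "L2d M X X' \<le> ennreal (16 * fact DIM('a)) * L2d leb_plus g g'"
  using graph_closure_bound[OF elem_graph_measurable elem_graph_bound assms(1,2)[unfolded mint_iff] assms(3,4)] .

lemma mint_unique:
  assumes "mint g X" "mint g X'" "g \<in> borel_measurable leb_plus"
  shows "AE \<omega> in M. X \<omega> = X' \<omega>"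
  using graph_closure_unique[OF elem_graph_measurable elem_graph_bound assms(1,2)[unfolded mint_iff] assms(3)] .

lemma mint_closed:
  assumes "\<And>k::nat. mint (g k) (X k)" "\<And>k. g k \<in> borel_measurable leb_plus" "h \<in> borel_measurable leb_plus"
    "Z \<in> borel_measurable M" "L2_tendsto leb_plus g h" "L2_tendsto M X Z"
  shows "mint h Z"
  using graph_closure_closed[OF elem_graph_measurable assms(1)[unfolded mint_iff] assms(2-6)]
  unfolding mint_iff .

lemma mint_complete:
  fixes h :: "'a::euclidean_space \<times> 'a \<Rightarrow> complex"
  assumes "\<And>k::nat. mint (g k) (X k)" "\<And>k. g k \<in> borel_measurable leb_plus" "h \<in> borel_measurable leb_plus"
    "L2_tendsto leb_plus g h"
  obtains Z where "mint h Z" "L2_tendsto M X Z"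
    "\<exists>r. strict_mono r \<and> (AE \<omega> in M. (\<lambda>k. X (r k) \<omega>) \<longlonglongrightarrow> Z \<omega>)"
proof (rule graph_closure_complete[OF elem_graph_measurable elem_graph_bound _ assms(1)[unfolded mint_iff] assms(2-4)])
  show "(0::real) < fact DIM('a)" by simp
qed (use that in \<open>auto simp: mint_iff\<close>)

lemma mint_cong_AE:
  assumes "mint g X" "AE z in leb_plus. g z = g' z" "AE \<omega> in M. X \<omega> = X' \<omega>" "X' \<in> borel_measurable M"
  shows "mint g' X'"
proof -
  have "L2d leb_plus F g = L2d leb_plus F g'" "L2d M Y X = L2d M Y X'" for F Y
    using assms(2,3) by (auto intro!: L2d_cong_AE)
  then show ?thesis using assms(1,4) unfolding mint_iff graph_closure_iff by auto
qed

lemma mint_add: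
  assumes "mint g X" "mint g' X'" and [measurable]: "g \<in> borel_measurable leb_plus" "g' \<in> borel_measurable leb_plus"
  shows "mint (\<lambda>z. g z + g' z) (\<lambda>\<omega>. X \<omega> + X' \<omega>)"
proof -
  note [measurable] = mint_measurable[OF assms(1)] mint_measurable[OF assms(2)]
  obtain S where S: "\<And>k. disjoint_list (S k)" "L2_tendsto leb_plus (\<lambda>k. elem_fun (S k)) g"
    "L2_tendsto M (\<lambda>k. elem_int (S k)) X" using mint_lists[OF assms(1)] by blast
  obtain S' where S': "\<And>k. disjoint_list (S' k)" "L2_tendsto leb_plus (\<lambda>k. elem_fun (S' k)) g'"
    "L2_tendsto M (\<lambda>k. elem_int (S' k)) X'" using mint_lists[OF assms(2)] by blast
  note m = measurable_leb_plus[OF measurable_elem_fun[OF disjoint_list_borel[OF S(1)]]]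
    measurable_leb_plus[OF measurable_elem_fun[OF disjoint_list_borel[OF S'(1)]]]
    fin_mom_measurable[OF fin_mom_elem_int[OF disjoint_list_borel[OF S(1)]]]
    fin_mom_measurable[OF fin_mom_elem_int[OF disjoint_list_borel[OF S'(1)]]]
  show ?thesis
  proof (rule mint_listsI[of _ "\<lambda>k. S k @ S' k"])
    show "disjoint_list (S k @ S' k)" for k using S S' by (simp add: disjoint_list_append)
    have "L2_tendsto leb_plus (\<lambda>k z. elem_fun (S k) z + elem_fun (S' k) z) (\<lambda>z. g z + g' z)"
      using S(2) S'(2) m by (intro L2_tendsto_add) auto
    then show "L2_tendsto leb_plus (\<lambda>k. elem_fun (S k @ S' k)) (\<lambda>z. g z + g' z)"
      by (simp add: elem_fun_append[abs_def])
    have "L2_tendsto M (\<lambda>k z. elem_int (S k) z + elem_int (S' k) z) (\<lambda>z. X z + X' z)"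
      using S(3) S'(3) m by (intro L2_tendsto_add) auto
    then show "L2_tendsto M (\<lambda>k. elem_int (S k @ S' k)) (\<lambda>z. X z + X' z)"
      by (simp add: elem_int_append[abs_def])
  qed measurable
qed

lemma mint_scale:
  assumes "mint g X" and [measurable]: "g \<in> borel_measurable leb_plus"
  shows "mint (\<lambda>z. a * g z) (\<lambda>\<omega>. a * X \<omega>)"
proof -
  note [measurable] = mint_measurable[OF assms(1)]
  obtain S where S: "\<And>k. disjoint_list (S k)" "L2_tendsto leb_plus (\<lambda>k. elem_fun (S k)) g"
    "L2_tendsto M (\<lambda>k. elem_int (S k)) X" using mint_lists[OF assms(1)] by blast
  note m = measurable_leb_plus[OF measurable_elem_fun[OF disjoint_list_borel[OF S(1)]]]
    fin_mom_measurable[OF fin_mom_elem_int[OF disjoint_list_borel[OF S(1)]]]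
  show ?thesis
  proof (rule mint_listsI[of _ "\<lambda>k. scale_list a (S k)"])
    show "disjoint_list (scale_list a (S k))" for k using S by (simp add: disjoint_list_scale)
    have "L2_tendsto leb_plus (\<lambda>k z. a * elem_fun (S k) z) (\<lambda>z. a * g z)"
      using S(2) m by (intro L2_tendsto_scale) auto
    then show "L2_tendsto leb_plus (\<lambda>k. elem_fun (scale_list a (S k))) (\<lambda>z. a * g z)"
      by (simp add: elem_fun_scale[abs_def])
    have "L2_tendsto M (\<lambda>k z. a * elem_int (S k) z) (\<lambda>z. a * X z)"
      using S(3) m by (intro L2_tendsto_scale) auto
    then show "L2_tendsto M (\<lambda>k. elem_int (scale_list a (S k))) (\<lambda>z. a * X z)"
      by (simp add: elem_int_scale[abs_def])
  qed measurable
qed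

lemma mint_zero: "mint (\<lambda>z :: 'a::euclidean_space \<times> 'a. 0) (\<lambda>\<omega>. 0)"
proof -
  have "mint (elem_fun ([] :: (complex \<times> ('a \<Rightarrow> (real \<times> real) set)) list)) (elem_int ([] :: (complex \<times> ('a \<Rightarrow> (real \<times> real) set)) list))"
    by (rule mint_elem) (simp add: disjoint_list_def)
  then show ?thesis by (simp add: elem_fun_def[abs_def] elem_int_def[abs_def])
qed

lemma mint_sum_list:
  assumes "\<And>x. x \<in> set L \<Longrightarrow> mint (g x) (X x)" "\<And>x. x \<in> set L \<Longrightarrow> g x \<in> borel_measurable leb_plus"
  shows "mint (\<lambda>z. \<Sum>x\<leftarrow>L. g x z) (\<lambda>\<omega>. \<Sum>x\<leftarrow>L. X x \<omega>)"
  using assms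
proof (induction L)
  case Nil
  then show ?case using mint_zero by simp
next
  case (Cons a L)
  then show ?case by (simp, intro mint_add) (auto intro: measurable_sum_list)
qed

lemma mint_sum:
  assumes "\<And>x. x \<in> I \<Longrightarrow> mint (g x) (X x)" "\<And>x. x \<in> I \<Longrightarrow> g x \<in> borel_measurable leb_plus"
  shows "mint (\<lambda>z. \<Sum>x\<in>I. g x z) (\<lambda>\<omega>. \<Sum>x\<in>I. X x \<omega>)"
  using assms
proof (induction I rule: infinite_finite_induct)
  case (insert a L)
  then show ?case by (simp, intro mint_add) auto
qed (auto intro: mint_zero)

lemma mint_mult_int:
  assumes "mint g X" shows "mint g (mult_int M W1 W2 g)"
  unfolding mult_int_def by (rule someI[of "is_mult_int M W1 W2 g", OF assms])

text \<open>Relabelling the sets of an elementary integrand permutes its variables but not the value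
  of the commutative product of the \<open>W (A b)\<close>.\<close>

lemma mint_permute:
  fixes g :: "'a::euclidean_space \<times> 'a \<Rightarrow> complex"
  assumes g: "mint g X" and [measurable]: "g \<in> borel_measurable borel" and p: "p permutes Basis"
  shows "mint (\<lambda>z. g (permute_pair p z)) X"
proof -
  obtain S where S: "\<And>k. disjoint_list (S k)" "L2_tendsto leb_plus (\<lambda>k. elem_fun (S k)) g"
    "L2_tendsto M (\<lambda>k. elem_int (S k)) X" using mint_lists[OF g] by blast
  note [measurable] = measurable_elem_fun[OF disjoint_list_borel[OF S(1)]]
  let ?q = "inv p"
  have q: "?q permutes Basis" by (rule permutes_inv[OF p])
  have pq: "inv ?q = p" by (rule inv_inv_eq[OF permutes_bij[OF p]])
  define T where "T k = map (\<lambda>(c, A). (c, \<lambda>b. A (?q b))) (S k)" for k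
  have Tf: "elem_fun (T k) z = elem_fun (S k) (permute_pair p z)" for k z
  proof -
    have "tensor h (permute_pair p z) = tensor (\<lambda>b. h (?q b)) z" for h :: "'a \<Rightarrow> real \<times> real \<Rightarrow> complex"
      using tensor_permute[OF q, of h z] by (simp add: pq)
    then show ?thesis unfolding T_def elem_fun_def case_prod_beta' by (simp add: o_def)
  qed
  have Ti: "elem_int (T k) = elem_int (S k)" for k
  proof -
    have "(\<Prod>b\<in>Basis. W (A (?q b)) \<omega>) = (\<Prod>b\<in>(Basis::'a set). W (A b) \<omega>)" for A \<omega>
      using prod.permute[OF q, of "\<lambda>b. W (A b) \<omega>"] by (simp add: o_def)
    then show ?thesis unfolding T_def elem_int_def[abs_def] case_prod_beta' by (simp add: o_def)
  qed
  show ?thesis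
  proof (rule mint_listsI[of _ T])
    show "disjoint_list (T k)" for k
    proof -
      have "?q b \<in> Basis \<longleftrightarrow> b \<in> Basis" "?q b = ?q c \<longleftrightarrow> b = c" for b c
        using permutes_in_image[OF q] permutes_inj[OF q] by (auto dest: injD)
      note qq = this
      show ?thesis
        unfolding disjoint_list_def
      proof (clarify, intro conjI ballI)
        fix c A' assume "(c, A') \<in> set (T k)"
        then obtain A where A: "(c, A) \<in> set (S k)" "A' = (\<lambda>b. A (?q b))" unfolding T_def by auto
        have "\<forall>b\<in>Basis. A b \<in> bounded_borel" and d: "disjoint_family_on A Basis"
          using S(1)[of k] A(1) unfolding disjoint_list_def by auto
        then show "A' b \<in> bounded_borel" if "b \<in> Basis" for b using that by (simp add: A(2) qq)
        show "disjoint_family_on A' Basis"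
          using d unfolding A(2) disjoint_family_on_def by (simp add: qq)
      qed
    qed
    have "L2d leb_plus (elem_fun (T k)) (\<lambda>z. g (permute_pair p z)) = L2d leb_plus (elem_fun (S k)) g" for k
      unfolding L2d_def Tf
      using nn_integral_permute_pair[OF p, of "\<lambda>z. ennreal ((norm (elem_fun (S k) z - g z))\<^sup>2)"] by simp
    then show "L2_tendsto leb_plus (\<lambda>k. elem_fun (T k)) (\<lambda>z. g (permute_pair p z))"
      using S(2) unfolding L2_tendsto_L2d by simp
    show "L2_tendsto M (\<lambda>k. elem_int (T k)) X" using S(3) by (simp add: Ti)
  qed (rule mint_measurable[OF g])
qed

text \<open>The average of n! integrands that all have the same integral.\<close>

lemma mint_symmetrize:
  fixes g :: "'a::euclidean_space \<times> 'a \<Rightarrow> complex"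
  assumes g: "mint g X" and [measurable]: "g \<in> borel_measurable borel"
  shows "mint (symmetrize g) X"
proof -
  have "mint (\<lambda>z. \<Sum>p | p permutes (Basis::'a set). 1 / fact DIM('a) * g (permute_pair p z)) (\<lambda>\<omega>. \<Sum>p | p permutes (Basis::'a set). 1 / fact DIM('a) * X \<omega>)"
    by (intro mint_sum mint_scale mint_permute[OF g]) (auto intro: measurable_leb_plus)
  also have "(\<lambda>z. \<Sum>p | p permutes (Basis::'a set). 1 / fact DIM('a) * g (permute_pair p z)) = symmetrize g"
    by (simp add: symmetrize_permute_pair[abs_def])
  also have "(\<lambda>\<omega>. \<Sum>p | p permutes (Basis::'a set). 1 / fact DIM('a) * X \<omega>) = X"
    by (simp add: card_permutations[OF refl])
  finally show ?thesis .
qed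

section \<open>Multiple integrals of tensor products\<close>

text \<open>The basis of the real line has one element, so there is no pair of sets to be
  disjoint.\<close>

lemma disjoint_list_real:
  fixes L :: "(complex \<times> (real \<Rightarrow> (real \<times> real) set)) list"
  shows "borel_list L \<Longrightarrow> disjoint_list L"
  by (auto simp: disjoint_list_def borel_list_def disjoint_family_on_def)

text \<open>
  Off the null set where two time coordinates agree, cutting time into slices of length
  \<open>1 / (k + 1)\<close> and keeping only the products of slices with distinct indices does not change
  the tensor product of indicators for large \<open>k\<close>.
\<close>

lemma mint_tensor_indicator:
  fixes A :: "'a::euclidean_space \<Rightarrow> (real \<times> real) set"
  assumes A: "\<And>b. b \<in> Basis \<Longrightarrow> A b \<in> bounded_borel"
  shows "mint (tensor (\<lambda>b. indicator (A b))) (\<lambda>\<omega>. \<Prod>b\<in>Basis. W (A b) \<omega>)"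
proof -
  let ?B = "Basis :: 'a set"
  let ?T = "tensor (\<lambda>b. indicator (A b)) :: 'a \<times> 'a \<Rightarrow> complex"
  have [measurable]: "A b \<in> sets borel" if "b \<in> ?B" for b using bounded_borelD(1)[OF A[OF that]] .
  have "bounded (\<Union>b\<in>?B. A b)" using bounded_borelD(2)[OF A] by auto
  then obtain R where R0: "\<forall>z\<in>(\<Union>b\<in>?B. A b). norm z \<le> R" unfolding bounded_iff by auto
  have R: "norm z \<le> R" if "b \<in> ?B" "z \<in> A b" for b z using R0 that by auto
  define fl where "fl k z = nat \<lfloor>real (Suc k) * fst z\<rfloor>" for k and z :: "real \<times> real"
  \<comment> \<open>The sets lie in a ball of radius R, so time times k + 1 is at most (k + 1) R;
    the successor makes the bound on slice indices strict.\<close>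
  define N where "N k = Suc (nat \<lfloor>real (Suc k) * R\<rfloor>)" for k
  have flN: "fl k z < N k" if "b \<in> ?B" "z \<in> A b" for k b z
  proof -
    have "fst z \<le> norm z" using norm_fst_le[of "fst z" "snd z"] abs_ge_self[of "fst z"] by simp
    then have "real (Suc k) * fst z \<le> real (Suc k) * R"
      using R[OF that] by (intro mult_left_mono) auto
    from nat_mono[OF floor_mono[OF this]] show ?thesis unfolding fl_def N_def by (rule le_imp_less_Suc)
  qed
  define cell where "cell k i = {z. fl k z = i}" for k i
  have [measurable]: "cell k i \<in> sets borel" for k i
  proof -
    have "fl k \<in> measurable borel (count_space UNIV)"
      unfolding fl_def by measurable
    from measurable_sets[OF this, of "{i}"] show ?thesis
      by (simp add: cell_def vimage_def)
  qed
  \<comment> \<open>Injective assignments of slices to coordinates: distinct slices make the sets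
    \<open>A b \<inter> cell k (\<iota> b)\<close> pairwise disjoint, even if the \<open>A b\<close>
    coincide.\<close>
  define I where "I k = {\<iota> \<in> PiE ?B (\<lambda>_. {..<N k}). inj_on \<iota> ?B}" for k
  have finI: "finite (I k)" for k unfolding I_def by (intro finite_Collect_conjI disjI1) (auto intro: finite_PiE)
  define Il where "Il k = (SOME l. distinct l \<and> set l = I k)" for k
  have Il: "distinct (Il k) \<and> set (Il k) = I k" for k
    unfolding Il_def by (rule someI_ex) (use finite_distinct_list[OF finI] in metis)
  define S where "S k = map (\<lambda>\<iota>. (1::complex, \<lambda>b. A b \<inter> cell k (\<iota> b))) (Il k)" for k
  have dS: "disjoint_list (S k)" for k
    unfolding disjoint_list_def
  proof (clarify, intro conjI ballI)
    fix c A' assume "(c, A') \<in> set (S k)"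
    then obtain \<iota> where i: "\<iota> \<in> I k" "A' = (\<lambda>b. A b \<inter> cell k (\<iota> b))" using Il[of k] unfolding S_def by auto
    show "A' b \<in> bounded_borel" if "b \<in> ?B" for b
      unfolding i(2) by (intro bounded_borel_Int A that) simp
    show "disjoint_family_on A' ?B"
      using i unfolding disjoint_family_on_def I_def by (auto simp: cell_def inj_on_def)
  qed
  \<comment> \<open>At most one assignment contributes at a given point, namely the one that records
    the slice of each coordinate; it is admissible exactly when it is injective.\<close>
  have eS: "elem_fun (S k) z = (if inj_on (\<lambda>b. fl k (coord b z)) ?B then ?T z else 0)" for k z
  proof (cases "\<forall>b\<in>?B. coord b z \<in> A b")
    case True
    define \<iota>0 where "\<iota>0 = restrict (\<lambda>b. fl k (coord b z)) ?B"
    have "elem_fun (S k) z = (\<Sum>\<iota>\<in>I k. tensor (\<lambda>b. indicator (A b \<inter> cell k (\<iota> b))) z)"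
      unfolding elem_fun_def S_def using Il[of k] by (simp add: o_def sum_list_distinct_conv_sum_set)
    also have "\<dots> = (\<Sum>\<iota>\<in>I k. if \<iota> = \<iota>0 then 1 else 0)"
    proof (intro sum.cong refl)
      fix \<iota> assume \<iota>: "\<iota> \<in> I k"
      show "tensor (\<lambda>b. indicator (A b \<inter> cell k (\<iota> b))) z = (if \<iota> = \<iota>0 then 1 else (0::complex))"
      proof (cases "\<iota> = \<iota>0")
        case True
        then show ?thesis using \<open>\<forall>b\<in>?B. coord b z \<in> A b\<close>
          by (auto simp: tensor_def \<iota>0_def cell_def intro!: prod.neutral)
      next
        case False
        moreover have "\<iota> \<in> extensional ?B" "\<iota>0 \<in> extensional ?B"
          using \<iota> unfolding \<iota>0_def I_def by (auto simp: PiE_def)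
        ultimately have "\<not> (\<forall>b\<in>?B. \<iota> b = \<iota>0 b)" using extensionalityI by blast
        then obtain b where "b \<in> ?B" "\<iota> b \<noteq> fl k (coord b z)"
          unfolding \<iota>0_def by auto
        then show ?thesis using False
          by (auto simp: tensor_def cell_def intro!: prod_zero bexI[of _ b])
      qed
    qed
    also have "\<dots> = (if \<iota>0 \<in> I k then 1 else 0)" using finI by simp
    also have "\<iota>0 \<in> I k \<longleftrightarrow> inj_on (\<lambda>b. fl k (coord b z)) ?B"
      using True flN unfolding I_def \<iota>0_def by (auto simp: inj_on_def)
    also have "1 = ?T z" using True by (auto simp: tensor_def)
    finally show ?thesis by simp
  next
    case False
    then obtain b where b: "b \<in> ?B" "coord b z \<notin> A b" by blast
    have "tensor (\<lambda>b. indicator (A b \<inter> C b)) z = (0::complex)" for C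
      using b by (auto simp: tensor_def intro!: prod_zero bexI[of _ b])
    from this[of "\<lambda>_. UNIV"] this show ?thesis
      unfolding elem_fun_def S_def by (simp add: o_def)
  qed
  have T1: "?T z = elem_fun [(1, A)] z" "(\<Prod>b\<in>?B. W (A b) \<omega>) = elem_int [(1, A)] \<omega>" for z \<omega>
    by (simp_all add: elem_fun_def elem_int_def)
  have bT: "borel_list [(1, A)]" using A by (simp add: borel_list_def)
  have fT: "L2d leb_plus ?T (\<lambda>_. 0) < \<infinity>"
  proof -
    have "(norm (?T z))\<^sup>2 = norm (?T z)" for z
    proof -
      have "?T z = 0 \<or> ?T z = 1"
      proof (cases "\<forall>b\<in>?B. coord b z \<in> A b")
        case True
        then show ?thesis unfolding tensor_def by (auto intro!: prod.neutral)
      next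
        case False
        then obtain b where "b \<in> ?B" "coord b z \<notin> A b" by blast
        then have "?T z = 0" unfolding tensor_def by (intro prod_zero bexI[of _ b]) auto
        then show ?thesis ..
      qed
      then show ?thesis by auto
    qed
    then show ?thesis
      using tensor_indicator_integral(1)[of A, OF A] unfolding L2d_def
      by (simp add: integrable_iff_bounded)
  qed
  have lim: "L2_tendsto leb_plus (\<lambda>k. elem_fun (S k)) ?T"
  proof (rule L2_tendsto_dominated[where w="\<lambda>z. norm (?T z)"])
    show "elem_fun (S k) \<in> borel_measurable leb_plus" for k
      by (intro measurable_leb_plus measurable_elem_fun disjoint_list_borel dS)
    show "?T \<in> borel_measurable leb_plus" "(\<lambda>z. norm (?T z)) \<in> borel_measurable leb_plus"
      by (auto intro!: measurable_leb_plus)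
    show "AE z in leb_plus. norm (elem_fun (S k) z) \<le> norm (?T z)" for k
      by (auto simp: eS)
    show "(\<integral>\<^sup>+ z. ennreal ((norm (?T z))\<^sup>2) \<partial>leb_plus) < \<infinity>" using fT by (simp add: L2d_def)
    show "AE z in leb_plus. (\<lambda>k. elem_fun (S k) z) \<longlonglongrightarrow> ?T z"
      using AE_distinct_coords AE_space[of leb_plus]
    proof eventually_elim
      case (elim z)
      have fz: "fst z \<bullet> b \<ge> 0" if "b \<in> ?B" for b
        using elim(2) that by (auto simp: space_leb_plus orthant_def)
      have "\<forall>\<^sub>F k in sequentially. fl k (coord b z) \<noteq> fl k (coord c z)" if "b \<in> ?B" "c \<in> ?B" "b \<noteq> c" for b c
      proof -
        let ?d = "\<bar>fst z \<bullet> b - fst z \<bullet> c\<bar>"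
        have d: "?d > 0" using elim(1) that by (auto simp: inj_on_def)
        \<comment> \<open>Equal floors force a difference below 1, which is impossible once (k + 1)
          d exceeds 1.\<close>
        then obtain k0 where k0: "1 / ?d < real k0" using reals_Archimedean2 by blast
        have "fl k (coord b z) \<noteq> fl k (coord c z)" if "k \<ge> k0" for k
        proof
          assume eq: "fl k (coord b z) = fl k (coord c z)"
          have "\<lfloor>real (Suc k) * (fst z \<bullet> b)\<rfloor> = \<lfloor>real (Suc k) * (fst z \<bullet> c)\<rfloor>"
            using eq fz[OF \<open>b \<in> ?B\<close>] fz[OF \<open>c \<in> ?B\<close>]
            unfolding fl_def coord_def by (simp del: of_nat_Suc add: eq_nat_nat_iff)
          moreover have "\<lfloor>x\<rfloor> = \<lfloor>y\<rfloor> \<Longrightarrow> \<bar>x - y\<bar> < 1" for x y :: real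
            using floor_correct[of x] floor_correct[of y] by linarith
          ultimately have "\<bar>real (Suc k) * (fst z \<bullet> b) - real (Suc k) * (fst z \<bullet> c)\<bar> < 1" by blast
          then have "real (Suc k) * ?d < 1"
            unfolding right_diff_distrib[symmetric] abs_mult by (simp del: of_nat_Suc)
          moreover have "1 < real k0 * ?d" using k0 d by (simp add: field_simps)
          moreover have "real k0 * ?d \<le> real (Suc k) * ?d" using that by (intro mult_right_mono) auto
          ultimately show False by linarith
        qed
        then show ?thesis unfolding eventually_sequentially by blast
      qed
      then have "\<forall>\<^sub>F k in sequentially. b \<noteq> c \<longrightarrow> fl k (coord b z) \<noteq> fl k (coord c z)" if "b \<in> ?B" "c \<in> ?B" for b c
        using that by (cases "b = c") auto
      then have "\<forall>\<^sub>F k in sequentially. \<forall>b\<in>?B. \<forall>c\<in>?B. b \<noteq> c \<longrightarrow> fl k (coord b z) \<noteq> fl k (coord c z)"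
        by (intro eventually_ball_finite ballI finite_Basis)
      then have "\<forall>\<^sub>F k in sequentially. ?T z = elem_fun (S k) z"
        by eventually_elim (auto simp: eS inj_on_def)
      then show ?case by (rule Lim_transform_eventually[OF tendsto_const])
    qed
  qed
  \<comment> \<open>The limit list \<open>[(1, A)]\<close> need not be disjoint; the bound applies
    because it asks only for \<open>borel_list\<close>.\<close>
  have limM: "L2_tendsto M (\<lambda>k. elem_int (S k)) (elem_int [(1, A)])"
    unfolding L2_tendsto_L2d
  proof (rule tendsto_sandwich[OF _ _ tendsto_const])
    have "(\<lambda>k. ennreal (fact DIM('a)) * L2d leb_plus (elem_fun (S k)) ?T) \<longlonglongrightarrow> ennreal (fact DIM('a)) * 0"
      using lim unfolding L2_tendsto_L2d by (intro ennreal_tendsto_cmult) auto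
    then show "(\<lambda>k. ennreal (fact DIM('a)) * L2d leb_plus (elem_fun (S k)) (elem_fun [(1, A)])) \<longlonglongrightarrow> 0"
      by (simp add: T1(1)[abs_def])
    show "\<forall>\<^sub>F k in sequentially. L2d M (elem_int (S k)) (elem_int [(1, A)])
        \<le> ennreal (fact DIM('a)) * L2d leb_plus (elem_fun (S k)) (elem_fun [(1, A)])"
      by (intro always_eventually allI elem_int_bound disjoint_list_borel dS bT)
  qed simp
  have "mint ?T (elem_int [(1, A)])"
    by (rule mint_listsI[OF _ dS lim limM]) (intro fin_mom_measurable fin_mom_elem_int bT)
  then show ?thesis by (simp add: T1(2)[abs_def])
qed

lemma mint_indicator_real:
  assumes "A \<in> bounded_borel"
  shows "mint (indicator A) (W A)"
  using mint_tensor_indicator[of "\<lambda>_::real. A"] assms by (simp add: tensor_real[abs_def])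

lemma L2d_indicator_less_top:
  assumes "A \<in> bounded_borel"
  shows "L2d leb_plus (indicator A :: _ \<Rightarrow> complex) (\<lambda>_. 0) < \<infinity>"
proof -
  have "L2d leb_plus (indicator A :: _ \<Rightarrow> complex) (\<lambda>_. 0) = (\<integral>\<^sup>+z. indicator A z \<partial>leb_plus)"
    unfolding L2d_def by (intro nn_integral_cong) (auto simp: indicator_def)
  then show ?thesis using emeasure_leb_plus_bounded_borel[OF assms] by simp
qed

text \<open>Factors are freed from being indicators one at a time. Multiplying an L2 limit by the
  other factors does not by itself give an L2 limit; completeness supplies a limit of the products,
  and a subsequence identifies it with the product of the limits almost surely.\<close>

lemma mint_tensor:
  fixes h :: "'a::euclidean_space \<Rightarrow> real \<times> real \<Rightarrow> complex"
  assumes "\<And>b. b \<in> Basis \<Longrightarrow> mint (h b) (X b)" "\<And>b. b \<in> Basis \<Longrightarrow> h b \<in> borel_measurable borel"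
    "\<And>b. b \<in> Basis \<Longrightarrow> L2d leb_plus (h b) (\<lambda>_. 0) < \<infinity>"
  shows "mint (tensor h) (\<lambda>\<omega>. \<Prod>b\<in>Basis. X b \<omega>)"
proof -
  let ?B = "Basis :: 'a set"
  \<comment> \<open>Generalized for induction: \<open>D\<close> holds the coordinates with arbitrary
    factors, all others carry indicators.\<close>
  have "mint (tensor h) (\<lambda>\<omega>. \<Prod>b\<in>Basis. X b \<omega>)"
    if "finite D" "D \<subseteq> ?B" "\<And>b. b \<in> ?B \<Longrightarrow> mint (h b) (X b)" "\<And>b. b \<in> ?B \<Longrightarrow> h b \<in> borel_measurable borel"
      "\<And>b. b \<in> ?B \<Longrightarrow> L2d leb_plus (h b) (\<lambda>_. 0) < \<infinity>"
      "\<And>b. b \<in> ?B - D \<Longrightarrow> \<exists>A\<in>bounded_borel. h b = indicator A \<and> X b = W A" for D h X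
    using that
  proof (induction D arbitrary: h X)
    case empty
    have "\<forall>b\<in>?B. \<exists>A. A \<in> bounded_borel \<and> h b = indicator A \<and> X b = W A"
      using empty.prems(5) by blast
    from bchoice[OF this] obtain A where A: "\<forall>b\<in>?B. A b \<in> bounded_borel \<and> h b = indicator (A b) \<and> X b = W (A b)"
      by blast
    have "mint (tensor (\<lambda>b. indicator (A b))) (\<lambda>\<omega>. \<Prod>b\<in>?B. W (A b) \<omega>)"
      using A by (intro mint_tensor_indicator) auto
    also have "tensor (\<lambda>b. indicator (A b)) = tensor h"
      unfolding tensor_def using A by (intro ext prod.cong) auto
    also have "(\<lambda>\<omega>. \<Prod>b\<in>?B. W (A b) \<omega>) = (\<lambda>\<omega>. \<Prod>b\<in>?B. X b \<omega>)"
      using A by (intro ext prod.cong) auto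
    finally show ?case .
  next
    case (insert d D)
    have d: "d \<in> ?B" using insert.prems by auto
    note [measurable] = insert.prems(3)
    obtain S where S: "\<And>k. disjoint_list (S k)" "L2_tendsto leb_plus (\<lambda>k. elem_fun (S k)) (h d)"
      "L2_tendsto M (\<lambda>k. elem_int (S k)) (X d)" using mint_lists[OF insert.prems(2)[OF d]] by blast
    let ?R = "\<lambda>\<omega>. \<Prod>b\<in>?B - {d}. X b \<omega>"
    have meas: "tensor (h(d := u)) \<in> borel_measurable leb_plus" if "u \<in> borel_measurable borel" for u
      using that by (intro measurable_leb_plus measurable_tensor) auto
    have Sm: "elem_fun (S k) \<in> borel_measurable borel" for k
      by (intro measurable_elem_fun disjoint_list_borel S)
    have Xm: "X b \<in> borel_measurable M" if "b \<in> ?B" for b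
      using mint_measurable[OF insert.prems(2)[OF that]] .
    have Ym: "elem_int (S k) \<in> borel_measurable M" for k
      by (intro fin_mom_measurable fin_mom_elem_int disjoint_list_borel S)
    have one: "mint (tensor (h(d := indicator A))) (\<lambda>\<omega>. W A \<omega> * ?R \<omega>)" if A: "A \<in> bounded_borel" for A
    proof -
      have "mint (tensor (h(d := indicator A))) (\<lambda>\<omega>. \<Prod>b\<in>?B. (X(d := W A)) b \<omega>)"
      proof (rule insert.IH)
        show "D \<subseteq> ?B" using insert.prems by auto
        show "mint ((h(d := indicator A)) b) ((X(d := W A)) b)" if "b \<in> ?B" for b
          using insert.prems(2)[OF that] mint_indicator_real[OF A] by simp
        show "(h(d := indicator A)) b \<in> borel_measurable borel" if "b \<in> ?B" for b
          using insert.prems(3)[OF that] bounded_borelD(1)[OF A] by simp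
        show "L2d leb_plus ((h(d := indicator A)) b) (\<lambda>_. 0) < \<infinity>" if "b \<in> ?B" for b
          using insert.prems(4)[OF that] L2d_indicator_less_top[OF A] by simp
        show "\<exists>A'\<in>bounded_borel. (h(d := indicator A)) b = indicator A' \<and> (X(d := W A)) b = W A'" if "b \<in> ?B - D" for b
          using insert.prems(5)[of b] that A by (cases "b = d") auto
      qed
      also have "(\<lambda>\<omega>. \<Prod>b\<in>?B. (X(d := W A)) b \<omega>) = (\<lambda>\<omega>. W A \<omega> * ?R \<omega>)"
        by (subst prod.remove[OF _ d]) auto
      finally show ?thesis .
    qed
    \<comment> \<open>The tensor is linear in its d-th slot, so the case of an indicator extends to
      elementary functions in that slot.\<close>
    have step: "mint (tensor (h(d := elem_fun (S k)))) (\<lambda>\<omega>. elem_int (S k) \<omega> * ?R \<omega>)" for k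
    proof -
      have Ab: "snd x 1 \<in> bounded_borel" if "x \<in> set (S k)" for x
        using S(1)[of k] that unfolding disjoint_list_def by auto
      have "mint (\<lambda>z. \<Sum>x\<leftarrow>S k. fst x * tensor (h(d := indicator (snd x 1))) z)
         (\<lambda>\<omega>. \<Sum>x\<leftarrow>S k. fst x * (W (snd x 1) \<omega> * ?R \<omega>))"
        using Ab bounded_borelD(1)[OF Ab]
        by (intro mint_sum_list mint_scale one borel_measurable_times meas) auto
      also have "(\<lambda>z. \<Sum>x\<leftarrow>S k. fst x * tensor (h(d := indicator (snd x 1))) z) = tensor (h(d := elem_fun (S k)))"
        unfolding tensor_fun_upd[OF d, abs_def] elem_fun_def
        by (simp add: fun_eq_iff tensor_real split_beta sum_list_mult_const[symmetric] mult.assoc)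
      also have "(\<lambda>\<omega>. \<Sum>x\<leftarrow>S k. fst x * (W (snd x 1) \<omega> * ?R \<omega>)) = (\<lambda>\<omega>. elem_int (S k) \<omega> * ?R \<omega>)"
        unfolding elem_int_def
        by (simp add: fun_eq_iff split_beta sum_list_mult_const[symmetric] mult.assoc)
      finally show ?thesis .
    qed
    have lim: "L2_tendsto leb_plus (\<lambda>k. tensor (h(d := elem_fun (S k)))) (tensor h)"
      by (rule L2_tendsto_tensor_fun_upd[of d h "\<lambda>k. elem_fun (S k)", OF d insert.prems(3) Sm insert.prems(4) S(2)])
    have ht: "tensor h \<in> borel_measurable leb_plus" by (intro measurable_leb_plus measurable_tensor insert.prems)
    obtain Z r where Z: "mint (tensor h) Z" and r: "strict_mono r"
      "AE \<omega> in M. (\<lambda>k. elem_int (S (r k)) \<omega> * ?R \<omega>) \<longlonglongrightarrow> Z \<omega>"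
      using mint_complete[of "\<lambda>k. tensor (h(d := elem_fun (S k)))" "\<lambda>k \<omega>. elem_int (S k) \<omega> * ?R \<omega>" "tensor h" thesis,
        OF step meas[OF Sm] ht lim] by blast
    \<comment> \<open>A second subsequence inside the first: along it both \<open>Z\<close> and
      \<open>X d\<close> are pointwise limits.\<close>
    have "L2_tendsto M (\<lambda>k. elem_int (S (r k))) (X d)"
      using LIMSEQ_subseq_LIMSEQ[OF S(3)[unfolded L2_tendsto_L2d] r(1)]
      unfolding L2_tendsto_L2d o_def .
    then obtain r' where r': "strict_mono r'" "AE \<omega> in M. (\<lambda>k. elem_int (S (r (r' k))) \<omega>) \<longlonglongrightarrow> X d \<omega>"
      by (rule L2_tendsto_AE_subseq[OF prob_space_axioms Ym Xm[OF d]])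
    have "AE \<omega> in M. Z \<omega> = (\<Prod>b\<in>?B. X b \<omega>)"
      using r(2) r'(2)
    proof eventually_elim
      case (elim \<omega>)
      have "(\<lambda>k. elem_int (S (r (r' k))) \<omega> * ?R \<omega>) \<longlonglongrightarrow> Z \<omega>"
        using LIMSEQ_subseq_LIMSEQ[OF elim(1) r'(1)] by (simp add: o_def)
      moreover have "(\<lambda>k. elem_int (S (r (r' k))) \<omega> * ?R \<omega>) \<longlonglongrightarrow> X d \<omega> * ?R \<omega>"
        by (intro tendsto_mult elim(2) tendsto_const)
      ultimately have "Z \<omega> = X d \<omega> * ?R \<omega>" by (rule LIMSEQ_unique)
      then show ?case by (subst prod.remove[OF _ d]) auto
    qed
    then show ?case
      using Xm by (intro mint_cong_AE[OF Z]) auto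
  qed
  from this[of ?B h X] assms show ?thesis by auto
qed

section \<open>The Wiener integral of order one\<close>

definition real_step :: "(real \<times> (real \<times> real) set) list \<Rightarrow> real \<times> real \<Rightarrow> real" where
  "real_step L z = (\<Sum>(c, A)\<leftarrow>L. c * indicator A z)"

definition real_int :: "((real \<times> real) set \<Rightarrow> 'w \<Rightarrow> real) \<Rightarrow> (real \<times> (real \<times> real) set) list \<Rightarrow> 'w \<Rightarrow> real" where
  "real_int V L \<omega> = (\<Sum>(c, A)\<leftarrow>L. c * V A \<omega>)"

text \<open>Real step functions become integrands of order one, so the bound for
  \<open>elem_int\<close> can be reused for each half of the measure.\<close>

definition complexify :: "(real \<times> (real \<times> real) set) list \<Rightarrow> (complex \<times> (real \<Rightarrow> (real \<times> real) set)) list" where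
  "complexify L = map (\<lambda>(c, A). (of_real c, \<lambda>_. A)) L"

lemma elem_complexify:
  "elem_fun (complexify L) z = of_real (real_step L z)"
  "elem_int (complexify L) \<omega> = of_real (real_int W1 L \<omega>) + \<i> * of_real (real_int W2 L \<omega>)"
proof -
  show "elem_fun (complexify L) z = of_real (real_step L z)"
    unfolding elem_fun_def complexify_def real_step_def
    by (induction L) (auto simp: tensor_real indicator_def)
  show "elem_int (complexify L) \<omega> = of_real (real_int W1 L \<omega>) + \<i> * of_real (real_int W2 L \<omega>)"
    unfolding elem_int_def complexify_def real_int_def
    by (induction L) (auto simp: W_def complex_eq_iff)
qed

lemma borel_list_complexify:
  "\<forall>(c, A)\<in>set L. A \<in> bounded_borel \<Longrightarrow> borel_list (complexify L)"
  by (auto simp: borel_list_def complexify_def)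

lemma real_graph:
  assumes V: "V = W1 \<or> V = W2" and L: "\<forall>(c, A)\<in>set L. A \<in> bounded_borel"
  shows "real_step L \<in> borel_measurable leb_plus" "real_int V L \<in> borel_measurable M"
proof -
  have "(\<lambda>z. \<Sum>x\<leftarrow>L. fst x * indicator (snd x) z) \<in> borel_measurable borel"
    using L bounded_borelD(1)
    by (intro measurable_sum_list borel_measurable_times borel_measurable_const borel_measurable_indicator) auto
  then show "real_step L \<in> borel_measurable leb_plus"
    unfolding real_step_def[abs_def] split_beta by (rule measurable_leb_plus)
  have "(\<lambda>\<omega>. \<Sum>x\<leftarrow>L. fst x * V (snd x) \<omega>) \<in> borel_measurable M"
    using L half_single[OF V] unfolding centered_gaussian_def
    by (intro measurable_sum_list borel_measurable_times borel_measurable_const) auto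
  then show "real_int V L \<in> borel_measurable M"
    unfolding real_int_def[abs_def] split_beta .
qed

text \<open>The integrals against \<open>W1\<close> and \<open>W2\<close> are the real and imaginary
  parts of one complex elementary integral, and the constant 1! of its bound is 1.\<close>

lemma real_int_bound:
  assumes V: "V = W1 \<or> V = W2" and L: "\<forall>(c, A)\<in>set L. A \<in> bounded_borel" "\<forall>(c, A)\<in>set L'. A \<in> bounded_borel"
  shows "L2d M (real_int V L) (real_int V L') \<le> ennreal 1 * L2d leb_plus (real_step L) (real_step L')"
proof -
  have "L2d M (real_int V L) (real_int V L') \<le> L2d M (elem_int (complexify L)) (elem_int (complexify L'))"
    unfolding L2d_def
  proof (intro nn_integral_mono ennreal_leI power_mono)
    fix \<omega>
    let ?D = "elem_int (complexify L) \<omega> - elem_int (complexify L') \<omega>"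
    have "Re ?D = real_int W1 L \<omega> - real_int W1 L' \<omega>" "Im ?D = real_int W2 L \<omega> - real_int W2 L' \<omega>"
      by (simp_all add: elem_complexify)
    then show "norm (real_int V L \<omega> - real_int V L' \<omega>) \<le> norm ?D"
      using V abs_Re_le_cmod[of ?D] abs_Im_le_cmod[of ?D] by auto
  qed simp
  also have "\<dots> \<le> ennreal (fact DIM(real)) * L2d leb_plus (elem_fun (complexify L)) (elem_fun (complexify L'))"
    by (intro elem_int_bound borel_list_complexify L)
  also have "\<dots> = ennreal 1 * L2d leb_plus (real_step L) (real_step L')"
    by (simp add: elem_complexify[abs_def] L2d_of_real)
  finally show ?thesis .
qed

text \<open>The chosen version comes with some unknown approximating sequence; by uniqueness it is
  also the limit along any prescribed one. This lets both halves of the measure share their step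
  functions.\<close>

lemma gauss_int_limit:
  assumes V: "V = W1 \<or> V = W2" and g: "g \<in> borel_measurable borel"
    and S: "\<And>k. \<forall>(c, A)\<in>set (S k). A \<in> bounded_borel" "L2_tendsto leb_plus (\<lambda>k. real_step (S k)) g"
  shows "gauss_int M V g \<in> borel_measurable M" "L2_tendsto M (\<lambda>k. real_int V (S k)) (gauss_int M V g)"
proof -
  let ?E = "{(real_step L, real_int V L) |L. \<forall>(c, A)\<in>set L. A \<in> bounded_borel}"
  have E: "F \<in> borel_measurable leb_plus \<and> Y \<in> borel_measurable M" if "(F, Y) \<in> ?E" for F Y
    using that real_graph[OF V] by auto
  have bound: "L2d M Y Y' \<le> ennreal 1 * L2d leb_plus F F'" if "(F, Y) \<in> ?E" "(F', Y') \<in> ?E" for F Y F' Y'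
    using that real_int_bound[OF V] by auto
  have gm: "g \<in> borel_measurable leb_plus" by (rule measurable_leb_plus[OF g])
  have is_iff: "is_gauss_int M V g X \<longleftrightarrow> (\<exists>S. X \<in> borel_measurable M \<and> (\<forall>k. \<forall>(c, A)\<in>set (S k). A \<in> bounded_borel) \<and>
      L2_tendsto leb_plus (\<lambda>k. real_step (S k)) g \<and> L2_tendsto M (\<lambda>k. real_int V (S k)) X)" for X
    unfolding is_gauss_int_def real_step_def[abs_def] real_int_def[abs_def] by blast
  have SE: "(real_step (S k), real_int V (S k)) \<in> graph_closure leb_plus M ?E" for k
    using S(1)[of k] real_graph[OF V S(1)[of k]] by (intro graph_closure_incl) auto
  obtain Z where Z: "(g, Z) \<in> graph_closure leb_plus M ?E" "L2_tendsto M (\<lambda>k. real_int V (S k)) Z"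
    using graph_closure_complete[of ?E leb_plus 1 "\<lambda>k. real_step (S k)" "\<lambda>k. real_int V (S k)" g thesis,
        OF E bound zero_less_one SE real_graph(1)[OF V S(1)] gm S(2)] by blast
  have Zm: "Z \<in> borel_measurable M" using Z(1) by (simp add: graph_closure_iff)
  have "is_gauss_int M V g Z" unfolding is_iff using S Z Zm by blast
  then have G: "is_gauss_int M V g (gauss_int M V g)"
    unfolding gauss_int_def by (rule someI[of "is_gauss_int M V g"])
  then show Gm: "gauss_int M V g \<in> borel_measurable M" by (simp add: is_gauss_int_def)
  obtain T where T: "\<forall>k. \<forall>(c, A)\<in>set (T k). A \<in> bounded_borel"
      "L2_tendsto leb_plus (\<lambda>k. real_step (T k)) g" "L2_tendsto M (\<lambda>k. real_int V (T k)) (gauss_int M V g)"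
    using G unfolding is_iff by blast
  have "(g, gauss_int M V g) \<in> graph_closure leb_plus M ?E"
  proof (rule graph_closure_closed[OF E _ _ gm Gm T(2,3)])
    show "real_step (T k) \<in> borel_measurable leb_plus" for k
      using real_graph(1)[OF V] T(1) by blast
    show "(real_step (T k), real_int V (T k)) \<in> graph_closure leb_plus M ?E" for k
      using spec[OF T(1), of k] real_graph[OF V spec[OF T(1), of k]] by (intro graph_closure_incl) auto
  qed
  note gG = this
  have "AE \<omega> in M. Z \<omega> = gauss_int M V g \<omega>"
    by (rule graph_closure_unique[OF E bound Z(1) gG gm])
  then have "L2d M (real_int V (S k)) Z = L2d M (real_int V (S k)) (gauss_int M V g)" for k
    by (intro L2d_cong_AE) auto
  then show "L2_tendsto M (\<lambda>k. real_int V (S k)) (gauss_int M V g)"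
    using Z(2) unfolding L2_tendsto_L2d by simp
qed

lemma L2_tendsto_of_real:
  "L2_tendsto N F g \<Longrightarrow> L2_tendsto N (\<lambda>k z. complex_of_real (F k z)) (\<lambda>z. complex_of_real (g z))"
  unfolding L2_tendsto_L2d L2d_of_real .

text \<open>Approximate Re g and Im g by real step functions and use the same sequences for
  \<open>W1\<close> and \<open>W2\<close>; the elementary integrals then combine complex
  linearly.\<close>

lemma mint_complex_gauss_int:
  assumes g[measurable]: "g \<in> borel_measurable borel" and fin: "L2d leb_plus g (\<lambda>_. 0) < \<infinity>"
  shows "mint g (complex_gauss_int M W1 W2 g)"
proof -
  have [measurable]: "(\<lambda>z. Re (g z)) \<in> borel_measurable borel" "(\<lambda>z. Im (g z)) \<in> borel_measurable borel"
    by measurable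
  have "L2d leb_plus (\<lambda>z. Re (g z)) (\<lambda>_. 0) \<le> L2d leb_plus g (\<lambda>_. 0)"
    "L2d leb_plus (\<lambda>z. Im (g z)) (\<lambda>_. 0) \<le> L2d leb_plus g (\<lambda>_. 0)"
    unfolding L2d_def
    by (auto intro!: nn_integral_mono ennreal_leI simp: abs_square_le_1 cmod_power2)
  then have "L2d leb_plus (\<lambda>z. Re (g z)) (\<lambda>_. 0) < \<infinity>" "L2d leb_plus (\<lambda>z. Im (g z)) (\<lambda>_. 0) < \<infinity>"
    using fin by (auto elim: le_less_trans)
  then obtain S T where S: "\<And>k. \<forall>(c, A)\<in>set (S k). A \<in> bounded_borel" "L2_tendsto leb_plus (\<lambda>k. real_step (S k)) (\<lambda>z. Re (g z))"
    and T: "\<And>k. \<forall>(c, A)\<in>set (T k). A \<in> bounded_borel" "L2_tendsto leb_plus (\<lambda>k. real_step (T k)) (\<lambda>z. Im (g z))"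
    using L2_dense_step_functions[of "\<lambda>z. Re (g z)"] L2_dense_step_functions[of "\<lambda>z. Im (g z)"]
    unfolding real_step_def by auto
  have v: "W1 = W1 \<or> W1 = W2" "W2 = W1 \<or> W2 = W2" by auto
  note GS = gauss_int_limit[OF v(1) _ S] gauss_int_limit[OF v(2) _ S]
  note GT = gauss_int_limit[OF v(1) _ T] gauss_int_limit[OF v(2) _ T]
  note [measurable] = GS(1,3) GT(1,3) real_graph(1)[OF v(1) S(1)] real_graph(1)[OF v(1) T(1)]
    real_graph(2)[OF v(1) S(1)] real_graph(2)[OF v(1) T(1)] real_graph(2)[OF v(2) S(1)] real_graph(2)[OF v(2) T(1)]
  define L where "L k = complexify (S k) @ scale_list \<i> (complexify (T k))" for k
  \<comment> \<open>Regrouped by real and imaginary part of the integrand instead of by half of the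
    measure, to match the shape of \<open>L\<close>.\<close>
  have cg: "complex_gauss_int M W1 W2 g = (\<lambda>\<omega>. (of_real (gauss_int M W1 (\<lambda>z. Re (g z)) \<omega>) + \<i> * of_real (gauss_int M W2 (\<lambda>z. Re (g z)) \<omega>))
      + \<i> * (of_real (gauss_int M W1 (\<lambda>z. Im (g z)) \<omega>) + \<i> * of_real (gauss_int M W2 (\<lambda>z. Im (g z)) \<omega>)))"
    by (simp add: fun_eq_iff complex_gauss_int_def gauss_int_c_def algebra_simps)
  show ?thesis
  proof (rule mint_listsI[of _ L])
    show "complex_gauss_int M W1 W2 g \<in> borel_measurable M" unfolding cg by measurable
    show "disjoint_list (L k)" for k
      unfolding L_def by (simp add: disjoint_list_append disjoint_list_scale disjoint_list_real borel_list_complexify S T)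
    have "L2_tendsto leb_plus (\<lambda>k z. complex_of_real (real_step (S k) z) + \<i> * complex_of_real (real_step (T k) z))
       (\<lambda>z. complex_of_real (Re (g z)) + \<i> * complex_of_real (Im (g z)))"
      by (intro L2_tendsto_add L2_tendsto_scale L2_tendsto_of_real S T; measurable)
    also have "(\<lambda>z. complex_of_real (Re (g z)) + \<i> * complex_of_real (Im (g z))) = g"
      by (simp add: complex_eq[symmetric])
    finally show "L2_tendsto leb_plus (\<lambda>k. elem_fun (L k)) g"
      by (simp add: L_def elem_fun_append[abs_def] elem_fun_scale elem_complexify)
    have "L2_tendsto M (\<lambda>k \<omega>. (of_real (real_int W1 (S k) \<omega>) + \<i> * of_real (real_int W2 (S k) \<omega>))
        + \<i> * (of_real (real_int W1 (T k) \<omega>) + \<i> * of_real (real_int W2 (T k) \<omega>))) (complex_gauss_int M W1 W2 g)"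
      unfolding cg
      by (intro L2_tendsto_add L2_tendsto_scale L2_tendsto_of_real GS GT; measurable)
    then show "L2_tendsto M (\<lambda>k. elem_int (L k)) (complex_gauss_int M W1 W2 g)"
      by (simp add: L_def elem_int_append[abs_def] elem_int_scale elem_complexify)
  qed
qed

end

section \<open>Vanishing of the second moment\<close>

lemma hermite_zero: "hermite k 0 z = z ^ k"
proof -
  have "hermite k 0 z = (\<Sum>j\<le>k div 2. if j = 0 then z ^ k else 0)"
    unfolding hermite_def by (intro sum.cong) (auto simp: power_0_left)
  then show ?thesis by simp
qed

context gaussian_measure
begin

text \<open>The two halves have equal covariances, which enter the real part of the product with
  opposite signs, and the mixed terms vanish by independence.\<close>

lemma W_product_mean:
  assumes A: "A \<in> bounded_borel" and B: "B \<in> bounded_borel"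
  shows "expectation (\<lambda>\<omega>. W A \<omega> * W B \<omega>) = 0"
proof -
  have cross: "expectation (\<lambda>\<omega>. complex_of_real (W1 A \<omega>) * complex_of_real (W2 B \<omega>)) = 0"
    if A: "A \<in> bounded_borel" and B: "B \<in> bounded_borel" for A B
  proof -
    have cA: "centered_gaussian M (W1 A)" and cB: "centered_gaussian M (W2 B)"
      using half_single A B by auto
    have F: "finite {A, B}" "{A, B} \<subseteq> bounded_borel" using A B by auto
    have "indep_var borel (W1 A) borel (W2 B)"
    proof -
      have "(\<Sum>X\<in>{A, B}. (if X = A then 1 else 0) * W1 X \<omega>) = W1 A \<omega>"
         "(\<Sum>X\<in>{A, B}. (if X = B then 1 else 0) * W2 X \<omega>) = W2 B \<omega>" for \<omega>
        by (cases "A = B"; simp)+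
      then show ?thesis using indep_halves[OF F, of "\<lambda>X. if X = A then 1 else 0" "\<lambda>X. if X = B then 1 else 0"]
        by simp
    qed
    moreover have "integrable M (W1 A)" "integrable M (W2 B)"
      using centered_gaussian_moments(1)[OF cA, of 1] centered_gaussian_moments(1)[OF cB, of 1] by auto
    ultimately have "expectation (\<lambda>\<omega>. W1 A \<omega> * W2 B \<omega>) = 0"
      using indep_var_lebesgue_integral[of "W1 A" "W2 B"] centered_gaussian_moments(2)[OF cA] by simp
    then show ?thesis by (simp only: of_real_mult[symmetric] integral_complex_of_real of_real_0)
  qed
  have same: "expectation (\<lambda>\<omega>. complex_of_real (V A \<omega>) * complex_of_real (V B \<omega>)) = of_real (measure lborel (A \<inter> B) / 2)"
    if "V = W1 \<or> V = W2" for V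
    using half_cov[OF that A B] by (simp only: of_real_mult[symmetric] integral_complex_of_real)
  let ?p = "\<lambda>V A V' B \<omega>. complex_of_real (V A \<omega>) * complex_of_real (V' B \<omega>)"
  have i: "integrable M (?p V A V' B)" if "V = W1 \<or> V = W2" "V' = W1 \<or> V' = W2" "A \<in> bounded_borel" "B \<in> bounded_borel" for V V' A B
    using that by (intro fin_mom_integrable fin_mom_mult fin_mom_half)
  have "(\<lambda>\<omega>. W A \<omega> * W B \<omega>) = (\<lambda>\<omega>. (?p W1 A W1 B \<omega> - ?p W2 A W2 B \<omega>) + \<i> * (?p W1 A W2 B \<omega> + ?p W1 B W2 A \<omega>))"
    by (auto simp: W_def complex_eq_iff)
  then have "expectation (\<lambda>\<omega>. W A \<omega> * W B \<omega>)
     = (expectation (?p W1 A W1 B) - expectation (?p W2 A W2 B)) + \<i> * (expectation (?p W1 A W2 B) + expectation (?p W1 B W2 A))"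
    using A B by (simp add: i Bochner_Integration.integral_add Bochner_Integration.integral_diff)
  then show ?thesis using same[of W1] same[of W2] cross[OF A B] cross[OF B A] by simp
qed

lemma elem_int_square_mean:
  fixes L :: "(complex \<times> (real \<Rightarrow> (real \<times> real) set)) list"
  assumes "borel_list L"
  shows "expectation (\<lambda>\<omega>. (elem_int L \<omega>)\<^sup>2) = 0"
proof -
  have A: "snd x 1 \<in> bounded_borel" if "x \<in> set L" for x
    using assms that unfolding borel_list_def by auto
  have i: "integrable M (\<lambda>\<omega>. fst x * fst y * (W (snd x 1) \<omega> * W (snd y 1) \<omega>))" if "x \<in> set L" "y \<in> set L" for x y
    using A that by (intro fin_mom_integrable fin_mom_intros fin_mom_W) auto
  have "expectation (\<lambda>\<omega>. (elem_int L \<omega>)\<^sup>2)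
     = expectation (\<lambda>\<omega>. \<Sum>x\<leftarrow>L. \<Sum>y\<leftarrow>L. fst x * fst y * (W (snd x 1) \<omega> * W (snd y 1) \<omega>))"
    unfolding elem_int_def case_prod_beta' power2_eq_square sum_list_product by (simp add: mult_ac)
  also have "\<dots> = (\<Sum>x\<leftarrow>L. \<Sum>y\<leftarrow>L. fst x * fst y * expectation (\<lambda>\<omega>. W (snd x 1) \<omega> * W (snd y 1) \<omega>))"
    using i by (simp add: integral_sum_list cong: map_cong)
  also have "\<dots> = 0" using A by (simp add: W_product_mean cong: map_cong)
  finally show ?thesis .
qed

text \<open>The quadratic functional E[X^2] is continuous in L2, and it vanishes on elementary
  integrals.\<close>

lemma mint_square_mean:
  fixes h :: "real \<times> real \<Rightarrow> complex"
  assumes h: "mint h X" "h \<in> borel_measurable borel" "L2d leb_plus h (\<lambda>_. 0) < \<infinity>"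
  shows "expectation (\<lambda>\<omega>. (X \<omega>)\<^sup>2) = 0"
proof -
  note [measurable] = mint_measurable[OF h(1)]
  obtain S where S: "\<And>k. disjoint_list (S k)" "L2_tendsto leb_plus (\<lambda>k. elem_fun (S k)) h"
      "L2_tendsto M (\<lambda>k. elem_int (S k)) X" using mint_lists[OF h(1)] by blast
  have bS: "borel_list (S k)" for k by (rule disjoint_list_borel[OF S(1)])
  have Y[measurable]: "elem_int (S k) \<in> borel_measurable M" for k by (rule fin_mom_measurable[OF fin_mom_elem_int[OF bS]])
  have Xfin: "(\<integral>\<^sup>+\<omega>. ennreal ((norm (X \<omega>))\<^sup>2) \<partial>M) < \<infinity>"
  proof -
    have "L2d M X (\<lambda>_. 0) \<le> ennreal (16 * fact DIM(real)) * L2d leb_plus h (\<lambda>_. 0)"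
      using h by (intro mint_bound[OF h(1) mint_zero]) (auto intro: measurable_leb_plus)
    also have "\<dots> < \<infinity>" using h(3) by (simp add: ennreal_mult_less_top)
    finally show ?thesis by (simp add: L2d_def)
  qed
  have iX: "integrable M (\<lambda>\<omega>. (norm (X \<omega>))\<^sup>2)"
    using Xfin by (intro integrableI_bounded) auto
  have iX2: "integrable M (\<lambda>\<omega>. (X \<omega>)\<^sup>2)"
  proof -
    have "integrable M (\<lambda>\<omega>. norm ((X \<omega>)\<^sup>2))" using iX by (simp only: norm_power)
    then show ?thesis by (rule integrable_norm_cancel) measurable
  qed
  define vX where "vX = expectation (\<lambda>\<omega>. (norm (X \<omega>))\<^sup>2)"
  have vX0: "vX \<ge> 0" unfolding vX_def by simp
  \<comment> \<open>With D = Y - X, Young's inequality bounds |X^2 - Y^2| by (1 + 1/\<delta>)|D|^2 +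
    \<delta>|X|^2, and Y is chosen so close that the first term has mean at most \<delta>.\<close>
  have main: "norm (expectation (\<lambda>\<omega>. (X \<omega>)\<^sup>2)) \<le> \<delta> + \<delta> * vX" if d: "\<delta> > 0" for \<delta>
  proof -
    have "\<delta> / (1 + 1 / \<delta>) > 0" using d by (simp add: add_pos_pos)
    then obtain k where k: "L2d M (elem_int (S k)) X < ennreal (\<delta> / (1 + 1 / \<delta>))"
      using S(3) unfolding L2_tendsto_L2d ennreal_lim_0_iff by blast
    let ?Y = "elem_int (S k)"
    have fY: "fin_mom ?Y" by (rule fin_mom_elem_int[OF bS])
    have iD: "integrable M (\<lambda>\<omega>. (norm (?Y \<omega> - X \<omega>))\<^sup>2)"
    proof (rule integrableI_bounded)
      have "L2d M ?Y X < \<infinity>" using k by (rule less_trans) simp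
      then show "(\<integral>\<^sup>+\<omega>. ennreal (norm ((norm (?Y \<omega> - X \<omega>))\<^sup>2)) \<partial>M) < \<infinity>" by (simp add: L2d_def)
    qed measurable
    have D: "expectation (\<lambda>\<omega>. (norm (?Y \<omega> - X \<omega>))\<^sup>2) < \<delta> / (1 + 1 / \<delta>)"
    proof -
      have "L2d M ?Y X = ennreal (expectation (\<lambda>\<omega>. (norm (?Y \<omega> - X \<omega>))\<^sup>2))"
        unfolding L2d_def by (rule nn_integral_eq_integral[OF iD]) simp
      with k show ?thesis by (simp add: ennreal_less_iff)
    qed
    have iY: "integrable M (\<lambda>\<omega>. (?Y \<omega>)\<^sup>2)" by (intro fin_mom_integrable fin_mom_power fY)
    have "expectation (\<lambda>\<omega>. (X \<omega>)\<^sup>2) = expectation (\<lambda>\<omega>. (X \<omega>)\<^sup>2 - (?Y \<omega>)\<^sup>2)"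
      using iX2 iY elem_int_square_mean[OF bS[of k]] by simp
    also have "norm \<dots> \<le> expectation (\<lambda>\<omega>. (1 + 1 / \<delta>) * (norm (?Y \<omega> - X \<omega>))\<^sup>2 + \<delta> * (norm (X \<omega>))\<^sup>2)"
    proof (rule order_trans[OF integral_norm_bound integral_mono])
      show "integrable M (\<lambda>\<omega>. norm ((X \<omega>)\<^sup>2 - (?Y \<omega>)\<^sup>2))" using iX2 iY by auto
      show "integrable M (\<lambda>\<omega>. (1 + 1 / \<delta>) * (norm (?Y \<omega> - X \<omega>))\<^sup>2 + \<delta> * (norm (X \<omega>))\<^sup>2)"
        using iD iX by auto
      fix \<omega>
      let ?D = "?Y \<omega> - X \<omega>"
      have "(X \<omega>)\<^sup>2 - (?Y \<omega>)\<^sup>2 = - (?D * (?D + 2 * X \<omega>))" by (simp add: power2_eq_square algebra_simps)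
      then have "norm ((X \<omega>)\<^sup>2 - (?Y \<omega>)\<^sup>2) = norm ?D * norm (?D + 2 * X \<omega>)" by (simp add: norm_mult)
      also have "\<dots> \<le> norm ?D * (norm ?D + 2 * norm (X \<omega>))"
        by (intro mult_left_mono order_trans[OF norm_triangle_ineq]) (auto simp: norm_mult)
      also have "\<dots> = (norm ?D)\<^sup>2 + 2 * (norm ?D * norm (X \<omega>))" by (simp add: power2_eq_square algebra_simps)
      also have "2 * (norm ?D * norm (X \<omega>)) \<le> (1 / \<delta>) * (norm ?D)\<^sup>2 + \<delta> * (norm (X \<omega>))\<^sup>2"
      proof -
        have "0 \<le> (norm ?D - \<delta> * norm (X \<omega>))\<^sup>2 / \<delta>" using d by simp
        also have "\<dots> = (1 / \<delta>) * (norm ?D)\<^sup>2 + \<delta> * (norm (X \<omega>))\<^sup>2 - 2 * (norm ?D * norm (X \<omega>))"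
          unfolding power2_diff using d by (simp add: power2_eq_square diff_divide_distrib add_divide_distrib mult_ac)
        finally show ?thesis by simp
      qed
      finally show "norm ((X \<omega>)\<^sup>2 - (?Y \<omega>)\<^sup>2) \<le> (1 + 1 / \<delta>) * (norm ?D)\<^sup>2 + \<delta> * (norm (X \<omega>))\<^sup>2"
        by (simp add: distrib_right)
    qed
    also have "\<dots> = (1 + 1 / \<delta>) * expectation (\<lambda>\<omega>. (norm (?Y \<omega> - X \<omega>))\<^sup>2) + \<delta> * vX"
      using iD iX unfolding vX_def by simp
    also have "\<dots> \<le> (1 + 1 / \<delta>) * (\<delta> / (1 + 1 / \<delta>)) + \<delta> * vX"
      using D d by (intro add_right_mono mult_left_mono) auto
    also have "(1 + 1 / \<delta>) * (\<delta> / (1 + 1 / \<delta>)) = \<delta>"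
    proof -
      have "1 + 1 / \<delta> > 0" using d by (intro add_pos_pos) auto
      then show ?thesis by simp
    qed
    finally show ?thesis .
  qed
  have "norm (expectation (\<lambda>\<omega>. (X \<omega>)\<^sup>2)) \<le> 0"
  proof (rule field_le_epsilon)
    fix \<epsilon> :: real assume e: "\<epsilon> > 0"
    \<comment> \<open>This \<delta> turns the bound \<delta> + \<delta> \<open>vX\<close> into
      \<epsilon>.\<close>
    then have "\<epsilon> / (1 + vX) > 0" using vX0 by simp
    from main[OF this] have "norm (expectation (\<lambda>\<omega>. (X \<omega>)\<^sup>2)) \<le> \<epsilon> / (1 + vX) * (1 + vX)"
      by (simp add: distrib_left)
    then show "norm (expectation (\<lambda>\<omega>. (X \<omega>)\<^sup>2)) \<le> 0 + \<epsilon>" using vX0 by simp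
  qed
  then show ?thesis by simp
qed

lemma hermite_rv_mint:
  fixes h :: "real \<times> real \<Rightarrow> complex"
  assumes "mint h X" "h \<in> borel_measurable borel" "L2d leb_plus h (\<lambda>_. 0) < \<infinity>"
  shows "hermite_rv M k X \<omega> = X \<omega> ^ k"
  unfolding hermite_rv_def mint_square_mean[OF assms] hermite_zero ..

end

text \<open>Undoes the grouping of equal indices that the definition of I_n^H uses for its Hermite
  polynomials.\<close>

lemma prod_card_fibre:
  fixes Z :: "'j \<Rightarrow> 'c::comm_monoid_mult"
  assumes "finite B"
  shows "(\<Prod>j\<in>\<sigma> ` B. Z j ^ card {b \<in> B. \<sigma> b = j}) = (\<Prod>b\<in>B. Z (\<sigma> b))"
proof -
  have "(\<Prod>b\<in>B. Z (\<sigma> b)) = (\<Prod>j\<in>\<sigma> ` B. \<Prod>b\<in>{b \<in> B. \<sigma> b = j}. Z (\<sigma> b))"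
    by (rule prod.image_gen[OF assms])
  also have "\<dots> = (\<Prod>j\<in>\<sigma> ` B. Z j ^ card {b \<in> B. \<sigma> b = j})"
    by (intro prod.cong refl) simp
  finally show ?thesis by simp
qed

section \<open>From the spectral measure to Lebesgue measure\<close>

lemma c_H_pos:
  assumes "0 < H" "H < 1" shows "0 < c_H H"
  unfolding c_H_def
proof (intro divide_pos_pos mult_pos_pos)
  show "0 < Gamma (2 * H + 1)" using assms by (intro Gamma_real_pos) auto
  show "0 < sin (pi * H)" using assms by (intro sin_gt_zero) auto
qed auto

text \<open>The multiplier of \<open>f_hat\<close> as an operator on functions: the square root of
  the spectral density. It applies equally to transforms of step functions, test functions and
  tensors.\<close>

definition hat :: "real \<Rightarrow> ('a::euclidean_space \<times> 'a \<Rightarrow> complex) \<Rightarrow> 'a \<times> 'a \<Rightarrow> complex" where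
  "hat H u z = complex_of_real (c_H H powr (real DIM('a) / 2)) * u z *
     complex_of_real (\<Prod>b\<in>Basis. \<bar>snd z \<bullet> b\<bar> powr (1 / 2 - H))"

lemma f_hat_eq: "f_hat H f = hat H (space_ft f)"
  unfolding f_hat_def hat_def by (simp add: fun_eq_iff)

lemma measurable_hat [measurable]:
  fixes u :: "'a::euclidean_space \<times> 'a \<Rightarrow> complex"
  assumes [measurable]: "u \<in> borel_measurable borel"
  shows "hat H u \<in> borel_measurable borel"
proof -
  have "(\<lambda>z. \<Prod>b\<in>Basis. \<bar>snd (z :: 'a \<times> 'a) \<bullet> b\<bar> powr (1 / 2 - H)) \<in> borel_measurable borel"
    by (intro borel_measurable_prod) measurable
  then show ?thesis
    unfolding hat_def[abs_def] by (intro borel_measurable_times borel_measurable_of_real) auto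
qed

lemma hat_scale: "hat H (\<lambda>z. a * u z) z = a * hat H u z"
  by (simp add: hat_def)

lemma hat_sum_list: "hat H (\<lambda>z. \<Sum>x\<leftarrow>L. u x z) z = (\<Sum>x\<leftarrow>L. hat H (u x) z)"
  by (induction L) (auto simp: hat_def distrib_left distrib_right)

lemma hat_tensor: "hat H (tensor h) z = tensor (\<lambda>b. hat H (h b)) z"
  for z :: "'a::euclidean_space \<times> 'a"
proof -
  have "c_H H powr (real DIM('a) / 2) = (c_H H powr (1 / 2)) ^ DIM('a)"
  \<comment> \<open>If c_H = 0, both sides vanish because the dimension is positive.\<close>
  proof (cases "c_H H = 0")
    case False
    then show ?thesis by (simp add: powr_power)
  qed simp
  then show ?thesis
    by (simp add: hat_def tensor_def coord_def prod.distrib)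
qed

lemma hat_permute:
  assumes p: "p permutes (Basis :: 'a set)"
  shows "hat H (\<lambda>z. u (permute_pair p z)) z = hat H u (permute_pair p (z :: 'a::euclidean_space \<times> 'a))"
proof -
  have "(\<Prod>b\<in>Basis. \<bar>snd (permute_pair p z) \<bullet> b\<bar> powr (1 / 2 - H)) = (\<Prod>b\<in>Basis. \<bar>snd z \<bullet> p b\<bar> powr (1 / 2 - H))"
    by (intro prod.cong refl) (simp add: permute_pair_def permute_coords_inner)
  also have "\<dots> = (\<Prod>b\<in>Basis. \<bar>snd z \<bullet> b\<bar> powr (1 / 2 - H))"
    using prod.permute[OF p, of "\<lambda>b. \<bar>snd z \<bullet> b\<bar> powr (1 / 2 - H)"] by (simp add: o_def)
  finally show ?thesis by (simp add: hat_def)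
qed

lemma hat_symmetrize: "hat H (symmetrize u) z = symmetrize (hat H u) z"
  for z :: "'a::euclidean_space \<times> 'a"
proof -
  have "hat H (symmetrize u) z = (\<Sum>p | p permutes (Basis::'a set). 1 / fact DIM('a) * hat H (\<lambda>z. u (permute_pair p z)) z)"
    unfolding hat_def symmetrize_permute_pair sum_distrib_left sum_distrib_right by (simp add: mult_ac)
  also have "\<dots> = (\<Sum>p | p permutes (Basis::'a set). 1 / fact DIM('a) * hat H u (permute_pair p z))"
    by (intro sum.cong refl) (simp add: hat_permute)
  finally show ?thesis by (simp add: symmetrize_permute_pair)
qed

lemma measurable_symmetrize [measurable]:
  assumes [measurable]: "u \<in> borel_measurable borel"
  shows "symmetrize u \<in> borel_measurable (borel :: ('a::euclidean_space \<times> 'a) measure)"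
  unfolding symmetrize_permute_pair[abs_def] by measurable

lemma measurable_spectral [measurable (raw)]:
  fixes f :: "'a::euclidean_space \<times> 'a \<Rightarrow> 'c::topological_space"
  assumes "f \<in> borel_measurable borel"
  shows "f \<in> borel_measurable (spectral_measure H)"
proof -
  have "(\<lambda>z. (fst z, snd z)) \<in> measurable (spectral_measure H :: ('a \<times> 'a) measure) (borel \<Otimes>\<^sub>M borel)"
  proof (rule measurable_Pair)
    have "(\<lambda>t. t) \<in> measurable (restrict_space lborel orthant) (borel :: 'a measure)"
      by (intro measurable_restrict_space1) simp
    from measurable_compose[OF measurable_fst this]
    show "fst \<in> measurable (spectral_measure H :: ('a \<times> 'a) measure) borel" unfolding spectral_measure_def .
    have "(\<lambda>t. t) \<in> measurable (mu_H H) (borel :: 'a measure)" unfolding mu_H_def by simp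
    from measurable_compose[OF measurable_snd this]
    show "snd \<in> measurable (spectral_measure H :: ('a \<times> 'a) measure) borel" unfolding spectral_measure_def .
  qed
  then have "(\<lambda>z. z) \<in> measurable (spectral_measure H :: ('a \<times> 'a) measure) borel" by (simp add: borel_prod)
  from measurable_compose[OF this assms] show ?thesis .
qed

definition spec_weight :: "real \<Rightarrow> 'a::euclidean_space \<Rightarrow> real" where
  "spec_weight H \<xi> = (\<Prod>b\<in>Basis. c_H H * \<bar>\<xi> \<bullet> b\<bar> powr (1 - 2 * H))"

lemma measurable_spec_weight [measurable]: "spec_weight H \<in> borel_measurable borel"
  unfolding spec_weight_def[abs_def] by measurable

lemma sigma_finite_mu_H: "sigma_finite_measure (mu_H H)"
  unfolding mu_H_def spec_weight_def[symmetric]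
  by (subst sigma_finite_measure.sigma_finite_iff_density_finite[OF sigma_finite_lborel]) auto

lemma nn_integral_spectral:
  fixes u :: "'a::euclidean_space \<times> 'a \<Rightarrow> ennreal"
  assumes u[measurable]: "u \<in> borel_measurable borel"
  shows "(\<integral>\<^sup>+z. u z \<partial>spectral_measure H) = (\<integral>\<^sup>+z. u z * ennreal (spec_weight H (snd z)) \<partial>leb_plus)"
proof -
  interpret mu: sigma_finite_measure "mu_H H :: 'a measure" by (rule sigma_finite_mu_H)
  have m: "u \<in> borel_measurable (restrict_space lborel orthant \<Otimes>\<^sub>M mu_H H)"
    using measurable_spectral[OF u, of H] unfolding spectral_measure_def .
  have pm[measurable]: "(\<lambda>x. u (t, x)) \<in> borel_measurable borel" for t by measurable
  have "(\<integral>\<^sup>+z. u z \<partial>spectral_measure H) = (\<integral>\<^sup>+t. \<integral>\<^sup>+x. u (t, x) \<partial>mu_H H \<partial>restrict_space lborel orthant)"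
    unfolding spectral_measure_def by (rule mu.nn_integral_fst[OF m, symmetric])
  also have "\<dots> = (\<integral>\<^sup>+t. \<integral>\<^sup>+x. ennreal (spec_weight H x) * u (t, x) \<partial>lborel \<partial>restrict_space lborel orthant)"
    unfolding mu_H_def spec_weight_def[symmetric] by (simp add: nn_integral_density)
  also have "\<dots> = (\<integral>\<^sup>+t. (\<integral>\<^sup>+x. ennreal (spec_weight H x) * u (t, x) \<partial>lborel) * indicator orthant t \<partial>lborel)"
    by (rule nn_integral_restrict_space) simp
  also have "\<dots> = (\<integral>\<^sup>+t. \<integral>\<^sup>+x. (u (t, x) * ennreal (spec_weight H x)) * indicator orthant t \<partial>lborel \<partial>lborel)"
    by (subst nn_integral_multc) (auto simp: mult.commute)
  also have "\<dots> = (\<integral>\<^sup>+z. u z * ennreal (spec_weight H (snd z)) \<partial>leb_plus)"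
    by (subst nn_integral_leb_plus) auto
  finally show ?thesis .
qed

lemma norm_hat:
  fixes u :: "'a::euclidean_space \<times> 'a \<Rightarrow> complex"
  assumes "0 < c_H H"
  shows "(norm (hat H u z))\<^sup>2 = (norm (u z))\<^sup>2 * spec_weight H (snd z)"
proof -
  have "(c_H H powr (real DIM('a) / 2))\<^sup>2 = c_H H ^ DIM('a)"
    using assms by (simp add: powr_power powr_realpow)
  \<comment> \<open>At x = 0 both sides are 0, since \<open>0 powr a = 0\<close> for every
    exponent.\<close>
  moreover have "(\<bar>x\<bar> powr (1 / 2 - H))\<^sup>2 = \<bar>x\<bar> powr (1 - 2 * H)" for x :: real
    by (cases "x = 0") (auto simp: powr_power algebra_simps)
  ultimately have "(norm (complex_of_real (\<Prod>b\<in>Basis. \<bar>snd z \<bullet> b\<bar> powr (1 / 2 - H))))\<^sup>2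
      = (\<Prod>b\<in>Basis. \<bar>snd z \<bullet> b\<bar> powr (1 - 2 * H))"
    and "(norm (complex_of_real (c_H H powr (real DIM('a) / 2))))\<^sup>2 = c_H H ^ DIM('a)"
    unfolding norm_of_real power2_abs prod_power_distrib by simp_all
  then show ?thesis
    unfolding hat_def spec_weight_def norm_mult power_mult_distrib prod.distrib by simp
qed

text \<open>\<open>hat\<close> is a linear isometry from the spectral L2 space to the Lebesgue one,
  because its squared modulus is the density of the spectral measure.\<close>

lemma L2d_spectral:
  fixes u v :: "'a::euclidean_space \<times> 'a \<Rightarrow> complex"
  assumes [measurable]: "u \<in> borel_measurable borel" "v \<in> borel_measurable borel" and c: "0 < c_H H"
  shows "L2d (spectral_measure H) u v = L2d leb_plus (hat H u) (hat H v)"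
proof -
  have "hat H u z - hat H v z = hat H (\<lambda>z. u z - v z) z" for z
    by (simp add: hat_def algebra_simps)
  then have "ennreal ((norm (hat H u z - hat H v z))\<^sup>2) = ennreal ((norm (u z - v z))\<^sup>2) * ennreal (spec_weight H (snd z))" for z
    by (simp add: norm_hat[OF c] ennreal_mult')
  then show ?thesis
    unfolding L2d_def by (subst nn_integral_spectral) auto
qed

lemma L2_tendsto_spectral:
  fixes F :: "nat \<Rightarrow> 'a::euclidean_space \<times> 'a \<Rightarrow> complex"
  assumes "\<And>k. F k \<in> borel_measurable borel" "g \<in> borel_measurable borel" "0 < c_H H"
  shows "L2_tendsto (spectral_measure H) F g \<longleftrightarrow> L2_tendsto leb_plus (\<lambda>k. hat H (F k)) (hat H g)"
  unfolding L2_tendsto_L2d using assms by (simp add: L2d_spectral)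

section \<open>Fourier transforms\<close>

lemma measurable_fourier [measurable]:
  fixes f :: "'b \<Rightarrow> 'a::euclidean_space \<Rightarrow> complex"
  assumes "(\<lambda>(y, x). f y x) \<in> borel_measurable (N \<Otimes>\<^sub>M borel)"
    and [measurable]: "g \<in> measurable N borel"
  shows "(\<lambda>y. fourier (f y) (g y)) \<in> borel_measurable N"
proof -
  have [measurable]: "(\<lambda>(y, x). f y x) \<in> borel_measurable (N \<Otimes>\<^sub>M lborel)"
    using assms(1) by (subst measurable_cong_sets[OF sets_pair_measure_cong[OF refl sets_lborel] refl])
  have "(\<lambda>(y, x). exp (- \<i> * complex_of_real (g y \<bullet> x)) * f y x) \<in> borel_measurable (N \<Otimes>\<^sub>M lborel)"
    unfolding split_beta by measurable
  then show ?thesis unfolding fourier_def by (rule lborel.borel_measurable_lebesgue_integral)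
qed

lemma norm_exp_imaginary [simp]: "norm (exp (- \<i> * complex_of_real r)) = 1"
  by (simp add: norm_exp_eq_Re)

lemma integrable_fourier_iff:
  fixes f :: "'a::euclidean_space \<Rightarrow> complex"
  assumes "f \<in> borel_measurable borel"
  shows "integrable lborel (\<lambda>x. exp (- \<i> * complex_of_real (\<xi> \<bullet> x)) * f x) \<longleftrightarrow> integrable lborel f"
proof -
  have [measurable]: "f \<in> borel_measurable borel" "(\<lambda>x. exp (- \<i> * complex_of_real (\<xi> \<bullet> x)) * f x) \<in> borel_measurable lborel"
    using assms by measurable
  have "integrable lborel (\<lambda>x. exp (- \<i> * complex_of_real (\<xi> \<bullet> x)) * f x) \<longleftrightarrow> integrable lborel (\<lambda>x. norm (exp (- \<i> * complex_of_real (\<xi> \<bullet> x)) * f x))"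
    by (rule integrable_norm_iff[symmetric]) measurable
  also have "\<dots> \<longleftrightarrow> integrable lborel (\<lambda>x. norm (f x))" by (simp only: norm_mult norm_exp_imaginary mult_1_left)
  also have "\<dots> \<longleftrightarrow> integrable lborel f" by (rule integrable_norm_iff) measurable
  finally show ?thesis .
qed

lemma integrable_fourier:
  fixes f :: "'a::euclidean_space \<Rightarrow> complex"
  assumes "integrable lborel f"
  shows "integrable lborel (\<lambda>x. exp (- \<i> * complex_of_real (\<xi> \<bullet> x)) * f x)"
  using assms by (subst integrable_fourier_iff) auto

lemma norm_fourier_le:
  fixes f :: "'a::euclidean_space \<Rightarrow> complex"
  shows "norm (fourier f \<xi>) \<le> (LINT x|lborel. norm (f x))"
proof -
  have "norm (fourier f \<xi>) \<le> (LINT x|lborel. norm (exp (- \<i> * complex_of_real (\<xi> \<bullet> x)) * f x))"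
    unfolding fourier_def by (rule integral_norm_bound)
  then show ?thesis by (simp only: norm_mult norm_exp_imaginary mult_1_left)
qed

lemma fourier_sum_list:
  fixes f :: "'x \<Rightarrow> 'a::euclidean_space \<Rightarrow> complex"
  assumes "\<And>x. x \<in> set L \<Longrightarrow> integrable lborel (f x)"
  shows "fourier (\<lambda>y. \<Sum>x\<leftarrow>L. c x * f x y) \<xi> = (\<Sum>x\<leftarrow>L. c x * fourier (f x) \<xi>)"
proof -
  have i: "integrable lborel (\<lambda>y. c x * (exp (- \<i> * complex_of_real (\<xi> \<bullet> y)) * f x y))" if "x \<in> set L" for x
    using integrable_fourier[OF assms[OF that]] by (rule integrable_mult_right)
  have "fourier (\<lambda>y. \<Sum>x\<leftarrow>L. c x * f x y) \<xi> = (LINT y|lborel. (\<Sum>x\<leftarrow>L. c x * (exp (- \<i> * complex_of_real (\<xi> \<bullet> y)) * f x y)))"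
    unfolding fourier_def by (intro Bochner_Integration.integral_cong refl) (simp add: sum_list_const_mult[symmetric] mult.left_commute)
  also have "\<dots> = (\<Sum>x\<leftarrow>L. LINT y|lborel. c x * (exp (- \<i> * complex_of_real (\<xi> \<bullet> y)) * f x y))"
    by (rule integral_sum_list(2)[OF i])
  finally show ?thesis unfolding fourier_def by simp
qed

lemma fourier_diff:
  fixes f g :: "'a::euclidean_space \<Rightarrow> complex"
  assumes "integrable lborel f" "integrable lborel g"
  shows "fourier (\<lambda>x. f x - g x) \<xi> = fourier f \<xi> - fourier g \<xi>"
  unfolding fourier_def right_diff_distrib
  using integrable_fourier[OF assms(1)] integrable_fourier[OF assms(2)] by simp

lemma fourier_cong_AE:
  fixes f g :: "'a::euclidean_space \<Rightarrow> complex"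
  assumes "AE x in lborel. f x = g x" "f \<in> borel_measurable borel" "g \<in> borel_measurable borel"
  shows "fourier f \<xi> = fourier g \<xi>"
  unfolding fourier_def using assms by (intro integral_cong_AE) auto

text \<open>The exponential factorizes over the coordinates, and Lebesgue measure is the image of
  the product measure; both claims are then Fubini's theorem.\<close>

lemma fourier_tensor:
  fixes f :: "'a::euclidean_space \<Rightarrow> real \<Rightarrow> complex"
  assumes f: "\<And>b. b \<in> Basis \<Longrightarrow> integrable lborel (f b)"
  shows "integrable lborel (\<lambda>x. \<Prod>b\<in>Basis. f b (x \<bullet> b))"
    "fourier (\<lambda>x. \<Prod>b\<in>Basis. f b (x \<bullet> b)) \<xi> = (\<Prod>b\<in>Basis. fourier (f b) (\<xi> \<bullet> b))"
proof -
  let ?B = "Basis :: 'a set"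
  interpret product_sigma_finite "\<lambda>_::'a. lborel :: real measure" ..
  have *: "integrable lborel (\<lambda>x. \<Prod>b\<in>?B. g b (x \<bullet> b)) \<and> (LINT x|lborel. (\<Prod>b\<in>?B. g b (x \<bullet> b))) = (\<Prod>b\<in>?B. LINT y|lborel. g b y)"
    if g: "\<And>b. b \<in> ?B \<Longrightarrow> integrable lborel (g b)" for g :: "'a \<Rightarrow> real \<Rightarrow> complex"
  proof -
    have [measurable]: "g b \<in> borel_measurable borel" if "b \<in> ?B" for b using g[OF that] by auto
    let ?T = "\<lambda>x. \<Sum>b\<in>?B. x b *\<^sub>R b"
    have T: "?T \<in> measurable (Pi\<^sub>M ?B (\<lambda>_. lborel)) borel" by measurable
    have eq: "(\<Prod>b\<in>?B. g b (?T x \<bullet> b)) = (\<Prod>b\<in>?B. g b (x b))" for x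
      by (intro prod.cong refl) (simp add: inner_sum_left_Basis)
    have i: "integrable (Pi\<^sub>M ?B (\<lambda>_. lborel)) (\<lambda>x. \<Prod>b\<in>?B. g b (x b))"
      by (rule product_integrable_prod) (auto intro: g)
    have "integrable lborel (\<lambda>x. \<Prod>b\<in>?B. g b (x \<bullet> b))"
      by (subst lborel_eq, subst integrable_distr_eq[OF T]) (simp_all only: eq i, measurable)
    moreover have "(LINT x|lborel. (\<Prod>b\<in>?B. g b (x \<bullet> b))) = (\<Prod>b\<in>?B. LINT y|lborel. g b y)"
      by (subst lborel_eq, subst integral_distr[OF T]) (simp_all only: eq product_integral_prod[OF finite_Basis g], measurable)
    ultimately show ?thesis ..
  qed
  show "integrable lborel (\<lambda>x. \<Prod>b\<in>?B. f b (x \<bullet> b))" using * f by blast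
  have "exp (- \<i> * complex_of_real (\<xi> \<bullet> x)) = (\<Prod>b\<in>?B. exp (- \<i> * complex_of_real ((\<xi> \<bullet> b) \<bullet> (x \<bullet> b))))" for x
  proof -
    have "- \<i> * complex_of_real (\<xi> \<bullet> x) = (\<Sum>b\<in>?B. - \<i> * complex_of_real ((\<xi> \<bullet> b) \<bullet> (x \<bullet> b)))"
      by (subst euclidean_inner) (simp add: sum_distrib_left)
    then show ?thesis by (simp only: exp_sum[OF finite_Basis])
  qed
  then have "fourier (\<lambda>x. \<Prod>b\<in>?B. f b (x \<bullet> b)) \<xi>
     = (LINT x|lborel. (\<Prod>b\<in>?B. exp (- \<i> * complex_of_real ((\<xi> \<bullet> b) \<bullet> (x \<bullet> b))) * f b (x \<bullet> b)))"
    unfolding fourier_def by (simp only: prod.distrib)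
  also have "\<dots> = (\<Prod>b\<in>?B. fourier (f b) (\<xi> \<bullet> b))"
    unfolding fourier_def using *[of "\<lambda>b y. exp (- \<i> * complex_of_real ((\<xi> \<bullet> b) \<bullet> y)) * f b y"] integrable_fourier[OF f]
    by blast
  finally show "fourier (\<lambda>x. \<Prod>b\<in>?B. f b (x \<bullet> b)) \<xi> = (\<Prod>b\<in>?B. fourier (f b) (\<xi> \<bullet> b))" .
qed

section \<open>Indicators of intervals\<close>

lemma measurable_signed_ind [measurable]: "signed_ind x \<in> borel_measurable borel"
  unfolding signed_ind_def[abs_def] by measurable

lemma integrable_complex_indicator:
  assumes "A \<in> sets N" "emeasure N A < \<infinity>"
  shows "integrable N (indicator A :: _ \<Rightarrow> complex)"
proof -
  have "integrable N (\<lambda>x. complex_of_real (indicator A x))"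
    using assms by (intro integrable_of_real integrable_real_indicator)
  also have "(\<lambda>x. complex_of_real (indicator A x)) = indicator A" by (auto simp: indicator_def)
  finally show ?thesis .
qed

lemma integrable_signed_ind: "integrable lborel (signed_ind x)"
proof -
  have "integrable lborel (indicator {a..b} :: real \<Rightarrow> complex)" for a b
    by (rule integrable_complex_indicator) (auto simp: emeasure_lborel_Icc_eq)
  then show ?thesis unfolding signed_ind_def[abs_def] by (cases "0 \<le> x") auto
qed

lemma integrable_Ioc: "integrable lborel (indicator {x<..y::real} :: real \<Rightarrow> complex)"
  by (rule integrable_complex_indicator; cases "x \<le> y") auto

text \<open>The closed intervals with their sign convention telescope to a half-open cell except at
  the points 0, x and y, a null set.\<close>

lemma fourier_signed_ind_diff:
  assumes "x \<le> y"
  shows "fourier (signed_ind y) \<xi> - fourier (signed_ind x) \<xi> = fourier (indicator {x<..y}) \<xi>"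
proof -
  have "AE s in lborel. s \<noteq> 0 \<and> s \<noteq> x \<and> s \<noteq> y"
    using AE_lborel_singleton[of 0] AE_lborel_singleton[of x] AE_lborel_singleton[of y] by eventually_elim simp
  then have ae: "AE s in lborel. signed_ind y s - signed_ind x s = indicator {x<..y} s"
    by eventually_elim (use assms in \<open>auto simp: signed_ind_def indicator_def\<close>)
  have "fourier (signed_ind y) \<xi> - fourier (signed_ind x) \<xi> = fourier (\<lambda>s. signed_ind y s - signed_ind x s) \<xi>"
    by (rule fourier_diff[symmetric]) (rule integrable_signed_ind)+
  also have "\<dots> = fourier (indicator {x<..y}) \<xi>" by (rule fourier_cong_AE[OF ae]) measurable
  finally show ?thesis .
qed

lemma norm_fourier_Ioc_le: "x \<le> y \<Longrightarrow> norm (fourier (indicator {x<..y}) \<xi>) \<le> y - x"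
proof -
  assume "x \<le> y"
  have "norm (indicator {x<..y} s :: complex) = indicator {x<..y} s" for s by (auto simp: indicator_def)
  then show ?thesis using norm_fourier_le[of "indicator {x<..y}" \<xi>] \<open>x \<le> y\<close> by simp
qed

lemma fourier_signed_ind:
  assumes "\<xi> \<noteq> 0"
  shows "fourier (signed_ind x) \<xi> = (1 - exp (- \<i> * complex_of_real (\<xi> * x))) / (\<i> * complex_of_real \<xi>)"
proof -
  let ?f = "\<lambda>y. exp (- \<i> * complex_of_real (\<xi> * y))"
  let ?F = "\<lambda>y. - ?f y / (\<i> * complex_of_real \<xi>)"
  have F: "(?F has_vector_derivative ?f y) (at y within S)" for y S
  proof -
    have "((\<lambda>z. - exp (- \<i> * complex_of_real \<xi> * z) / (\<i> * complex_of_real \<xi>)) has_field_derivative exp (- \<i> * complex_of_real \<xi> * complex_of_real y)) (at (complex_of_real y))"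
      using assms by (auto intro!: derivative_eq_intros)
    then have "((\<lambda>z. - exp (- \<i> * complex_of_real \<xi> * complex_of_real z) / (\<i> * complex_of_real \<xi>)) has_vector_derivative exp (- \<i> * complex_of_real \<xi> * complex_of_real y)) (at y within S)"
      by (rule has_vector_derivative_real_field)
    then show ?thesis by (simp add: mult.assoc)
  qed
  have cont: "continuous_on {a..b} ?f" for a b by (intro continuous_intros)
  have I: "(LINT y|lborel. indicator {a..b} y *\<^sub>R ?f y) = ?F b - ?F a" if "a \<le> b" for a b
    by (rule integral_FTC_Icc[OF that F cont])
  show ?thesis
  proof (cases "0 \<le> x")
    case True
    have "fourier (signed_ind x) \<xi> = (LINT y|lborel. indicator {0..x} y *\<^sub>R ?f y)"
      unfolding fourier_def signed_ind_def using True
      by (intro Bochner_Integration.integral_cong refl) (auto simp: indicator_def)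
    then show ?thesis using I[OF True] by (simp add: diff_divide_distrib)
  next
    case False
    have "fourier (signed_ind x) \<xi> = (LINT y|lborel. - (indicator {x..0} y *\<^sub>R ?f y))"
      unfolding fourier_def signed_ind_def using False
      by (intro Bochner_Integration.integral_cong refl) (auto simp: indicator_def)
    also have "\<dots> = - (?F 0 - ?F x)" using I[of x 0] False by simp
    finally show ?thesis by (simp add: diff_divide_distrib)
  qed
qed

text \<open>The bound for high frequencies, uniform in x. Its companion with right-hand side |x|
  serves the low frequencies.\<close>

lemma norm_fourier_signed_ind_le: "\<xi> \<noteq> 0 \<Longrightarrow> norm (fourier (signed_ind x) \<xi>) \<le> 2 / \<bar>\<xi>\<bar>"
proof -
  assume "\<xi> \<noteq> 0"
  then have "norm (fourier (signed_ind x) \<xi>) = norm (1 - exp (- \<i> * complex_of_real (\<xi> * x))) / \<bar>\<xi>\<bar>"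
    by (simp add: fourier_signed_ind norm_divide norm_mult)
  also have "\<dots> \<le> 2 / \<bar>\<xi>\<bar>"
    using norm_triangle_ineq4[of 1 "exp (- \<i> * complex_of_real (\<xi> * x))"] norm_exp_imaginary[of "\<xi> * x"]
    by (intro divide_right_mono) auto
  finally show ?thesis .
qed

lemma norm_fourier_signed_ind_le': "norm (fourier (signed_ind x) \<xi>) \<le> \<bar>x\<bar>"
proof -
  have "norm (signed_ind x y) = indicator {min 0 x..max 0 x} y" for y
    by (auto simp: signed_ind_def indicator_def)
  then show ?thesis using norm_fourier_le[of "signed_ind x" \<xi>] by (auto simp: max_def min_def split: if_splits)
qed

section \<open>Integrability of the spectral weight\<close>

text \<open>The function min(1, 1/|xi|): up to constants, a common envelope for transforms of
  intervals and of discretized test functions.\<close>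

definition decay :: "real \<Rightarrow> real" where
  "decay \<xi> = (if \<bar>\<xi>\<bar> \<le> 1 then 1 else 1 / \<bar>\<xi>\<bar>)"

lemma measurable_decay [measurable]: "decay \<in> borel_measurable borel"
  unfolding decay_def[abs_def] by measurable

lemma decay_pos: "0 < decay \<xi>" by (auto simp: decay_def)

lemma spec_weight_real: "spec_weight H (\<xi>::real) = c_H H * \<bar>\<xi>\<bar> powr (1 - 2 * H)"
  by (simp add: spec_weight_def)

text \<open>The integrand behaves like |xi|^(1-2H) near 0, integrable since H < 1, and like
  |xi|^(-1-2H) at infinity, integrable since H > 0.\<close>

lemma decay_weight_integral:
  assumes H: "0 < H" "H < 1"
  shows "(\<integral>\<^sup>+\<xi>. ennreal ((decay \<xi>)\<^sup>2 * spec_weight H (\<xi>::real)) \<partial>lborel) < \<infinity>"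
proof -
  define g1 :: "real \<Rightarrow> ennreal" where "g1 x = ennreal (x powr (1 - 2 * H)) * indicator {0..1} x" for x
  define g2 :: "real \<Rightarrow> ennreal" where "g2 x = ennreal (x powr (- 1 - 2 * H)) * indicator {1..} x" for x
  have [measurable]: "g1 \<in> borel_measurable borel" "g2 \<in> borel_measurable borel"
    unfolding g1_def[abs_def] g2_def[abs_def] by measurable
  have h1: "((\<lambda>x. x powr (1 - 2 * H)) has_integral (1 powr (1 - 2 * H + 1) / (1 - 2 * H + 1))) {0..1::real}"
    by (rule has_integral_powr_from_0) (use H in auto)
  have i1: "(\<integral>\<^sup>+x. g1 x \<partial>lborel) < \<infinity>"
    unfolding g1_def using nn_integral_has_integral_lebesgue'[OF _ h1] by simp
  have h2: "((\<lambda>x. x powr (- 1 - 2 * H)) has_integral - (1 powr (- 1 - 2 * H + 1)) / (- 1 - 2 * H + 1)) {1::real..}"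
    by (rule has_integral_powr_to_inf) (use H in auto)
  have i2: "(\<integral>\<^sup>+x. g2 x \<partial>lborel) < \<infinity>"
    unfolding g2_def using nn_integral_has_integral_lebesgue'[OF _ h2] by simp
  define g where "g x = g1 x + g2 x" for x
  have [measurable]: "g \<in> borel_measurable borel" unfolding g_def[abs_def] by measurable
  have ig: "(\<integral>\<^sup>+x. g x \<partial>lborel) < \<infinity>"
    unfolding g_def using i1 i2 by (subst nn_integral_add) auto
  \<comment> \<open>\<open>g\<close> lives on the positive half line; its reflection takes care of
    the negative frequencies.\<close>
  have ig': "(\<integral>\<^sup>+x. g (- x) \<partial>lborel) < \<infinity>"
    using ig nn_integral_real_affine[of g "-1" 0] by simp
  have c: "0 < c_H H" by (rule c_H_pos[OF H])
  have pt: "ennreal ((decay \<xi>)\<^sup>2 * spec_weight H \<xi>) \<le> ennreal (c_H H) * (g \<xi> + g (- \<xi>))" for \<xi>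
  proof -
    have "ennreal ((decay \<xi>)\<^sup>2 * \<bar>\<xi>\<bar> powr (1 - 2 * H)) \<le> g \<bar>\<xi>\<bar>"
    proof (cases "\<bar>\<xi>\<bar> \<le> 1")
      case True
      then have "ennreal ((decay \<xi>)\<^sup>2 * \<bar>\<xi>\<bar> powr (1 - 2 * H)) = g1 \<bar>\<xi>\<bar>" by (simp add: decay_def g1_def)
      then show ?thesis by (simp add: g_def)
    next
      case False
      have "1 / \<bar>\<xi>\<bar> = \<bar>\<xi>\<bar> powr (- 1)" using False by (simp add: powr_minus_divide)
      then have "(decay \<xi>)\<^sup>2 * \<bar>\<xi>\<bar> powr (1 - 2 * H) = \<bar>\<xi>\<bar> powr (- 1) * \<bar>\<xi>\<bar> powr (- 1) * \<bar>\<xi>\<bar> powr (1 - 2 * H)"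
        using False by (simp add: decay_def power2_eq_square)
      also have "\<dots> = \<bar>\<xi>\<bar> powr (- 1 - 2 * H)" unfolding powr_add[symmetric] by simp
      finally have "ennreal ((decay \<xi>)\<^sup>2 * \<bar>\<xi>\<bar> powr (1 - 2 * H)) = g2 \<bar>\<xi>\<bar>" using False by (simp add: g2_def)
      then show ?thesis by (simp add: g_def)
    qed
    also have "g \<bar>\<xi>\<bar> \<le> g \<xi> + g (- \<xi>)" by (cases "\<xi> \<ge> 0") auto
    finally have "ennreal (c_H H) * ennreal ((decay \<xi>)\<^sup>2 * \<bar>\<xi>\<bar> powr (1 - 2 * H)) \<le> ennreal (c_H H) * (g \<xi> + g (- \<xi>))"
      by (rule mult_left_mono) simp
    then show ?thesis using c by (simp add: spec_weight_real ennreal_mult'[symmetric] mult_ac)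
  qed
  have "(\<integral>\<^sup>+\<xi>. ennreal ((decay \<xi>)\<^sup>2 * spec_weight H \<xi>) \<partial>lborel) \<le> (\<integral>\<^sup>+\<xi>. ennreal (c_H H) * (g \<xi> + g (- \<xi>)) \<partial>lborel)"
    by (rule nn_integral_mono) (rule pt)
  also have "\<dots> = ennreal (c_H H) * ((\<integral>\<^sup>+x. g x \<partial>lborel) + (\<integral>\<^sup>+x. g (- x) \<partial>lborel))"
    by (subst nn_integral_cmult) (auto simp: nn_integral_add)
  also have "\<dots> < \<infinity>" using ig ig' by (simp add: ennreal_mult_less_top)
  finally show ?thesis .
qed

lemma measurable_dominator:
  "(\<lambda>z :: real \<times> real. indicator {0..R} (fst z) * (D * decay (snd z))) \<in> borel_measurable borel"
proof -
  have "(\<lambda>z :: real \<times> real. indicator {0..R} (fst z) :: real) \<in> borel_measurable borel"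
    by (rule measurable_compose[OF measurable_borel_fst]) simp
  moreover have "(\<lambda>z :: real \<times> real. decay (snd z)) \<in> borel_measurable borel" by measurable
  ultimately show ?thesis by (intro borel_measurable_times) auto
qed

lemma spectral_dominator_finite:
  assumes H: "0 < H" "H < 1" and D: "0 \<le> D"
  shows "(\<integral>\<^sup>+z. ennreal ((indicator {0..R} (fst z) * (D * decay (snd z)))\<^sup>2) \<partial>(spectral_measure H :: (real \<times> real) measure)) < \<infinity>"
proof -
  let ?w = "\<lambda>z :: real \<times> real. indicator {0..R} (fst z) * (D * decay (snd z))"
  let ?I = "\<integral>\<^sup>+\<xi>. ennreal ((decay \<xi>)\<^sup>2 * spec_weight H (\<xi>::real)) \<partial>lborel"
  have sw: "0 \<le> spec_weight H (x::real)" for x using c_H_pos[OF H] by (simp add: spec_weight_real)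
  have eq: "ennreal ((?w (t, x))\<^sup>2) * ennreal (spec_weight H x) = (ennreal (D\<^sup>2) * indicator {0..R} t) * ennreal ((decay x)\<^sup>2 * spec_weight H x)" for t x
    using sw[of x] by (auto simp: indicator_def power_mult_distrib ennreal_mult'[symmetric] mult_ac)
  note wm = measurable_dominator[of R D]
  have wm2: "(\<lambda>z. ennreal ((?w z)\<^sup>2)) \<in> borel_measurable borel"
    by (intro measurable_compose[OF _ measurable_ennreal] borel_measurable_power wm)
  have swm: "(\<lambda>z :: real \<times> real. ennreal (spec_weight H (snd z))) \<in> borel_measurable borel" by measurable
  have "(\<integral>\<^sup>+z. ennreal ((?w z)\<^sup>2) \<partial>(spectral_measure H)) = (\<integral>\<^sup>+z. ennreal ((?w z)\<^sup>2) * ennreal (spec_weight H (snd z)) \<partial>leb_plus)"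
    by (rule nn_integral_spectral[OF wm2])
  also have "\<dots> = (\<integral>\<^sup>+t. \<integral>\<^sup>+x. (ennreal ((?w (t, x))\<^sup>2) * ennreal (spec_weight H x)) * indicator orthant t \<partial>lborel \<partial>lborel)"
    by (subst nn_integral_leb_plus[OF borel_measurable_times_ennreal[OF wm2 swm]]) simp
  also have "\<dots> \<le> (\<integral>\<^sup>+t. \<integral>\<^sup>+x. (ennreal (D\<^sup>2) * indicator {0..R} t) * ennreal ((decay x)\<^sup>2 * spec_weight H x) \<partial>lborel \<partial>lborel)"
    unfolding eq by (intro nn_integral_mono) (auto simp: indicator_def)
  also have "\<dots> = ennreal (D\<^sup>2) * emeasure lborel {0..R} * ?I"
    by (simp add: nn_integral_cmult nn_integral_multc)
  also have "\<dots> < \<infinity>"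
    using decay_weight_integral[OF H] by (simp add: ennreal_mult_less_top emeasure_lborel_Icc_eq)
  finally show ?thesis .
qed

section \<open>Approximation of test functions by step functions\<close>

lemma smooth_continuous:
  assumes "smooth f" "bs \<in> lists Basis" shows "continuous_on UNIV (iter_partial bs f)"
  using assms unfolding smooth_def
  by (auto intro!: continuous_at_imp_continuous_on differentiable_imp_continuous_within)

text \<open>Collects what the discretization uses. The side R is a natural number so that grids of
  mesh 1/N end exactly at R.\<close>

lemma test_function_bounds:
  assumes "\<phi> \<in> test_functions K"
  obtains R B L :: real where "\<exists>n::nat. R = real n" "1 \<le> R" "0 \<le> B" "0 \<le> L"
    "\<And>t x. \<phi> (t, x) \<noteq> 0 \<Longrightarrow> 0 < t \<and> t < R \<and> \<bar>x\<bar> < R"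
    "\<And>z. norm (\<phi> z) \<le> B"
    "\<And>s x t y. s \<in> {0..R} \<Longrightarrow> t \<in> {0..R} \<Longrightarrow> x \<in> {-R..R} \<Longrightarrow> y \<in> {-R..R} \<Longrightarrow>
       norm (\<phi> (s, x) - \<phi> (t, y)) \<le> L * (\<bar>s - t\<bar> + \<bar>x - y\<bar>)"
proof -
  obtain C where sm: "smooth \<phi>" and C: "compact C" "C \<subseteq> {0<..} \<times> UNIV" "\<And>z. z \<notin> C \<Longrightarrow> \<phi> z = 0"
    using assms unfolding test_functions_def by auto
  obtain b where b: "\<forall>z\<in>C. norm z \<le> b" using compact_imp_bounded[OF C(1)] unfolding bounded_iff by blast
  obtain n :: nat where n: "max b 1 < real n" using reals_Archimedean2 by blast
  define R where "R = real n"
  have R1: "1 \<le> R" and Rb: "b < R" using n by (auto simp: R_def)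
  have supp: "0 < t \<and> t < R \<and> \<bar>x\<bar> < R" if "\<phi> (t, x) \<noteq> 0" for t x
  proof -
    have zC: "(t, x) \<in> C" using C(3) that by blast
    then have "norm (t, x) < R" using b Rb by fastforce
    moreover have "\<bar>t\<bar> \<le> norm (t, x)" "\<bar>x\<bar> \<le> norm (t, x)"
      using norm_fst_le[of t x] norm_snd_le[of x t] by auto
    moreover have "0 < t" using zC C(2) by auto
    ultimately show ?thesis by auto
  qed
  \<comment> \<open>Compact, so that the partial derivatives are bounded on it; convex, so that such
    a bound gives a Lipschitz estimate.\<close>
  define Q :: "(real \<times> real) set" where "Q = {0..R} \<times> {-R..R}"
  have Q: "compact Q" "convex Q" unfolding Q_def by (auto intro!: compact_Times convex_Times)
  have cont: "continuous_on UNIV \<phi>" using smooth_continuous[OF sm, of "[]"] by simp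
  have "bounded (\<phi> ` C)"
    by (intro compact_imp_bounded compact_continuous_image C continuous_on_subset[OF cont]) auto
  then obtain B0 where B0: "\<forall>z\<in>C. norm (\<phi> z) \<le> B0" unfolding bounded_iff by blast
  define B where "B = max B0 0"
  have B: "norm (\<phi> z) \<le> B" for z
    using B0 C(3)[of z] unfolding B_def by (cases "z \<in> C") auto
  let ?D = "\<lambda>b. iter_partial [b] \<phi>"
  have bas: "(1, 0) \<in> (Basis :: (real \<times> real) set)" "(0, 1) \<in> (Basis :: (real \<times> real) set)"
    by (auto simp: Basis_prod_def)
  have bd: "\<exists>l. \<forall>z\<in>Q. norm (?D v z) \<le> l" if "v \<in> Basis" for v
  proof -
    have "bounded (?D v ` Q)"
      using smooth_continuous[OF sm, of "[v]"] that
      by (intro compact_imp_bounded compact_continuous_image Q) (auto intro: continuous_on_subset)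
    then show ?thesis unfolding bounded_iff by blast
  qed
  obtain l1 where l1: "\<forall>z\<in>Q. norm (?D (1, 0) z) \<le> l1" using bd[OF bas(1)] by blast
  obtain l2 where l2: "\<forall>z\<in>Q. norm (?D (0, 1) z) \<le> l2" using bd[OF bas(2)] by blast
  define L where "L = \<bar>l1\<bar> + \<bar>l2\<bar>"
  have der: "(\<phi> has_derivative frechet_derivative \<phi> (at z)) (at z)" for z
    using sm unfolding smooth_def by (metis iter_partial.simps(1) frechet_derivative_works lists.Nil)
  have on: "onorm (frechet_derivative \<phi> (at z)) \<le> L" if "z \<in> Q" for z
  proof (rule onorm_le)
    fix v :: "real \<times> real"
    let ?F = "frechet_derivative \<phi> (at z)"
    have lin: "linear ?F" using has_derivative_linear[OF der] .
    \<comment> \<open>\<open>smooth\<close> speaks of partial derivatives in basis directions, so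
      the operator norm of the derivative is estimated through these two.\<close>
    have "v = fst v *\<^sub>R (1, 0) + snd v *\<^sub>R (0, 1)" by (cases v) simp
    then have "?F v = fst v *\<^sub>R ?F (1, 0) + snd v *\<^sub>R ?F (0, 1)"
      using linear_add[OF lin] linear_scale[OF lin] by metis
    then have "norm (?F v) \<le> norm (fst v *\<^sub>R ?F (1, 0)) + norm (snd v *\<^sub>R ?F (0, 1))"
      by (metis norm_triangle_ineq)
    also have "\<dots> = \<bar>fst v\<bar> * norm (?D (1, 0) z) + \<bar>snd v\<bar> * norm (?D (0, 1) z)" by simp
    also have "\<dots> \<le> norm v * \<bar>l1\<bar> + norm v * \<bar>l2\<bar>"
    proof (intro add_mono mult_mono)
      show "\<bar>fst v\<bar> \<le> norm v" "\<bar>snd v\<bar> \<le> norm v"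
        using norm_fst_le[of "fst v" "snd v"] norm_snd_le[of "snd v" "fst v"] by auto
      show "norm (?D (1, 0) z) \<le> \<bar>l1\<bar>" "norm (?D (0, 1) z) \<le> \<bar>l2\<bar>"
        using l1 l2 that by fastforce+
    qed auto
    finally show "norm (?F v) \<le> L * norm v" by (simp add: L_def algebra_simps)
  qed
  have lip: "norm (\<phi> (s, x) - \<phi> (t, y)) \<le> L * (\<bar>s - t\<bar> + \<bar>x - y\<bar>)"
    if "s \<in> {0..R}" "t \<in> {0..R}" "x \<in> {-R..R}" "y \<in> {-R..R}" for s x t y
  proof -
    have "norm (\<phi> (s, x) - \<phi> (t, y)) \<le> L * norm ((s, x) - (t, y))"
      by (rule differentiable_bound[OF Q(2), where f'="\<lambda>z. frechet_derivative \<phi> (at z)"])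
        (use that on in \<open>auto simp: Q_def intro: has_derivative_at_withinI der\<close>)
    also have "\<dots> \<le> L * (\<bar>s - t\<bar> + \<bar>x - y\<bar>)"
      using norm_Pair_le[of "s - t" "x - y"] by (intro mult_left_mono) (auto simp: L_def)
    finally show ?thesis .
  qed
  show ?thesis
    by (rule that[of R B L]) (use R1 supp B lip in \<open>auto simp: R_def B_def L_def\<close>)
qed

lemma test_function_continuous: "\<phi> \<in> test_functions K \<Longrightarrow> continuous_on UNIV \<phi>"
  unfolding test_functions_def using smooth_continuous[of \<phi> "[]"] by auto

lemma measurable_test_function: "\<phi> \<in> test_functions K \<Longrightarrow> \<phi> \<in> borel_measurable borel"
  by (intro borel_measurable_continuous_onI test_function_continuous)

lemma measurable_test_slice:
  assumes "\<phi> \<in> test_functions K" shows "(\<lambda>x. \<phi> (t, x)) \<in> borel_measurable borel"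
proof -
  note [measurable] = measurable_test_function[OF assms]
  show ?thesis by measurable
qed

lemma integrable_test_slice:
  assumes "\<phi> \<in> test_functions K" shows "integrable lborel (\<lambda>x. \<phi> (t, x))"
proof -
  obtain R B L where *: "1 \<le> R" "\<And>t x. \<phi> (t, x) \<noteq> 0 \<Longrightarrow> 0 < t \<and> t < R \<and> \<bar>x\<bar> < R" "\<And>z. norm (\<phi> z) \<le> B" "0 \<le> B"
    using test_function_bounds[OF assms] by metis
  show ?thesis
  proof (rule Bochner_Integration.integrable_bound)
    show "integrable lborel (\<lambda>x. B * indicator {-R..R} x :: real)"
      by (intro integrable_mult_right integrable_real_indicator) (auto simp: emeasure_lborel_Icc_eq)
    have "norm (\<phi> (t, x)) \<le> B * indicator {-R..R} x" for x
      using *(2)[of t x] *(3)[of "(t, x)"] *(4) by (cases "\<phi> (t, x) = 0") (auto simp: indicator_def)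
    then show "AE x in lborel. norm (\<phi> (t, x)) \<le> norm (B * indicator {-R..R} x :: real)"
      using *(4) by auto
  qed (use measurable_test_slice[OF assms] in auto)
qed

definition test_ft :: "(real \<times> real \<Rightarrow> complex) \<Rightarrow> real \<times> real \<Rightarrow> complex" where
  "test_ft \<phi> z = fourier (\<lambda>x. \<phi> (fst z, x)) (snd z)"

lemma measurable_test_ft [measurable]:
  assumes "\<phi> \<in> test_functions K" shows "test_ft \<phi> \<in> borel_measurable borel"
proof -
  note [measurable] = measurable_test_function[OF assms]
  have "(\<lambda>(z :: real \<times> real, x). \<phi> (fst z, x)) \<in> borel_measurable (borel \<Otimes>\<^sub>M borel)"
    unfolding borel_prod split_beta by measurable
  then show ?thesis unfolding test_ft_def[abs_def] by (rule measurable_fourier) measurable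
qed

definition step_ft :: "(complex \<times> real \<times> real) list \<Rightarrow> real \<times> real \<Rightarrow> complex" where
  "step_ft S z = (\<Sum>(c, t, x)\<leftarrow>S. c * (indicator {0..t} (fst z) * fourier (signed_ind x) (snd z)))"

lemma step_ft_fourier:
  "fourier (\<lambda>y. \<Sum>(c, t, x)\<leftarrow>S. c * indicator {0..t} s * signed_ind x y) \<xi> = step_ft S (s, \<xi>)"
proof -
  have "fourier (\<lambda>y. \<Sum>v\<leftarrow>S. (fst v * indicator {0..fst (snd v)} s) * signed_ind (snd (snd v)) y) \<xi>
     = (\<Sum>v\<leftarrow>S. (fst v * indicator {0..fst (snd v)} s) * fourier (signed_ind (snd (snd v))) \<xi>)"
    by (rule fourier_sum_list) (rule integrable_signed_ind)
  then show ?thesis unfolding step_ft_def case_prod_beta' by (simp add: mult.assoc)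
qed

lemma measurable_step_ft [measurable]: "step_ft S \<in> borel_measurable borel"
proof -
  have "(\<lambda>z :: real \<times> real. fourier (signed_ind x) (snd z)) \<in> borel_measurable borel" for x
    by (rule measurable_fourier) measurable
  then show ?thesis
    unfolding step_ft_def[abs_def] case_prod_beta'
    by (intro measurable_sum_list borel_measurable_times borel_measurable_const) measurable
qed

section \<open>Discretization of a test function on a grid\<close>

lemma sum_indicator_Ioc:
  fixes a :: "nat \<Rightarrow> real"
  assumes "\<And>j. a j \<le> a (Suc j)"
  shows "(\<Sum>j<n. indicator {a j<..a (Suc j)} y) = (indicator {a 0<..a n} y :: 'c::ring_1)"
proof (induction n)
  case (Suc n)
  have "a 0 \<le> a n" using lift_Suc_mono_le[of a 0 n, OF assms] by simp
  with assms[of n] Suc show ?case by (auto simp: indicator_def)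
qed simp

text \<open>
  Sampling at the left end points. The bound by \<open>decay\<close> is uniform in the mesh: for small
  frequencies it comes from the supremum norm, for large ones from the total variation
  by summation by parts.
\<close>

locale grid =
  fixes \<phi> :: "real \<times> real \<Rightarrow> complex" and K :: "complex set" and R B L :: real and N :: nat and nR :: nat
  assumes test: "\<phi> \<in> test_functions K"
    and R: "R = real nR" "1 \<le> R" and B: "0 \<le> B" and L: "0 \<le> L" and N: "0 < N"
    and supp: "\<And>t x. \<phi> (t, x) \<noteq> 0 \<Longrightarrow> 0 < t \<and> t < R \<and> \<bar>x\<bar> < R"
    and bnd: "\<And>z. norm (\<phi> z) \<le> B"
    and lip: "\<And>s x t y. s \<in> {0..R} \<Longrightarrow> t \<in> {0..R} \<Longrightarrow> x \<in> {-R..R} \<Longrightarrow> y \<in> {-R..R} \<Longrightarrow>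
       norm (\<phi> (s, x) - \<phi> (t, y)) \<le> L * (\<bar>s - t\<bar> + \<bar>x - y\<bar>)"
begin

definition X :: "nat \<Rightarrow> real" where "X j = - R + real j / real N"
definition T :: "nat \<Rightarrow> real" where "T i = real i / real N"
text \<open>Numbers of cells in [-R, R] and in [0, R]. They are exact because R is the natural
  number \<open>nR\<close>.\<close>

definition J :: nat where "J = 2 * nR * N"
definition I :: nat where "I = nR * N"

lemma J_div_N: "real J / real N = 2 * R"
  using N by (simp add: J_def R(1))

lemma I_div_N: "real I / real N = R"
  using N by (simp add: I_def R(1))

lemma X_simps: "X 0 = - R" "X J = R" "X j \<le> X (Suc j)" "X (Suc j) - X j = 1 / real N"
  using N by (simp_all add: X_def J_div_N add_divide_distrib)

lemma T_simps: "T 0 = 0" "T I = R" "T i \<le> T (Suc i)" "T (Suc i) - T i = 1 / real N" "0 \<le> T i"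
  using N by (simp_all add: T_def I_div_N add_divide_distrib)

lemma X_mono: "i \<le> j \<Longrightarrow> X i \<le> X j" by (rule lift_Suc_mono_le[of X, OF X_simps(3)])
lemma T_mono: "i \<le> j \<Longrightarrow> T i \<le> T j" by (rule lift_Suc_mono_le[of T, OF T_simps(3)])

lemma X_range: "j \<le> J \<Longrightarrow> X j \<in> {-R..R}"
  using X_mono[of 0 j] X_mono[of j J] by (simp add: X_simps)

lemma T_range: "i \<le> I \<Longrightarrow> T i \<in> {0..R}"
  using T_mono[of i I] by (simp add: T_simps)

definition cellF :: "nat \<Rightarrow> real \<Rightarrow> complex" where "cellF j \<xi> = fourier (indicator {X j<..X (Suc j)}) \<xi>"
text \<open>The transform of the step function that samples \<phi>(\<tau>, .) at left end points;
  \<open>U\<close> also freezes the time at the left end of its slice.\<close>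

definition V :: "real \<Rightarrow> real \<Rightarrow> complex" where "V \<tau> \<xi> = (\<Sum>j<J. \<phi> (\<tau>, X j) * cellF j \<xi>)"
definition U :: "real \<times> real \<Rightarrow> complex" where
  "U z = (\<Sum>i<I. indicator {T i<..T (Suc i)} (fst z) * V (T i) (snd z))"

lemma V_fourier: "V \<tau> \<xi> = fourier (\<lambda>y. \<Sum>j<J. \<phi> (\<tau>, X j) * indicator {X j<..X (Suc j)} y) \<xi>"
proof -
  have "fourier (\<lambda>y. \<Sum>j\<leftarrow>[0..<J]. \<phi> (\<tau>, X j) * indicator {X j<..X (Suc j)} y) \<xi>
     = (\<Sum>j\<leftarrow>[0..<J]. \<phi> (\<tau>, X j) * fourier (indicator {X j<..X (Suc j)}) \<xi>)"
    by (rule fourier_sum_list) (rule integrable_Ioc)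
  then show ?thesis unfolding V_def cellF_def
    by (simp add: interv_sum_list_conv_sum_set_nat atLeast0LessThan)
qed

text \<open>The sampled function differs from \<phi>(s, .) by at most L(1/N + 1/N) on an interval of
  length 2R and nowhere else. The transform is bounded by the L1 norm of the difference, uniformly
  in the frequency.\<close>

lemma V_close:
  assumes "\<tau> \<in> {0..R}" "s \<in> {0..R}" "\<bar>\<tau> - s\<bar> \<le> 1 / real N"
  shows "norm (V \<tau> \<xi> - fourier (\<lambda>y. \<phi> (s, y)) \<xi>) \<le> 4 * R * L / real N"
proof -
  let ?ind = "\<lambda>j y. indicator {X j<..X (Suc j)} y :: complex"
  let ?p = "\<lambda>y. \<Sum>j<J. \<phi> (\<tau>, X j) * ?ind j y"
  have ip: "integrable lborel ?p"
    by (intro Bochner_Integration.integrable_sum integrable_mult_right integrable_Ioc)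
  have ist: "integrable lborel (\<lambda>y. \<phi> (s, y))" by (rule integrable_test_slice[OF test])
  have pt: "norm (?p y - \<phi> (s, y)) \<le> (2 * L / real N) * indicator {-R<..R} y" for y
  proof (cases "y \<in> {-R<..R}")
    case False
    then have "\<phi> (s, y) = 0" using supp[of s y] by force
    moreover have "?ind j y = 0" if "j < J" for j
      using False X_range[of j] X_range[of "Suc j"] that by (auto simp: indicator_def)
    ultimately show ?thesis using L by simp
  next
    case True
    \<comment> \<open>The cells form a partition of unity on (-R, R], which lets \<phi>(s, y) be
      subtracted cell by cell.\<close>
    have one: "(\<Sum>j<J. ?ind j y) = 1"
      using sum_indicator_Ioc[of X y J] X_simps(3) True by (simp add: X_simps)
    have oner: "(\<Sum>j<J. indicator {X j<..X (Suc j)} y :: real) = 1"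
      using sum_indicator_Ioc[of X y J, where ?'c = real] X_simps(3) True by (simp add: X_simps)
    have "?p y - \<phi> (s, y) = ?p y - \<phi> (s, y) * (\<Sum>j<J. ?ind j y)" by (simp only: one mult_1_right)
    also have "\<dots> = (\<Sum>j<J. (\<phi> (\<tau>, X j) - \<phi> (s, y)) * ?ind j y)"
      by (simp only: sum_distrib_left sum_subtractf[symmetric] left_diff_distrib)
    also have "norm \<dots> \<le> (\<Sum>j<J. (2 * L / real N) * indicator {X j<..X (Suc j)} y)"
    proof (rule sum_norm_le)
      fix j assume "j \<in> {..<J}"
      then have j: "j < J" by simp
      show "norm ((\<phi> (\<tau>, X j) - \<phi> (s, y)) * ?ind j y) \<le> (2 * L / real N) * indicator {X j<..X (Suc j)} y"
      proof (cases "y \<in> {X j<..X (Suc j)}")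
        case True2: True
        have "norm (\<phi> (\<tau>, X j) - \<phi> (s, y)) \<le> L * (\<bar>\<tau> - s\<bar> + \<bar>X j - y\<bar>)"
          using assms j True X_range[of j] by (intro lip) auto
        also have "\<dots> \<le> L * (1 / real N + 1 / real N)"
          using True2 X_simps(4)[of j] assms L by (intro mult_left_mono add_mono) auto
        finally show ?thesis using True2 by (simp add: field_simps)
      qed simp
    qed
    also have "\<dots> = 2 * L / real N" by (simp only: sum_distrib_left[symmetric] oner mult_1_right)
    finally show ?thesis using True by simp
  qed
  have "norm (V \<tau> \<xi> - fourier (\<lambda>y. \<phi> (s, y)) \<xi>) = norm (fourier (\<lambda>y. ?p y - \<phi> (s, y)) \<xi>)"
    unfolding V_fourier using fourier_diff[OF ip ist] by simp
  also have "\<dots> \<le> (LINT y|lborel. norm (?p y - \<phi> (s, y)))" by (rule norm_fourier_le)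
  also have "\<dots> \<le> (LINT y|lborel. (2 * L / real N) * indicator {-R<..R} y)"
  proof (rule integral_mono)
    show "integrable lborel (\<lambda>y. norm (?p y - \<phi> (s, y)))" using ip ist by auto
    show "integrable lborel (\<lambda>y. (2 * L / real N) * indicator {-R<..R} y :: real)"
      by (intro integrable_mult_right integrable_real_indicator) (use R in auto)
  qed (rule pt)
  also have "\<dots> = (2 * L / real N) * (2 * R)" using R by simp
  finally show ?thesis by (simp add: field_simps)
qed

lemma V_bound: "norm (V \<tau> \<xi>) \<le> (2 * R * B + 4 * R * L) * decay \<xi>" if "\<tau> \<in> {0..R}"
proof -
  have b1: "norm (V \<tau> \<xi>) \<le> 2 * R * B"
  proof -
    have "norm (V \<tau> \<xi>) \<le> (\<Sum>j<J. B * (1 / real N))"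
      unfolding V_def
    proof (rule sum_norm_le)
      fix j
      have "norm (cellF j \<xi>) \<le> 1 / real N"
        unfolding cellF_def using norm_fourier_Ioc_le[OF X_simps(3), of j \<xi>] by (simp add: X_simps(4))
      then show "norm (\<phi> (\<tau>, X j) * cellF j \<xi>) \<le> B * (1 / real N)"
        using bnd[of "(\<tau>, X j)"] B by (simp only: norm_mult) (intro mult_mono, auto)
    qed
    also have "\<dots> = B * (real J / real N)" by simp
    finally show ?thesis unfolding J_div_N by (simp add: mult_ac)
  qed
  have b2: "norm (V \<tau> \<xi>) \<le> 4 * R * L / \<bar>\<xi>\<bar>" if xi: "\<xi> \<noteq> 0"
  proof -
    let ?e = "\<lambda>j. fourier (signed_ind (X j)) \<xi>"
    let ?f = "\<lambda>j. \<phi> (\<tau>, X j)"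
    have cF: "cellF j \<xi> = ?e (Suc j) - ?e j" for j
      unfolding cellF_def by (rule fourier_signed_ind_diff[OF X_simps(3), symmetric])
    \<comment> \<open>The strict inequality in the support condition kills both boundary terms of
      the summation by parts.\<close>
    have z: "\<phi> (\<tau>, x) = 0" if "\<bar>x\<bar> = R" for x
    proof (rule ccontr)
      assume "\<phi> (\<tau>, x) \<noteq> 0"
      from supp[OF this] that show False by simp
    qed
    have zz: "?f 0 = 0" "?f J = 0" using z[of "X 0"] z[of "X J"] R(2) by (simp_all add: X_simps)
    have "(\<Sum>j<J. ?f j * (?e (Suc j) - ?e j)) = (\<Sum>j<J. ?f (Suc j) * ?e (Suc j) - ?f j * ?e j) - (\<Sum>j<J. (?f (Suc j) - ?f j) * ?e (Suc j))"
      unfolding sum_subtractf[symmetric] by (intro sum.cong refl) (simp add: algebra_simps)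
    also have "(\<Sum>j<J. ?f (Suc j) * ?e (Suc j) - ?f j * ?e j) = ?f J * ?e J - ?f 0 * ?e 0"
      by (rule sum_lessThan_telescope)
    finally have "V \<tau> \<xi> = - (\<Sum>j<J. (?f (Suc j) - ?f j) * ?e (Suc j))"
      unfolding V_def cF by (simp add: zz)
    then have "norm (V \<tau> \<xi>) = norm (\<Sum>j<J. (?f (Suc j) - ?f j) * ?e (Suc j))" by simp
    \<comment> \<open>Each increment is at most L/N, so the 2RN cells give total variation at most
      2RL, independent of the mesh.\<close>
    also have "\<dots> \<le> (\<Sum>j<J. (L * (1 / real N)) * (2 / \<bar>\<xi>\<bar>))"
    proof (rule sum_norm_le)
      fix j assume "j \<in> {..<J}"
      then have j: "j < J" by simp
      have "norm (?f (Suc j) - ?f j) \<le> L * (\<bar>\<tau> - \<tau>\<bar> + \<bar>X (Suc j) - X j\<bar>)"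
        using \<open>\<tau> \<in> {0..R}\<close> X_range[of j] X_range[of "Suc j"] j by (intro lip) auto
      also have "\<dots> = L * (1 / real N)" by (simp add: X_simps(4))
      finally have "norm (?f (Suc j) - ?f j) \<le> L * (1 / real N)" .
      moreover have "norm (?e (Suc j)) \<le> 2 / \<bar>\<xi>\<bar>" by (rule norm_fourier_signed_ind_le[OF xi])
      ultimately show "norm ((?f (Suc j) - ?f j) * ?e (Suc j)) \<le> (L * (1 / real N)) * (2 / \<bar>\<xi>\<bar>)"
        using L by (simp only: norm_mult) (intro mult_mono, auto)
    qed
    also have "\<dots> = (real J / real N) * (L * (2 / \<bar>\<xi>\<bar>))" by simp
    also have "\<dots> = 4 * R * L / \<bar>\<xi>\<bar>" unfolding J_div_N by simp
    finally show ?thesis .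
  qed
  have nn: "0 \<le> 2 * R * B" "0 \<le> 4 * R * L" using R B L by auto
  show ?thesis
  proof (cases "\<bar>\<xi>\<bar> \<le> 1")
    case True
    have "norm (V \<tau> \<xi>) \<le> 2 * R * B + 4 * R * L" using b1 nn by linarith
    then show ?thesis using True by (simp add: decay_def)
  next
    case False
    then have "norm (V \<tau> \<xi>) \<le> 4 * R * L / \<bar>\<xi>\<bar>" by (intro b2) auto
    also have "\<dots> \<le> (2 * R * B + 4 * R * L) / \<bar>\<xi>\<bar>" using nn by (intro divide_right_mono) auto
    finally show ?thesis using False by (simp add: decay_def)
  qed
qed

lemma U_single:
  assumes "i < I" "fst z \<in> {T i<..T (Suc i)}"
  shows "U z = V (T i) (snd z)"
proof -
  have "indicator {T k<..T (Suc k)} (fst z) = (if k = i then 1 else 0 :: complex)" for k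
  proof -
    have "fst z \<notin> {T k<..T (Suc k)}" if "k \<noteq> i"
      using assms(2) T_mono[of "Suc k" i] T_mono[of "Suc i" k] that by (cases "k < i") auto
    then show ?thesis using assms(2) by auto
  qed
  then show ?thesis unfolding U_def using assms(1) by (simp add: if_distrib[of "\<lambda>c. c * _"] cong: if_cong)
qed

text \<open>Time 0 lies in no half-open slice and is grouped with the times outside (0, R], where
  \<phi> vanishes as well.\<close>

lemma U_cases:
  obtains i where "i < I" "fst z \<in> {T i<..T (Suc i)}" | "fst z \<notin> {0<..R}" "U z = 0"
proof (cases "\<exists>i<I. fst z \<in> {T i<..T (Suc i)}")
  case True
  then show ?thesis using that by blast
next
  case False
  then have notin: "fst z \<notin> {T i<..T (Suc i)}" if "i < I" for i using that by blast
  have zero: "indicator {T i<..T (Suc i)} (fst z) = (0 :: complex)" if "i < I" for i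
    using notin[OF that] by simp
  have "(\<Sum>i<I. indicator {T i<..T (Suc i)} (fst z) :: real) = 0"
    using notin by (intro sum.neutral) auto
  then have "(indicator {0<..R} (fst z) :: real) = 0"
    using sum_indicator_Ioc[of T "fst z" I, where ?'c = real, OF T_simps(3)]
    by (simp only: T_simps)
  moreover have "U z = 0" unfolding U_def using zero by (intro sum.neutral) auto
  ultimately show ?thesis using that by (auto simp: indicator_def split: if_splits)
qed

lemma U_bound: "norm (U z) \<le> indicator {0..R} (fst z) * ((2 * R * B + 4 * R * L) * decay (snd z))"
proof (cases rule: U_cases[of z])
  case (1 i)
  have "fst z \<in> {0..R}" using 1 T_range[of i] T_range[of "Suc i"] by auto
  then show ?thesis using U_single[OF 1] V_bound[OF T_range[of i], of "snd z"] 1(1) by simp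
next
  case 2
  have "0 \<le> (2 * R * B + 4 * R * L) * decay (snd z)"
    using R B L decay_pos[of "snd z"] by (intro mult_nonneg_nonneg) auto
  then show ?thesis using 2 by simp
qed

lemma U_close: "norm (U z - test_ft \<phi> z) \<le> 4 * R * L / real N"
proof (cases rule: U_cases[of z])
  case (1 i)
  have "fst z \<in> {0..R}" using 1 T_range[of i] T_range[of "Suc i"] by auto
  moreover have "\<bar>T i - fst z\<bar> \<le> 1 / real N" using 1 T_simps(4)[of i] by auto
  ultimately show ?thesis unfolding U_single[OF 1] test_ft_def
    using 1 T_range[of i] by (intro V_close) auto
next
  case 2
  have "\<phi> (fst z, x) = 0" for x using supp[of "fst z" x] 2(1) by force
  then have "test_ft \<phi> z = 0" by (simp add: test_ft_def fourier_def)
  then show ?thesis using 2 R L by simp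
qed

text \<open>The indicator of a cell is the second mixed difference of rectangles anchored at the
  origin, hence four corners with alternating signs.\<close>

definition S :: "(complex \<times> real \<times> real) list" where
  "S = concat (map (\<lambda>i. concat (map (\<lambda>j.
     [(\<phi> (T i, X j), T (Suc i), X (Suc j)), (- \<phi> (T i, X j), T i, X (Suc j)),
      (- \<phi> (T i, X j), T (Suc i), X j), (\<phi> (T i, X j), T i, X j)]) [0..<J])) [0..<I])"

lemma S_step_ft: "step_ft S z = U z"
proof -
  have cc: "(\<Sum>x\<leftarrow>concat (map f l). g x) = (\<Sum>y\<leftarrow>l. \<Sum>x\<leftarrow>f y. g x)"
    for f :: "nat \<Rightarrow> (complex \<times> real \<times> real) list" and g :: "_ \<Rightarrow> complex" and l
    by (induction l) auto
  have ind: "indicator {0..T (Suc i)} (fst z) - indicator {0..T i} (fst z) = (indicator {T i<..T (Suc i)} (fst z) :: complex)" for i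
    using T_simps(3,5)[of i] by (auto simp: indicator_def)
  have cF: "cellF j \<xi> = fourier (signed_ind (X (Suc j))) \<xi> - fourier (signed_ind (X j)) \<xi>" for j \<xi>
    unfolding cellF_def by (rule fourier_signed_ind_diff[OF X_simps(3), symmetric])
  have "step_ft S z = (\<Sum>i<I. \<Sum>j<J. \<phi> (T i, X j) * ((indicator {0..T (Suc i)} (fst z) - indicator {0..T i} (fst z)) *
     (fourier (signed_ind (X (Suc j))) (snd z) - fourier (signed_ind (X j)) (snd z))))"
    unfolding step_ft_def S_def cc interv_sum_list_conv_sum_set_nat set_upt atLeast0LessThan
    by (intro sum.cong refl) (simp add: algebra_simps)
  then show ?thesis unfolding ind cF[symmetric] U_def V_def by (simp add: sum_distrib_left mult_ac)
qed

lemma S_coeffs: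
  assumes "\<And>c. c \<in> K \<Longrightarrow> - c \<in> K"
  shows "\<forall>(c, t, x)\<in>set S. c \<in> K \<and> 0 \<le> t"
proof -
  have "range \<phi> \<subseteq> K" using test by (simp add: test_functions_def)
  then have "\<phi> z \<in> K" for z by auto
  then show ?thesis using assms T_simps(5) unfolding S_def by auto
qed

end

text \<open>The error of order 1/N gives pointwise convergence, and the envelope independent of the
  mesh allows dominated convergence; a bound constant in xi would have infinite spectral norm. The
  same envelope bounds the limit.\<close>

lemma test_function_step_approx:
  assumes \<phi>: "\<phi> \<in> test_functions K" and K: "\<And>c. c \<in> K \<Longrightarrow> - c \<in> K" and H: "0 < H" "H < 1"
  shows "\<exists>S. (\<forall>k::nat. \<forall>(c, t, x)\<in>set (S k). c \<in> K \<and> 0 \<le> t) \<and>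
     L2_tendsto (spectral_measure H) (\<lambda>k. step_ft (S k)) (test_ft \<phi>)"
    and "L2d (spectral_measure H) (test_ft \<phi>) (\<lambda>_. 0) < \<infinity>"
proof -
  obtain R B L where RBL: "\<exists>n::nat. R = real n" "1 \<le> R" "0 \<le> B" "0 \<le> L"
    "\<And>t x. \<phi> (t, x) \<noteq> 0 \<Longrightarrow> 0 < t \<and> t < R \<and> \<bar>x\<bar> < R" "\<And>z. norm (\<phi> z) \<le> B"
    "\<And>s x t y. s \<in> {0..R} \<Longrightarrow> t \<in> {0..R} \<Longrightarrow> x \<in> {-R..R} \<Longrightarrow> y \<in> {-R..R} \<Longrightarrow>
       norm (\<phi> (s, x) - \<phi> (t, y)) \<le> L * (\<bar>s - t\<bar> + \<bar>x - y\<bar>)"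
    using test_function_bounds[OF \<phi>] by blast
  obtain nR where nR: "R = real nR" using RBL(1) by blast
  have g: "grid \<phi> K R B L (Suc k) nR" for k
    by (unfold_locales) (use \<phi> nR RBL in auto)
  define S where "S k = grid.S \<phi> R (Suc k) nR" for k
  have coeff: "\<forall>(c, t, x)\<in>set (S k). c \<in> K \<and> 0 \<le> t" for k
    unfolding S_def by (rule grid.S_coeffs[OF g K])
  have close: "norm (step_ft (S k) z - test_ft \<phi> z) \<le> 4 * R * L / real (Suc k)" for k z
    unfolding S_def grid.S_step_ft[OF g] by (rule grid.U_close[OF g])
  define D where "D = 2 * R * B + 4 * R * L"
  have D0: "0 \<le> D" using RBL by (simp add: D_def)
  let ?w = "\<lambda>z :: real \<times> real. indicator {0..R} (fst z) * (D * decay (snd z))"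
  have bound: "norm (step_ft (S k) z) \<le> ?w z" for k z
    unfolding S_def grid.S_step_ft[OF g] D_def by (rule grid.U_bound[OF g])
  have lim: "(\<lambda>k. step_ft (S k) z) \<longlonglongrightarrow> test_ft \<phi> z" for z
  proof (rule metric_LIMSEQ_I)
    fix e :: real assume e: "0 < e"
    obtain k0 where k0: "4 * R * L / e < real k0" using reals_Archimedean2 by blast
    show "\<exists>k0. \<forall>k\<ge>k0. dist (step_ft (S k) z) (test_ft \<phi> z) < e"
    proof (intro exI[of _ k0] allI impI)
      fix k assume "k0 \<le> k"
      then have "4 * R * L / e < real (Suc k)" using k0 by simp
      then have "4 * R * L / real (Suc k) < e" using e by (simp add: field_simps)
      then show "dist (step_ft (S k) z) (test_ft \<phi> z) < e" using close[of k z] by (simp add: dist_norm)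
    qed
  qed
  note fin = spectral_dominator_finite[OF H D0, of R]
  have [measurable]: "test_ft \<phi> \<in> borel_measurable borel" by (rule measurable_test_ft[OF \<phi>])
  note wm = measurable_dominator[of R D]
  have "L2_tendsto (spectral_measure H) (\<lambda>k. step_ft (S k)) (test_ft \<phi>)"
    by (rule L2_tendsto_dominated[where w="?w", OF _ _ _ _ _ fin])
      (use wm lim bound in \<open>auto intro!: measurable_spectral\<close>)
  with coeff show "\<exists>S. (\<forall>k::nat. \<forall>(c, t, x)\<in>set (S k). c \<in> K \<and> 0 \<le> t) \<and>
     L2_tendsto (spectral_measure H) (\<lambda>k. step_ft (S k)) (test_ft \<phi>)" by blast
  have "norm (test_ft \<phi> z) \<le> ?w z" for z
    using LIMSEQ_le_const2[OF tendsto_norm[OF lim[of z]]] bound by blast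
  then have "(norm (test_ft \<phi> z))\<^sup>2 \<le> (?w z)\<^sup>2" for z by (intro power_mono) auto
  then have "L2d (spectral_measure H) (test_ft \<phi>) (\<lambda>_. 0) \<le> (\<integral>\<^sup>+z. ennreal ((?w z)\<^sup>2) \<partial>(spectral_measure H :: (real \<times> real) measure))"
    unfolding L2d_def by (intro nn_integral_mono ennreal_leI) simp
  also have "\<dots> < \<infinity>" by (rule fin)
  finally show "L2d (spectral_measure H) (test_ft \<phi>) (\<lambda>_. 0) < \<infinity>" .
qed

section \<open>Functions with the same action on the Schwartz space\<close>

text \<open>Modulated Gaussians times polynomials: a class stable under differentiation, so
  membership in \<open>schwartz\<close> needs only one decay estimate, and containing a Gaussian
  times any character.\<close>

definition gauss_poly :: "complex poly \<Rightarrow> real \<Rightarrow> real \<Rightarrow> complex" where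
  "gauss_poly p \<theta> x = poly p (of_real x) * exp (- \<i> * of_real \<theta> * of_real x - (of_real x)\<^sup>2)"

lemma gauss_poly_derivative:
  "(gauss_poly p \<theta> has_vector_derivative gauss_poly (pderiv p - p * [:\<i> * of_real \<theta>, 2:]) \<theta> x) (at x)"
proof -
  have "((\<lambda>z. poly p z * exp (- \<i> * of_real \<theta> * z - z\<^sup>2)) has_field_derivative
      (poly (pderiv p - p * [:\<i> * of_real \<theta>, 2:]) (of_real x) * exp (- \<i> * of_real \<theta> * of_real x - (of_real x)\<^sup>2))) (at (complex_of_real x))"
    by (auto intro!: derivative_eq_intros simp: algebra_simps)
  from has_vector_derivative_real_field[OF this, of UNIV] show ?thesis unfolding gauss_poly_def[abs_def] .
qed

lemma iter_partial_gauss_poly: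
  "bs \<in> lists Basis \<Longrightarrow> \<exists>q. iter_partial bs (gauss_poly p \<theta>) = gauss_poly q \<theta>"
proof (induction bs)
  case (Cons b bs)
  then obtain q where q: "iter_partial bs (gauss_poly p \<theta>) = gauss_poly q \<theta>" and b: "b = 1" by auto
  have "frechet_derivative (gauss_poly q \<theta>) (at x) 1 = gauss_poly (pderiv q - q * [:\<i> * of_real \<theta>, 2:]) \<theta> x" for x
    using frechet_derivative_at[OF gauss_poly_derivative[of q \<theta> x, unfolded has_vector_derivative_def], symmetric] by simp
  then have "iter_partial (b # bs) (gauss_poly p \<theta>) = gauss_poly (pderiv q - q * [:\<i> * of_real \<theta>, 2:]) \<theta>"
    unfolding iter_partial.simps q b by (rule ext)
  then show ?case by blast
qed auto

text \<open>With n = m + 1, the inequality 1 + y <= exp y at y = x^2/n gives (1 + x^2/n)^n <=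
  exp(x^2), and 1 + |x| is at most 2n(1 + x^2/n).\<close>

lemma power_exp_bounded: "\<exists>C. \<forall>x::real. (1 + \<bar>x\<bar>) ^ m * exp (- x\<^sup>2) \<le> C"
proof (intro exI allI)
  fix x :: real
  let ?n = "real (Suc m)"
  have "1 + \<bar>x\<bar> \<le> 2 * (1 + x\<^sup>2)"
  proof -
    have "2 * \<bar>x\<bar> \<le> 1 + x\<^sup>2" using sum_squares_bound[of 1 "\<bar>x\<bar>"] by simp
    then show ?thesis using zero_le_power2[of x] abs_ge_zero[of x] unfolding distrib_left by linarith
  qed
  also have "\<dots> \<le> 2 * (?n * (1 + x\<^sup>2 / ?n))" by (simp add: distrib_left)
  finally have "(1 + \<bar>x\<bar>) ^ Suc m \<le> (2 * (?n * (1 + x\<^sup>2 / ?n))) ^ Suc m"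
    by (intro power_mono) auto
  also have "\<dots> = (2 * ?n) ^ Suc m * (1 + x\<^sup>2 / ?n) ^ Suc m" by (simp only: power_mult_distrib mult.assoc)
  also have "\<dots> \<le> (2 * ?n) ^ Suc m * exp (x\<^sup>2)"
  proof (intro mult_left_mono)
    have "(1 + x\<^sup>2 / ?n) ^ Suc m \<le> exp (x\<^sup>2 / ?n) ^ Suc m"
      by (intro power_mono exp_ge_add_one_self add_nonneg_nonneg) auto
    also have "\<dots> = exp (x\<^sup>2)" by (simp only: exp_of_nat_mult[symmetric]) simp
    finally show "(1 + x\<^sup>2 / ?n) ^ Suc m \<le> exp (x\<^sup>2)" .
  qed auto
  finally have le: "(1 + \<bar>x\<bar>) ^ Suc m \<le> (2 * ?n) ^ Suc m * exp (x\<^sup>2)" .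
  have "(1 + \<bar>x\<bar>) ^ m * exp (- x\<^sup>2) \<le> (1 + \<bar>x\<bar>) ^ Suc m * exp (- x\<^sup>2)"
    by (intro mult_right_mono power_increasing) auto
  also have "\<dots> \<le> ((2 * ?n) ^ Suc m * exp (x\<^sup>2)) * exp (- x\<^sup>2)"
    by (intro mult_right_mono le) auto
  also have "\<dots> = (2 * ?n) ^ Suc m" by (simp add: mult.assoc exp_add[symmetric])
  finally show "(1 + \<bar>x\<bar>) ^ m * exp (- x\<^sup>2) \<le> (2 * ?n) ^ Suc m" .
qed

lemma gauss_poly_bounded: "\<exists>C. \<forall>x. (1 + norm x) ^ N * norm (gauss_poly p \<theta> x) \<le> C"
proof -
  let ?d = "degree p" and ?A = "\<Sum>i\<le>degree p. norm (coeff p i)"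
  obtain C where C: "\<And>x::real. (1 + \<bar>x\<bar>) ^ (N + ?d) * exp (- x\<^sup>2) \<le> C" using power_exp_bounded by blast
  have "(1 + norm x) ^ N * norm (gauss_poly p \<theta> x) \<le> ?A * C" for x
  proof -
    have "norm (poly p (of_real x)) \<le> (\<Sum>i\<le>?d. norm (coeff p i) * (1 + \<bar>x\<bar>) ^ ?d)"
      unfolding poly_altdef
    proof (rule sum_norm_le)
      fix i assume "i \<in> {..?d}"
      then have "\<bar>x\<bar> ^ i \<le> (1 + \<bar>x\<bar>) ^ ?d"
        by (intro order_trans[OF power_mono[of "\<bar>x\<bar>" "1 + \<bar>x\<bar>" i] power_increasing]) auto
      then show "norm (coeff p i * of_real x ^ i) \<le> norm (coeff p i) * (1 + \<bar>x\<bar>) ^ ?d"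
        by (simp add: norm_mult norm_power mult_left_mono)
    qed
    then have p: "norm (poly p (of_real x)) \<le> ?A * (1 + \<bar>x\<bar>) ^ ?d" by (simp add: sum_distrib_right)
    have "norm (exp (- \<i> * of_real \<theta> * of_real x - (complex_of_real x)\<^sup>2)) = exp (- x\<^sup>2)"
      by (simp add: norm_exp_eq_Re)
    then have "(1 + norm x) ^ N * norm (gauss_poly p \<theta> x) = (1 + \<bar>x\<bar>) ^ N * (norm (poly p (of_real x)) * exp (- x\<^sup>2))"
      by (simp add: gauss_poly_def norm_mult)
    also have "\<dots> \<le> (1 + \<bar>x\<bar>) ^ N * ((?A * (1 + \<bar>x\<bar>) ^ ?d) * exp (- x\<^sup>2))"
      using p by (intro mult_left_mono mult_right_mono) auto
    also have "\<dots> = ?A * ((1 + \<bar>x\<bar>) ^ (N + ?d) * exp (- x\<^sup>2))" by (simp add: power_add mult_ac)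
    also have "\<dots> \<le> ?A * C" by (intro mult_left_mono C sum_nonneg) auto
    finally show ?thesis .
  qed
  then show ?thesis by blast
qed

lemma gauss_poly_schwartz: "gauss_poly p \<theta> \<in> schwartz"
proof -
  have "iter_partial bs (gauss_poly p \<theta>) differentiable (at x)" if bs: "bs \<in> lists Basis" for bs x
  proof -
    obtain q where "iter_partial bs (gauss_poly p \<theta>) = gauss_poly q \<theta>" using iter_partial_gauss_poly[OF bs] by blast
    then show ?thesis
      using gauss_poly_derivative[of q \<theta> x] unfolding has_vector_derivative_def by (auto intro: differentiableI)
  qed
  moreover have "\<exists>B. \<forall>x. (1 + norm x) ^ N * norm (iter_partial bs (gauss_poly p \<theta>) x) \<le> B" if bs: "bs \<in> lists Basis" for bs N
  proof -
    obtain q where "iter_partial bs (gauss_poly p \<theta>) = gauss_poly q \<theta>" using iter_partial_gauss_poly[OF bs] by blast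
    then show ?thesis using gauss_poly_bounded[of N q \<theta>] by simp
  qed
  ultimately show ?thesis unfolding schwartz_def smooth_def by blast
qed

text \<open>The positive and negative parts of h have equal Fourier integrals. After normalization
  they are densities of probability measures with the same characteristic function, which Levy's
  uniqueness theorem identifies.\<close>

lemma real_char_zero:
  fixes h :: "real \<Rightarrow> real"
  assumes h: "integrable lborel h" and z: "\<And>\<theta>. (LINT x|lborel. iexp (\<theta> * x) * complex_of_real (h x)) = 0"
  shows "AE x in lborel. h x = 0"
proof -
  define P where "P x = max 0 (h x)" for x
  define Q where "Q x = max 0 (- h x)" for x
  have iP: "integrable lborel P" and iQ: "integrable lborel Q"
    using h unfolding P_def[abs_def] Q_def[abs_def] by auto
  note [measurable] = borel_measurable_integrable[OF iP] borel_measurable_integrable[OF iQ]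
  have hPQ: "h x = P x - Q x" for x by (auto simp: P_def Q_def)
  have iE: "integrable lborel (\<lambda>x. iexp (\<theta> * x) * complex_of_real (g x))" if "integrable lborel g" for g :: "real \<Rightarrow> real" and \<theta>
  proof (rule Bochner_Integration.integrable_bound[OF that])
    note [measurable] = borel_measurable_integrable[OF that]
    show "(\<lambda>x. iexp (\<theta> * x) * complex_of_real (g x)) \<in> borel_measurable lborel" by measurable
    show "AE x in lborel. norm (iexp (\<theta> * x) * complex_of_real (g x)) \<le> norm (g x)"
      by (simp add: norm_mult norm_exp_eq_Re)
  qed
  have eq: "(LINT x|lborel. iexp (\<theta> * x) * complex_of_real (P x)) = (LINT x|lborel. iexp (\<theta> * x) * complex_of_real (Q x))" for \<theta>
  proof -
    have "(LINT x|lborel. iexp (\<theta> * x) * complex_of_real (P x)) - (LINT x|lborel. iexp (\<theta> * x) * complex_of_real (Q x))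
       = (LINT x|lborel. iexp (\<theta> * x) * complex_of_real (h x))"
      unfolding hPQ using iE[OF iP] iE[OF iQ] by (simp add: right_diff_distrib)
    then show ?thesis using z by simp
  qed
  define m where "m = (LINT x|lborel. P x)"
  \<comment> \<open>At \<theta> = 0 the hypothesis says that both parts have the same mass, so one
    constant normalizes both.\<close>
  have mQ: "m = (LINT x|lborel. Q x)"
    using eq[of 0] unfolding m_def by simp
  have m0: "0 \<le> m" unfolding m_def by (intro integral_nonneg_AE) (auto simp: P_def)
  show ?thesis
  proof (cases "m = 0")
    case True
    have "AE x in lborel. 0 \<le> P x" "AE x in lborel. 0 \<le> Q x" by (simp_all add: P_def Q_def)
    then have "AE x in lborel. P x = 0" "AE x in lborel. Q x = 0"
      using integral_nonneg_eq_0_iff_AE[OF iP] integral_nonneg_eq_0_iff_AE[OF iQ] True mQ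
      by (simp_all only: m_def)
    then show ?thesis by eventually_elim (simp add: hPQ)
  next
    case False
    with m0 have m: "m > 0" by simp
    define D where "D g = density lborel (\<lambda>x. ennreal (g x / m))" for g :: "real \<Rightarrow> real"
    have rd: "real_distribution (D g)" and ch: "char (D g) \<theta> = (LINT x|lborel. iexp (\<theta> * x) * complex_of_real (g x)) / of_real m"
      and nn: "(\<integral>\<^sup>+x. ennreal (g x / m) \<partial>lborel) = 1"
      if g: "integrable lborel g" "\<And>x. 0 \<le> g x" "(LINT x|lborel. g x) = m" for g \<theta>
    proof -
      note [measurable] = borel_measurable_integrable[OF g(1)]
      have "(\<integral>\<^sup>+x. ennreal (g x / m) \<partial>lborel) = ennreal (LINT x|lborel. g x / m)"
        using g m by (intro nn_integral_eq_integral) auto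
      also have "(LINT x|lborel. g x / m) = 1" using g m by simp
      finally show nn: "(\<integral>\<^sup>+x. ennreal (g x / m) \<partial>lborel) = 1" by simp
      have "prob_space (D g)"
        by (rule prob_spaceI) (simp add: D_def emeasure_density nn)
      then show "real_distribution (D g)"
        unfolding real_distribution_def real_distribution_axioms_def by (simp add: D_def)
      have "char (D g) \<theta> = (LINT x|lborel. (g x / m) *\<^sub>R iexp (\<theta> * x))"
        unfolding char_def D_def using g(2) m by (intro integral_density) auto
      also have "\<dots> = (LINT x|lborel. (iexp (\<theta> * x) * complex_of_real (g x)) / of_real m)"
        by (intro Bochner_Integration.integral_cong refl) (simp add: scaleR_conv_of_real mult_ac)
      finally show "char (D g) \<theta> = (LINT x|lborel. iexp (\<theta> * x) * complex_of_real (g x)) / of_real m" by simp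
    qed
    have Pnn: "0 \<le> P x" "0 \<le> Q x" for x by (auto simp: P_def Q_def)
    note dP = rd[OF iP Pnn(1) m_def[symmetric]] ch[OF iP Pnn(1) m_def[symmetric]] nn[OF iP Pnn(1) m_def[symmetric]]
    note dQ = rd[OF iQ Pnn(2) mQ[symmetric]] ch[OF iQ Pnn(2) mQ[symmetric]]
    have "char (D P) = char (D Q)" by (rule ext) (simp only: dP(2) dQ(2) eq)
    then have "D P = D Q" by (rule Levy_uniqueness[OF dP(1) dQ(1)])
    then have "AE x in lborel. ennreal (P x / m) = ennreal (Q x / m)"
      unfolding D_def by (subst (asm) finite_density_unique) (auto simp: dP(3))
    then show ?thesis
    proof eventually_elim
      case (elim x)
      then have "P x = Q x" using Pnn[of x] m by simp
      then show ?case by (simp add: hPQ)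
    qed
  qed
qed

text \<open>Conjugation turns \<theta> into -\<theta>, so the conjugate of h satisfies the same
  hypothesis, and with it the real and imaginary parts.\<close>

lemma complex_char_zero:
  fixes h :: "real \<Rightarrow> complex"
  assumes h: "integrable lborel h" and z: "\<And>\<theta>. (LINT x|lborel. iexp (\<theta> * x) * h x) = 0"
  shows "AE x in lborel. h x = 0"
proof -
  have iE: "integrable lborel (\<lambda>x. iexp (\<theta> * x) * g x)" if "integrable lborel g" for g :: "real \<Rightarrow> complex" and \<theta>
  proof (rule Bochner_Integration.integrable_bound[OF that])
    note [measurable] = borel_measurable_integrable[OF that]
    show "(\<lambda>x. iexp (\<theta> * x) * g x) \<in> borel_measurable lborel" by measurable
    show "AE x in lborel. norm (iexp (\<theta> * x) * g x) \<le> norm (g x)"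
      by (simp add: norm_mult norm_exp_eq_Re)
  qed
  have hc: "integrable lborel (\<lambda>x. cnj (h x))" using h by simp
  have zc: "(LINT x|lborel. iexp (\<theta> * x) * cnj (h x)) = 0" for \<theta>
  proof -
    have "(LINT x|lborel. iexp (\<theta> * x) * cnj (h x)) = (LINT x|lborel. cnj (iexp ((- \<theta>) * x) * h x))"
      by (intro Bochner_Integration.integral_cong refl) (simp add: exp_cnj)
    also have "\<dots> = cnj (LINT x|lborel. iexp ((- \<theta>) * x) * h x)" by (rule Bochner_Integration.integral_cnj)
    finally show ?thesis using z[of "- \<theta>"] by simp
  qed
  have "AE x in lborel. Re (h x) = 0"
  proof (rule real_char_zero)
    show "integrable lborel (\<lambda>x. Re (h x))" using h by simp
    fix \<theta>
    have "(LINT x|lborel. iexp (\<theta> * x) * complex_of_real (Re (h x))) = (LINT x|lborel. (iexp (\<theta> * x) * h x + iexp (\<theta> * x) * cnj (h x)) / 2)"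
      by (intro Bochner_Integration.integral_cong refl) (simp add: distrib_left[symmetric] complex_add_cnj)
    also have "\<dots> = 0" using iE[OF h, of \<theta>] iE[OF hc, of \<theta>] z[of \<theta>] zc[of \<theta>] by simp
    finally show "(LINT x|lborel. iexp (\<theta> * x) * complex_of_real (Re (h x))) = 0" .
  qed
  moreover have "AE x in lborel. Im (h x) = 0"
  proof (rule real_char_zero)
    show "integrable lborel (\<lambda>x. Im (h x))" using h by simp
    fix \<theta>
    have "(LINT x|lborel. iexp (\<theta> * x) * complex_of_real (Im (h x))) = (LINT x|lborel. (iexp (\<theta> * x) * h x - iexp (\<theta> * x) * cnj (h x)) / (2 * \<i>))"
    proof (intro Bochner_Integration.integral_cong refl)
      fix x
      have "complex_of_real (Im w) = (w - cnj w) / (2 * \<i>)" for w by (simp add: complex_eq_iff)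
      then show "iexp (\<theta> * x) * complex_of_real (Im (h x)) = (iexp (\<theta> * x) * h x - iexp (\<theta> * x) * cnj (h x)) / (2 * \<i>)"
        by (simp only: right_diff_distrib[symmetric] times_divide_eq_right)
    qed
    also have "\<dots> = 0" using iE[OF h, of \<theta>] iE[OF hc, of \<theta>] z[of \<theta>] zc[of \<theta>] by simp
    finally show "(LINT x|lborel. iexp (\<theta> * x) * complex_of_real (Im (h x))) = 0" .
  qed
  ultimately show ?thesis by eventually_elim (simp add: complex_eq_iff)
qed

text \<open>Testing against modulated Gaussians says that d times a Gaussian has vanishing Fourier
  transform. The Gaussian makes the product integrable and has no zeros, so d itself
  vanishes.\<close>

lemma schwartz_test_zero:
  fixes d :: "real \<Rightarrow> complex"
  assumes "\<And>\<psi>. \<psi> \<in> schwartz \<Longrightarrow> integrable lborel (\<lambda>x. d x * \<psi> x)"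
    and "\<And>\<psi>. \<psi> \<in> schwartz \<Longrightarrow> (LINT x|lborel. d x * \<psi> x) = 0"
  shows "AE x in lborel. d x = 0"
proof -
  have gp: "gauss_poly 1 (- \<theta>) x = iexp (\<theta> * x) * gauss_poly 1 0 x" for \<theta> x
    unfolding gauss_poly_def by (simp add: exp_diff mult_ac exp_minus divide_inverse)
  have "AE x in lborel. d x * gauss_poly 1 0 x = 0"
  proof (rule complex_char_zero)
    show "integrable lborel (\<lambda>x. d x * gauss_poly 1 0 x)" by (intro assms gauss_poly_schwartz)
    fix \<theta>
    have "(LINT x|lborel. iexp (\<theta> * x) * (d x * gauss_poly 1 0 x)) = (LINT x|lborel. d x * gauss_poly 1 (- \<theta>) x)"
      unfolding gp by (simp add: mult_ac)
    then show "(LINT x|lborel. iexp (\<theta> * x) * (d x * gauss_poly 1 0 x)) = 0"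
      using assms(2)[OF gauss_poly_schwartz] by simp
  qed
  then show ?thesis by eventually_elim (simp add: gauss_poly_def)
qed

lemma dist_is_function_unique:
  fixes g g' :: "real \<Rightarrow> complex"
  assumes "dist_is_function u g" "dist_is_function u g'"
  shows "AE x in lborel. g x = g' x"
proof -
  have "AE x in lborel. g x - g' x = 0"
  proof (rule schwartz_test_zero)
    fix \<psi> :: "real \<Rightarrow> complex" assume "\<psi> \<in> schwartz"
    then have i: "integrable lborel (\<lambda>x. g x * \<psi> x)" "integrable lborel (\<lambda>x. g' x * \<psi> x)"
      and e: "(LINT x|lborel. g x * \<psi> x) = (LINT x|lborel. g' x * \<psi> x)"
      using assms unfolding dist_is_function_def by metis+
    from i show "integrable lborel (\<lambda>x. (g x - g' x) * \<psi> x)" by (simp add: left_diff_distrib)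
    from i e show "(LINT x|lborel. (g x - g' x) * \<psi> x) = 0" by (simp add: left_diff_distrib)
  qed
  then show ?thesis by eventually_elim simp
qed

section \<open>Test functions as elements of the Hilbert space\<close>

lemma schwartz_continuous: "\<psi> \<in> schwartz \<Longrightarrow> continuous_on UNIV \<psi>"
  unfolding schwartz_def using smooth_continuous[of \<psi> "[]"] by auto

lemma schwartz_integrable:
  fixes \<psi> :: "real \<Rightarrow> complex"
  assumes "\<psi> \<in> schwartz" shows "integrable lborel \<psi>"
proof -
  have "\<forall>N. \<exists>B. \<forall>x. (1 + norm x) ^ N * norm (iter_partial [] \<psi> x) \<le> B"
    using assms lists.Nil unfolding schwartz_def by blast
  then obtain B where B: "\<And>x. (1 + norm x) ^ 2 * norm (\<psi> x) \<le> B" by (metis iter_partial.simps(1))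
  have "integrable lborel (\<lambda>x::real. inverse (1 + x\<^sup>2))"
    using integrable_inverse_1_plus_square unfolding set_integrable_def by simp
  then have i: "integrable lborel (\<lambda>x::real. B * inverse (1 + x\<^sup>2))" by simp
  show ?thesis
  proof (rule Bochner_Integration.integrable_bound[OF i])
    show "\<psi> \<in> borel_measurable lborel"
      using borel_measurable_continuous_onI[OF schwartz_continuous[OF assms]] by simp
    have "norm (\<psi> x) \<le> B * inverse (1 + x\<^sup>2)" for x
    proof -
      have "1 + x\<^sup>2 \<le> (1 + norm x) ^ 2" by (simp add: power2_sum)
      then have "(1 + x\<^sup>2) * norm (\<psi> x) \<le> B"
        using order_trans[OF mult_right_mono B] by simp
      moreover have "0 < 1 + x\<^sup>2" by (simp add: add_pos_nonneg)
      ultimately show ?thesis by (simp add: field_simps)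
    qed
    then show "AE x in lborel. norm (\<psi> x) \<le> norm (B * inverse (1 + x\<^sup>2))"
      by (auto intro: order_trans[OF _ abs_ge_self])
  qed
qed

text \<open>A test function as the family of distributions that \<open>hilbert_H\<close> expects of
  its elements.\<close>

definition test_dist :: "(real \<times> real \<Rightarrow> complex) \<Rightarrow> real \<Rightarrow> (real \<Rightarrow> complex) \<Rightarrow> complex" where
  "test_dist \<phi> t \<psi> = (LINT x|lborel. \<phi> (t, x) * \<psi> x)"

lemma integrable_times_bounded:
  fixes f g :: "real \<Rightarrow> complex"
  assumes "integrable lborel f" and [measurable]: "g \<in> borel_measurable borel" and B: "\<And>x. norm (g x) \<le> B"
  shows "integrable lborel (\<lambda>x. f x * g x)"
proof (rule Bochner_Integration.integrable_bound)
  show "integrable lborel (\<lambda>x. B * norm (f x))" using assms(1) by simp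
  note [measurable] = borel_measurable_integrable[OF assms(1)]
  show "(\<lambda>x. f x * g x) \<in> borel_measurable lborel" by measurable
  have "norm (f x * g x) \<le> norm (B * norm (f x))" for x
  proof -
    have "norm (f x * g x) \<le> norm (f x) * B" unfolding norm_mult by (intro mult_left_mono B) auto
    also have "\<dots> \<le> norm (B * norm (f x))" by (simp add: mult.commute)
    finally show ?thesis .
  qed
  then show "AE x in lborel. norm (f x * g x) \<le> norm (B * norm (f x))" by simp
qed

lemma tempered_test_dist:
  assumes \<phi>: "\<phi> \<in> test_functions K" shows "tempered (test_dist \<phi> t)"
proof -
  have i\<phi>: "integrable lborel (\<lambda>x. \<phi> (t, x))" by (rule integrable_test_slice[OF \<phi>])
  have i: "integrable lborel (\<lambda>x. \<phi> (t, x) * \<psi> x)" and bnd: "(\<And>x. norm (\<psi> x) \<le> B) \<Longrightarrow> norm (test_dist \<phi> t \<psi>) \<le> (LINT x|lborel. norm (\<phi> (t, x))) * B"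
    if "\<psi> \<in> schwartz" for \<psi> B
  proof -
    have [measurable]: "\<psi> \<in> borel_measurable borel"
      by (intro borel_measurable_continuous_onI schwartz_continuous that)
    have "\<exists>B. \<forall>x. (1 + norm x) ^ 0 * norm (iter_partial [] \<psi> x) \<le> B"
      using that lists.Nil unfolding schwartz_def by blast
    then obtain B0 where B0: "\<And>x. norm (\<psi> x) \<le> B0" by auto
    show ii: "integrable lborel (\<lambda>x. \<phi> (t, x) * \<psi> x)" by (rule integrable_times_bounded[OF i\<phi> _ B0]) measurable
    assume B: "\<And>x. norm (\<psi> x) \<le> B"
    have "norm (test_dist \<phi> t \<psi>) \<le> (LINT x|lborel. norm (\<phi> (t, x) * \<psi> x))"
      unfolding test_dist_def by (rule integral_norm_bound)
    also have "\<dots> \<le> (LINT x|lborel. norm (\<phi> (t, x)) * B)"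
    proof (rule integral_mono)
      show "integrable lborel (\<lambda>x. norm (\<phi> (t, x) * \<psi> x))" using ii by (rule integrable_norm)
      show "integrable lborel (\<lambda>x. norm (\<phi> (t, x)) * B)" using i\<phi> by simp
    qed (auto simp: norm_mult intro: mult_left_mono B)
    finally show "norm (test_dist \<phi> t \<psi>) \<le> (LINT x|lborel. norm (\<phi> (t, x))) * B" by simp
  qed
  have lin: "test_dist \<phi> t (\<lambda>x. a * \<psi> x + b * \<eta> x) = a * test_dist \<phi> t \<psi> + b * test_dist \<phi> t \<eta>"
    if "\<psi> \<in> schwartz" "\<eta> \<in> schwartz" for \<psi> \<eta> a b
  proof -
    have "test_dist \<phi> t (\<lambda>x. a * \<psi> x + b * \<eta> x) = (LINT x|lborel. a * (\<phi> (t, x) * \<psi> x) + b * (\<phi> (t, x) * \<eta> x))"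
      unfolding test_dist_def by (intro Bochner_Integration.integral_cong refl) (simp add: algebra_simps)
    also have "\<dots> = a * test_dist \<phi> t \<psi> + b * test_dist \<phi> t \<eta>"
      unfolding test_dist_def using i[OF that(1)] i[OF that(2)] by simp
    finally show ?thesis .
  qed
  have cont: "\<exists>C N. \<forall>\<psi>\<in>schwartz. \<forall>B. (\<forall>bs\<in>lists Basis. length bs \<le> N \<longrightarrow>
           (\<forall>x. (1 + norm x) ^ N * norm (iter_partial bs \<psi> x) \<le> B)) \<longrightarrow> norm (test_dist \<phi> t \<psi>) \<le> C * B"
  \<comment> \<open>A distribution of order 0: the supremum norm of the test function suffices, and
    the constant is the L1 norm of the slice.\<close>
  proof (intro exI[of _ "LINT x|lborel. norm (\<phi> (t, x))"] exI[of _ 0] ballI allI impI)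
    fix \<psi> :: "real \<Rightarrow> complex" and B assume s: "\<psi> \<in> schwartz"
      and b: "\<forall>bs\<in>lists Basis. length bs \<le> 0 \<longrightarrow> (\<forall>x. (1 + norm x) ^ 0 * norm (iter_partial bs \<psi> x) \<le> B)"
    have "norm (\<psi> x) \<le> B" for x using bspec[OF b lists.Nil] by simp
    then show "norm (test_dist \<phi> t \<psi>) \<le> (LINT x|lborel. norm (\<phi> (t, x))) * B" by (rule bnd[OF s])
  qed
  show ?thesis unfolding tempered_def using lin cont by blast
qed

text \<open>Fubini moves the transform from the Schwartz function to the slice; the product of the
  two functions is integrable on the plane.\<close>

lemma fourier_test_dist:
  assumes \<phi>: "\<phi> \<in> test_functions K"
  shows "dist_is_function (fourier_dist (test_dist \<phi> t)) (\<lambda>\<xi>. test_ft \<phi> (t, \<xi>))"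
  unfolding dist_is_function_def
proof (intro ballI conjI)
  fix \<psi> :: "real \<Rightarrow> complex" assume s: "\<psi> \<in> schwartz"
  have i\<phi>: "integrable lborel (\<lambda>x. \<phi> (t, x))" by (rule integrable_test_slice[OF \<phi>])
  have i\<psi>: "integrable lborel \<psi>" by (rule schwartz_integrable[OF s])
  note [measurable] = borel_measurable_integrable[OF i\<phi>, simplified] borel_measurable_integrable[OF i\<psi>, simplified] measurable_test_ft[OF \<phi>]
  have "integrable lborel (\<lambda>\<xi>. \<psi> \<xi> * test_ft \<phi> (t, \<xi>))"
  proof (rule integrable_times_bounded[OF i\<psi>])
    show "(\<lambda>\<xi>. test_ft \<phi> (t, \<xi>)) \<in> borel_measurable borel" by measurable
    show "norm (test_ft \<phi> (t, \<xi>)) \<le> (LINT x|lborel. norm (\<phi> (t, x)))" for \<xi>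
      unfolding test_ft_def by (simp add: norm_fourier_le)
  qed
  then show "integrable lborel (\<lambda>\<xi>. test_ft \<phi> (t, \<xi>) * \<psi> \<xi>)" by (simp add: mult.commute)
  let ?f = "\<lambda>x y. \<phi> (t, x) * (exp (- \<i> * complex_of_real (x \<bullet> y)) * \<psi> y)"
  have m: "case_prod ?f \<in> borel_measurable (lborel \<Otimes>\<^sub>M lborel)" by measurable
  have nf: "norm (?f x y) = norm (\<phi> (t, x)) * norm (\<psi> y)" for x y
    unfolding norm_mult norm_exp_imaginary by simp
  have int: "integrable (lborel \<Otimes>\<^sub>M lborel) (case_prod ?f)"
  proof (rule lborel_pair.Fubini_integrable[OF m])
    show "integrable lborel (\<lambda>x. LINT y|lborel. norm (case_prod ?f (x, y)))"
      unfolding prod.case nf using i\<phi> by simp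
    show "AE x in lborel. integrable lborel (\<lambda>y. case_prod ?f (x, y))"
      unfolding prod.case using integrable_fourier[OF i\<psi>] by (intro AE_I2 integrable_mult_right)
  qed
  have "fourier_dist (test_dist \<phi> t) \<psi> = (LINT x|lborel. (LINT y|lborel. ?f x y))"
    unfolding fourier_dist_def test_dist_def fourier_def by simp
  also have "\<dots> = (LINT y|lborel. (LINT x|lborel. ?f x y))"
    by (rule lborel_pair.Fubini_integral[OF int, symmetric])
  also have "\<dots> = (LINT y|lborel. (LINT x|lborel. (exp (- \<i> * complex_of_real (y \<bullet> x)) * \<phi> (t, x)) * \<psi> y))"
    by (simp add: mult_ac)
  also have "\<dots> = (LINT \<xi>|lborel. test_ft \<phi> (t, \<xi>) * \<psi> \<xi>)"
    unfolding test_ft_def fourier_def by simp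
  finally show "fourier_dist (test_dist \<phi> t) \<psi> = (LINT \<xi>|lborel. test_ft \<phi> (t, \<xi>) * \<psi> \<xi>)" .
qed

lemma is_space_ft_test: "\<phi> \<in> test_functions K \<Longrightarrow> is_space_ft (test_dist \<phi>) (test_ft \<phi>)"
  unfolding is_space_ft_def using tempered_test_dist fourier_test_dist by (auto intro: measurable_test_ft)

lemma space_ft_measurable: "\<exists>G. is_space_ft f G \<Longrightarrow> space_ft f \<in> borel_measurable borel"
proof -
  assume "\<exists>G. is_space_ft f G"
  then have "is_space_ft f (space_ft f)"
    unfolding space_ft_def by (rule someI_ex[of "is_space_ft f"])
  then show ?thesis by (simp add: is_space_ft_def)
qed

lemma sigma_finite_restrict_orthant: "sigma_finite_measure (restrict_space lborel (orthant :: real set))"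
  by (rule sigma_finite_measure_restrict_space[OF sigma_finite_lborel]) simp

text \<open>The chosen transform and the classical one represent the same distribution for almost
  every time, hence agree almost everywhere by \<open>dist_is_function_unique\<close>.\<close>

lemma space_ft_test:
  assumes \<phi>: "\<phi> \<in> test_functions K"
  shows "AE z in spectral_measure H. space_ft (test_dist \<phi>) z = test_ft \<phi> z"
proof -
  let ?G = "space_ft (test_dist \<phi>)"
  have G: "is_space_ft (test_dist \<phi>) ?G"
    unfolding space_ft_def by (rule someI[of "is_space_ft (test_dist \<phi>)", OF is_space_ft_test[OF \<phi>]])
  then have Gm: "?G \<in> borel_measurable borel" by (simp add: is_space_ft_def)
  have "AE t in restrict_space lborel orthant. AE \<xi> in lborel. ?G (t, \<xi>) = test_ft \<phi> (t, \<xi>)"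
    using conjunct2[OF G[unfolded is_space_ft_def]]
    by eventually_elim (use fourier_test_dist[OF \<phi>] dist_is_function_unique in blast)
  then have ae: "AE t in restrict_space lborel orthant. AE \<xi> in mu_H H. ?G (t, \<xi>) = test_ft \<phi> (t, \<xi>)"
  proof eventually_elim
    case (elim t)
    \<comment> \<open>Null sets of Lebesgue measure are null sets of \<open>mu_H\<close>, which has
      a density.\<close>
    then show ?case unfolding mu_H_def by (subst AE_density) auto
  qed
  interpret A: sigma_finite_measure "restrict_space lborel (orthant :: real set)" by (rule sigma_finite_restrict_orthant)
  interpret B: sigma_finite_measure "mu_H H :: real measure" by (rule sigma_finite_mu_H)
  interpret P: pair_sigma_finite "restrict_space lborel (orthant :: real set)" "mu_H H :: real measure" ..
  have m: "?G \<in> borel_measurable (spectral_measure H)" "test_ft \<phi> \<in> borel_measurable (spectral_measure H)"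
    by (intro measurable_spectral Gm measurable_test_ft[OF \<phi>])+
  have "{z \<in> space (spectral_measure H). ?G z = test_ft \<phi> z} \<in> sets (spectral_measure H)"
    using m by measurable
  then show ?thesis
    unfolding spectral_measure_def using ae by (rule P.AE_pair_measure)
qed

text \<open>Makes the completeness of the basis \<open>e\<close> applicable to test functions; the
  approximating sequence is constant.\<close>

lemma test_dist_hilbert:
  assumes \<phi>: "\<phi> \<in> test_functions K" and K: "1 \<in> K"
  shows "test_dist \<phi> \<in> hilbert_H K H"
proof -
  let ?S = "\<lambda>_::nat. [(1 :: complex, \<lambda>_::real. \<phi>)]"
  have "(\<lambda>(t, \<xi>). fourier (\<lambda>x. \<Sum>(c, \<phi>)\<leftarrow>[(1 :: complex, \<lambda>_::real. \<phi>)]. c * (\<Prod>b\<in>Basis. \<phi> b (t \<bullet> b, x \<bullet> b))) \<xi>) = test_ft \<phi>"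
    by (simp add: fun_eq_iff test_ft_def)
  moreover have "L2d (spectral_measure H) (test_ft \<phi>) (space_ft (test_dist \<phi>)) = 0"
  proof -
    have "L2d (spectral_measure H) (test_ft \<phi>) (space_ft (test_dist \<phi>)) = L2d (spectral_measure H) (test_ft \<phi>) (test_ft \<phi>)"
      by (rule L2d_cong_AE[OF _ space_ft_test[OF \<phi>]]) simp
    then show ?thesis by simp
  qed
  ultimately have "L2_tendsto (spectral_measure H)
      (\<lambda>k (t, \<xi>). fourier (\<lambda>x. \<Sum>(c, \<phi>)\<leftarrow>?S k. c * (\<Prod>b\<in>Basis. \<phi> b (t \<bullet> b, x \<bullet> b))) \<xi>) (space_ft (test_dist \<phi>))"
    unfolding L2_tendsto_L2d by simp
  then show ?thesis
    unfolding hilbert_H_def using is_space_ft_test[OF \<phi>] K \<phi>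
    by (intro CollectI conjI exI[of _ "test_ft \<phi>"] exI[of _ ?S]) auto
qed

section \<open>Mean-square approximation\<close>

definition L2_approx :: "'b measure \<Rightarrow> ('b \<Rightarrow> complex) set \<Rightarrow> ('b \<Rightarrow> complex) \<Rightarrow> bool" where
  "L2_approx N P g \<longleftrightarrow> (\<forall>\<epsilon>>0. \<exists>u\<in>P. L2d N u g < ennreal \<epsilon>)"

lemma L2_approx_sequence:
  assumes "L2_approx N P g"
  obtains u where "\<And>k::nat. u k \<in> P" "L2_tendsto N u g"
proof -
  have "\<exists>u\<in>P. L2d N u g < ennreal (1 / real (Suc k))" for k
  proof -
    have "0 < 1 / real (Suc k)" by simp
    then show ?thesis using assms unfolding L2_approx_def by blast
  qed
  then have "\<forall>k. \<exists>u. u \<in> P \<and> L2d N u g < ennreal (1 / real (Suc k))" by blast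
  from choice[OF this] obtain u where u: "\<forall>k. u k \<in> P \<and> L2d N (u k) g < ennreal (1 / real (Suc k))" by blast
  have "L2_tendsto N u g"
    unfolding L2_tendsto_L2d ennreal_lim_0_iff
  proof (intro allI impI)
    fix \<epsilon> :: real assume e: "0 < \<epsilon>"
    obtain k0 where k0: "1 / \<epsilon> < real k0" using reals_Archimedean2 by blast
    have "L2d N (u k) g < ennreal \<epsilon>" if "k \<ge> k0" for k
    proof -
      have "1 / \<epsilon> < real (Suc k)" using k0 that by simp
      then have "1 / real (Suc k) \<le> \<epsilon>" using e by (simp add: field_simps)
      then show ?thesis using u by (meson ennreal_leI less_le_trans)
    qed
    then show "\<exists>k0. \<forall>k\<ge>k0. L2d N (u k) g < ennreal \<epsilon>" by blast
  qed
  with u that show ?thesis by blast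
qed

lemma L2_approx_incl: "u \<in> P \<Longrightarrow> L2_approx N P u"
  unfolding L2_approx_def by (auto intro!: bexI[of _ u])

lemma L2_approx_limit:
  assumes P: "\<And>u. u \<in> P \<Longrightarrow> u \<in> borel_measurable N"
    and g: "\<And>k::nat. L2_approx N P (g k)" "\<And>k. g k \<in> borel_measurable N" "h \<in> borel_measurable N"
    and lim: "L2_tendsto N g h"
  shows "L2_approx N P h"
  unfolding L2_approx_def
proof (intro allI impI)
  fix \<epsilon> :: real assume e: "0 < \<epsilon>"
  then have e4: "0 < \<epsilon> / 4" by simp
  then obtain k where k: "L2d N (g k) h < ennreal (\<epsilon> / 4)"
    using lim unfolding L2_tendsto_L2d ennreal_lim_0_iff by blast
  obtain u where u: "u \<in> P" "L2d N u (g k) < ennreal (\<epsilon> / 4)"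
    using g(1)[of k] e4 unfolding L2_approx_def by blast
  have "L2d N u h \<le> 2 * L2d N u (g k) + 2 * L2d N (g k) h" by (intro L2d_triangle P u g)
  also have "\<dots> < 2 * ennreal (\<epsilon> / 4) + 2 * ennreal (\<epsilon> / 4)"
    using u k by (intro add_strict_mono ennreal_mult_strict_left_mono) (auto simp: ennreal_numeral_less_top)
  also have "\<dots> = ennreal \<epsilon>"
    using e by (simp add: ennreal_mult'[symmetric] ennreal_plus[symmetric] ennreal_numeral[symmetric] del: ennreal_plus ennreal_numeral)
  finally show "\<exists>u\<in>P. L2d N u h < ennreal \<epsilon>" using u(1) by blast
qed

lemma L2_approx_add:
  assumes P: "\<And>u. u \<in> P \<Longrightarrow> u \<in> borel_measurable N" "\<And>u v. u \<in> P \<Longrightarrow> v \<in> P \<Longrightarrow> (\<lambda>z. u z + v z) \<in> P"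
    and g: "L2_approx N P g" "L2_approx N P h" "g \<in> borel_measurable N" "h \<in> borel_measurable N"
  shows "L2_approx N P (\<lambda>z. g z + h z)"
proof -
  obtain u where u: "\<And>k::nat. u k \<in> P" "L2_tendsto N u g" using L2_approx_sequence[OF g(1)] by blast
  obtain v where v: "\<And>k::nat. v k \<in> P" "L2_tendsto N v h" using L2_approx_sequence[OF g(2)] by blast
  have "L2_tendsto N (\<lambda>k z. u k z + v k z) (\<lambda>z. g z + h z)"
    by (intro L2_tendsto_add P(1) u v g)
  then show ?thesis
    by (rule L2_approx_limit[OF P(1), rotated -1])
      (auto intro!: L2_approx_incl P(2) u v g borel_measurable_add P(1)[OF u(1)] P(1)[OF v(1)])
qed

lemma L2_approx_scale:
  assumes P: "\<And>u. u \<in> P \<Longrightarrow> u \<in> borel_measurable N" "\<And>u. u \<in> P \<Longrightarrow> (\<lambda>z. a * u z) \<in> P"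
    and g: "L2_approx N P g" "g \<in> borel_measurable N"
  shows "L2_approx N P (\<lambda>z. a * g z)"
proof -
  obtain u where u: "\<And>k::nat. u k \<in> P" "L2_tendsto N u g" using L2_approx_sequence[OF g(1)] by blast
  have "L2_tendsto N (\<lambda>k z. a * u k z) (\<lambda>z. a * g z)"
    by (intro L2_tendsto_scale P(1) u g)
  then show ?thesis
    by (rule L2_approx_limit[OF P(1), rotated -1])
      (auto intro!: L2_approx_incl P(2) u g borel_measurable_times P(1)[OF u(1)])
qed

lemma L2_approx_sum_list:
  assumes P: "\<And>u. u \<in> P \<Longrightarrow> u \<in> borel_measurable N" "\<And>u v. u \<in> P \<Longrightarrow> v \<in> P \<Longrightarrow> (\<lambda>z. u z + v z) \<in> P"
    "(\<lambda>z. 0) \<in> P" "\<And>a u. a \<in> K \<Longrightarrow> u \<in> P \<Longrightarrow> (\<lambda>z. a * u z) \<in> P"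
    and L: "\<And>x. x \<in> set L \<Longrightarrow> c x \<in> K" "\<And>x. x \<in> set L \<Longrightarrow> L2_approx N P (g x)"
      "\<And>x. x \<in> set L \<Longrightarrow> g x \<in> borel_measurable N"
  shows "L2_approx N P (\<lambda>z. \<Sum>x\<leftarrow>L. c x * g x z)"
  using L
proof (induction L)
  case Nil
  then show ?case using L2_approx_incl[OF P(3)] by simp
next
  case (Cons x L)
  have "L2_approx N P (\<lambda>z. c x * g x z + (\<Sum>x\<leftarrow>L. c x * g x z))"
  proof (rule L2_approx_add[OF P(1,2)])
    show "L2_approx N P (\<lambda>z. c x * g x z)"
      using Cons.prems by (intro L2_approx_scale[OF P(1) P(4)]) auto
    show "L2_approx N P (\<lambda>z. \<Sum>x\<leftarrow>L. c x * g x z)" using Cons by auto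
    show "(\<lambda>z. c x * g x z) \<in> borel_measurable N"
      using Cons.prems(3)[of x] by (intro borel_measurable_times) auto
    show "(\<lambda>z. \<Sum>x\<leftarrow>L. c x * g x z) \<in> borel_measurable N"
      using Cons.prems(3) by (intro measurable_sum_list borel_measurable_times) auto
  qed
  then show ?case by simp
qed

text \<open>Coefficients are confined to K because the defining sequences of I_n^H admit no others:
  for K = \<real> the approximation has to be real linear.\<close>

definition tensor_span :: "complex set \<Rightarrow> ('a \<Rightarrow> nat \<Rightarrow> real \<times> real \<Rightarrow> complex) \<Rightarrow> ('a::euclidean_space \<times> 'a \<Rightarrow> complex) set" where
  "tensor_span K u = {\<lambda>z. \<Sum>(c, \<sigma>)\<leftarrow>L. c * tensor (\<lambda>b. u b (\<sigma> b)) z |L. \<forall>(c, \<sigma>)\<in>set L. c \<in> K}"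

lemma tensor_span_closed:
  assumes K: "\<And>a b. a \<in> K \<Longrightarrow> b \<in> K \<Longrightarrow> a * b \<in> K"
  shows "(\<lambda>z. 0) \<in> tensor_span K u"
    "v \<in> tensor_span K u \<Longrightarrow> w \<in> tensor_span K u \<Longrightarrow> (\<lambda>z. v z + w z) \<in> tensor_span K u"
    "a \<in> K \<Longrightarrow> v \<in> tensor_span K u \<Longrightarrow> (\<lambda>z. a * v z) \<in> tensor_span K u"
proof -
  let ?f = "\<lambda>L z. \<Sum>(c, \<sigma>)\<leftarrow>L. c * tensor (\<lambda>b. u b (\<sigma> b)) z"
  show "(\<lambda>z. 0) \<in> tensor_span K u"
    unfolding tensor_span_def by (intro CollectI exI[of _ "[]"]) auto
  show "(\<lambda>z. v z + w z) \<in> tensor_span K u" if v: "v \<in> tensor_span K u" and w: "w \<in> tensor_span K u"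
  proof -
    obtain L L' where L: "v = ?f L" "\<forall>(c, \<sigma>)\<in>set L. c \<in> K" "w = ?f L'" "\<forall>(c, \<sigma>)\<in>set L'. c \<in> K"
      using v w unfolding tensor_span_def by blast
    show ?thesis unfolding tensor_span_def
      by (intro CollectI exI[of _ "L @ L'"] conjI) (use L in auto)
  qed
  show "(\<lambda>z. a * v z) \<in> tensor_span K u" if a: "a \<in> K" and v: "v \<in> tensor_span K u"
  proof -
    obtain L where L: "v = ?f L" "\<forall>(c, \<sigma>)\<in>set L. c \<in> K"
      using v unfolding tensor_span_def by blast
    let ?L = "scale_list a L"
    have "?f ?L z = a * ?f L z" for z
      unfolding scale_list_def by (induction L) (auto simp: distrib_left mult.assoc)
    moreover have "\<forall>(c, \<sigma>)\<in>set ?L. c \<in> K" using L(2) K[OF a] unfolding scale_list_def by auto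
    ultimately show ?thesis unfolding tensor_span_def L(1)
      by (intro CollectI exI[of _ ?L] conjI) auto
  qed
qed

lemma measurable_tensor_span:
  assumes u: "\<And>b j. b \<in> Basis \<Longrightarrow> u b j \<in> borel_measurable borel" and v: "v \<in> tensor_span K u"
  shows "v \<in> borel_measurable (borel :: ('a::euclidean_space \<times> 'a) measure)"
proof -
  obtain L where "v = (\<lambda>z. \<Sum>x\<leftarrow>L. fst x * tensor (\<lambda>b. u b (snd x b)) z)"
    using v unfolding tensor_span_def case_prod_beta' by blast
  then show ?thesis
    by (auto intro!: measurable_sum_list borel_measurable_times measurable_tensor u)
qed

text \<open>Replaces one factor at a time by linear combinations of the generators.\<close>

lemma tensor_approx:
  fixes u :: "nat \<Rightarrow> real \<times> real \<Rightarrow> complex" and h :: "'a::euclidean_space \<Rightarrow> real \<times> real \<Rightarrow> complex"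
  assumes K: "\<And>a b. a \<in> K \<Longrightarrow> b \<in> K \<Longrightarrow> a * b \<in> K" "1 \<in> K"
    and u: "\<And>j. u j \<in> borel_measurable borel" "\<And>j. L2d leb_plus (u j) (\<lambda>_. 0) < \<infinity>"
    and h: "\<And>b. b \<in> Basis \<Longrightarrow> h b \<in> borel_measurable borel" "\<And>b. b \<in> Basis \<Longrightarrow> L2d leb_plus (h b) (\<lambda>_. 0) < \<infinity>"
      "\<And>b. b \<in> Basis \<Longrightarrow> \<exists>a :: nat \<Rightarrow> nat \<Rightarrow> complex. (\<forall>k j. a k j \<in> K) \<and> L2_tendsto leb_plus (\<lambda>k z. \<Sum>j<k. a k j * u j z) (h b)"
  shows "L2_approx leb_plus (tensor_span K (\<lambda>_. u)) (tensor h)"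
proof -
  let ?B = "Basis :: 'a set" and ?P = "tensor_span K (\<lambda>_::'a. u)"
  have Pm: "v \<in> borel_measurable leb_plus" if "v \<in> ?P" for v
    by (intro measurable_leb_plus measurable_tensor_span[OF _ that] u)
  have "L2_approx leb_plus ?P (tensor h)"
    if "finite D" "D \<subseteq> ?B" "\<And>b. b \<in> ?B \<Longrightarrow> h b \<in> borel_measurable borel" "\<And>b. b \<in> ?B \<Longrightarrow> L2d leb_plus (h b) (\<lambda>_. 0) < \<infinity>"
      "\<And>b. b \<in> D \<Longrightarrow> \<exists>a :: nat \<Rightarrow> nat \<Rightarrow> complex. (\<forall>k j. a k j \<in> K) \<and> L2_tendsto leb_plus (\<lambda>k z. \<Sum>j<k. a k j * u j z) (h b)"
      "\<And>b. b \<in> ?B - D \<Longrightarrow> \<exists>j. h b = u j" for D h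
    using that
  proof (induction D arbitrary: h)
    case empty
    then have "\<forall>b\<in>?B. \<exists>j. h b = u j" by blast
    from bchoice[OF this] obtain \<sigma> where s: "\<forall>b\<in>?B. h b = u (\<sigma> b)" by blast
    have "tensor h z = (\<Sum>(c, \<sigma>)\<leftarrow>[(1, \<sigma>)]. c * tensor (\<lambda>b. u (\<sigma> b)) z)" for z
      using s by (simp add: tensor_def)
    then have "tensor h \<in> ?P"
      unfolding tensor_span_def using K(2) by (intro CollectI exI[of _ "[(1, \<sigma>)]"] conjI ext) auto
    then show ?case by (rule L2_approx_incl)
  next
    case (insert d D)
    have d: "d \<in> ?B" using insert.prems by auto
    obtain a :: "nat \<Rightarrow> nat \<Rightarrow> complex" where a: "\<forall>k j. a k j \<in> K" "L2_tendsto leb_plus (\<lambda>k z. \<Sum>j<k. a k j * u j z) (h d)"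
      using insert.prems(4)[of d] by blast
    define F where "F k z = (\<Sum>j<k. a k j * u j z)" for k z
    have Fm: "F k \<in> borel_measurable borel" for k unfolding F_def[abs_def] using u(1) by measurable
    have tm: "tensor (h(d := v)) \<in> borel_measurable leb_plus" if "v \<in> borel_measurable borel" for v
      using that insert.prems(2) by (intro measurable_leb_plus measurable_tensor) auto
    have one: "L2_approx leb_plus ?P (tensor (h(d := u j)))" for j
    proof (rule insert.IH)
      show "D \<subseteq> ?B" using insert.prems by auto
      show "(h(d := u j)) b \<in> borel_measurable borel" if "b \<in> ?B" for b using insert.prems(2)[OF that] u by simp
      show "L2d leb_plus ((h(d := u j)) b) (\<lambda>_. 0) < \<infinity>" if "b \<in> ?B" for b using insert.prems(3)[OF that] u by simp
      show "\<exists>a :: nat \<Rightarrow> nat \<Rightarrow> complex. (\<forall>k j. a k j \<in> K) \<and> L2_tendsto leb_plus (\<lambda>k z. \<Sum>j<k. a k j * u j z) ((h(d := u j)) b)" if "b \<in> D" for b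
        using insert.prems(4)[of b] insert.hyps that by auto
      show "\<exists>j'. (h(d := u j)) b = u j'" if "b \<in> ?B - D" for b
        using insert.prems(5)[of b] that by (cases "b = d") auto
    qed
    \<comment> \<open>Linearity in the d-th slot, with the coefficients \<open>a k j\<close> from K
      under which the span is closed.\<close>
    have step: "L2_approx leb_plus ?P (tensor (h(d := F k)))" for k
    proof -
      have "L2_approx leb_plus ?P (\<lambda>z. \<Sum>j\<leftarrow>[0..<k]. a k j * tensor (h(d := u j)) z)"
        by (rule L2_approx_sum_list[where K=K, OF Pm]) (auto intro: tensor_span_closed K one tm u a(1)[rule_format])
      also have "(\<lambda>z. \<Sum>j\<leftarrow>[0..<k]. a k j * tensor (h(d := u j)) z) = tensor (h(d := F k))"
        unfolding tensor_fun_upd[OF d, abs_def] F_def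
        by (simp add: interv_sum_list_conv_sum_set_nat atLeast0LessThan sum_distrib_right mult.assoc)
      finally show ?thesis .
    qed
    have "L2_tendsto leb_plus (\<lambda>k. tensor (h(d := F k))) (tensor h)"
      by (rule L2_tendsto_tensor_fun_upd[of d h F, OF d insert.prems(2) Fm insert.prems(3)])
        (use a(2) in \<open>simp_all add: F_def[abs_def]\<close>)
    moreover have "tensor h \<in> borel_measurable leb_plus"
      by (intro measurable_leb_plus measurable_tensor insert.prems)
    ultimately show ?case
      using L2_approx_limit[of ?P leb_plus "\<lambda>k. tensor (h(d := F k))" "tensor h", OF Pm step tm[OF Fm]] by blast
  qed
  from this[of ?B h] h show ?thesis by auto
qed

text \<open>Symmetrization is a finite average of coordinate permutations, each of which preserves
  the Lebesgue distance.\<close>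

lemma L2_tendsto_symmetrize:
  fixes F :: "nat \<Rightarrow> 'a::euclidean_space \<times> 'a \<Rightarrow> complex"
  assumes F[measurable]: "\<And>k. F k \<in> borel_measurable borel" and g[measurable]: "g \<in> borel_measurable borel"
    and lim: "L2_tendsto leb_plus F g"
  shows "L2_tendsto leb_plus (\<lambda>k. symmetrize (F k)) (symmetrize g)"
proof -
  have one: "L2_tendsto leb_plus (\<lambda>k z. 1 / fact DIM('a) * F k (permute_pair p z)) (\<lambda>z. 1 / fact DIM('a) * g (permute_pair p z))"
    if p: "p permutes Basis" for p
  proof (intro L2_tendsto_scale measurable_leb_plus)
    have "L2d leb_plus (\<lambda>z. F k (permute_pair p z)) (\<lambda>z. g (permute_pair p z)) = L2d leb_plus (F k) g" for k
      unfolding L2d_def using nn_integral_permute_pair[OF p, of "\<lambda>z. ennreal ((norm (F k z - g z))\<^sup>2)"] by simp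
    then show "L2_tendsto leb_plus (\<lambda>k z. F k (permute_pair p z)) (\<lambda>z. g (permute_pair p z))"
      using lim unfolding L2_tendsto_L2d by simp
  qed measurable
  have "L2_tendsto leb_plus (\<lambda>k z. \<Sum>p\<in>Q. 1 / fact DIM('a) * F k (permute_pair p z)) (\<lambda>z. \<Sum>p\<in>Q. 1 / fact DIM('a) * g (permute_pair p z))"
    if "finite Q" "Q \<subseteq> {p. p permutes Basis}" for Q
    using that
  proof (induction Q)
    case empty
    then show ?case by (simp add: L2_tendsto_L2d)
  next
    case (insert p Q)
    have "L2_tendsto leb_plus (\<lambda>k z. 1 / fact DIM('a) * F k (permute_pair p z) + (\<Sum>p\<in>Q. 1 / fact DIM('a) * F k (permute_pair p z)))
       (\<lambda>z. 1 / fact DIM('a) * g (permute_pair p z) + (\<Sum>p\<in>Q. 1 / fact DIM('a) * g (permute_pair p z)))"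
    proof (intro L2_tendsto_add)
      show "L2_tendsto leb_plus (\<lambda>k z. 1 / fact DIM('a) * F k (permute_pair p z)) (\<lambda>z. 1 / fact DIM('a) * g (permute_pair p z))"
        using insert.prems by (intro one) auto
      show "L2_tendsto leb_plus (\<lambda>k z. \<Sum>p\<in>Q. 1 / fact DIM('a) * F k (permute_pair p z)) (\<lambda>z. \<Sum>p\<in>Q. 1 / fact DIM('a) * g (permute_pair p z))"
        using insert by auto
    qed (intro measurable_leb_plus; measurable)+
    then show ?case using insert.hyps by simp
  qed
  from this[of "{p. p permutes (Basis :: 'a set)}"] show ?thesis
    unfolding symmetrize_permute_pair[abs_def] by (simp add: finite_permutations)
qed

section \<open>The process and its multiple integrals\<close>

text \<open>The approximants in the definition are transforms of sums of product functions;
  \<open>fourier_tensor\<close> rewrites them as sums of tensors of one-dimensional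
  transforms.\<close>

lemma hilbert_H_approx:
  fixes f :: "'a::euclidean_space \<Rightarrow> ('a \<Rightarrow> complex) \<Rightarrow> complex"
  assumes f: "f \<in> hilbert_H K H"
  shows "\<exists>S :: nat \<Rightarrow> (complex \<times> ('a \<Rightarrow> real \<times> real \<Rightarrow> complex)) list.
    (\<forall>k. \<forall>x\<in>set (S k). fst x \<in> K \<and> (\<forall>b\<in>Basis. snd x b \<in> test_functions K)) \<and>
    L2_tendsto (spectral_measure H) (\<lambda>k z. \<Sum>x\<leftarrow>S k. fst x * tensor (\<lambda>b. test_ft (snd x b)) z) (space_ft f)"
proof -
  obtain S :: "nat \<Rightarrow> (complex \<times> ('a \<Rightarrow> real \<times> real \<Rightarrow> complex)) list" where
    S: "\<forall>k. \<forall>(c, \<phi>)\<in>set (S k). c \<in> K \<and> (\<forall>b\<in>Basis. \<phi> b \<in> test_functions K)"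
      "L2_tendsto (spectral_measure H)
          (\<lambda>k (t, \<xi>). fourier (\<lambda>x. \<Sum>(c, \<phi>)\<leftarrow>S k. c * (\<Prod>b\<in>Basis. \<phi> b (t \<bullet> b, x \<bullet> b))) \<xi>) (space_ft f)"
    using f unfolding hilbert_H_def by blast
  have SK: "fst x \<in> K \<and> (\<forall>b\<in>Basis. snd x b \<in> test_functions K)" if "x \<in> set (S k)" for x k
    using bspec[OF spec[OF S(1), of k] that] by (simp add: split_beta)
  have eq: "fourier (\<lambda>x. \<Sum>(c, \<phi>)\<leftarrow>S k. c * (\<Prod>b\<in>Basis. \<phi> b (t \<bullet> b, x \<bullet> b))) \<xi>
      = (\<Sum>x\<leftarrow>S k. fst x * tensor (\<lambda>b. test_ft (snd x b)) (t, \<xi>))" for k t \<xi>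
  proof -
    have F: "integrable lborel (\<lambda>y. \<Prod>b\<in>Basis. snd x b (t \<bullet> b, y \<bullet> b))"
      "fourier (\<lambda>y. \<Prod>b\<in>Basis. snd x b (t \<bullet> b, y \<bullet> b)) \<xi> = (\<Prod>b\<in>Basis. fourier (\<lambda>y. snd x b (t \<bullet> b, y)) (\<xi> \<bullet> b))"
      if "x \<in> set (S k)" for x
      using fourier_tensor[of "\<lambda>b y. snd x b (t \<bullet> b, y)"] SK[OF that] integrable_test_slice by blast+
    have "fourier (\<lambda>y. \<Sum>x\<leftarrow>S k. fst x * (\<Prod>b\<in>Basis. snd x b (t \<bullet> b, y \<bullet> b))) \<xi>
       = (\<Sum>x\<leftarrow>S k. fst x * fourier (\<lambda>y. \<Prod>b\<in>Basis. snd x b (t \<bullet> b, y \<bullet> b)) \<xi>)"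
      by (rule fourier_sum_list[OF F(1)])
    also have "\<dots> = (\<Sum>x\<leftarrow>S k. fst x * tensor (\<lambda>b. test_ft (snd x b)) (t, \<xi>))"
      by (intro arg_cong[where f=sum_list] map_cong refl) (simp add: F(2) tensor_def test_ft_def coord_def)
    finally show ?thesis unfolding case_prod_beta' .
  qed
  have "(\<lambda>k (t, \<xi>). fourier (\<lambda>x. \<Sum>(c, \<phi>)\<leftarrow>S k. c * (\<Prod>b\<in>Basis. \<phi> b (t \<bullet> b, x \<bullet> b))) \<xi>)
     = (\<lambda>k z. \<Sum>x\<leftarrow>S k. fst x * tensor (\<lambda>b. test_ft (snd x b)) z)"
    unfolding eq by (simp add: fun_eq_iff)
  with S(2) have "L2_tendsto (spectral_measure H) (\<lambda>k z. \<Sum>x\<leftarrow>S k. fst x * tensor (\<lambda>b. test_ft (snd x b)) z) (space_ft f)"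
    by simp
  then show ?thesis using SK by (intro exI[of _ S]) auto
qed

lemma space_ft_measurable_hilbert: "f \<in> hilbert_H K H \<Longrightarrow> space_ft f \<in> borel_measurable borel"
  unfolding hilbert_H_def by (intro space_ft_measurable) auto

locale wiener_setup = gaussian_measure M W1 W2 for M :: "'w measure" and W1 W2 +
  fixes K :: "complex set" and H :: real and e :: "nat \<Rightarrow> real \<Rightarrow> (real \<Rightarrow> complex) \<Rightarrow> complex"
  assumes K_cases: "K = \<real> \<or> K = UNIV" and H: "0 < H" "H < 1" and basis: "orthonormal_basis_H K H e"
begin

lemma K_closed: "1 \<in> K" "a \<in> K \<Longrightarrow> b \<in> K \<Longrightarrow> a * b \<in> K" "a \<in> K \<Longrightarrow> - a \<in> K"
  using K_cases by auto

lemma c_pos: "0 < c_H H" by (rule c_H_pos[OF H])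

lemma hat_zero: "hat H (\<lambda>_. 0) = (\<lambda>_. 0)" by (simp add: hat_def fun_eq_iff)

lemma e_hilbert: "e j \<in> hilbert_H K H"
  using basis by (simp add: orthonormal_basis_H_def)

lemma e_ft_measurable [measurable]: "space_ft (e j) \<in> borel_measurable borel"
  by (rule space_ft_measurable_hilbert[OF e_hilbert])

definition ehat :: "nat \<Rightarrow> real \<times> real \<Rightarrow> complex" where "ehat j = hat H (space_ft (e j))"

lemma ehat_measurable [measurable]: "ehat j \<in> borel_measurable borel"
  unfolding ehat_def by measurable

text \<open>The integral of a non-integrable function is 0 by convention, so the normalization with
  value 1 forces square integrability.\<close>

lemma ehat_finite: "L2d leb_plus (ehat j) (\<lambda>_. 0) < \<infinity>"
proof -
  let ?u = "space_ft (e j)"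
  have "(LINT z|spectral_measure H. ?u z * cnj (?u z)) = 1"
    using basis by (simp add: orthonormal_basis_H_def inner_H_def)
  then have "integrable (spectral_measure H) (\<lambda>z. ?u z * cnj (?u z))"
    using not_integrable_integral_eq by fastforce
  then have "integrable (spectral_measure H) (\<lambda>z. norm (?u z * cnj (?u z)))" by (rule integrable_norm)
  then have "(\<integral>\<^sup>+z. ennreal (norm (norm (?u z * cnj (?u z)))) \<partial>spectral_measure H) < \<infinity>"
    by (simp only: integrable_iff_bounded)
  then have "L2d (spectral_measure H) ?u (\<lambda>_. 0) < \<infinity>"
    unfolding L2d_def by (simp add: norm_mult power2_eq_square)
  then show ?thesis
    unfolding ehat_def using L2d_spectral[of ?u "\<lambda>_. 0" H] c_pos by (simp add: hat_zero)
qed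

text \<open>In dimension one the constant of \<open>hat\<close> is the square root of c_H, so the
  defining integrand of W^H on a rectangle is the image of the rectangle's transform.\<close>

lemma mint_WH_rect:
  "mint (hat H (\<lambda>z. indicator {0..t} (fst z) * fourier (signed_ind x) (snd z))) (WH_rect M W1 W2 H t x)"
proof -
  let ?u = "\<lambda>z :: real \<times> real. indicator {0..t} (fst z) * fourier (signed_ind x) (snd z) :: complex"
  let ?g = "\<lambda>(s, \<xi>). indicator {0..t} s * fourier (signed_ind x) \<xi> * complex_of_real (\<bar>\<xi>\<bar> powr (1 / 2 - H))"
  have fm: "(\<lambda>z :: real \<times> real. fourier (signed_ind x) (snd z)) \<in> borel_measurable borel"
    by (rule measurable_fourier) measurable
  have im: "(\<lambda>z :: real \<times> real. indicator {0..t} (fst z) :: complex) \<in> borel_measurable borel"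
    by (rule measurable_compose[OF measurable_borel_fst]) simp
  have um[measurable]: "?u \<in> borel_measurable borel" by (intro borel_measurable_times im fm)
  \<comment> \<open>|x| covers the frequencies below 1 and 2 the others; their sum works for
    both.\<close>
  have bound: "norm (?u z) \<le> indicator {0..t} (fst z) * ((\<bar>x\<bar> + 2) * decay (snd z))" for z
  proof -
    have "norm (fourier (signed_ind x) (snd z)) \<le> (\<bar>x\<bar> + 2) * decay (snd z)"
    proof (cases "\<bar>snd z\<bar> \<le> 1")
      case True
      then show ?thesis using norm_fourier_signed_ind_le'[of x "snd z"] by (simp add: decay_def)
    next
      case False
      then have "norm (fourier (signed_ind x) (snd z)) \<le> 2 / \<bar>snd z\<bar>" by (intro norm_fourier_signed_ind_le) auto
      also have "\<dots> \<le> (\<bar>x\<bar> + 2) / \<bar>snd z\<bar>" by (intro divide_right_mono) auto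
      finally show ?thesis using False by (simp add: decay_def)
    qed
    then show ?thesis by (auto simp: indicator_def)
  qed
  have "L2d (spectral_measure H) ?u (\<lambda>_. 0)
      \<le> (\<integral>\<^sup>+z. ennreal ((indicator {0..t} (fst z) * ((\<bar>x\<bar> + 2) * decay (snd z)))\<^sup>2) \<partial>(spectral_measure H :: (real \<times> real) measure))"
    unfolding L2d_def using bound by (intro nn_integral_mono ennreal_leI power_mono) auto
  also have "\<dots> < \<infinity>" by (rule spectral_dominator_finite[OF H]) simp
  finally have fin: "L2d leb_plus (hat H ?u) (\<lambda>_. 0) < \<infinity>"
    using L2d_spectral[of ?u "\<lambda>_. 0" H] um c_pos by (simp add: hat_zero)
  have hu: "hat H ?u z = complex_of_real (sqrt (c_H H)) * ?g z" for z
    using c_pos by (cases z) (simp add: hat_def powr_half_sqrt mult_ac)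
  have s: "complex_of_real (sqrt (c_H H)) \<noteq> 0" using c_pos by simp
  \<comment> \<open>Dividing by the nonzero constant gives measurability and finite norm of the
    integrand proper, for which the order one integral is defined.\<close>
  have g: "?g = (\<lambda>z. inverse (complex_of_real (sqrt (c_H H))) * hat H ?u z)"
    unfolding hu using s by (simp add: fun_eq_iff mult.assoc[symmetric])
  have gm: "?g \<in> borel_measurable borel" unfolding g by measurable
  have "L2d leb_plus ?g (\<lambda>_. 0) < \<infinity>"
    using L2d_scale[of "hat H ?u" leb_plus "\<lambda>_. 0" "inverse (complex_of_real (sqrt (c_H H)))"] fin
    unfolding g by (simp add: ennreal_mult_less_top measurable_leb_plus)
  then have "mint ?g (complex_gauss_int M W1 W2 ?g)" by (rule mint_complex_gauss_int[OF gm])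
  then have "mint (\<lambda>z. complex_of_real (sqrt (c_H H)) * ?g z) (\<lambda>\<omega>. complex_of_real (sqrt (c_H H)) * complex_gauss_int M W1 W2 ?g \<omega>)"
    by (intro mint_scale measurable_leb_plus gm)
  then show ?thesis unfolding hu[symmetric] WH_rect_def[abs_def] .
qed

lemma mint_step_ft:
  "mint (hat H (step_ft S)) (\<lambda>\<omega>. \<Sum>(c, t, x)\<leftarrow>S. c * WH_rect M W1 W2 H t x \<omega>)"
proof -
  let ?u = "\<lambda>v z. indicator {0..fst (snd v)} (fst z) * fourier (signed_ind (snd (snd v))) (snd z) :: complex"
  have fm: "(\<lambda>z :: real \<times> real. fourier (signed_ind x) (snd z)) \<in> borel_measurable borel" for x
    by (rule measurable_fourier) measurable
  have im: "(\<lambda>z :: real \<times> real. indicator {0..t} (fst z) :: complex) \<in> borel_measurable borel" for t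
    by (rule measurable_compose[OF measurable_borel_fst]) simp
  have "mint (\<lambda>z. \<Sum>v\<leftarrow>S. fst v * hat H (?u v) z) (\<lambda>\<omega>. \<Sum>v\<leftarrow>S. fst v * WH_rect M W1 W2 H (fst (snd v)) (snd (snd v)) \<omega>)"
    by (intro mint_sum_list mint_scale mint_WH_rect borel_measurable_times borel_measurable_const
        measurable_leb_plus measurable_hat im fm)
  also have "(\<lambda>z. \<Sum>v\<leftarrow>S. fst v * hat H (?u v) z) = hat H (step_ft S)"
    unfolding step_ft_def[abs_def] case_prod_beta' by (simp add: fun_eq_iff hat_sum_list hat_scale)
  finally show ?thesis unfolding case_prod_beta' .
qed

definition step_class :: "(real \<times> real \<Rightarrow> complex) set" where
  "step_class = {step_ft S |S. \<forall>(c, t, x)\<in>set S. c \<in> K \<and> 0 \<le> t}"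

lemma step_class_closed:
  "(\<lambda>z. 0) \<in> step_class" "u \<in> step_class \<Longrightarrow> v \<in> step_class \<Longrightarrow> (\<lambda>z. u z + v z) \<in> step_class"
  "a \<in> K \<Longrightarrow> u \<in> step_class \<Longrightarrow> (\<lambda>z. a * u z) \<in> step_class"
  "u \<in> step_class \<Longrightarrow> u \<in> borel_measurable (spectral_measure H)"
proof -
  show "(\<lambda>z. 0) \<in> step_class"
    unfolding step_class_def by (intro CollectI exI[of _ "[]"]) (auto simp: step_ft_def[abs_def])
  show "(\<lambda>z. u z + v z) \<in> step_class" if u: "u \<in> step_class" and v: "v \<in> step_class"
  proof -
    obtain S T where "u = step_ft S" "\<forall>(c, t, x)\<in>set S. c \<in> K \<and> 0 \<le> t" "v = step_ft T" "\<forall>(c, t, x)\<in>set T. c \<in> K \<and> 0 \<le> t"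
      using u v unfolding step_class_def by blast
    then show ?thesis unfolding step_class_def
      by (intro CollectI exI[of _ "S @ T"] conjI) (auto simp: step_ft_def[abs_def])
  qed
  show "(\<lambda>z. a * u z) \<in> step_class" if a: "a \<in> K" and u: "u \<in> step_class"
  proof -
    obtain S where S: "u = step_ft S" "\<forall>(c, t, x)\<in>set S. c \<in> K \<and> 0 \<le> t"
      using u unfolding step_class_def by blast
    have "step_ft (scale_list a S) z = a * step_ft S z" for z
      unfolding step_ft_def scale_list_def by (induction S) (auto simp: distrib_left mult.assoc)
    moreover have "\<forall>(c, t, x)\<in>set (scale_list a S). c \<in> K \<and> 0 \<le> t"
      using S(2) K_closed(2)[OF a] unfolding scale_list_def by auto
    ultimately show ?thesis unfolding step_class_def S(1)
      by (intro CollectI exI[of _ "scale_list a S"] conjI) auto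
  qed
  show "u \<in> borel_measurable (spectral_measure H)" if "u \<in> step_class"
    using that unfolding step_class_def by (auto intro: measurable_spectral)
qed

text \<open>Two approximations: elements of the Hilbert space by test functions, by definition, and
  test functions by rectangles. Coefficients stay in K throughout.\<close>

lemma step_approx: "L2_approx (spectral_measure H) step_class (space_ft (e j))"
proof -
  obtain S :: "nat \<Rightarrow> (complex \<times> (real \<Rightarrow> real \<times> real \<Rightarrow> complex)) list" where
    S0: "\<forall>k. \<forall>x\<in>set (S k). fst x \<in> K \<and> (\<forall>b\<in>Basis. snd x b \<in> test_functions K)"
    and S: "L2_tendsto (spectral_measure H) (\<lambda>k z. \<Sum>x\<leftarrow>S k. fst x * tensor (\<lambda>b. test_ft (snd x b)) z) (space_ft (e j))"
    using hilbert_H_approx[OF e_hilbert[of j]] by (elim exE conjE)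
  have t: "snd x 1 \<in> test_functions K" "fst x \<in> K" if "x \<in> set (S k)" for x k
    using bspec[OF spec[OF S0, of k] that] by auto
  have tm: "test_ft \<phi> \<in> borel_measurable (spectral_measure H)" if "\<phi> \<in> test_functions K" for \<phi>
    by (intro measurable_spectral measurable_test_ft[OF that])
  have one: "L2_approx (spectral_measure H) step_class (test_ft \<phi>)" if \<phi>: "\<phi> \<in> test_functions K" for \<phi>
  proof -
    obtain T where T: "\<forall>k::nat. \<forall>(c, t, x)\<in>set (T k). c \<in> K \<and> 0 \<le> t"
      "L2_tendsto (spectral_measure H) (\<lambda>k. step_ft (T k)) (test_ft \<phi>)"
      using test_function_step_approx(1)[OF \<phi> K_closed(3) H] by blast
    have "step_ft (T k) \<in> step_class" for k using T(1) unfolding step_class_def by blast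
    then show ?thesis
      by (intro L2_approx_limit[OF step_class_closed(4) _ _ tm[OF \<phi>] T(2)] L2_approx_incl step_class_closed(4)) auto
  qed
  have sum: "L2_approx (spectral_measure H) step_class (\<lambda>z. \<Sum>x\<leftarrow>S k. fst x * test_ft (snd x 1) z)" for k
    by (rule L2_approx_sum_list[where K=K, OF step_class_closed(4)]) (auto intro: step_class_closed one tm t)
  have summ: "(\<lambda>z. \<Sum>x\<leftarrow>S k. fst x * test_ft (snd x 1) z) \<in> borel_measurable (spectral_measure H)" for k
    by (intro measurable_sum_list borel_measurable_times borel_measurable_const tm t)
  show ?thesis
    by (rule L2_approx_limit[OF step_class_closed(4) sum summ _ S[unfolded tensor_real]])
      (auto intro: measurable_spectral)
qed

lemma is_WH_iff:
  "is_WH M W1 W2 K H \<phi> X \<longleftrightarrow> X \<in> borel_measurable M \<and> (\<exists>S. (\<forall>k::nat. \<forall>(c, t, x)\<in>set (S k). c \<in> K \<and> 0 \<le> t) \<and>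
     L2_tendsto (spectral_measure H) (\<lambda>k. step_ft (S k)) (space_ft \<phi>) \<and>
     L2_tendsto M (\<lambda>k \<omega>. \<Sum>(c, t, x)\<leftarrow>S k. c * WH_rect M W1 W2 H t x \<omega>) X)"
proof -
  have "(\<lambda>k (s, \<xi>). fourier (\<lambda>y. \<Sum>(c, t, x)\<leftarrow>S k. c * indicator {0..t} s * signed_ind x y) \<xi>) = (\<lambda>k. step_ft (S k))"
    for S :: "nat \<Rightarrow> (complex \<times> real \<times> real) list"
    by (simp add: fun_eq_iff step_ft_fourier)
  then show ?thesis unfolding is_WH_def by simp
qed

definition Z :: "nat \<Rightarrow> 'w \<Rightarrow> complex" where "Z j = WH M W1 W2 K H (e j)"

text \<open>First a version of W^H(e_j) is constructed, which gives the choice in \<open>WH\<close>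
  its defining property. Then the unknown sequence behind the chosen version is pushed through the
  closedness of the order one integral.\<close>

lemma mint_Z: "mint (ehat j) (Z j)"
proof -
  have m: "hat H (step_ft S) \<in> borel_measurable leb_plus" for S
    by (intro measurable_leb_plus measurable_hat measurable_step_ft)
  have em: "ehat j \<in> borel_measurable leb_plus" by (intro measurable_leb_plus ehat_measurable)
  obtain u where u: "\<And>k::nat. u k \<in> step_class" "L2_tendsto (spectral_measure H) u (space_ft (e j))"
    using L2_approx_sequence[OF step_approx] by blast
  have "\<forall>k. \<exists>S. u k = step_ft S \<and> (\<forall>(c, t, x)\<in>set S. c \<in> K \<and> 0 \<le> t)"
    using u(1) unfolding step_class_def by blast
  from choice[OF this] obtain S where S: "\<forall>k. u k = step_ft (S k) \<and> (\<forall>(c, t, x)\<in>set (S k). c \<in> K \<and> 0 \<le> t)" by blast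
  then have us: "u = (\<lambda>k. step_ft (S k))" by auto
  have lim: "L2_tendsto leb_plus (\<lambda>k. hat H (step_ft (S k))) (ehat j)"
    using u(2) L2_tendsto_spectral[of "\<lambda>k. step_ft (S k)" "space_ft (e j)" H] c_pos unfolding us ehat_def by simp
  obtain X where X: "mint (ehat j) X" "L2_tendsto M (\<lambda>k \<omega>. \<Sum>(c, t, x)\<leftarrow>S k. c * WH_rect M W1 W2 H t x \<omega>) X"
    using mint_complete[of "\<lambda>k. hat H (step_ft (S k))" "\<lambda>k \<omega>. \<Sum>(c, t, x)\<leftarrow>S k. c * WH_rect M W1 W2 H t x \<omega>" "ehat j" thesis,
        OF mint_step_ft m em lim] by blast
  have "is_WH M W1 W2 K H (e j) X"
    unfolding is_WH_iff using mint_measurable[OF X(1)] S u(2) X(2) unfolding us by blast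
  then have "is_WH M W1 W2 K H (e j) (Z j)"
    unfolding Z_def WH_def by (rule someI[of "is_WH M W1 W2 K H (e j)"])
  then obtain T where T: "Z j \<in> borel_measurable M"
     "L2_tendsto (spectral_measure H) (\<lambda>k. step_ft (T k)) (space_ft (e j))"
     "L2_tendsto M (\<lambda>k \<omega>. \<Sum>(c, t, x)\<leftarrow>T k. c * WH_rect M W1 W2 H t x \<omega>) (Z j)"
    unfolding is_WH_iff by blast
  have limT: "L2_tendsto leb_plus (\<lambda>k. hat H (step_ft (T k))) (ehat j)"
    using T(2) L2_tendsto_spectral[of "\<lambda>k. step_ft (T k)" "space_ft (e j)" H] c_pos unfolding ehat_def by simp
  show ?thesis
    using mint_closed[of "\<lambda>k. hat H (step_ft (T k))" "\<lambda>k \<omega>. \<Sum>(c, t, x)\<leftarrow>T k. c * WH_rect M W1 W2 H t x \<omega>" "ehat j" "Z j",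
        OF mint_step_ft m em T(1) limT T(3)] .
qed

lemma mint_tensor_ehat:
  fixes \<sigma> :: "'a::euclidean_space \<Rightarrow> nat"
  shows "mint (tensor (\<lambda>b. ehat (\<sigma> b))) (\<lambda>\<omega>. \<Prod>b\<in>(Basis::'a set). Z (\<sigma> b) \<omega>)"
  by (rule mint_tensor[OF mint_Z ehat_measurable ehat_finite])

text \<open>By \<open>mint_Z\<close> each W^H(e_j) is an order one integral, hence has vanishing
  second moment E[Z^2], and the Hermite polynomials are powers.\<close>

lemma hermite_product:
  fixes \<sigma> :: "'a::euclidean_space \<Rightarrow> nat"
  shows "(\<Prod>j\<in>\<sigma> ` Basis. hermite_rv M (card {b \<in> Basis. \<sigma> b = j}) (WH M W1 W2 K H (e j)) \<omega>) = (\<Prod>b\<in>Basis. Z (\<sigma> b) \<omega>)"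
proof -
  have "hermite_rv M k (WH M W1 W2 K H (e j)) \<omega> = Z j \<omega> ^ k" for k j
    using hermite_rv_mint[OF mint_Z ehat_measurable ehat_finite, of k j \<omega>] by (simp add: Z_def)
  then show ?thesis using prod_card_fibre[OF finite_Basis, of "\<lambda>j. Z j \<omega>" \<sigma>] by simp
qed

text \<open>The unsymmetrized combination on the Lebesgue side; \<open>sym_fun\<close> is the
  symmetrized one on the spectral side. The random variable \<open>comb_int\<close> belongs to
  both.\<close>

definition comb_fun :: "(complex \<times> ('a \<Rightarrow> nat)) list \<Rightarrow> 'a::euclidean_space \<times> 'a \<Rightarrow> complex" where
  "comb_fun L z = (\<Sum>(c, \<sigma>)\<leftarrow>L. c * tensor (\<lambda>b. ehat (\<sigma> b)) z)"

definition comb_int :: "(complex \<times> ('a::euclidean_space \<Rightarrow> nat)) list \<Rightarrow> 'w \<Rightarrow> complex" where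
  "comb_int L \<omega> = (\<Sum>(c, \<sigma>)\<leftarrow>L. c * (\<Prod>b\<in>Basis. Z (\<sigma> b) \<omega>))"

lemma measurable_comb_fun [measurable]: "comb_fun L \<in> borel_measurable borel"
  unfolding comb_fun_def[abs_def] case_prod_beta'
  by (intro measurable_sum_list borel_measurable_times borel_measurable_const measurable_tensor ehat_measurable)

lemma mint_comb: "mint (comb_fun L) (comb_int L)"
  unfolding comb_fun_def[abs_def] comb_int_def[abs_def] case_prod_beta'
  by (intro mint_sum_list mint_scale mint_tensor_ehat borel_measurable_times borel_measurable_const
      measurable_leb_plus measurable_tensor ehat_measurable)

definition sym_fun :: "(complex \<times> ('a \<Rightarrow> nat)) list \<Rightarrow> 'a::euclidean_space \<times> 'a \<Rightarrow> complex" where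
  "sym_fun L z = (\<Sum>(c, \<sigma>)\<leftarrow>L. c * sym_tensor_ft e \<sigma> z)"

lemma sym_tensor_ft_eq: "sym_tensor_ft e \<sigma> = symmetrize (tensor (\<lambda>b. space_ft (e (\<sigma> b))))"
  unfolding sym_tensor_ft_def tensor_def[abs_def] coord_def case_prod_beta' by simp

lemma measurable_sym_fun [measurable]: "sym_fun L \<in> borel_measurable borel"
  unfolding sym_fun_def[abs_def] case_prod_beta' sym_tensor_ft_eq
  by (intro measurable_sum_list borel_measurable_times borel_measurable_const measurable_symmetrize measurable_tensor e_ft_measurable)

lemma hat_sym_fun: "hat H (sym_fun L) = symmetrize (comb_fun L)"
proof (rule ext)
  fix z
  have "hat H (sym_fun L) z = (\<Sum>x\<leftarrow>L. fst x * symmetrize (hat H (tensor (\<lambda>b. space_ft (e (snd x b))))) z)"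
    unfolding sym_fun_def[abs_def] case_prod_beta' sym_tensor_ft_eq by (simp add: hat_sum_list hat_scale hat_symmetrize)
  also have "\<dots> = (\<Sum>x\<leftarrow>L. fst x * symmetrize (tensor (\<lambda>b. ehat (snd x b))) z)"
    by (simp add: hat_tensor[abs_def] ehat_def)
  also have "\<dots> = symmetrize (comb_fun L) z"
    unfolding comb_fun_def[abs_def] symmetrize_permute_pair case_prod_beta'
    by (induction L) (simp_all add: distrib_left sum.distrib sum_distrib_left mult_ac)
  finally show "hat H (sym_fun L) z = symmetrize (comb_fun L) z" .
qed

lemma is_mult_int_WH_iff:
  "is_mult_int_WH M W1 W2 K H e f X \<longleftrightarrow> X \<in> borel_measurable M \<and> (\<exists>S. (\<forall>k::nat. \<forall>(c, \<sigma>)\<in>set (S k). c \<in> K) \<and>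
     L2_tendsto (spectral_measure H) (\<lambda>k. sym_fun (S k)) (symmetrize (space_ft f)) \<and>
     L2_tendsto M (\<lambda>k. comb_int (S k)) X)"
  unfolding is_mult_int_WH_def sym_fun_def[abs_def] comb_int_def[abs_def] hermite_product ..

text \<open>The basis expands only elements of the one-dimensional space, so f is first approximated
  by tensors of test functions, and each factor is then expanded in the e_j.\<close>

lemma tensor_span_approx:
  fixes f :: "'a::euclidean_space \<Rightarrow> ('a \<Rightarrow> complex) \<Rightarrow> complex"
  assumes f: "f \<in> hilbert_H K H"
  shows "L2_approx leb_plus (tensor_span K (\<lambda>_. ehat)) (hat H (space_ft f))"
proof -
  let ?P = "tensor_span K (\<lambda>_::'a. ehat)"
  have Pm: "v \<in> borel_measurable leb_plus" if "v \<in> ?P" for v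
    by (intro measurable_leb_plus measurable_tensor_span[OF _ that] ehat_measurable)
  obtain S :: "nat \<Rightarrow> (complex \<times> ('a \<Rightarrow> real \<times> real \<Rightarrow> complex)) list" where
    S0: "\<forall>k. \<forall>x\<in>set (S k). fst x \<in> K \<and> (\<forall>b\<in>Basis. snd x b \<in> test_functions K)"
    and S: "L2_tendsto (spectral_measure H) (\<lambda>k z. \<Sum>x\<leftarrow>S k. fst x * tensor (\<lambda>b. test_ft (snd x b)) z) (space_ft f)"
    using hilbert_H_approx[OF f] by (elim exE conjE)
  have t: "snd x b \<in> test_functions K" if "x \<in> set (S k)" "b \<in> Basis" for x k b
    using bspec[OF spec[OF S0, of k] that(1)] that(2) by auto
  have t2: "fst x \<in> K" if "x \<in> set (S k)" for x k using bspec[OF spec[OF S0, of k] that] by auto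
  have hb: "\<exists>a :: nat \<Rightarrow> nat \<Rightarrow> complex. (\<forall>k j. a k j \<in> K) \<and> L2_tendsto leb_plus (\<lambda>k z. \<Sum>j<k. a k j * ehat j z) (hat H (test_ft \<phi>))"
    and hfin: "L2d leb_plus (hat H (test_ft \<phi>)) (\<lambda>_. 0) < \<infinity>" if \<phi>: "\<phi> \<in> test_functions K" for \<phi>
  proof -
    note [measurable] = measurable_test_ft[OF \<phi>]
    have td: "test_dist \<phi> \<in> hilbert_H K H" by (rule test_dist_hilbert[OF \<phi> K_closed(1)])
    then obtain a :: "nat \<Rightarrow> nat \<Rightarrow> complex" where a: "\<forall>k j. a k j \<in> K"
      "L2_tendsto (spectral_measure H) (\<lambda>k z. \<Sum>j<k. a k j * space_ft (e j) z) (space_ft (test_dist \<phi>))"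
      using basis unfolding orthonormal_basis_H_def by blast
    have sm: "(\<lambda>z. \<Sum>j<k. a k j * space_ft (e j) z) \<in> borel_measurable borel" for k by measurable
    \<comment> \<open>The expansion concerns the chosen transform of
      \<open>test_dist \<phi>\<close>, which is replaced by the classical one up to null
      sets.\<close>
    have "L2d (spectral_measure H) v (space_ft (test_dist \<phi>)) = L2d (spectral_measure H) v (test_ft \<phi>)" for v
      by (rule L2d_cong_AE[OF _ space_ft_test[OF \<phi>]]) simp
    then have "L2_tendsto (spectral_measure H) (\<lambda>k z. \<Sum>j<k. a k j * space_ft (e j) z) (test_ft \<phi>)"
      using a(2) unfolding L2_tendsto_L2d by simp
    then have "L2_tendsto leb_plus (\<lambda>k. hat H (\<lambda>z. \<Sum>j<k. a k j * space_ft (e j) z)) (hat H (test_ft \<phi>))"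
      using L2_tendsto_spectral[of "\<lambda>k z. \<Sum>j<k. a k j * space_ft (e j) z" "test_ft \<phi>" H] sm c_pos measurable_test_ft[OF \<phi>] by simp
    moreover have "hat H (\<lambda>z. \<Sum>j<k. a k j * space_ft (e j) z) = (\<lambda>z. \<Sum>j<k. a k j * ehat j z)" for k
      by (simp add: fun_eq_iff hat_def ehat_def sum_distrib_left sum_distrib_right mult_ac)
    ultimately show "\<exists>a :: nat \<Rightarrow> nat \<Rightarrow> complex. (\<forall>k j. a k j \<in> K) \<and> L2_tendsto leb_plus (\<lambda>k z. \<Sum>j<k. a k j * ehat j z) (hat H (test_ft \<phi>))"
      using a(1) by auto
    show "L2d leb_plus (hat H (test_ft \<phi>)) (\<lambda>_. 0) < \<infinity>"
      using test_function_step_approx(2)[OF \<phi> K_closed(3) H] L2d_spectral[of "test_ft \<phi>" "\<lambda>_. 0" H] c_pos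
        measurable_test_ft[OF \<phi>] by (simp add: hat_zero)
  qed
  have one: "L2_approx leb_plus ?P (tensor (\<lambda>b. hat H (test_ft (snd x b))))" if x: "x \<in> set (S k)" for x k
  proof (rule tensor_approx[OF K_closed(2) K_closed(1) ehat_measurable ehat_finite])
    fix b :: 'a assume b: "b \<in> Basis"
    show "hat H (test_ft (snd x b)) \<in> borel_measurable borel"
      by (intro measurable_hat measurable_test_ft[OF t[OF x b]])
    show "L2d leb_plus (hat H (test_ft (snd x b))) (\<lambda>_. 0) < \<infinity>" by (rule hfin[OF t[OF x b]])
    show "\<exists>a :: nat \<Rightarrow> nat \<Rightarrow> complex. (\<forall>k j. a k j \<in> K) \<and> L2_tendsto leb_plus (\<lambda>k z. \<Sum>j<k. a k j * ehat j z) (hat H (test_ft (snd x b)))"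
      by (rule hb[OF t[OF x b]])
  qed
  have tm: "tensor (\<lambda>b. test_ft (snd x b)) \<in> borel_measurable borel"
    "tensor (\<lambda>b. hat H (test_ft (snd x b))) \<in> borel_measurable borel" if x: "x \<in> set (S k)" for x k
    using measurable_tensor[of "\<lambda>b. test_ft (snd x b)", OF measurable_test_ft[OF t[OF x]]]
      measurable_tensor[of "\<lambda>b. hat H (test_ft (snd x b))", OF measurable_hat[OF measurable_test_ft[OF t[OF x]]]]
    by blast+
  let ?v = "\<lambda>k z. \<Sum>x\<leftarrow>S k. fst x * tensor (\<lambda>b. hat H (test_ft (snd x b))) z"
  have sum: "L2_approx leb_plus ?P (?v k)" for k
    by (rule L2_approx_sum_list[where K=K, OF Pm])
      (auto intro: tensor_span_closed K_closed one t2 measurable_leb_plus tm)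
  have vm: "?v k \<in> borel_measurable leb_plus" for k
    by (intro measurable_leb_plus measurable_sum_list borel_measurable_times borel_measurable_const tm)
  have sm: "(\<lambda>z. \<Sum>x\<leftarrow>S k. fst x * tensor (\<lambda>b. test_ft (snd x b)) z) \<in> borel_measurable borel" for k
    by (intro measurable_sum_list borel_measurable_times borel_measurable_const tm)
  have fm: "space_ft f \<in> borel_measurable borel" by (rule space_ft_measurable_hilbert[OF f])
  have hv: "hat H (\<lambda>z. \<Sum>x\<leftarrow>S k. fst x * tensor (\<lambda>b. test_ft (snd x b)) z) = ?v k" for k
    by (simp add: fun_eq_iff hat_sum_list hat_scale hat_tensor)
  have "L2_tendsto leb_plus ?v (hat H (space_ft f))"
    using S L2_tendsto_spectral[of "\<lambda>k z. \<Sum>x\<leftarrow>S k. fst x * tensor (\<lambda>b. test_ft (snd x b)) z" "space_ft f" H, OF sm fm c_pos]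
    unfolding hv by simp
  then show ?thesis
    using L2_approx_limit[of ?P leb_plus ?v "hat H (space_ft f)", OF Pm sum vm] fm
    by (auto intro: measurable_leb_plus measurable_hat)
qed

text \<open>Both chosen variables are shown to be versions of the integral of the symmetrized
  transform of f, and versions agree almost surely.\<close>

theorem mult_int_WH_eq:
  fixes f :: "'a::euclidean_space \<Rightarrow> ('a \<Rightarrow> complex) \<Rightarrow> complex"
  assumes f: "f \<in> hilbert_H K H"
  shows "AE \<omega> in M. mult_int_WH M W1 W2 K H e f \<omega> = mult_int M W1 W2 (f_hat H f) \<omega>"
proof -
  let ?g = "hat H (space_ft f)"
  have fm: "space_ft f \<in> borel_measurable borel" by (rule space_ft_measurable_hilbert[OF f])
  then have gm: "?g \<in> borel_measurable borel" by (rule measurable_hat)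
  have gl: "?g \<in> borel_measurable leb_plus" by (rule measurable_leb_plus[OF gm])
  have sgl: "symmetrize ?g \<in> borel_measurable leb_plus" by (intro measurable_leb_plus measurable_symmetrize gm)
  have cl: "comb_fun L \<in> borel_measurable leb_plus" for L :: "(complex \<times> ('a \<Rightarrow> nat)) list"
    by (intro measurable_leb_plus measurable_comb_fun)
  have scl: "symmetrize (comb_fun L) \<in> borel_measurable leb_plus" for L :: "(complex \<times> ('a \<Rightarrow> nat)) list"
    by (intro measurable_leb_plus measurable_symmetrize measurable_comb_fun)
  have hs: "hat H (symmetrize (space_ft f)) = symmetrize ?g" by (simp add: fun_eq_iff hat_symmetrize)
  have spec: "L2_tendsto (spectral_measure H) (\<lambda>k. sym_fun (S k)) (symmetrize (space_ft f)) \<longleftrightarrow>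
      L2_tendsto leb_plus (\<lambda>k. symmetrize (comb_fun (S k))) (symmetrize ?g)" for S :: "nat \<Rightarrow> (complex \<times> ('a \<Rightarrow> nat)) list"
    using L2_tendsto_spectral[of "\<lambda>k. sym_fun (S k)" "symmetrize (space_ft f)" H, OF measurable_sym_fun measurable_symmetrize[OF fm] c_pos]
    unfolding hat_sym_fun hs .
  obtain v where v: "\<And>k::nat. v k \<in> tensor_span K (\<lambda>_::'a. ehat)" "L2_tendsto leb_plus v ?g"
    using L2_approx_sequence[OF tensor_span_approx[OF f]] by blast
  have "\<forall>k. \<exists>L. v k = comb_fun L \<and> (\<forall>(c, \<sigma>)\<in>set L. c \<in> K)"
    using v(1) unfolding tensor_span_def comb_fun_def[abs_def] by blast
  from choice[OF this] obtain S where S: "\<forall>k. v k = comb_fun (S k) \<and> (\<forall>(c, \<sigma>)\<in>set (S k). c \<in> K)" by blast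
  then have vS: "v = (\<lambda>k. comb_fun (S k))" by auto
  \<comment> \<open>This one variable witnesses existence on both sides: it is a version of the
    integral of \<open>?g\<close> and, as shown next, of I_n^H(f).\<close>
  obtain Y where Y: "mint ?g Y" "L2_tendsto M (\<lambda>k. comb_int (S k)) Y"
    using mint_complete[of "\<lambda>k. comb_fun (S k)" "\<lambda>k. comb_int (S k)" ?g thesis, OF mint_comb cl gl v(2)[unfolded vS]] by blast
  have "L2_tendsto leb_plus (\<lambda>k. symmetrize (comb_fun (S k))) (symmetrize ?g)"
    by (rule L2_tendsto_symmetrize[OF measurable_comb_fun gm v(2)[unfolded vS]])
  then have "is_mult_int_WH M W1 W2 K H e f Y"
    unfolding is_mult_int_WH_iff spec using mint_measurable[OF Y(1)] S Y(2) by blast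
  then have "is_mult_int_WH M W1 W2 K H e f (mult_int_WH M W1 W2 K H e f)"
    unfolding mult_int_WH_def by (rule someI[of "is_mult_int_WH M W1 W2 K H e f"])
  then obtain T where T: "mult_int_WH M W1 W2 K H e f \<in> borel_measurable M"
     "L2_tendsto leb_plus (\<lambda>k. symmetrize (comb_fun (T k))) (symmetrize ?g)"
     "L2_tendsto M (\<lambda>k. comb_int (T k)) (mult_int_WH M W1 W2 K H e f)"
    unfolding is_mult_int_WH_iff spec by blast
  \<comment> \<open>For the chosen version only the symmetrized combinations are known to converge,
    so \<open>comb_int\<close> is read as the integral of the symmetrized \<open>comb_fun\<close>
    before passing to the limit.\<close>
  have A: "mint (symmetrize ?g) (mult_int_WH M W1 W2 K H e f)"
    using mint_closed[of "\<lambda>k. symmetrize (comb_fun (T k))" "\<lambda>k. comb_int (T k)" "symmetrize ?g" "mult_int_WH M W1 W2 K H e f",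
        OF mint_symmetrize[OF mint_comb measurable_comb_fun] scl sgl T] .
  \<comment> \<open>Existence of \<open>Y\<close> validates the choice in \<open>mult_int\<close>;
    symmetrizing the integrand leaves the integral unchanged.\<close>
  have B: "mint (symmetrize ?g) (mult_int M W1 W2 (f_hat H f))"
    unfolding f_hat_eq by (rule mint_symmetrize[OF mint_mult_int[OF Y(1)] gm])
  show ?thesis by (rule mint_unique[OF A B sgl])
qed

end

theorem theorem2p7:
  fixes M :: "'w measure"
    and W1 W2 :: "(real \<times> real) set \<Rightarrow> 'w \<Rightarrow> real"
    and K :: "complex set"
    and H :: real
    and e :: "nat \<Rightarrow> real \<Rightarrow> (real \<Rightarrow> complex) \<Rightarrow> complex"
    and f :: "real ^ 'n \<Rightarrow> (real ^ 'n \<Rightarrow> complex) \<Rightarrow> complex"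
  assumes "prob_space M"
    and "complex_gaussian_measure M W1 W2"
    and "K = \<real> \<or> K = UNIV"
    and "0 < H" and "H < 1"
    and "orthonormal_basis_H K H e"
    and "f \<in> hilbert_H K H"
  shows "AE \<omega> in M. mult_int_WH M W1 W2 K H e f \<omega> = mult_int M W1 W2 (f_hat H f) \<omega>"
proof -
  interpret prob_space M by fact
  interpret wiener_setup M W1 W2 K H e by unfold_locales (use assms in auto)
  show ?thesis by (rule mult_int_WH_eq[OF assms(7)])
qed

end
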